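(* Let $\mathbb{G}$ be a locally compact quantum group, let $\mathbb{K}$ be the compact quantum group determined by the compact quantum group $\mathbb{AP}(C_0^u(\mathbb{G}))$, and let $\Lambda:C^u(\mathbb{K})\to M(C_0^u(\mathbb{G}))$ be the Hopf $*$-homomorphism given by the canonical surjection $C^u(\mathbb{K})\to\mathbb{AP}(C_0^u(\mathbb{G}))$ followed by the inclusion $\mathbb{AP}(C_0^u(\mathbb{G}))\subseteq M(C_0^u(\mathbb{G}))$; it defines an arrow $\mathbb{G}\to\mathbb{K}$ in ${\sf LCQG}$. Then, with this arrow, $\mathbb{K}$ is the compactification of $\mathbb{G}$ in ${\sf LCQG}$. That is: for every compact quantum group $\mathbb{H}$ and every Hopf $*$-homomorphism $\theta:C^u(\mathbb{H})\to M(C_0^u(\mathbb{G}))$ there is a unique Hopf $*$-homomorphism $\theta_1:C^u(\mathbb{H})\to C^u(\mathbb{K})$ with $\theta=\Lambda\circ\theta_1$.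
   Context: A C$^*$-bialgebra $(A,\Delta)$ is a C$^*$-algebra $A$ with a non-degenerate $*$-homomorphism $\Delta:A\to M(A\otimes A)$ (minimal tensor product) with $(\Delta\otimes\iota)\Delta=(\iota\otimes\Delta)\Delta$. A Hopf $*$-homomorphism from $(A,\Delta_A)$ to $(B,\Delta_B)$ is a non-degenerate $*$-homomorphism $\theta:A\to M(B)$ with $\Delta_B\theta=(\theta\otimes\theta)\Delta_A$ (using strict extensions). Locally compact quantum groups are in the sense of Kustermans and Vaes. $C_0(\mathbb{G})$ and $C_0^u(\mathbb{G})$ are the reduced and universal (Kustermans) C$^*$-bialgebras of $\mathbb{G}$. ${\sf LCQG}$ is the category whose objects are locally compact quantum groups and whose arrows $\mathbb{G}\to\mathbb{H}$ are the Hopf $*$-homomorphisms $C_0^u(\mathbb{H})\to M(C_0^u(\mathbb{G}))$ (note the reversal). The compact objects are those $\mathbb{G}$ with $C_0(\mathbb{G})$ (equivalently $C_0^u(\mathbb{G})$) unital; for these one writes $C(\mathbb{G})$, $C^u(\mathbb{G})$. A C$^*$-algebraic compact quantum group (Woronowicz) is a unital C$^*$-bialgebra $(A,\Delta)$ such that the linear spans of $\Delta(A)(A\otimes 1)$ and $\Delta(A)(1\otimes A)$ are dense in $A\otimes A$; it has a unique dense Hopf $*$-algebra $\mathcal{A}$, and determines a compact quantum group $\mathbb{K}$ in ${\sf LCQG}$, where $C^u(\mathbb{K})$ is the universal enveloping C$^*$-algebra of $\mathcal{A}$ and $C(\mathbb{K})$ is the completion of $\mathcal{A}$ acting on the GNS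 space of the Haar state; there is a canonical surjective Hopf $*$-homomorphism $C^u(\mathbb{K})\to A$ which is the identity on $\mathcal{A}$. For a C$^*$-bialgebra $(A,\Delta)$, a (finite-dimensional) invertible corepresentation is an invertible $T=(T_{ij})\in\mathbb{M}_n(M(A))$ with $\Delta(T_{ij})=\sum_k T_{ik}\otimes T_{kj}$. It is admissible if moreover $T^\top=(T_{ji})$ is invertible. The matrix elements of $T$ are the elements of the linear span of the $T_{ij}$. $\mathcal{AP}(A)\subseteq M(A)$ is the set of all matrix elements of admissible corepresentations of $A$, a unital $*$-subalgebra, and $\mathbb{AP}(A)$ is its norm closure. With the restriction of $\Delta$, $\mathbb{AP}(A)$ is a compact quantum group (Sołtan) whose unique dense Hopf $*$-algebra is $\mathcal{AP}(A)$. *)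

theory Defs
  imports "HOL-Analysis.Analysis"
begin

section \<open>The Hilbert spaces \<open>\<ell>\<^sup>2(I)\<close>\<close>

text \<open>Every nonzero Hilbert space is isomorphic to some \<open>\<ell>\<^sup>2(I)\<close>, with \<open>I\<close> the (nonempty) index type,
  and \<open>\<ell>\<^sup>2(I) \<otimes> \<ell>\<^sup>2(J) = \<ell>\<^sup>2(I \<times> J)\<close>.\<close>

definition square_summable :: "('i \<Rightarrow> complex) \<Rightarrow> bool" where
  "square_summable f \<longleftrightarrow> (\<lambda>i. (cmod (f i))\<^sup>2) summable_on UNIV"

lemma square_summable_mult:
  assumes "square_summable f" "square_summable g"
  shows "(\<lambda>i. norm (f i * g i)) summable_on UNIV"
  by (rule abs_summable_product)
     (use assms in \<open>simp_all add: square_summable_def norm_mult power2_eq_square\<close>)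

lemma square_summable_cnj_mult:
  assumes "square_summable f" "square_summable g"
  shows "(\<lambda>i. cnj (f i) * g i) summable_on UNIV"
proof -
  have "square_summable (\<lambda>i. cnj (f i))"
    using assms(1) by (simp add: square_summable_def)
  from square_summable_mult[OF this assms(2)] show ?thesis
    by (rule abs_summable_summable)
qed

lemma square_summable_add:
  assumes "square_summable f" "square_summable g"
  shows "square_summable (\<lambda>i. f i + g i)"
proof -
  have "(\<lambda>i. 2 * (cmod (f i))\<^sup>2 + 2 * (cmod (g i))\<^sup>2) summable_on UNIV"
    using assms unfolding square_summable_def
    by (intro summable_on_add summable_on_cmult_right)
  then show ?thesis
    unfolding square_summable_def
  proof (rule summable_on_comparison_test)
    fix i
    have "(cmod (f i + g i))\<^sup>2 \<le> (cmod (f i) + cmod (g i))\<^sup>2"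
      by (simp add: norm_triangle_ineq power_mono)
    also have "\<dots> \<le> 2 * (cmod (f i))\<^sup>2 + 2 * (cmod (g i))\<^sup>2"
      using sum_squares_bound[of "cmod (f i)" "cmod (g i)"] by (simp add: power2_sum)
    finally show "(cmod (f i + g i))\<^sup>2 \<le> 2 * (cmod (f i))\<^sup>2 + 2 * (cmod (g i))\<^sup>2" .
  qed auto
qed

lemma square_summable_scale:
  "square_summable f \<Longrightarrow> square_summable (\<lambda>i. c * f i)"
  unfolding square_summable_def by (simp add: norm_mult power_mult_distrib summable_on_cmult_right)

lemma square_summable_zero: "square_summable (\<lambda>_. 0)"
  by (simp add: square_summable_def)

typedef 'i ell2 = "{f :: 'i \<Rightarrow> complex. square_summable f}"
  using square_summable_zero by blast

setup_lifting type_definition_ell2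

instantiation ell2 :: (type) real_vector
begin
lift_definition zero_ell2 :: "'a ell2" is "\<lambda>_. 0" by (rule square_summable_zero)
lift_definition plus_ell2 :: "'a ell2 \<Rightarrow> 'a ell2 \<Rightarrow> 'a ell2" is "\<lambda>f g i. f i + g i"
  by (rule square_summable_add)
lift_definition uminus_ell2 :: "'a ell2 \<Rightarrow> 'a ell2" is "\<lambda>f i. - f i"
  by (simp add: square_summable_def)
lift_definition minus_ell2 :: "'a ell2 \<Rightarrow> 'a ell2 \<Rightarrow> 'a ell2" is "\<lambda>f g i. f i - g i"
  subgoal for f g
    using square_summable_add[of f "\<lambda>i. - g i"] by (simp add: square_summable_def)
  done
lift_definition scaleR_ell2 :: "real \<Rightarrow> 'a ell2 \<Rightarrow> 'a ell2" is "\<lambda>r f i. complex_of_real r * f i"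
  by (rule square_summable_scale)
instance
  by standard (transfer; simp add: algebra_simps fun_eq_iff)+
end

lift_definition scaleC :: "complex \<Rightarrow> 'i ell2 \<Rightarrow> 'i ell2" is "\<lambda>c f i. c * f i"
  by (rule square_summable_scale)

lift_definition cinner :: "'i ell2 \<Rightarrow> 'i ell2 \<Rightarrow> complex" is
  "\<lambda>f g. \<Sum>\<^sub>\<infinity>i. cnj (f i) * g i" .

lemma cinner_self: "cinner x x = complex_of_real (\<Sum>\<^sub>\<infinity>i. (cmod (Rep_ell2 x i))\<^sup>2)"
proof -
  have "((\<lambda>i. (cmod (Rep_ell2 x i))\<^sup>2) has_sum (\<Sum>\<^sub>\<infinity>i. (cmod (Rep_ell2 x i))\<^sup>2)) UNIV"
    using Rep_ell2[of x] by (intro has_sum_infsum) (simp add: square_summable_def)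
  from has_sum_of_real[OF this, where 'a = complex]
  have "((\<lambda>i. cnj (Rep_ell2 x i) * Rep_ell2 x i)
      has_sum complex_of_real (\<Sum>\<^sub>\<infinity>i. (cmod (Rep_ell2 x i))\<^sup>2)) UNIV"
    by (simp only: mult.commute[of "cnj _"] complex_norm_square)
  then show ?thesis unfolding cinner.rep_eq by (rule infsumI)
qed

instantiation ell2 :: (type) real_inner
begin
definition inner_ell2 :: "'a ell2 \<Rightarrow> 'a ell2 \<Rightarrow> real" where
  "inner_ell2 x y = Re (cinner x y)"
definition norm_ell2 :: "'a ell2 \<Rightarrow> real" where
  "norm_ell2 x = sqrt (inner x x)"
definition sgn_ell2 :: "'a ell2 \<Rightarrow> 'a ell2" where
  "sgn_ell2 x = x /\<^sub>R norm x"
definition dist_ell2 :: "'a ell2 \<Rightarrow> 'a ell2 \<Rightarrow> real" where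
  "dist_ell2 x y = norm (x - y)"
definition uniformity_ell2 :: "('a ell2 \<times> 'a ell2) filter" where
  "uniformity_ell2 = (INF e\<in>{0<..}. principal {(x, y). dist x y < e})"
definition open_ell2 :: "'a ell2 set \<Rightarrow> bool" where
  "open_ell2 U = (\<forall>x\<in>U. \<forall>\<^sub>F (x', y) in uniformity. x' = x \<longrightarrow> y \<in> U)"

instance
proof
  fix x y z :: "'a ell2" and r :: real
  show "sgn x = x /\<^sub>R norm x" "dist x y = norm (x - y)" "norm x = sqrt (inner x x)"
    by (simp_all add: sgn_ell2_def dist_ell2_def norm_ell2_def)
  show "uniformity = (INF e\<in>{0<..}. principal {(x, y :: 'a ell2). dist x y < e})"
    by (simp add: uniformity_ell2_def)
  show "open U = (\<forall>x\<in>U. \<forall>\<^sub>F (x', y) in uniformity. x' = x \<longrightarrow> y \<in> U)" for U :: "'a ell2 set"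
    by (simp add: open_ell2_def)
  have "cinner x y = cnj (cinner y x)"
    by transfer (simp flip: infsum_cnj add: mult.commute)
  then show "inner x y = inner y x"
    by (simp add: inner_ell2_def)
  have "cinner (x + y) z = cinner x z + cinner y z"
    by transfer (simp add: distrib_right infsum_add square_summable_cnj_mult)
  then show "inner (x + y) z = inner x z + inner y z"
    by (simp add: inner_ell2_def)
  have "cinner (r *\<^sub>R x) y = complex_of_real r * cinner x y"
    by transfer (simp add: mult.assoc infsum_cmult_right')
  then show "inner (r *\<^sub>R x) y = r * inner x y"
    by (simp add: inner_ell2_def)
  have sq: "inner x x = (\<Sum>\<^sub>\<infinity>i. (cmod (Rep_ell2 x i))\<^sup>2)"
    using cinner_self[of x] by (simp add: inner_ell2_def)
  show "0 \<le> inner x x"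
    unfolding sq by (rule infsum_nonneg) simp
  show "inner x x = 0 \<longleftrightarrow> x = 0"
  proof
    assume "inner x x = 0"
    have "Rep_ell2 x i = 0" for i
    proof -
      have "(cmod (Rep_ell2 x i))\<^sup>2 = 0"
        by (rule nonneg_infsum_le_0D[where A = UNIV and f = "\<lambda>i. (cmod (Rep_ell2 x i))\<^sup>2"])
           (use \<open>inner x x = 0\<close> Rep_ell2[of x] in \<open>auto simp: sq square_summable_def\<close>)
      then show ?thesis by simp
    qed
    then show "x = 0" by transfer auto
  next
    assume "x = 0"
    then show "inner x x = 0" unfolding sq by (simp add: zero_ell2.rep_eq)
  qed
qed
end

lemma norm_ell2_eq: "(norm x)\<^sup>2 = (\<Sum>\<^sub>\<infinity>i. (cmod (Rep_ell2 x i))\<^sup>2)"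
proof -
  have "(norm x)\<^sup>2 = inner x x" by (simp add: power2_norm_eq_inner)
  also have "\<dots> = (\<Sum>\<^sub>\<infinity>i. (cmod (Rep_ell2 x i))\<^sup>2)"
    using cinner_self[of x] by (simp add: inner_ell2_def)
  finally show ?thesis .
qed

lemma finite_sum_le_norm_ell2:
  assumes "finite F" shows "(\<Sum>i\<in>F. (cmod (Rep_ell2 x i))\<^sup>2) \<le> (norm x)\<^sup>2"
  unfolding norm_ell2_eq
  by (rule finite_sum_le_infsum) (use assms Rep_ell2[of x] in \<open>auto simp: square_summable_def\<close>)

lemma norm_ell2_le:
  assumes "0 \<le> c" "\<And>F. finite F \<Longrightarrow> (\<Sum>i\<in>F. (cmod (Rep_ell2 x i))\<^sup>2) \<le> c\<^sup>2"
  shows "norm x \<le> c"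
proof -
  have "(norm x)\<^sup>2 \<le> c\<^sup>2"
    unfolding norm_ell2_eq
    by (rule infsum_le_finite_sums) (use assms Rep_ell2[of x] in \<open>auto simp: square_summable_def\<close>)
  then show ?thesis using assms(1) by (rule power2_le_imp_le)
qed

instance ell2 :: (type) complete_space
proof
  fix X :: "nat \<Rightarrow> 'a ell2"
  assume X: "Cauchy X"
  let ?r = "\<lambda>n i. Rep_ell2 (X n) i"
  have coord: "cmod (Rep_ell2 x i) \<le> norm x" for x :: "'a ell2" and i
    by (rule power2_le_imp_le) (use finite_sum_le_norm_ell2[of "{i}" x] in simp_all)
  have "convergent (\<lambda>n. ?r n i)" for i
  proof (rule Cauchy_convergent, rule metric_CauchyI)
    fix e :: real assume "0 < e"
    then obtain M where M: "\<forall>m\<ge>M. \<forall>n\<ge>M. dist (X m) (X n) < e"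
      using metric_CauchyD[OF X \<open>0 < e\<close>] by (elim exE)
    have "dist (?r m i) (?r n i) < e" if "m \<ge> M" "n \<ge> M" for m n
    proof -
      have "norm (X m - X n) < e" using M that by (simp add: dist_norm)
      with coord[of "X m - X n" i] show ?thesis by (simp add: dist_norm minus_ell2.rep_eq)
    qed
    then show "\<exists>M. \<forall>m\<ge>M. \<forall>n\<ge>M. dist (?r m i) (?r n i) < e" by blast
  qed
  then obtain l where l: "\<And>i. (\<lambda>n. ?r n i) \<longlonglongrightarrow> l i"
    unfolding convergent_def by (metis (no_types))
  have tail: "(\<Sum>i\<in>F. (cmod (?r m i - l i))\<^sup>2) \<le> e\<^sup>2"
    if "finite F" and M: "\<forall>n\<ge>M. dist (X m) (X n) < e" for F e m M
  proof (rule tendsto_upperbound)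
    show "(\<lambda>n. \<Sum>i\<in>F. (cmod (?r m i - ?r n i))\<^sup>2) \<longlonglongrightarrow> (\<Sum>i\<in>F. (cmod (?r m i - l i))\<^sup>2)"
      by (intro tendsto_sum tendsto_power tendsto_norm tendsto_diff tendsto_const l)
    show "\<forall>\<^sub>F n in sequentially. (\<Sum>i\<in>F. (cmod (?r m i - ?r n i))\<^sup>2) \<le> e\<^sup>2"
    proof (rule eventually_sequentiallyI)
      fix n assume "M \<le> n"
      then have "norm (X m - X n) < e" using M by (simp add: dist_norm)
      then have "(norm (X m - X n))\<^sup>2 \<le> e\<^sup>2" by (intro power_mono) auto
      then show "(\<Sum>i\<in>F. (cmod (?r m i - ?r n i))\<^sup>2) \<le> e\<^sup>2"
        using finite_sum_le_norm_ell2[OF \<open>finite F\<close>, of "X m - X n"]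
        by (simp add: minus_ell2.rep_eq)
    qed
  qed simp
  have "square_summable l"
  proof -
    obtain M where M: "\<forall>m\<ge>M. \<forall>n\<ge>M. dist (X m) (X n) < 1"
      using metric_CauchyD[OF X zero_less_one] by (elim exE)
    have "square_summable (\<lambda>i. ?r M i - l i)"
      unfolding square_summable_def
    proof (rule nonneg_bdd_above_summable_on)
      show "bdd_above (sum (\<lambda>i. (cmod (?r M i - l i))\<^sup>2) ` {F. F \<subseteq> UNIV \<and> finite F})"
        by (rule bdd_aboveI2[where M = "1\<^sup>2"], rule tail[where M = M]) (use M in auto)
    qed simp
    from square_summable_add[OF square_summable_scale[OF this, of "-1"], of "?r M"]
    show ?thesis using Rep_ell2[of "X M"] by simp
  qed
  then have Rl: "Rep_ell2 (Abs_ell2 l) = l" by (simp add: Abs_ell2_inverse)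
  have "X \<longlonglongrightarrow> Abs_ell2 l"
  proof (rule metric_LIMSEQ_I)
    fix e :: real assume "0 < e"
    then have "0 < e / 2" by simp
    from metric_CauchyD[OF X this] obtain M
      where M: "\<forall>m\<ge>M. \<forall>n\<ge>M. dist (X m) (X n) < e / 2" by (elim exE)
    have "dist (X m) (Abs_ell2 l) < e" if "m \<ge> M" for m
    proof -
      have "norm (X m - Abs_ell2 l) \<le> e / 2"
      proof (rule norm_ell2_le)
        fix F :: "'a set" assume "finite F"
        then have "(\<Sum>i\<in>F. (cmod (?r m i - l i))\<^sup>2) \<le> (e / 2)\<^sup>2"
          by (rule tail[where M = M]) (use M that in blast)
        then show "(\<Sum>i\<in>F. (cmod (Rep_ell2 (X m - Abs_ell2 l) i))\<^sup>2) \<le> (e / 2)\<^sup>2"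
          by (simp only: minus_ell2.rep_eq Rl)
      qed (use \<open>0 < e\<close> in simp)
      then show ?thesis using \<open>0 < e\<close> by (simp add: dist_norm)
    qed
    then show "\<exists>M. \<forall>m\<ge>M. dist (X m) (Abs_ell2 l) < e" by blast
  qed
  then show "convergent X" by (auto simp: convergent_def)
qed

lemma square_summable_prod:
  assumes "square_summable f" "square_summable g"
  shows "square_summable (\<lambda>(i, j). f i * g j)"
proof -
  let ?h = "\<lambda>(i, j). (cmod (f i))\<^sup>2 * (cmod (g j))\<^sup>2"
  have f: "(\<lambda>i. (cmod (f i))\<^sup>2) summable_on UNIV" and g: "(\<lambda>j. (cmod (g j))\<^sup>2) summable_on UNIV"
    using assms by (simp_all only: square_summable_def)
  have *: "norm (?h (i, j)) = (cmod (f i))\<^sup>2 * (cmod (g j))\<^sup>2" for i j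
    by (simp add: abs_mult)
  have eq: "(\<Sum>\<^sub>\<infinity>j. norm (?h (i, j))) = (cmod (f i))\<^sup>2 * (\<Sum>\<^sub>\<infinity>j. (cmod (g j))\<^sup>2)" for i
    unfolding * by (rule infsum_cmult_right')
  have nn: "0 \<le> (\<Sum>\<^sub>\<infinity>j. (cmod (g j))\<^sup>2)"
    by (rule infsum_nonneg) simp
  have "(\<lambda>p. norm (?h p)) summable_on UNIV \<times> UNIV"
  proof (subst Infinite_Sum.abs_summable_on_Sigma_iff, intro conjI ballI)
    show "(\<lambda>j. norm (?h (i, j))) summable_on UNIV" for i
      unfolding * by (rule summable_on_cmult_right[OF g])
    have "norm (\<Sum>\<^sub>\<infinity>j. norm (?h (i, j))) = (cmod (f i))\<^sup>2 * (\<Sum>\<^sub>\<infinity>j. (cmod (g j))\<^sup>2)" for i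
      unfolding eq using nn by (simp only: real_norm_def abs_mult abs_of_nonneg zero_le_power2)
    then show "(\<lambda>i. norm (\<Sum>\<^sub>\<infinity>j. norm (?h (i, j)))) summable_on UNIV"
      using summable_on_cmult_left[OF f] by (simp only:)
  qed
  moreover have "norm (?h p) = (cmod ((\<lambda>(i, j). f i * g j) p))\<^sup>2" for p
    by (cases p) (simp add: norm_mult power_mult_distrib)
  ultimately show ?thesis
    by (simp only: square_summable_def UNIV_Times_UNIV)
qed

lift_definition vtensor :: "'i ell2 \<Rightarrow> 'j ell2 \<Rightarrow> ('i \<times> 'j) ell2" is
  "\<lambda>f g (i, j). f i * g j"
  by (rule square_summable_prod)


section \<open>Bounded operators\<close>

text \<open>Operators are bounded real-linear maps in the sense of the library; \<open>bop\<close> singles out the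
  complex-linear ones, i.e. it is \<open>B(\<ell>\<^sup>2(I))\<close>. The norm and topology are those of
  the library type.\<close>

type_synonym 'i op = "'i ell2 \<Rightarrow>\<^sub>L 'i ell2"

definition bop :: "'i op set" where
  "bop = {T. \<forall>c x. blinfun_apply T (scaleC c x) = scaleC c (blinfun_apply T x)}"

definition cscale :: "complex \<Rightarrow> 'i op \<Rightarrow> 'i op" where
  "cscale c T = Blinfun (\<lambda>x. scaleC c (blinfun_apply T x))"

definition adj :: "'i op \<Rightarrow> 'i op" where
  "adj T = (THE S. \<forall>x y. cinner (blinfun_apply S x) y = cinner x (blinfun_apply T y))"

definition unitary :: "'i op \<Rightarrow> bool" where
  "unitary U \<longleftrightarrow> U \<in> bop \<and> adj U o\<^sub>L U = id_blinfun \<and> U o\<^sub>L adj U = id_blinfun"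

definition positive_op :: "'i op \<Rightarrow> bool" where
  "positive_op T \<longleftrightarrow> T \<in> bop \<and>
    (\<forall>x. Im (cinner x (blinfun_apply T x)) = 0 \<and> 0 \<le> Re (cinner x (blinfun_apply T x)))"

definition op_tensor :: "'i op \<Rightarrow> 'j op \<Rightarrow> ('i \<times> 'j) op" where
  "op_tensor S T = (THE R. R \<in> bop \<and>
    (\<forall>x y. blinfun_apply R (vtensor x y) = vtensor (blinfun_apply S x) (blinfun_apply T y)))"

text \<open>For a bijection \<open>f\<close> of index types, \<open>reindex f\<close> is the unitary sending the basis vector
  \<open>e\<^sub>i\<close> to \<open>e\<^bsub>f i\<^esub>\<close>, and \<open>transport f\<close> is conjugation by it. It is used to
  rebracket tensor products and to permute their legs.\<close>

definition reindex :: "('i \<Rightarrow> 'j) \<Rightarrow> 'i ell2 \<Rightarrow>\<^sub>L 'j ell2" where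
  "reindex f = Blinfun (\<lambda>x. Abs_ell2 (\<lambda>j. Rep_ell2 x (inv f j)))"

definition transport :: "('i \<Rightarrow> 'j) \<Rightarrow> 'i op \<Rightarrow> 'j op" where
  "transport f T = reindex f o\<^sub>L T o\<^sub>L reindex (inv f)"


section \<open>C*-algebras\<close>

text \<open>C*-algebras are norm-closed *-subalgebras acting nondegenerately on some \<open>\<ell>\<^sup>2(I)\<close>
  (Gelfand--Naimark). For such an algebra, \<open>M(A)\<close> is the idealizer of \<open>A\<close> in
  \<open>B(\<ell>\<^sup>2(I))\<close>, and the minimal tensor product is the spatial one. The real-linear
  \<open>span\<close> of the library is used only on sets closed under multiplication by complex scalars,
  where it is the complex span.\<close>

definition star_subalgebra :: "'i op set \<Rightarrow> bool" where
  "star_subalgebra A \<longleftrightarrow> A \<subseteq> bop \<and> 0 \<in> A \<and>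
    (\<forall>a\<in>A. \<forall>b\<in>A. a + b \<in> A \<and> a o\<^sub>L b \<in> A) \<and>
    (\<forall>a\<in>A. adj a \<in> A \<and> (\<forall>c. cscale c a \<in> A))"

definition cstar_algebra :: "'i op set \<Rightarrow> bool" where
  "cstar_algebra A \<longleftrightarrow> star_subalgebra A \<and> closed A \<and>
    closure (span {blinfun_apply a x | a x. a \<in> A}) = UNIV"

definition multipliers :: "'i op set \<Rightarrow> 'i op set" where
  "multipliers A = {m \<in> bop. \<forall>a\<in>A. m o\<^sub>L a \<in> A \<and> a o\<^sub>L m \<in> A}"

definition min_tensor :: "'i op set \<Rightarrow> 'j op set \<Rightarrow> ('i \<times> 'j) op set" where
  "min_tensor A B = closure (span {op_tensor a b | a b. a \<in> A \<and> b \<in> B})"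

definition star_hom :: "'i op set \<Rightarrow> ('i op \<Rightarrow> 'j op) \<Rightarrow> 'j op set \<Rightarrow> bool" where
  "star_hom A \<theta> B \<longleftrightarrow> (\<forall>a\<in>A. \<theta> a \<in> B) \<and>
    (\<forall>a\<in>A. \<forall>b\<in>A. \<theta> (a + b) = \<theta> a + \<theta> b \<and> \<theta> (a o\<^sub>L b) = \<theta> a o\<^sub>L \<theta> b) \<and>
    (\<forall>a\<in>A. \<theta> (adj a) = adj (\<theta> a) \<and> (\<forall>c. \<theta> (cscale c a) = cscale c (\<theta> a)))"

text \<open>A nondegenerate *-homomorphism \<open>A \<rightarrow> M(B)\<close>.\<close>

definition nondeg_hom :: "'i op set \<Rightarrow> ('i op \<Rightarrow> 'j op) \<Rightarrow> 'j op set \<Rightarrow> bool" where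
  "nondeg_hom A \<theta> B \<longleftrightarrow> star_hom A \<theta> (multipliers B) \<and>
    closure (span {\<theta> a o\<^sub>L b | a b. a \<in> A \<and> b \<in> B}) = B"

text \<open>The strict extension \<open>M(A) \<rightarrow> M(B)\<close> of a nondegenerate \<open>\<theta> : A \<rightarrow> M(B)\<close>: since
  \<open>\<theta>(A)\<ell>\<^sup>2(J)\<close> spans a dense subspace, the value at \<open>m\<close> is determined by
  \<open>\<theta>(m) \<theta>(a) = \<theta>(m a)\<close>, and it lies in \<open>M(B)\<close>.\<close>

definition strict_ext :: "'i op set \<Rightarrow> ('i op \<Rightarrow> 'j op) \<Rightarrow> 'i op \<Rightarrow> 'j op" where
  "strict_ext A \<theta> m = (THE T. T \<in> bop \<and> (\<forall>a\<in>A. T o\<^sub>L \<theta> a = \<theta> (m o\<^sub>L a)))"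

definition hom_tensor ::
  "'i op set \<Rightarrow> ('i op \<Rightarrow> 'k op) \<Rightarrow> 'j op set \<Rightarrow> ('j op \<Rightarrow> 'l op) \<Rightarrow> ('i \<times> 'j) op \<Rightarrow> ('k \<times> 'l) op"
where
  "hom_tensor A \<theta> B \<rho> = (THE \<Phi>. \<Phi> \<in> extensional (min_tensor A B) \<and>
    star_hom (min_tensor A B) \<Phi> bop \<and>
    (\<forall>a\<in>A. \<forall>b\<in>B. \<Phi> (op_tensor a b) = op_tensor (\<theta> a) (\<rho> b)))"

definition cstar_bialgebra :: "'i op set \<Rightarrow> ('i op \<Rightarrow> ('i \<times> 'i) op) \<Rightarrow> bool" where
  "cstar_bialgebra A \<Delta> \<longleftrightarrow> cstar_algebra A \<and> nondeg_hom A \<Delta> (min_tensor A A) \<and>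
    (\<forall>a\<in>A. transport (\<lambda>((i, j), k). (i, (j, k)))
          (strict_ext (min_tensor A A) (hom_tensor A \<Delta> A (\<lambda>x. x)) (\<Delta> a))
        = strict_ext (min_tensor A A) (hom_tensor A (\<lambda>x. x) A \<Delta>) (\<Delta> a))"

text \<open>A Hopf *-homomorphism \<open>(A, \<Delta>\<^sub>A) \<rightarrow> (B, \<Delta>\<^sub>B)\<close>, that is a map \<open>A \<rightarrow> M(B)\<close>; for unital
  \<open>B\<close> one has \<open>M(B) = B\<close>.\<close>

definition hopf_hom ::
  "'i op set \<Rightarrow> ('i op \<Rightarrow> ('i \<times> 'i) op) \<Rightarrow> 'j op set \<Rightarrow> ('j op \<Rightarrow> ('j \<times> 'j) op)
    \<Rightarrow> ('i op \<Rightarrow> 'j op) \<Rightarrow> bool"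
where
  "hopf_hom A \<Delta>A B \<Delta>B \<theta> \<longleftrightarrow> nondeg_hom A \<theta> B \<and>
    (\<forall>a\<in>A. strict_ext B \<Delta>B (\<theta> a) = strict_ext (min_tensor A A) (hom_tensor A \<theta> A \<theta>) (\<Delta>A a))"

definition cstar_seminorm :: "'i op set \<Rightarrow> ('i op \<Rightarrow> real) \<Rightarrow> bool" where
  "cstar_seminorm A p \<longleftrightarrow>
    (\<forall>a\<in>A. 0 \<le> p a \<and> p (adj a o\<^sub>L a) = (p a)\<^sup>2 \<and> (\<forall>c. p (cscale c a) = cmod c * p a)) \<and>
    (\<forall>a\<in>A. \<forall>b\<in>A. p (a + b) \<le> p a + p b \<and> p (a o\<^sub>L b) \<le> p a * p b)"

text \<open>\<open>(C, \<iota>)\<close> is the universal enveloping C*-algebra of the *-algebra \<open>A\<close>: the completion of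
  \<open>A\<close> with respect to its largest C*-seminorm, which is \<open>a \<mapsto> \<parallel>\<iota> a\<parallel>\<close>.
  Only the *-algebra structure of \<open>A\<close> matters, not the operator norm.\<close>

definition universal_envelope :: "'i op set \<Rightarrow> 'j op set \<Rightarrow> ('i op \<Rightarrow> 'j op) \<Rightarrow> bool" where
  "universal_envelope A C \<iota> \<longleftrightarrow> star_subalgebra A \<and> cstar_algebra C \<and> star_hom A \<iota> C \<and>
    closure (\<iota> ` A) = C \<and>
    (\<forall>p. cstar_seminorm A p \<longrightarrow> (\<forall>a\<in>A. p a \<le> norm (\<iota> a)))"


section \<open>Compact quantum groups\<close>

definition cqg :: "'i op set \<Rightarrow> ('i op \<Rightarrow> ('i \<times> 'i) op) \<Rightarrow> bool" where
  "cqg A \<Delta> \<longleftrightarrow> cstar_bialgebra A \<Delta> \<and> id_blinfun \<in> A \<and>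
    closure (span {\<Delta> a o\<^sub>L op_tensor b id_blinfun | a b. a \<in> A \<and> b \<in> A}) = min_tensor A A \<and>
    closure (span {\<Delta> a o\<^sub>L op_tensor id_blinfun b | a b. a \<in> A \<and> b \<in> A}) = min_tensor A A"

text \<open>\<open>P\<close> is a dense unital *-subalgebra of \<open>A\<close> that is a Hopf *-algebra under \<open>\<Delta>\<close>, with counit
  \<open>\<epsilon>\<close> and antipode \<open>S\<close>. The algebraic tensor product \<open>P \<odot> P\<close> embeds in the operators on
  \<open>\<ell>\<^sup>2(I \<times> I)\<close>, so the axioms may be read off from any decomposition of \<open>\<Delta> a\<close>.\<close>

definition dense_hopf_star_algebra ::
  "'i op set \<Rightarrow> ('i op \<Rightarrow> ('i \<times> 'i) op) \<Rightarrow> 'i op set \<Rightarrow> bool"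
where
  "dense_hopf_star_algebra A \<Delta> P \<longleftrightarrow>
    star_subalgebra P \<and> id_blinfun \<in> P \<and> closure P = A \<and>
    (\<forall>a\<in>P. \<Delta> a \<in> span {op_tensor b c | b c. b \<in> P \<and> c \<in> P}) \<and>
    (\<exists>(\<epsilon> :: 'i op \<Rightarrow> complex) (S :: 'i op \<Rightarrow> 'i op).
      \<epsilon> id_blinfun = 1 \<and>
      (\<forall>a\<in>P. \<forall>b\<in>P. \<epsilon> (a + b) = \<epsilon> a + \<epsilon> b \<and> \<epsilon> (a o\<^sub>L b) = \<epsilon> a * \<epsilon> b) \<and>
      (\<forall>a\<in>P. \<forall>c. \<epsilon> (cscale c a) = c * \<epsilon> a) \<and>
      (\<forall>a\<in>P. S a \<in> P \<and> (\<forall>c. S (cscale c a) = cscale c (S a))) \<and>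
      (\<forall>a\<in>P. \<forall>b\<in>P. S (a + b) = S a + S b) \<and>
      (\<forall>a\<in>P. \<forall>(n::nat) b c. (\<forall>k<n. b k \<in> P \<and> c k \<in> P) \<and> \<Delta> a = (\<Sum>k<n. op_tensor (b k) (c k)) \<longrightarrow>
        (\<Sum>k<n. cscale (\<epsilon> (b k)) (c k)) = a \<and> (\<Sum>k<n. cscale (\<epsilon> (c k)) (b k)) = a \<and>
        (\<Sum>k<n. S (b k) o\<^sub>L c k) = cscale (\<epsilon> a) id_blinfun \<and>
        (\<Sum>k<n. b k o\<^sub>L S (c k)) = cscale (\<epsilon> a) id_blinfun))"

text \<open>\<open>(C, \<Delta>\<^sub>C)\<close> is \<open>C\<^sup>u\<close> of the compact quantum group whose dense Hopf *-algebra is \<open>P\<close> with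
  comultiplication \<open>\<Delta>\<close>; \<open>\<iota> : P \<rightarrow> C\<close> is the canonical map, and
  \<open>\<Delta>\<^sub>C \<circ> \<iota> = (\<iota> \<odot> \<iota>) \<circ> \<Delta>\<close>.\<close>

definition universal_cqg ::
  "'i op set \<Rightarrow> ('i op \<Rightarrow> ('i \<times> 'i) op) \<Rightarrow> 'j op set \<Rightarrow> ('i op \<Rightarrow> 'j op)
    \<Rightarrow> ('j op \<Rightarrow> ('j \<times> 'j) op) \<Rightarrow> bool"
where
  "universal_cqg P \<Delta> C \<iota> \<Delta>C \<longleftrightarrow> universal_envelope P C \<iota> \<and> cstar_bialgebra C \<Delta>C \<and>
    (\<forall>a\<in>P. \<forall>(n::nat) b c. (\<forall>k<n. b k \<in> P \<and> c k \<in> P) \<and> \<Delta> a = (\<Sum>k<n. op_tensor (b k) (c k)) \<longrightarrow>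
      \<Delta>C (\<iota> a) = (\<Sum>k<n. op_tensor (\<iota> (b k)) (\<iota> (c k))))"


section \<open>Admissible corepresentations and almost periodic elements\<close>

text \<open>\<open>n \<times> n\<close> matrices are functions of two indices, of which only the values at indices below
  \<open>n\<close> matter.\<close>

definition mat_invertible :: "'i op set \<Rightarrow> nat \<Rightarrow> (nat \<Rightarrow> nat \<Rightarrow> 'i op) \<Rightarrow> bool" where
  "mat_invertible B n T \<longleftrightarrow> (\<exists>S. (\<forall>i<n. \<forall>j<n. S i j \<in> B) \<and>
    (\<forall>i<n. \<forall>j<n. (\<Sum>k<n. T i k o\<^sub>L S k j) = (if i = j then id_blinfun else 0) \<and>
                 (\<Sum>k<n. S i k o\<^sub>L T k j) = (if i = j then id_blinfun else 0)))"

definition invertible_corep ::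
  "'i op set \<Rightarrow> ('i op \<Rightarrow> ('i \<times> 'i) op) \<Rightarrow> nat \<Rightarrow> (nat \<Rightarrow> nat \<Rightarrow> 'i op) \<Rightarrow> bool"
where
  "invertible_corep A \<Delta> n T \<longleftrightarrow> (\<forall>i<n. \<forall>j<n. T i j \<in> multipliers A) \<and> mat_invertible (multipliers A) n T \<and>
    (\<forall>i<n. \<forall>j<n. strict_ext A \<Delta> (T i j) = (\<Sum>k<n. op_tensor (T i k) (T k j)))"

definition admissible_corep ::
  "'i op set \<Rightarrow> ('i op \<Rightarrow> ('i \<times> 'i) op) \<Rightarrow> nat \<Rightarrow> (nat \<Rightarrow> nat \<Rightarrow> 'i op) \<Rightarrow> bool"
where
  "admissible_corep A \<Delta> n T \<longleftrightarrow>
    invertible_corep A \<Delta> n T \<and> mat_invertible (multipliers A) n (\<lambda>i j. T j i)"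

definition AP :: "'i op set \<Rightarrow> ('i op \<Rightarrow> ('i \<times> 'i) op) \<Rightarrow> 'i op set" where
  "AP A \<Delta> = {x. \<exists>n T c. admissible_corep A \<Delta> n T \<and> x = (\<Sum>i<n. \<Sum>j<n. cscale (c i j) (T i j))}"

definition AP_closure :: "'i op set \<Rightarrow> ('i op \<Rightarrow> ('i \<times> 'i) op) \<Rightarrow> 'i op set" where
  "AP_closure A \<Delta> = closure (AP A \<Delta>)"


section \<open>Von Neumann algebras, normal functionals, slice maps\<close>

definition commutant :: "'i op set \<Rightarrow> 'i op set" where
  "commutant M = {T \<in> bop. \<forall>x\<in>M. T o\<^sub>L x = x o\<^sub>L T}"

definition von_neumann_algebra :: "'i op set \<Rightarrow> bool" where
  "von_neumann_algebra M \<longleftrightarrow> M \<subseteq> bop \<and> adj ` M \<subseteq> M \<and> commutant (commutant M) = M"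

definition vn_tensor :: "'i op set \<Rightarrow> 'j op set \<Rightarrow> ('i \<times> 'j) op set" where
  "vn_tensor M N = commutant (commutant {op_tensor a b | a b. a \<in> M \<and> b \<in> N})"

text \<open>A normal functional is given by two square-summable sequences of vectors, as
  \<open>\<omega>(T) = \<Sum>\<^sub>n \<langle>\<xi>\<^sub>n, T \<eta>\<^sub>n\<rangle>\<close>; it is positive when \<open>\<xi> = \<eta>\<close>. All (positive) normal functionals on
  a von Neumann algebra arise in this way. The maps \<open>slice_left\<close> and \<open>slice_right\<close> are
  \<open>\<omega> \<otimes> id\<close> and \<open>id \<otimes> \<omega>\<close>.\<close>

definition l2_seq :: "(nat \<Rightarrow> 'i ell2) \<Rightarrow> bool" where
  "l2_seq \<xi> \<longleftrightarrow> summable (\<lambda>n. (norm (\<xi> n))\<^sup>2)"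

definition normal_functional :: "(nat \<Rightarrow> 'i ell2) \<Rightarrow> (nat \<Rightarrow> 'i ell2) \<Rightarrow> 'i op \<Rightarrow> complex" where
  "normal_functional \<xi> \<eta> T = (\<Sum>n. cinner (\<xi> n) (blinfun_apply T (\<eta> n)))"

definition slice_left ::
  "(nat \<Rightarrow> 'i ell2) \<Rightarrow> (nat \<Rightarrow> 'i ell2) \<Rightarrow> ('i \<times> 'j) op \<Rightarrow> 'j op"
where
  "slice_left \<xi> \<eta> X = (THE R. R \<in> bop \<and> (\<forall>x y. cinner x (blinfun_apply R y) =
    (\<Sum>n. cinner (vtensor (\<xi> n) x) (blinfun_apply X (vtensor (\<eta> n) y)))))"

definition slice_right ::
  "(nat \<Rightarrow> 'j ell2) \<Rightarrow> (nat \<Rightarrow> 'j ell2) \<Rightarrow> ('i \<times> 'j) op \<Rightarrow> 'i op"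
where
  "slice_right \<xi> \<eta> X = (THE R. R \<in> bop \<and> (\<forall>x y. cinner x (blinfun_apply R y) =
    (\<Sum>n. cinner (vtensor x (\<xi> n)) (blinfun_apply X (vtensor y (\<eta> n))))))"

text \<open>Normality of a *-homomorphism is \<open>\<sigma>\<close>-weak continuity: normal functionals pull back to
  normal functionals.\<close>

definition normal_hom :: "'i op set \<Rightarrow> ('i op \<Rightarrow> 'j op) \<Rightarrow> 'j op set \<Rightarrow> bool" where
  "normal_hom M \<theta> N \<longleftrightarrow> star_hom M \<theta> N \<and>
    (\<forall>\<xi> \<eta>. l2_seq \<xi> \<and> l2_seq \<eta> \<longrightarrow> (\<exists>\<xi>' \<eta>'. l2_seq \<xi>' \<and> l2_seq \<eta>' \<and>
      (\<forall>x\<in>M. normal_functional \<xi> \<eta> (\<theta> x) = normal_functional \<xi>' \<eta>' x)))"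

definition normal_hom_tensor ::
  "'i op set \<Rightarrow> ('i op \<Rightarrow> 'k op) \<Rightarrow> 'j op set \<Rightarrow> ('j op \<Rightarrow> 'l op) \<Rightarrow> ('i \<times> 'j) op \<Rightarrow> ('k \<times> 'l) op"
where
  "normal_hom_tensor M \<theta> N \<rho> = (THE \<Phi>. \<Phi> \<in> extensional (vn_tensor M N) \<and>
    normal_hom (vn_tensor M N) \<Phi> bop \<and>
    (\<forall>a\<in>M. \<forall>b\<in>N. \<Phi> (op_tensor a b) = op_tensor (\<theta> a) (\<rho> b)))"


section \<open>Weights\<close>

definition positive_part :: "'i op set \<Rightarrow> 'i op set" where
  "positive_part M = {x \<in> M. positive_op x}"

definition weight :: "'i op set \<Rightarrow> ('i op \<Rightarrow> ennreal) \<Rightarrow> bool" where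
  "weight M \<phi> \<longleftrightarrow>
    (\<forall>x\<in>positive_part M. \<forall>y\<in>positive_part M. \<phi> (x + y) = \<phi> x + \<phi> y) \<and>
    (\<forall>x\<in>positive_part M. \<forall>r\<ge>0. \<phi> (r *\<^sub>R x) = ennreal r * \<phi> x)"

definition N_ideal :: "'i op set \<Rightarrow> ('i op \<Rightarrow> ennreal) \<Rightarrow> 'i op set" where
  "N_ideal M \<phi> = {x \<in> M. \<phi> (adj x o\<^sub>L x) < \<infinity>}"

definition faithful_weight :: "'i op set \<Rightarrow> ('i op \<Rightarrow> ennreal) \<Rightarrow> bool" where
  "faithful_weight M \<phi> \<longleftrightarrow> (\<forall>x\<in>positive_part M. \<phi> x = 0 \<longrightarrow> x = 0)"

text \<open>Normality: \<open>\<phi>\<close> preserves suprema of upward directed sets of positive elements.\<close>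

definition normal_weight :: "'i op set \<Rightarrow> ('i op \<Rightarrow> ennreal) \<Rightarrow> bool" where
  "normal_weight M \<phi> \<longleftrightarrow> (\<forall>D x. D \<subseteq> positive_part M \<and> D \<noteq> {} \<and>
      (\<forall>a\<in>D. \<forall>b\<in>D. \<exists>c\<in>D. positive_op (c - a) \<and> positive_op (c - b)) \<and>
      x \<in> positive_part M \<and> (\<forall>a\<in>D. positive_op (x - a)) \<and>
      (\<forall>y\<in>positive_part M. (\<forall>a\<in>D. positive_op (y - a)) \<longrightarrow> positive_op (y - x))
    \<longrightarrow> \<phi> x = (SUP a\<in>D. \<phi> a))"

text \<open>Semifiniteness: \<open>N_ideal M \<phi>\<close> is \<open>\<sigma>\<close>-weakly dense in \<open>M\<close>.\<close>

definition semifinite_weight :: "'i op set \<Rightarrow> ('i op \<Rightarrow> ennreal) \<Rightarrow> bool" where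
  "semifinite_weight M \<phi> \<longleftrightarrow> (\<forall>x\<in>M. \<forall>F. \<forall>e>0.
    finite F \<and> (\<forall>(\<xi>, \<eta>)\<in>F. l2_seq \<xi> \<and> l2_seq \<eta>) \<longrightarrow>
    (\<exists>y\<in>N_ideal M \<phi>. \<forall>(\<xi>, \<eta>)\<in>F. cmod (normal_functional \<xi> \<eta> (x - y)) < e))"

definition nsf_weight :: "'i op set \<Rightarrow> ('i op \<Rightarrow> ennreal) \<Rightarrow> bool" where
  "nsf_weight M \<phi> \<longleftrightarrow>
    weight M \<phi> \<and> normal_weight M \<phi> \<and> semifinite_weight M \<phi> \<and> faithful_weight M \<phi>"

text \<open>\<open>\<Lambda> : N_ideal M \<phi> \<rightarrow> \<ell>\<^sup>2(X)\<close> is a GNS map exhibiting the given action of \<open>M\<close> on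
  \<open>\<ell>\<^sup>2(X)\<close> as the GNS representation of \<open>\<phi>\<close>. By polarization the norm condition is
  \<open>\<langle>\<Lambda> x, \<Lambda> y\<rangle> = \<phi>(x\<^sup>* y)\<close>.\<close>

definition gns_map :: "'x op set \<Rightarrow> ('x op \<Rightarrow> ennreal) \<Rightarrow> ('x op \<Rightarrow> 'x ell2) \<Rightarrow> bool" where
  "gns_map M \<phi> \<Lambda> \<longleftrightarrow>
    (\<forall>x\<in>N_ideal M \<phi>. ennreal ((norm (\<Lambda> x))\<^sup>2) = \<phi> (adj x o\<^sub>L x)) \<and>
    (\<forall>x\<in>N_ideal M \<phi>. \<forall>y\<in>N_ideal M \<phi>. \<Lambda> (x + y) = \<Lambda> x + \<Lambda> y) \<and>
    (\<forall>x\<in>N_ideal M \<phi>. \<forall>c. \<Lambda> (cscale c x) = scaleC c (\<Lambda> x)) \<and>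
    (\<forall>x\<in>N_ideal M \<phi>. \<forall>a\<in>M. \<Lambda> (a o\<^sub>L x) = blinfun_apply a (\<Lambda> x)) \<and>
    closure (\<Lambda> ` N_ideal M \<phi>) = UNIV"


section \<open>Locally compact quantum groups\<close>

text \<open>The von Neumann algebraic definition of Kustermans and Vaes, with \<open>M = L\<^sup>\<infinity>(G)\<close>. The
  data include the left Haar weight \<open>\<phi>\<close>, the right Haar weight \<open>\<psi>\<close>, and a GNS map for
  \<open>\<phi>\<close>: as is customary, \<open>M\<close> acts on the GNS space of \<open>\<phi>\<close>, which loses no generality
  because the GNS representation is faithful and normal.\<close>

record 'x qgroup =
  Linf :: "'x op set"
  comult :: "'x op \<Rightarrow> ('x \<times> 'x) op"
  left_haar :: "'x op \<Rightarrow> ennreal"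
  right_haar :: "'x op \<Rightarrow> ennreal"
  gns :: "'x op \<Rightarrow> 'x ell2"

definition left_invariant ::
  "'x op set \<Rightarrow> ('x op \<Rightarrow> ('x \<times> 'x) op) \<Rightarrow> ('x op \<Rightarrow> ennreal) \<Rightarrow> bool"
where
  "left_invariant M \<Delta> \<phi> \<longleftrightarrow> (\<forall>x\<in>positive_part M. \<forall>\<xi>. \<phi> x < \<infinity> \<and> l2_seq \<xi> \<longrightarrow>
    \<phi> (slice_left \<xi> \<xi> (\<Delta> x)) = ennreal (\<Sum>n. (norm (\<xi> n))\<^sup>2) * \<phi> x)"

definition right_invariant ::
  "'x op set \<Rightarrow> ('x op \<Rightarrow> ('x \<times> 'x) op) \<Rightarrow> ('x op \<Rightarrow> ennreal) \<Rightarrow> bool"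
where
  "right_invariant M \<Delta> \<psi> \<longleftrightarrow> (\<forall>x\<in>positive_part M. \<forall>\<xi>. \<psi> x < \<infinity> \<and> l2_seq \<xi> \<longrightarrow>
    \<psi> (slice_right \<xi> \<xi> (\<Delta> x)) = ennreal (\<Sum>n. (norm (\<xi> n))\<^sup>2) * \<psi> x)"

definition lcqg :: "'x qgroup \<Rightarrow> bool" where
  "lcqg G \<longleftrightarrow> von_neumann_algebra (Linf G) \<and>
    normal_hom (Linf G) (comult G) (vn_tensor (Linf G) (Linf G)) \<and>
    comult G id_blinfun = id_blinfun \<and>
    (\<forall>x\<in>Linf G. transport (\<lambda>((i, j), k). (i, (j, k)))
          (normal_hom_tensor (Linf G) (comult G) (Linf G) (\<lambda>x. x) (comult G x))
        = normal_hom_tensor (Linf G) (\<lambda>x. x) (Linf G) (comult G) (comult G x)) \<and>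
    nsf_weight (Linf G) (left_haar G) \<and> left_invariant (Linf G) (comult G) (left_haar G) \<and>
    nsf_weight (Linf G) (right_haar G) \<and> right_invariant (Linf G) (comult G) (right_haar G) \<and>
    gns_map (Linf G) (left_haar G) (gns G)"

text \<open>The multiplicative unitary \<open>W\<close>, for which
  \<open>W\<^sup>*(\<Lambda> x \<otimes> \<Lambda> y) = (\<Lambda> \<otimes> \<Lambda>)(\<Delta>(y)(x \<otimes> 1))\<close>; this formula is stated after applying
  normal functionals to the first leg, which avoids the weight \<open>\<phi> \<otimes> \<phi>\<close>.\<close>

definition mult_unitary :: "'x qgroup \<Rightarrow> ('x \<times> 'x) op" where
  "mult_unitary G = (THE W. unitary W \<and>
    (\<forall>\<xi> \<eta>. l2_seq \<xi> \<and> l2_seq \<eta> \<longrightarrow> (\<forall>y\<in>N_ideal (Linf G) (left_haar G).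
      blinfun_apply (slice_left \<xi> \<eta> (adj W)) (gns G y) = gns G (slice_left \<xi> \<eta> (comult G y)))))"

definition C0_dual :: "'x qgroup \<Rightarrow> 'x op set" where
  "C0_dual G = closure {slice_left \<xi> \<eta> (mult_unitary G) | \<xi> \<eta>. l2_seq \<xi> \<and> l2_seq \<eta>}"

text \<open>The dual has multiplicative unitary \<open>\<Sigma> W\<^sup>* \<Sigma>\<close>, so its left regular representation is
  \<open>\<lambda>(\<omega>) = (id \<otimes> \<omega>)(W\<^sup>*)\<close> for \<open>\<omega>\<close> in the predual \<open>L\<^sup>1\<close> of the dual. It is an injective algebra
  homomorphism on \<open>L\<^sup>1\<close>, and Kustermans' *-algebra consists of those \<open>\<omega>\<close> for which
  \<open>\<lambda>(\<omega>)\<^sup>* = \<lambda>(\<omega>')\<close> for some \<open>\<omega>'\<close>, with the involution \<open>\<omega> \<mapsto> \<omega>'\<close>. It is represented here by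
  its isomorphic image under \<open>\<lambda>\<close>.\<close>

definition L1_dual_image :: "'x qgroup \<Rightarrow> 'x op set" where
  "L1_dual_image G =
    {slice_right \<xi> \<eta> (adj (mult_unitary G)) | \<xi> \<eta>. l2_seq \<xi> \<and> l2_seq \<eta>}"

definition L1_sharp_dual_image :: "'x qgroup \<Rightarrow> 'x op set" where
  "L1_sharp_dual_image G = {x \<in> L1_dual_image G. adj x \<in> L1_dual_image G}"

definition leg13 :: "('u \<times> 'x) op \<Rightarrow> (('u \<times> 'u) \<times> 'x) op" where
  "leg13 V = transport (\<lambda>(v, (u, x)). ((u, v), x)) (op_tensor id_blinfun V)"

definition leg23 :: "('u \<times> 'x) op \<Rightarrow> (('u \<times> 'u) \<times> 'x) op" where
  "leg23 V = transport (\<lambda>(u, (v, x)). ((u, v), x)) (op_tensor id_blinfun V)"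

text \<open>\<open>(A, \<Delta>)\<close> is (a realization of) Kustermans' universal C*-bialgebra of \<open>G\<close>: \<open>A\<close> is the
  universal enveloping C*-algebra, via \<open>j\<close>, of the *-algebra above; the universal unitary
  \<open>V \<in> M(A \<otimes> C0_dual G)\<close> satisfies
  \<open>(id \<otimes> \<omega>)(V\<^sup>*) = j(\<lambda>(\<omega>))\<close>; and \<open>\<Delta>\<close> is determined by \<open>(\<Delta> \<otimes> id)(V) = V\<^sub>1\<^sub>3 V\<^sub>2\<^sub>3\<close>.\<close>

definition universal_C0 :: "'x qgroup \<Rightarrow> 'u op set \<Rightarrow> ('u op \<Rightarrow> ('u \<times> 'u) op) \<Rightarrow> bool" where
  "universal_C0 G A \<Delta> \<longleftrightarrow> cstar_bialgebra A \<Delta> \<and>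
    (\<exists>j V. universal_envelope (L1_sharp_dual_image G) A j \<and>
      unitary V \<and> V \<in> multipliers (min_tensor A (C0_dual G)) \<and>
      (\<forall>\<xi> \<eta>. l2_seq \<xi> \<and> l2_seq \<eta> \<and>
          slice_right \<xi> \<eta> (adj (mult_unitary G)) \<in> L1_sharp_dual_image G \<longrightarrow>
        slice_right \<xi> \<eta> (adj V) = j (slice_right \<xi> \<eta> (adj (mult_unitary G)))) \<and>
      strict_ext (min_tensor A (C0_dual G)) (hom_tensor A \<Delta> (C0_dual G) (\<lambda>x. x)) V
        = leg13 V o\<^sub>L leg23 V)"

end

theory Submission
  imports Defs
begin

text \<open>Say that a corepresentation \<open>T\<close> is over a *-algebra \<open>V\<close> if \<open>V\<close> contains the entries of \<open>T\<close>
  and of the inverses of \<open>T\<close> and \<open>T\<^sup>T\<close>. Every element of a Hopf *-algebra \<open>P\<close> is a coefficient of such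
  a corepresentation over \<open>P\<close>, the antipode providing the inverses. Applying a Hopf
  *-homomorphism \<open>\<theta>\<close> gives admissible corepresentations, so \<open>\<theta>\<close> maps \<open>P\<close> into
  \<open>AP\<close>; composing with \<open>AP \<rightarrow> K\<close> and using the universal property of \<open>H\<close> gives \<open>\<theta>\<^sub>1\<close>.

  It remains to see that \<open>AP\<close> contains the entries of the inverses of an
  admissible \<open>T\<close> and of \<open>T\<^sup>T\<close>, and that a corepresentation \<open>X\<close> of \<open>K\<close> has its entries in
  the image of \<open>AP\<close>. Both follow by averaging with a state that is invariant on the finitely many
  coefficients involved: this yields intertwiners between \<open>T\<close> and its contragredient, and between
  \<open>X\<close> and corepresentations over the dense subalgebra. By the second fact a factor \<open>\<theta>\<^sub>1\<close> maps \<open>P\<close>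
  into the image of \<open>AP\<close>, on which \<open>\<Lambda>\<close> is injective; hence it is unique.

  Strict extensions, tensor products of *-homomorphisms and extensions by continuity rest on the
  contractivity of *-homomorphisms, for which \<open>1 - a\<^sup>* a\<close> is written as a square.\<close>

section \<open>Operators between Hilbert spaces\<close>

text \<open>The inverse matrices that make a corepresentation admissible have entries only in
  \<open>multipliers A\<close>, and this algebra, where the averaging has to happen, is not a
  compact quantum group: its comultiplication takes values in multipliers of the tensor product, no
  density condition is available, and no Haar state is given. The way out is to avoid topological
  tensor products. The largest set \<open>cf\<close> of elements whose comultiplication is a finite
  combination of tensors from the set itself is a unital *-algebra that contains the entries of all
  corepresentations in question and of their inverses, and slices do not leave it. A faithful state
  may fail to exist, so the averaged vector state is only asked to separate the finitely many
  operators at hand. Its limit need not be faithful either; that the scalar intertwining matrices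
  have trivial kernel is deduced instead from the inverse matrices in one case, and from closeness
  to the identity matrix in the other. Membership in a subspace is tested by linear functionals, so
  that a trivial kernel is all that has to be known of these matrices.\<close>

instance ell2 :: (type) banach ..

lemma cinner_commute: "cinner x y = cnj (cinner y x)"
  by transfer (simp flip: infsum_cnj add: mult.commute)

lemma cinner_add_left: "cinner (x + y) z = cinner x z + cinner y z"
  by transfer (simp add: distrib_right infsum_add square_summable_cnj_mult)

lemma cinner_add_right: "cinner x (y + z) = cinner x y + cinner x z"
  by transfer (simp add: distrib_left infsum_add square_summable_cnj_mult)

lemma cinner_scaleC_left: "cinner (scaleC c x) y = cnj c * cinner x y"
  by transfer (simp add: mult.assoc infsum_cmult_right')

lemma cinner_scaleC_right: "cinner x (scaleC c y) = c * cinner x y"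
  by transfer (simp add: mult.left_commute infsum_cmult_right')

lemma scaleR_eq_scaleC: "r *\<^sub>R (x :: 'i ell2) = scaleC (complex_of_real r) x"
  by transfer simp

lemma scaleC_simps [simp]:
  "scaleC 1 x = x" "scaleC 0 x = 0" "scaleC c 0 = 0" "scaleC c (scaleC d x) = scaleC (c * d) x"
  by (transfer; simp add: mult.assoc)+

lemma scaleC_add_right: "scaleC c (x + y) = scaleC c x + scaleC c y"
  by transfer (simp add: algebra_simps)

lemma scaleC_add_left: "scaleC (c + d) x = scaleC c x + scaleC d x"
  by transfer (simp add: algebra_simps)

lemma cinner_scaleR_left: "cinner (r *\<^sub>R x) y = r *\<^sub>R cinner x y"
  by (simp add: scaleR_eq_scaleC cinner_scaleC_left scaleR_conv_of_real)

lemma cinner_scaleR_right: "cinner x (r *\<^sub>R y) = r *\<^sub>R cinner x y"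
  by (simp add: scaleR_eq_scaleC cinner_scaleC_right scaleR_conv_of_real)

lemma cinner_self_norm: "cinner x x = complex_of_real ((norm x)\<^sup>2)"
  by (simp only: cinner_self norm_ell2_eq)

lemma Re_cinner_self: "Re (cinner x x) = (norm x)\<^sup>2"
  by (simp add: cinner_self_norm)

lemma norm_scaleC: "norm (scaleC c x) = cmod c * norm x"
proof -
  have "(norm (scaleC c x))\<^sup>2 = Re (cinner (scaleC c x) (scaleC c x))"
    by (simp add: Re_cinner_self)
  also have "cinner (scaleC c x) (scaleC c x) = of_real ((cmod c * norm x)\<^sup>2)"
    unfolding power_mult_distrib of_real_mult complex_norm_square cinner_self_norm[symmetric]
    by (simp add: cinner_scaleC_left cinner_scaleC_right)
  finally show ?thesis by (simp add: power2_eq_iff_nonneg)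
qed

text \<open>Rotating \<open>y\<close> by a phase makes the inner product real and nonnegative; then
  the Cauchy-Schwarz inequality of the underlying real inner product applies.\<close>

lemma norm_cinner_le: "cmod (cinner x y) \<le> norm x * norm y"
proof (cases "cinner x y = 0")
  case False
  define u where "u = cnj (cinner x y) / cmod (cinner x y)"
  have "cmod (cinner x y) = Re (cinner x (scaleC u y))"
    using False
    by (simp add: cinner_scaleC_right u_def mult.commute power2_eq_square flip: complex_norm_square)
  also have "\<dots> = inner x (scaleC u y)" by (simp add: inner_ell2_def)
  also have "\<dots> \<le> norm x * norm (scaleC u y)" by (rule norm_cauchy_schwarz)
  also have "norm (scaleC u y) = norm y"
    using False by (simp add: norm_scaleC u_def norm_divide)
  finally show ?thesis .
qed simp

interpretation cinner: bounded_bilinear cinner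
proof
  show "\<exists>K. \<forall>a b. norm (cinner a b) \<le> norm a * norm b * K"
    by (rule exI[of _ 1]) (simp add: norm_cinner_le)
qed (simp_all add: cinner_add_left cinner_add_right cinner_scaleR_left cinner_scaleR_right)

lemmas cinner_zero [simp] = cinner.zero_left cinner.zero_right

lemma bounded_linear_scaleC: "bounded_linear (scaleC c)"
  by (rule bounded_linear_intro[where K = "cmod c"])
     (simp_all add: scaleC_add_right norm_scaleC scaleR_eq_scaleC mult.commute)

lemmas scaleC_diff_right = linear_diff[OF bounded_linear.linear[OF bounded_linear_scaleC]]
lemmas scaleC_minus_right = linear_neg[OF bounded_linear.linear[OF bounded_linear_scaleC]]

lemma cinner_ext: "(\<And>z. cinner z x = cinner z y) \<Longrightarrow> x = y"
proof -
  assume "\<And>z. cinner z x = cinner z y"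
  then have "cinner (x - y) (x - y) = 0" by (simp add: cinner.diff_right)
  then show ?thesis by (simp add: cinner_self_norm)
qed

lemma cinner_ext_left: "(\<And>z. cinner x z = cinner y z) \<Longrightarrow> x = y"
  by (rule cinner_ext) (metis cinner_commute)

lemma norm_le_cinnerI:
  assumes "0 \<le> C" "\<And>z. cmod (cinner z x) \<le> C * norm z"
  shows "norm x \<le> C"
proof (cases "x = 0")
  case False
  have "(norm x)\<^sup>2 \<le> C * norm x"
    using assms(2)[of x] by (simp add: cinner_self_norm norm_power)
  then show ?thesis using False by (simp add: power2_eq_square)
qed (use assms in simp)

section \<open>The standard basis\<close>

lift_definition ebasis :: "'i \<Rightarrow> 'i ell2" is "\<lambda>i j. if j = i then 1 else 0"
  unfolding square_summable_def
  subgoal for i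
    by (rule summable_on_cong_neutral[THEN iffD1, OF _ _ _ summable_on_finite[of "{i}"]]) auto
  done

lemma cinner_ebasis_left: "cinner (ebasis i) x = Rep_ell2 x i"
proof -
  have "cinner (ebasis i) x = (\<Sum>\<^sub>\<infinity>j. if j = i then Rep_ell2 x i else 0)"
    unfolding cinner.rep_eq ebasis.rep_eq by (rule infsum_cong) auto
  also have "\<dots> = (\<Sum>\<^sub>\<infinity>j\<in>{i}. Rep_ell2 x i)"
    by (rule infsum_cong_neutral) auto
  finally show ?thesis by simp
qed

lemma cinner_ebasis_right: "cinner x (ebasis i) = cnj (Rep_ell2 x i)"
  by (subst cinner_commute) (simp add: cinner_ebasis_left)

lemma ebasis_orthonormal: "cinner (ebasis i) (ebasis j) = (if i = j then 1 else 0)"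
  by (simp add: cinner_ebasis_left ebasis.rep_eq)

lemma norm_ebasis [simp]: "norm (ebasis i) = 1"
proof -
  have "(norm (ebasis i))\<^sup>2 = 1"
    by (simp flip: Re_cinner_self add: ebasis_orthonormal)
  then show ?thesis by (metis norm_ge_zero one_power2 power2_eq_iff_nonneg zero_le_one)
qed

lemma norm_sum_ebasis:
  assumes "finite F"
  shows "(norm (\<Sum>i\<in>F. scaleC (c i) (ebasis i)))\<^sup>2 = (\<Sum>i\<in>F. (cmod (c i))\<^sup>2)"
proof -
  have "complex_of_real ((norm (\<Sum>i\<in>F. scaleC (c i) (ebasis i)))\<^sup>2)
      = (\<Sum>i\<in>F. \<Sum>j\<in>F. cnj (c j) * (c i * (if j = i then 1 else 0)))"
    unfolding cinner_self_norm[symmetric]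
    by (simp add: cinner.sum_left cinner.sum_right cinner_scaleC_left cinner_scaleC_right
        ebasis_orthonormal sum_distrib_left mult_ac cong: if_cong)
  also have "\<dots> = (\<Sum>i\<in>F. complex_of_real ((cmod (c i))\<^sup>2))"
    using assms by (simp add: complex_norm_square mult.commute if_distrib sum.delta' cong: if_cong
        del: of_real_power)
  finally show ?thesis by (simp only: of_real_eq_iff flip: of_real_sum)
qed

lemma ell2_sums_ebasis:
  "((\<lambda>F. \<Sum>i\<in>F. scaleC (Rep_ell2 x i) (ebasis i)) \<longlongrightarrow> x) (finite_subsets_at_top UNIV)"
proof -
  let ?t = "\<lambda>F. \<Sum>i\<in>F. scaleC (Rep_ell2 x i) (ebasis i)"
  \<comment> \<open>Pythagoras: the partial sum is the orthogonal projection of \<open>x\<close>, so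
    the squared error is the tail of the series of squared coordinates.\<close>
  have n: "(norm (x - ?t F))\<^sup>2 = (norm x)\<^sup>2 - (\<Sum>i\<in>F. (cmod (Rep_ell2 x i))\<^sup>2)" if "finite F" for F
  proof -
    have "cinner x (?t F) = of_real (\<Sum>i\<in>F. (cmod (Rep_ell2 x i))\<^sup>2)"
      by (simp add: cinner.sum_right cinner_scaleC_right cinner_ebasis_right complex_norm_square
          del: of_real_power)
    moreover have "(norm (x - ?t F))\<^sup>2 = (norm x)\<^sup>2 - 2 * Re (cinner x (?t F)) + (norm (?t F))\<^sup>2"
      by (simp add: power2_norm_eq_inner inner_diff_left inner_diff_right inner_commute[of "?t F" x])
         (simp add: inner_ell2_def)
    ultimately show ?thesis using norm_sum_ebasis[OF that, of "Rep_ell2 x"] by simp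
  qed
  have "((\<lambda>F. \<Sum>i\<in>F. (cmod (Rep_ell2 x i))\<^sup>2) \<longlongrightarrow> (norm x)\<^sup>2) (finite_subsets_at_top UNIV)"
    unfolding norm_ell2_eq using Rep_ell2[of x]
    by (simp add: infsum_tendsto square_summable_def)
  then have "((\<lambda>F. (norm x)\<^sup>2 - (\<Sum>i\<in>F. (cmod (Rep_ell2 x i))\<^sup>2)) \<longlongrightarrow> (norm x)\<^sup>2 - (norm x)\<^sup>2)
      (finite_subsets_at_top UNIV)"
    by (intro tendsto_diff tendsto_const)
  then have "((\<lambda>F. (norm (x - ?t F))\<^sup>2) \<longlongrightarrow> 0) (finite_subsets_at_top UNIV)"
    unfolding diff_self
    by (rule Lim_transform_eventually)
       (rule eventually_finite_subsets_at_top_weakI, simp add: n)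
  then have "((\<lambda>F. sqrt ((norm (x - ?t F))\<^sup>2)) \<longlongrightarrow> sqrt 0) (finite_subsets_at_top UNIV)"
    by (rule tendsto_real_sqrt)
  then have "((\<lambda>F. norm (?t F - x)) \<longlongrightarrow> 0) (finite_subsets_at_top UNIV)"
    by (simp add: norm_minus_commute)
  then show ?thesis by (simp add: tendsto_norm_zero_iff LIM_zero_iff)
qed

text \<open>Finite combinations of basis vectors are dense, so a closed property that survives sums
  reaches all vectors. Identities between continuous maps are reduced to the basis in this way, one
  tensor leg at a time.\<close>

lemma ell2_induct [case_names closed zero add ebasis]:
  assumes "closed {x. P x}" and "P 0" and "\<And>x y. P x \<Longrightarrow> P y \<Longrightarrow> P (x + y)"
    and "\<And>c i. P (scaleC c (ebasis i))"
  shows "P x"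
proof -
  have fin: "P (\<Sum>i\<in>F. scaleC (Rep_ell2 x i) (ebasis i))" if "finite F" for F
    using that by (induction F) (auto intro: assms)
  have "x \<in> {x. P x}"
    by (rule Lim_in_closed_set[OF assms(1) _ _ ell2_sums_ebasis[of x]])
       (rule eventually_finite_subsets_at_top_weakI, simp_all add: fin)
  then show ?thesis by simp
qed

lemma ebasis_ext:
  assumes "\<And>i. cinner (ebasis i) x = cinner (ebasis i) y" shows "x = y"
  using assms by (metis Rep_ell2_inject cinner_ebasis_left ext)


text \<open>Complex linearity between different spaces, as needed for \<open>reindex\<close> and for
  the maps \<open>rtens\<close> below; \<open>bop\<close> speaks only of operators on one
  space.\<close>

definition clin :: "('i ell2 \<Rightarrow>\<^sub>L 'j ell2) \<Rightarrow> bool" where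
  "clin T \<longleftrightarrow> (\<forall>c x. T (scaleC c x) = scaleC c (T x))"

lemma clinD: "clin T \<Longrightarrow> T (scaleC c x) = scaleC c (T x)"
  by (simp add: clin_def)

lemma bop_iff_clin: "T \<in> bop \<longleftrightarrow> clin T"
  by (simp add: bop_def clin_def)

lemma clin_ext:
  assumes "clin S" "clin T" "\<And>i. S (ebasis i) = T (ebasis i)"
  shows "S = T"
proof (rule blinfun_eqI)
  fix x show "S x = T x"
  proof (induction x rule: ell2_induct)
    show "closed {x. S x = T x}" by (intro closed_Collect_eq continuous_intros)
  qed (use assms in \<open>simp_all add: blinfun.add_right clinD\<close>)
qed

text \<open>A family of vectors on which finite linear combinations are dominated by the
  \<open>\<ell>\<^sup>2\<close>-norm of the coefficients is the image of the standard basis under a bounded operator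
  \<open>T\<close>; the operator \<open>S\<close> is its adjoint.\<close>

lemma bessel_family:
  fixes w :: "'i \<Rightarrow> 'j ell2"
  assumes C: "0 \<le> C"
    and w: "\<And>F c. finite F \<Longrightarrow>
      norm (\<Sum>i\<in>F. scaleC (c i) (w i)) \<le> C * norm (\<Sum>i\<in>F. scaleC (c i) (ebasis i))"
  shows "\<exists>S. clin S \<and> norm S \<le> C \<and> (\<forall>i x. Rep_ell2 (blinfun_apply S x) i = cinner (w i) x)"
proof -
  have fin: "(\<Sum>i\<in>F. (cmod (cinner (w i) x))\<^sup>2) \<le> (C * norm x)\<^sup>2" if "finite F" for F x
  proof -
    \<comment> \<open>Duality: \<open>y\<close> is chosen so that \<open>cinner y x\<close> is the
      sum of squares itself, while the hypothesis bounds \<open>norm y\<close> by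
      \<open>C * s\<close>; dividing by \<open>s\<close> gives the estimate.\<close>
    define y where "y = (\<Sum>i\<in>F. scaleC (cinner (w i) x) (w i))"
    define s where "s = sqrt (\<Sum>i\<in>F. (cmod (cinner (w i) x))\<^sup>2)"
    have s2: "s\<^sup>2 = (\<Sum>i\<in>F. (cmod (cinner (w i) x))\<^sup>2)" and s0: "0 \<le> s"
      by (auto simp: s_def sum_nonneg)
    have "norm (\<Sum>i\<in>F. scaleC (cinner (w i) x) (ebasis i)) = s"
      unfolding s_def norm_sum_ebasis[OF that, symmetric] by simp
    then have ny: "norm y \<le> C * s"
      using w[OF that, of "\<lambda>i. cinner (w i) x"] by (simp add: y_def)
    have "cinner y x = of_real (s\<^sup>2)"
      by (simp add: y_def cinner.sum_left cinner_scaleC_left s2 complex_norm_square mult.commute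
          del: of_real_power)
    then have "s\<^sup>2 = cmod (cinner y x)" by (simp add: norm_power)
    also have "\<dots> \<le> norm y * norm x" by (rule norm_cinner_le)
    also have "\<dots> \<le> C * s * norm x" using ny by (simp add: mult_right_mono)
    finally have "s * s \<le> s * (C * norm x)" by (simp add: power2_eq_square mult_ac)
    then have "s \<le> C * norm x"
      using s0 C by (cases "s = 0") (auto simp: mult_le_cancel_left)
    then show ?thesis using s0 by (simp flip: s2 add: power_mono)
  qed
  have sq: "square_summable (\<lambda>i. cinner (w i) x)" for x
    unfolding square_summable_def
    by (rule nonneg_bdd_above_summable_on)
       (auto intro!: bdd_aboveI2[where M = "(C * norm x)\<^sup>2"] fin)
  define S0 where "S0 x = Abs_ell2 (\<lambda>i. cinner (w i) x)" for x
  have R: "Rep_ell2 (S0 x) i = cinner (w i) x" for x i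
    by (simp add: S0_def Abs_ell2_inverse sq)
  have nS: "norm (S0 x) \<le> C * norm x" for x
    by (rule norm_ell2_le) (auto simp: C R fin)
  have bl: "bounded_linear S0"
  proof (rule bounded_linear_intro[where K = C])
    show "S0 (x + y) = S0 x + S0 y" for x y
      by (rule ebasis_ext) (simp add: cinner_ebasis_left cinner_add_right R plus_ell2.rep_eq)
    show "S0 (r *\<^sub>R x) = r *\<^sub>R S0 x" for r x
      by (rule ebasis_ext)
         (simp add: scaleR_eq_scaleC cinner_scaleC_right R cinner_ebasis_left)
    show "norm (S0 x) \<le> norm x * C" for x using nS[of x] by (simp add: mult.commute)
  qed
  show ?thesis
  proof (intro exI[of _ "Blinfun S0"] conjI allI)
    show "clin (Blinfun S0)"
      unfolding clin_def
      by (auto intro!: ebasis_ext simp: bounded_linear_Blinfun_apply[OF bl] cinner_scaleC_right R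
          cinner_ebasis_left)
    show "norm (Blinfun S0) \<le> C"
      by (rule norm_blinfun_bound) (auto simp: C nS bounded_linear_Blinfun_apply[OF bl])
  qed (simp add: bounded_linear_Blinfun_apply[OF bl] R)
qed

text \<open>The images of the basis vectors under \<open>T\<close> satisfy the hypothesis of
  \<open>bessel_family\<close> with the constant \<open>norm T\<close>, and the operator obtained
  has the coordinates that the adjoint must have.\<close>

lemma ex_gadj:
  assumes "clin T"
  shows "\<exists>S. clin S \<and> norm S \<le> norm T \<and> (\<forall>x y. cinner (blinfun_apply S x) y = cinner x (blinfun_apply T y))"
proof -
  have "norm (\<Sum>i\<in>F. scaleC (c i) (T (ebasis i))) \<le> norm T * norm (\<Sum>i\<in>F. scaleC (c i) (ebasis i))"
    for F and c :: "'a \<Rightarrow> complex"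
    using norm_blinfun[of T "\<Sum>i\<in>F. scaleC (c i) (ebasis i)"]
    by (simp add: blinfun.sum_right clinD[OF assms])
  from bessel_family[OF norm_ge_zero this] obtain S where S: "clin S" "norm S \<le> norm T"
    "\<And>i x. Rep_ell2 (blinfun_apply S x) i = cinner (T (ebasis i)) x" by auto
  have "cinner (S x) y = cinner x (T y)" for x y
  proof (induction y rule: ell2_induct)
    show "closed {y. cinner (S x) y = cinner x (T y)}"
      by (intro closed_Collect_eq continuous_intros cinner.continuous_on)
  next
    case (ebasis c i)
    have "cinner (S x) (ebasis i) = cinner x (T (ebasis i))"
      by (subst (1 2) cinner_commute) (simp add: cinner_ebasis_left S(3))
    then show ?case by (simp add: cinner_scaleC_right clinD[OF assms])
  qed (simp_all add: cinner_add_right blinfun.add_right)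
  with S show ?thesis by blast
qed

text \<open>The adjoint between different spaces, chosen together with its norm bound. On
  \<open>bop\<close> it agrees with \<open>adj\<close>, whose definite description is justified
  through it in \<open>adj_eq_gadj\<close>.\<close>

definition gadj :: "('i ell2 \<Rightarrow>\<^sub>L 'j ell2) \<Rightarrow> ('j ell2 \<Rightarrow>\<^sub>L 'i ell2)" where
  "gadj T = (SOME S. clin S \<and> norm S \<le> norm T \<and> (\<forall>x y. cinner (blinfun_apply S x) y = cinner x (blinfun_apply T y)))"

lemma
  assumes "clin T"
  shows clin_gadj: "clin (gadj T)"
    and norm_gadj_le: "norm (gadj T) \<le> norm T"
    and cinner_gadj_left: "cinner (gadj T x) y = cinner x (T y)"
    and cinner_gadj_right: "cinner y (gadj T x) = cinner (T y) x"
proof -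
  have *: "clin (gadj T) \<and> norm (gadj T) \<le> norm T \<and>
      (\<forall>x y. cinner (gadj T x) y = cinner x (T y))"
    unfolding gadj_def by (rule someI_ex) (rule ex_gadj[OF assms])
  then show "clin (gadj T)" "norm (gadj T) \<le> norm T" "cinner (gadj T x) y = cinner x (T y)"
    by auto
  show "cinner y (gadj T x) = cinner (T y) x"
    using * by (subst (1 2) cinner_commute) simp
qed

lemma adj_eq_gadj: "T \<in> bop \<Longrightarrow> adj T = gadj T"
  unfolding adj_def bop_iff_clin
  by (rule the_equality)
     (auto simp: cinner_gadj_left intro!: blinfun_eqI cinner_ext_left)

lemma
  assumes "T \<in> bop"
  shows adj_bop [simp, intro]: "adj T \<in> bop"
    and cinner_adj_left: "cinner (adj T x) y = cinner x (T y)"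
    and cinner_adj_right: "cinner y (adj T x) = cinner (T y) x"
  using assms unfolding adj_eq_gadj[OF assms] bop_iff_clin
  by (simp_all add: clin_gadj cinner_gadj_left cinner_gadj_right)

lemma adj_unique:
  fixes S T :: "'i op"
  assumes "\<And>x y. cinner (S x) y = cinner x (T y)" "T \<in> bop"
  shows "S = adj T"
  by (rule blinfun_eqI, rule cinner_ext_left) (simp add: assms cinner_adj_left)

lemma adj_adj [simp]: "T \<in> bop \<Longrightarrow> adj (adj T) = T"
  by (rule adj_unique[symmetric]) (simp_all add: cinner_adj_right)

lemma cscale_apply [simp]: "blinfun_apply (cscale c T) x = scaleC c (blinfun_apply T x)"
  unfolding cscale_def
  by (subst bounded_linear_Blinfun_apply)
     (simp_all add: bounded_linear_compose[OF bounded_linear_scaleC blinfun.bounded_linear_right])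

lemma bopD: "T \<in> bop \<Longrightarrow> T (scaleC c x) = scaleC c (T x)"
  by (simp add: bop_def)

lemma bop_simps [simp, intro]:
  "0 \<in> bop" "id_blinfun \<in> bop"
  "S \<in> bop \<Longrightarrow> T \<in> bop \<Longrightarrow> S + T \<in> bop"
  "S \<in> bop \<Longrightarrow> T \<in> bop \<Longrightarrow> S - T \<in> bop"
  "S \<in> bop \<Longrightarrow> - S \<in> bop"
  "S \<in> bop \<Longrightarrow> T \<in> bop \<Longrightarrow> S o\<^sub>L T \<in> bop"
  "S \<in> bop \<Longrightarrow> cscale c S \<in> bop"
  by (auto simp: bop_def blinfun.add_left blinfun.diff_left blinfun.minus_left scaleC_add_right
      scaleC_diff_right scaleC_minus_right mult.commute)

lemma closed_bop: "closed (bop :: 'i op set)"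
proof -
  have "closed (\<Inter>c. \<Inter>x. {T :: 'i op. blinfun_apply T (scaleC c x) = scaleC c (blinfun_apply T x)})"
    by (intro closed_INT ballI closed_Collect_eq continuous_intros
        bounded_linear.continuous_on[OF bounded_linear_scaleC])
  also have "(\<Inter>c. \<Inter>x. {T. blinfun_apply T (scaleC c x) = scaleC c (blinfun_apply T x)}) = (bop :: 'i op set)"
    by (auto simp: bop_def)
  finally show ?thesis .
qed

text \<open>The topology on operators comes with a real vector space structure. This interpretation
  adds complex spans, subspaces and independent sets under the prefix \<open>cop\<close>.\<close>

interpretation cop: vector_space cscale
  by standard
     (auto intro!: blinfun_eqI simp: scaleC_add_right scaleC_add_left blinfun.add_left mult.commute)

lemma scaleR_eq_cscale: "r *\<^sub>R (T :: 'i op) = cscale (complex_of_real r) T"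
  by (rule blinfun_eqI) (simp add: blinfun.scaleR_left scaleR_eq_scaleC)

lemma norm_cscale_le: "norm (cscale c T) \<le> cmod c * norm T"
  by (rule norm_blinfun_bound)
     (auto simp: norm_scaleC mult.assoc intro!: mult_left_mono norm_blinfun)

lemma norm_cscale: "norm (cscale c T) = cmod c * norm T"
proof (rule antisym[OF norm_cscale_le])
  show "cmod c * norm T \<le> norm (cscale c T)"
  proof (cases "c = 0")
    case False
    have "cmod c * norm T = cmod c * norm (cscale (inverse c) (cscale c T))"
      using False by simp
    also have "\<dots> \<le> cmod c * (cmod (inverse c) * norm (cscale c T))"
      by (intro mult_left_mono norm_cscale_le) auto
    also have "\<dots> = norm (cscale c T)"
      using False by (simp add: norm_inverse flip: mult.assoc)
    finally show ?thesis .
  qed simp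
qed

lemma bounded_linear_cscale: "bounded_linear (cscale c)"
  by (rule bounded_linear_intro[where K = "cmod c"])
     (simp_all add: cop.scale_right_distrib scaleR_eq_cscale norm_cscale mult.commute)

lemma comp_cscale_left: "cscale c S o\<^sub>L T = cscale c (S o\<^sub>L T)"
  by (rule blinfun_eqI) simp

lemma comp_cscale_right: "S \<in> bop \<Longrightarrow> S o\<^sub>L cscale c T = cscale c (S o\<^sub>L T)"
  by (rule blinfun_eqI) (simp add: bopD)

lemma adj_simps:
  "adj (0 :: 'i op) = 0" "adj (id_blinfun :: 'i op) = id_blinfun"
  "S \<in> bop \<Longrightarrow> T \<in> bop \<Longrightarrow> adj (S + T) = adj S + adj T"
  "S \<in> bop \<Longrightarrow> T \<in> bop \<Longrightarrow> adj (S - T) = adj S - adj T"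
  "S \<in> bop \<Longrightarrow> T \<in> bop \<Longrightarrow> adj (S o\<^sub>L T) = adj T o\<^sub>L adj S"
  "S \<in> bop \<Longrightarrow> adj (cscale c S) = cscale (cnj c) (adj S)"
  by (rule adj_unique[symmetric];
      simp add: bopD blinfun.add_left blinfun.diff_left cinner.add_left cinner.add_right
      cinner.diff_left cinner.diff_right cinner_adj_left cinner_scaleC_left cinner_scaleC_right)+

lemma adj_sum: "(\<And>i. i \<in> F \<Longrightarrow> f i \<in> bop) \<Longrightarrow> adj (sum f F) = (\<Sum>i\<in>F. adj (f i))"
  "(\<And>i. i \<in> F \<Longrightarrow> f i \<in> bop) \<Longrightarrow> sum f F \<in> bop"
proof -
  assume "\<And>i. i \<in> F \<Longrightarrow> f i \<in> bop"
  then have "adj (sum f F) = (\<Sum>i\<in>F. adj (f i)) \<and> sum f F \<in> bop"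
    by (induction F rule: infinite_finite_induct) (auto simp: adj_simps)
  then show "adj (sum f F) = (\<Sum>i\<in>F. adj (f i))" "sum f F \<in> bop" by auto
qed

lemmas sum_bop [simp, intro] = adj_sum(2)

lemma norm_adj: "T \<in> bop \<Longrightarrow> norm (adj T) = norm T"
proof -
  have "norm (adj T) \<le> norm T" if "T \<in> bop" for T :: "'a op"
    using that norm_gadj_le[of T] by (simp add: adj_eq_gadj bop_iff_clin)
  from this[of T] this[of "adj T"] show "T \<in> bop \<Longrightarrow> norm (adj T) = norm T" by simp
qed

text \<open>The C*-identity, from Cauchy-Schwarz for
  \<open>cinner x ((adj T o\<^sub>L T) x)\<close>, which is the square of
  \<open>norm (T x)\<close>.\<close>

lemma norm_adj_comp: "T \<in> bop \<Longrightarrow> norm (adj T o\<^sub>L T) = (norm T)\<^sup>2"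
proof (rule antisym)
  assume T: "T \<in> bop"
  show "norm (adj T o\<^sub>L T) \<le> (norm T)\<^sup>2"
    using norm_blinfun_compose[of "adj T" T] by (simp add: norm_adj T power2_eq_square)
  have "norm T \<le> sqrt (norm (adj T o\<^sub>L T))"
  proof (rule norm_blinfun_bound)
    fix x
    have "(norm (T x))\<^sup>2 = Re (cinner x ((adj T o\<^sub>L T) x))"
      by (simp flip: Re_cinner_self add: cinner_adj_right T)
    also have "\<dots> \<le> cmod (cinner x ((adj T o\<^sub>L T) x))" by (rule complex_Re_le_cmod)
    also have "\<dots> \<le> norm x * norm ((adj T o\<^sub>L T) x)" by (rule norm_cinner_le)
    also have "\<dots> \<le> norm x * (norm (adj T o\<^sub>L T) * norm x)"
      by (intro mult_left_mono norm_blinfun) auto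
    finally have "(norm (T x))\<^sup>2 \<le> (sqrt (norm (adj T o\<^sub>L T)) * norm x)\<^sup>2"
      by (simp add: power_mult_distrib power2_eq_square mult_ac)
    then show "norm (T x) \<le> sqrt (norm (adj T o\<^sub>L T)) * norm x"
      by (rule power2_le_imp_le) simp
  qed simp
  then have "(norm T)\<^sup>2 \<le> (sqrt (norm (adj T o\<^sub>L T)))\<^sup>2" by (intro power_mono) auto
  then show "(norm T)\<^sup>2 \<le> norm (adj T o\<^sub>L T)" by simp
qed

lemma continuous_on_adj: "continuous_on bop adj"
proof (rule continuous_onI)
  fix T :: "'a op" and e :: real assume T: "T \<in> bop" "0 < e"
  have "dist (adj S) (adj T) = dist S T" if "S \<in> bop" for S
    using that T(1) by (simp add: dist_norm norm_adj flip: adj_simps(4))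
  then show "\<exists>d>0. \<forall>S\<in>bop. dist S T < d \<longrightarrow> dist (adj S) (adj T) \<le> e"
    using T(2) by (intro exI[of _ e]) auto
qed

lemma star_subalgebra_bop: "star_subalgebra bop"
  by (auto simp: star_subalgebra_def)

section \<open>Tensor products of operators\<close>

lemma vtensor_add_left: "vtensor (x + y) z = vtensor x z + vtensor y z"
  by transfer (auto simp: algebra_simps)

lemma vtensor_add_right: "vtensor x (y + z) = vtensor x y + vtensor x z"
  by transfer (auto simp: algebra_simps)

lemma vtensor_scaleC_left: "vtensor (scaleC c x) y = scaleC c (vtensor x y)"
  by transfer (auto simp: algebra_simps)

lemma vtensor_scaleC_right: "vtensor x (scaleC c y) = scaleC c (vtensor x y)"
  by transfer (auto simp: algebra_simps)

lemma norm_vtensor_le: "norm (vtensor x y) \<le> norm x * norm y"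
proof (rule norm_ell2_le)
  fix F :: "('a \<times> 'b) set" assume F: "finite F"
  have "(\<Sum>p\<in>F. (cmod (Rep_ell2 (vtensor x y) p))\<^sup>2)
      \<le> (\<Sum>p\<in>fst ` F \<times> snd ` F. (cmod (Rep_ell2 (vtensor x y) p))\<^sup>2)"
    using F by (intro sum_mono2 finite_cartesian_product finite_imageI subset_fst_snd) auto
  also have "\<dots> = (\<Sum>i\<in>fst ` F. (cmod (Rep_ell2 x i))\<^sup>2) * (\<Sum>j\<in>snd ` F. (cmod (Rep_ell2 y j))\<^sup>2)"
    by (simp add: sum_product sum.cartesian_product vtensor.rep_eq norm_mult power_mult_distrib
        case_prod_unfold)
  also have "\<dots> \<le> (norm x)\<^sup>2 * (norm y)\<^sup>2"
    using F by (intro mult_mono finite_sum_le_norm_ell2) (auto intro: sum_nonneg)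
  finally show "(\<Sum>p\<in>F. (cmod (Rep_ell2 (vtensor x y) p))\<^sup>2) \<le> (norm x * norm y)\<^sup>2"
    by (simp add: power_mult_distrib)
qed simp

interpretation vtensor: bounded_bilinear vtensor
proof
  show "\<exists>K. \<forall>a b. norm (vtensor a b) \<le> norm a * norm b * K"
    by (rule exI[of _ 1]) (simp add: norm_vtensor_le)
qed (simp_all add: vtensor_add_left vtensor_add_right vtensor_scaleC_left vtensor_scaleC_right
    scaleR_eq_scaleC)

lemma ebasis_pair: "ebasis (i, j) = vtensor (ebasis i) (ebasis j)"
  by transfer auto

lemma cinner_vtensor: "cinner (vtensor x y) (vtensor x' y') = cinner x x' * cinner y y'"
proof (induction x' rule: ell2_induct)
  case closed
  show ?case by (intro closed_Collect_eq continuous_intros cinner.continuous_on vtensor.continuous_on)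
next
  case (ebasis c i)
  show ?case
  proof (induction y' rule: ell2_induct)
    case closed
    show ?case by (intro closed_Collect_eq continuous_intros cinner.continuous_on vtensor.continuous_on)
  next
    case (ebasis d j)
    show ?case
      by (simp add: vtensor_scaleC_left vtensor_scaleC_right cinner_scaleC_right
          cinner_ebasis_right vtensor.rep_eq flip: ebasis_pair)
  qed (simp_all add: vtensor.zero_right vtensor_add_right cinner_add_right algebra_simps)
qed (simp_all add: vtensor.zero_left vtensor_add_left cinner_add_right algebra_simps)

lemma vtensor_clin_ext:
  assumes "clin S" "clin T" "\<And>x y. S (vtensor x y) = T (vtensor x y)"
  shows "S = T"
proof (rule clin_ext[OF assms(1,2)])
  show "S (ebasis p) = T (ebasis p)" for p
    by (cases p) (simp add: ebasis_pair assms(3))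
qed

text \<open>\<open>bessel_family\<close> yields the adjoint of the wanted operator, since its
  coordinates are inner products with the prescribed vectors; taking the adjoint once more puts
  these vectors at the images of the basis.\<close>

lemma ex_bounded_on_ebasis:
  fixes w :: "'i \<Rightarrow> 'j ell2"
  assumes "0 \<le> C"
    and "\<And>F c. finite F \<Longrightarrow>
      norm (\<Sum>i\<in>F. scaleC (c i) (w i)) \<le> C * norm (\<Sum>i\<in>F. scaleC (c i) (ebasis i))"
  shows "\<exists>T. clin T \<and> norm T \<le> C \<and> (\<forall>i. blinfun_apply T (ebasis i) = w i)"
proof -
  obtain S where S: "clin S" "norm S \<le> C" "\<And>i x. Rep_ell2 (blinfun_apply S x) i = cinner (w i) x"
    using bessel_family[OF assms] by auto
  have "gadj S (ebasis i) = w i" for i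
    by (rule cinner_ext_left) (simp add: cinner_gadj_left[OF S(1)] cinner_ebasis_left S(3))
  with S show ?thesis
    by (intro exI[of _ "gadj S"]) (auto simp: clin_gadj intro: order_trans[OF norm_gadj_le])
qed

lemma norm_sum_vtensor_ebasis:
  assumes "finite J"
  shows "(norm (\<Sum>j\<in>J. vtensor (x j) (ebasis j)))\<^sup>2 = (\<Sum>j\<in>J. (norm (x j))\<^sup>2)"
    and "(norm (\<Sum>j\<in>J. vtensor (ebasis j) (x j)))\<^sup>2 = (\<Sum>j\<in>J. (norm (x j))\<^sup>2)"
proof -
  have "complex_of_real ((norm (\<Sum>j\<in>J. vtensor (x j) (ebasis j)))\<^sup>2) = (\<Sum>j\<in>J. of_real ((norm (x j))\<^sup>2))"
    unfolding cinner_self_norm[symmetric]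
    using assms by (simp add: cinner.sum_left cinner.sum_right cinner_vtensor ebasis_orthonormal
        if_distrib cong: if_cong)
  then show "(norm (\<Sum>j\<in>J. vtensor (x j) (ebasis j)))\<^sup>2 = (\<Sum>j\<in>J. (norm (x j))\<^sup>2)"
    by (simp only: of_real_eq_iff flip: of_real_sum)
  have "complex_of_real ((norm (\<Sum>j\<in>J. vtensor (ebasis j) (x j)))\<^sup>2) = (\<Sum>j\<in>J. of_real ((norm (x j))\<^sup>2))"
    unfolding cinner_self_norm[symmetric]
    using assms by (simp add: cinner.sum_left cinner.sum_right cinner_vtensor ebasis_orthonormal
        if_distrib[of "\<lambda>x. x * _"] cong: if_cong)
  then show "(norm (\<Sum>j\<in>J. vtensor (ebasis j) (x j)))\<^sup>2 = (\<Sum>j\<in>J. (norm (x j))\<^sup>2)"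
    by (simp only: of_real_eq_iff flip: of_real_sum)
qed

lemma norm_sum_image_le:
  fixes S :: "'i ell2 \<Rightarrow>\<^sub>L 'j ell2"
  shows "(\<Sum>j\<in>J. (norm (S (x j)))\<^sup>2) \<le> (norm S)\<^sup>2 * (\<Sum>j\<in>J. (norm (x j))\<^sup>2)"
  unfolding sum_distrib_left power_mult_distrib[symmetric]
  by (intro sum_mono power_mono norm_blinfun) auto

text \<open>Grouped by the index of the leg on which nothing happens, a finite combination of basis
  vectors splits into orthogonal blocks. \<open>S\<close> acts inside each block, so the sum of
  squared norms grows at most by the factor \<open>(norm S)^2\<close>.\<close>

lemma ex_amplification:
  fixes S :: "'i op"
  assumes S: "clin S"
  shows "\<exists>T :: ('i \<times> 'j) op. clin T \<and> norm T \<le> norm S \<and> (\<forall>x y. T (vtensor x y) = vtensor (S x) y)"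
    and "\<exists>T :: ('j \<times> 'i) op. clin T \<and> norm T \<le> norm S \<and> (\<forall>x y. T (vtensor y x) = vtensor y (S x))"
proof -
  have "norm (\<Sum>p\<in>F. scaleC (c p) (vtensor (S (ebasis (fst p))) (ebasis (snd p))))
      \<le> norm S * norm (\<Sum>p\<in>F. scaleC (c p) (ebasis p))"
    if F: "finite F" for F :: "('i \<times> 'j) set" and c
  proof -
    define I J where "I = fst ` F" and "J = snd ` F"
    \<comment> \<open>The coefficients are extended by zero from \<open>F\<close> to the rectangle
      \<open>I \<times> J\<close>, where the double sum can be regrouped.\<close>
    define d where "d p = (if p \<in> F then c p else 0)" for p
    define x where "x j = (\<Sum>i\<in>I. scaleC (d (i, j)) (ebasis i))" for j
    have fin: "finite I" "finite J" "F \<subseteq> I \<times> J" using F subset_fst_snd[of F] by (auto simp: I_def J_def)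
    have 1: "(\<Sum>p\<in>F. scaleC (c p) (w p)) = (\<Sum>j\<in>J. \<Sum>i\<in>I. scaleC (d (i, j)) (w (i, j)))"
      for w :: "_ \<Rightarrow> ('i \<times> 'j) ell2"
    proof -
      have "(\<Sum>p\<in>F. scaleC (c p) (w p)) = (\<Sum>p\<in>I \<times> J. scaleC (d p) (w p))"
        using fin by (intro sum.mono_neutral_cong_left) (auto simp: d_def)
      also have "\<dots> = (\<Sum>i\<in>I. \<Sum>j\<in>J. scaleC (d (i, j)) (w (i, j)))"
        by (simp add: sum.cartesian_product)
      finally show ?thesis by (simp add: sum.swap[of _ J])
    qed
    have "(norm (\<Sum>p\<in>F. scaleC (c p) (vtensor (S (ebasis (fst p))) (ebasis (snd p)))))\<^sup>2
        = (norm (\<Sum>j\<in>J. vtensor (S (x j)) (ebasis j)))\<^sup>2"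
      unfolding 1 x_def
      by (simp add: blinfun.sum_right clinD[OF S] vtensor.sum_left vtensor_scaleC_left)
    also have "\<dots> \<le> (norm S)\<^sup>2 * (\<Sum>j\<in>J. (norm (x j))\<^sup>2)"
      by (simp add: norm_sum_vtensor_ebasis fin norm_sum_image_le)
    also have "(\<Sum>j\<in>J. (norm (x j))\<^sup>2) = (norm (\<Sum>p\<in>F. scaleC (c p) (ebasis p)))\<^sup>2"
      unfolding norm_sum_vtensor_ebasis(1)[OF fin(2), symmetric]
      unfolding 1 x_def
      by (simp add: ebasis_pair vtensor.sum_left vtensor_scaleC_left)
    finally show ?thesis
      by (intro power2_le_imp_le[of "norm _"]) (simp_all add: power_mult_distrib)
  qed
  then have "\<exists>T :: ('i \<times> 'j) op. clin T \<and> norm T \<le> norm S \<and> (\<forall>p. blinfun_apply T (ebasis p) = vtensor (S (ebasis (fst p))) (ebasis (snd p)))"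
    by (intro ex_bounded_on_ebasis norm_ge_zero)
  then obtain T :: "('i \<times> 'j) op" where T: "clin T" "norm T \<le> norm S"
      "\<And>p. blinfun_apply T (ebasis p) = vtensor (S (ebasis (fst p))) (ebasis (snd p))" by blast
  have "T (vtensor x y) = vtensor (S x) y" for x y
  proof (induction x rule: ell2_induct)
    case (ebasis c i)
    show ?case
    proof (induction y rule: ell2_induct)
      case (ebasis d j)
      show ?case
        using T(3)[of "(i, j)"]
        by (simp add: vtensor_scaleC_left vtensor_scaleC_right clinD[OF T(1)] clinD[OF S] ebasis_pair)
    qed (auto intro!: closed_Collect_eq continuous_intros vtensor.continuous_on
        simp: vtensor.zero_right vtensor_add_right blinfun.add_right)
  qed (auto intro!: closed_Collect_eq continuous_intros vtensor.continuous_on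
        simp: vtensor.zero_left vtensor_add_left blinfun.add_right)
  with T(1,2) show "\<exists>T :: ('i \<times> 'j) op. clin T \<and> norm T \<le> norm S \<and> (\<forall>x y. T (vtensor x y) = vtensor (S x) y)"
    by auto
  have "norm (\<Sum>p\<in>F. scaleC (c p) (vtensor (ebasis (fst p)) (S (ebasis (snd p)))))
      \<le> norm S * norm (\<Sum>p\<in>F. scaleC (c p) (ebasis p))"
    if F: "finite F" for F :: "('j \<times> 'i) set" and c
  proof -
    define I J where "I = snd ` F" and "J = fst ` F"
    define d where "d p = (if p \<in> F then c p else 0)" for p
    define x where "x j = (\<Sum>i\<in>I. scaleC (d (j, i)) (ebasis i))" for j
    have fin: "finite I" "finite J" "F \<subseteq> J \<times> I" using F subset_fst_snd[of F] by (auto simp: I_def J_def)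
    have 1: "(\<Sum>p\<in>F. scaleC (c p) (w p)) = (\<Sum>j\<in>J. \<Sum>i\<in>I. scaleC (d (j, i)) (w (j, i)))"
      for w :: "_ \<Rightarrow> ('j \<times> 'i) ell2"
    proof -
      have "(\<Sum>p\<in>F. scaleC (c p) (w p)) = (\<Sum>p\<in>J \<times> I. scaleC (d p) (w p))"
        using fin by (intro sum.mono_neutral_cong_left) (auto simp: d_def)
      also have "\<dots> = (\<Sum>j\<in>J. \<Sum>i\<in>I. scaleC (d (j, i)) (w (j, i)))"
        by (simp add: sum.cartesian_product)
      finally show ?thesis .
    qed
    have "(norm (\<Sum>p\<in>F. scaleC (c p) (vtensor (ebasis (fst p)) (S (ebasis (snd p))))))\<^sup>2
        = (norm (\<Sum>j\<in>J. vtensor (ebasis j) (S (x j))))\<^sup>2"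
      unfolding 1 x_def
      by (simp add: blinfun.sum_right clinD[OF S] vtensor.sum_right vtensor_scaleC_right)
    also have "\<dots> \<le> (norm S)\<^sup>2 * (\<Sum>j\<in>J. (norm (x j))\<^sup>2)"
      by (simp add: norm_sum_vtensor_ebasis fin norm_sum_image_le)
    also have "(\<Sum>j\<in>J. (norm (x j))\<^sup>2) = (norm (\<Sum>p\<in>F. scaleC (c p) (ebasis p)))\<^sup>2"
      unfolding norm_sum_vtensor_ebasis(2)[OF fin(2), symmetric]
      unfolding 1 x_def
      by (simp add: ebasis_pair vtensor.sum_right vtensor_scaleC_right)
    finally show ?thesis
      by (intro power2_le_imp_le[of "norm _"]) (simp_all add: power_mult_distrib)
  qed
  then have "\<exists>T :: ('j \<times> 'i) op. clin T \<and> norm T \<le> norm S \<and> (\<forall>p. blinfun_apply T (ebasis p) = vtensor (ebasis (fst p)) (S (ebasis (snd p))))"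
    by (intro ex_bounded_on_ebasis norm_ge_zero)
  then obtain T :: "('j \<times> 'i) op" where T: "clin T" "norm T \<le> norm S"
      "\<And>p. blinfun_apply T (ebasis p) = vtensor (ebasis (fst p)) (S (ebasis (snd p)))" by blast
  have "T (vtensor y x) = vtensor y (S x)" for x y
  proof (induction x rule: ell2_induct)
    case (ebasis c i)
    show ?case
    proof (induction y rule: ell2_induct)
      case (ebasis d j)
      show ?case
        using T(3)[of "(j, i)"]
        by (simp add: vtensor_scaleC_left vtensor_scaleC_right clinD[OF T(1)] clinD[OF S] ebasis_pair)
    qed (auto intro!: closed_Collect_eq continuous_intros vtensor.continuous_on
        simp: vtensor.zero_left vtensor_add_left blinfun.add_right)
  qed (auto intro!: closed_Collect_eq continuous_intros vtensor.continuous_on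
        simp: vtensor.zero_right vtensor_add_right blinfun.add_right)
  with T(1,2) show "\<exists>T :: ('j \<times> 'i) op. clin T \<and> norm T \<le> norm S \<and> (\<forall>x y. T (vtensor y x) = vtensor y (S x))"
    by auto
qed

text \<open>The tensor product is the composition of the two amplifications, which gives the norm
  bound; uniqueness holds because the basis consists of elementary tensors.\<close>

lemma
  fixes S :: "'i op" and T :: "'j op"
  assumes S: "S \<in> bop" and T: "T \<in> bop"
  shows op_tensor_bop [simp, intro]: "op_tensor S T \<in> bop"
    and op_tensor_vtensor: "op_tensor S T (vtensor x y) = vtensor (S x) (T y)"
    and op_tensor_unique: "R \<in> bop \<Longrightarrow> (\<And>x y. R (vtensor x y) = vtensor (S x) (T y)) \<Longrightarrow> R = op_tensor S T"
    and norm_op_tensor_le: "norm (op_tensor S T) \<le> norm S * norm T"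
proof -
  let ?P = "\<lambda>R. R \<in> bop \<and> (\<forall>x y. R (vtensor x y) = vtensor (S x) (T y))"
  obtain S1 T1 :: "('i \<times> 'j) op" where 1: "clin S1" "norm S1 \<le> norm S" "\<And>x y. S1 (vtensor x y) = vtensor (S x) y"
    and 2: "clin T1" "norm T1 \<le> norm T" "\<And>x y. T1 (vtensor x y) = vtensor x (T y)"
    using ex_amplification(1)[of S] ex_amplification(2)[of T] S T unfolding bop_iff_clin by metis
  have P: "?P (S1 o\<^sub>L T1)" using 1 2 by (auto simp: bop_iff_clin clin_def)
  have u: "R = R'" if "?P R" "?P R'" for R R'
    using that unfolding bop_iff_clin by (intro vtensor_clin_ext) auto
  have eq: "op_tensor S T = S1 o\<^sub>L T1"
    unfolding op_tensor_def using P u by (intro the_equality) blast+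
  show "op_tensor S T \<in> bop" "op_tensor S T (vtensor x y) = vtensor (S x) (T y)"
    using P eq by auto
  show "R \<in> bop \<Longrightarrow> (\<And>x y. R (vtensor x y) = vtensor (S x) (T y)) \<Longrightarrow> R = op_tensor S T"
    using P u eq by auto
  show "norm (op_tensor S T) \<le> norm S * norm T"
    unfolding eq using 1 2
    by (intro order_trans[OF norm_blinfun_compose] mult_mono) auto
qed

lemma op_tensor_add_left:
  "S \<in> bop \<Longrightarrow> S' \<in> bop \<Longrightarrow> T \<in> bop \<Longrightarrow> op_tensor (S + S') T = op_tensor S T + op_tensor S' T"
  by (rule op_tensor_unique[symmetric]) (auto simp: blinfun.add_left op_tensor_vtensor vtensor_add_left)

lemma op_tensor_add_right:
  "S \<in> bop \<Longrightarrow> T \<in> bop \<Longrightarrow> T' \<in> bop \<Longrightarrow> op_tensor S (T + T') = op_tensor S T + op_tensor S T'"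
  by (rule op_tensor_unique[symmetric]) (auto simp: blinfun.add_left op_tensor_vtensor vtensor_add_right)

lemma op_tensor_diff_right:
  "S \<in> bop \<Longrightarrow> T \<in> bop \<Longrightarrow> T' \<in> bop \<Longrightarrow> op_tensor S (T - T') = op_tensor S T - op_tensor S T'"
  by (rule op_tensor_unique[symmetric]) (auto simp: blinfun.diff_left op_tensor_vtensor vtensor.diff_right)

lemma op_tensor_zero_left [simp]: "T \<in> bop \<Longrightarrow> op_tensor 0 T = 0"
  by (rule op_tensor_unique[symmetric]) (auto simp: vtensor.zero_left)

lemma op_tensor_zero_right [simp]: "S \<in> bop \<Longrightarrow> op_tensor S 0 = 0"
  by (rule op_tensor_unique[symmetric]) (auto simp: vtensor.zero_right)

lemma op_tensor_cscale_left:
  "S \<in> bop \<Longrightarrow> T \<in> bop \<Longrightarrow> op_tensor (cscale c S) T = cscale c (op_tensor S T)"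
  by (rule op_tensor_unique[symmetric]) (auto simp: op_tensor_vtensor vtensor_scaleC_left)

lemma op_tensor_cscale_right:
  "S \<in> bop \<Longrightarrow> T \<in> bop \<Longrightarrow> op_tensor S (cscale c T) = cscale c (op_tensor S T)"
  by (rule op_tensor_unique[symmetric]) (auto simp: op_tensor_vtensor vtensor_scaleC_right)

lemma op_tensor_comp:
  "S \<in> bop \<Longrightarrow> S' \<in> bop \<Longrightarrow> T \<in> bop \<Longrightarrow> T' \<in> bop \<Longrightarrow>
    op_tensor S T o\<^sub>L op_tensor S' T' = op_tensor (S o\<^sub>L S') (T o\<^sub>L T')"
  by (rule op_tensor_unique) (auto simp: op_tensor_vtensor)

lemma op_tensor_id [simp]: "op_tensor id_blinfun id_blinfun = id_blinfun"
  by (rule op_tensor_unique[symmetric]) auto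

lemma op_tensor_sum_left:
  "(\<And>i. i \<in> F \<Longrightarrow> f i \<in> bop) \<Longrightarrow> T \<in> bop \<Longrightarrow> op_tensor (sum f F) T = (\<Sum>i\<in>F. op_tensor (f i) T)"
  by (induction F rule: infinite_finite_induct) (auto simp: op_tensor_add_left)

lemma op_tensor_sum_right:
  "(\<And>i. i \<in> F \<Longrightarrow> f i \<in> bop) \<Longrightarrow> T \<in> bop \<Longrightarrow> op_tensor T (sum f F) = (\<Sum>i\<in>F. op_tensor T (f i))"
  by (induction F rule: infinite_finite_induct) (auto simp: op_tensor_add_right)

lemma cinner_op_tensor_vtensor:
  "S \<in> bop \<Longrightarrow> T \<in> bop \<Longrightarrow>
    cinner (vtensor x y) (op_tensor S T (vtensor x' y')) = cinner x (S x') * cinner y (T y')"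
  by (simp add: op_tensor_vtensor cinner_vtensor)

lemma adj_op_tensor:
  assumes "S \<in> bop" "T \<in> bop"
  shows "adj (op_tensor S T) = op_tensor (adj S) (adj T)"
proof (rule op_tensor_unique)
  fix x y
  have "cinner z (adj (op_tensor S T) (vtensor x y)) = cinner z (vtensor (adj S x) (adj T y))" for z
  proof (induction z rule: ell2_induct)
    case (ebasis c p)
    show ?case
      using assms by (cases p) (simp add: ebasis_pair cinner_scaleC_left cinner_adj_right
        op_tensor_vtensor cinner_vtensor)
  qed (auto intro!: closed_Collect_eq continuous_intros cinner.continuous_on
        simp: cinner_add_left)
  then show "adj (op_tensor S T) (vtensor x y) = vtensor (adj S x) (adj T y)"
    by (rule cinner_ext)
qed (use assms in auto)


section \<open>Slices by vector functionals\<close>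

definition rtens :: "'j ell2 \<Rightarrow> 'i ell2 \<Rightarrow>\<^sub>L ('i \<times> 'j) ell2" where
  "rtens \<xi> = Blinfun (\<lambda>x. vtensor x \<xi>)"

lemma rtens_apply [simp]: "blinfun_apply (rtens \<xi>) x = vtensor x \<xi>"
  by (simp add: rtens_def bounded_linear_Blinfun_apply vtensor.bounded_linear_left)

lemma clin_rtens: "clin (rtens \<xi>)"
  by (simp add: clin_def vtensor_scaleC_left)

lemma norm_rtens_le: "norm (rtens \<xi>) \<le> norm \<xi>"
  by (rule norm_blinfun_bound) (simp_all, metis mult.commute norm_vtensor_le)

text \<open>The slice of the second leg by the functional of \<open>\<xi>\<close> and
  \<open>\<eta>\<close>, as \<open>cinner_compr\<close> shows. For basis vectors it is an entry of
  \<open>X\<close> regarded as a matrix of operators on the first leg.\<close>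

definition compr :: "'j ell2 \<Rightarrow> 'j ell2 \<Rightarrow> ('i \<times> 'j) op \<Rightarrow> 'i op" where
  "compr \<xi> \<eta> X = gadj (rtens \<xi>) o\<^sub>L X o\<^sub>L rtens \<eta>"

lemma cinner_compr: "cinner x (compr \<xi> \<eta> X y) = cinner (vtensor x \<xi>) (X (vtensor y \<eta>))"
  by (simp add: compr_def cinner_gadj_right[OF clin_rtens])

lemma compr_bop [simp, intro]: "X \<in> bop \<Longrightarrow> compr \<xi> \<eta> X \<in> bop"
  unfolding bop_iff_clin compr_def
  by (simp add: clin_def vtensor_scaleC_left clinD[OF clin_gadj[OF clin_rtens]])

lemma bounded_linear_compr: "bounded_linear (compr \<xi> \<eta>)"
  unfolding compr_def
  by (intro bounded_linear_compose[OF bounded_bilinear.bounded_linear_left[OF bounded_bilinear_blinfun_compose]]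
      bounded_bilinear.bounded_linear_right[OF bounded_bilinear_blinfun_compose])

lemmas compr_add = linear_add[OF bounded_linear.linear[OF bounded_linear_compr]]
lemmas compr_diff = linear_diff[OF bounded_linear.linear[OF bounded_linear_compr]]
lemmas compr_sum = linear_sum[OF bounded_linear.linear[OF bounded_linear_compr]]

lemma compr_cscale: "compr \<xi> \<eta> (cscale c X) = cscale c (compr \<xi> \<eta> X)"
  by (rule blinfun_eqI, rule cinner_ext) (simp add: cinner_compr cinner_scaleC_right)

lemma norm_compr_le: "norm (compr \<xi> \<eta> X) \<le> norm \<xi> * norm X * norm \<eta>"
  unfolding compr_def
  by (intro order_trans[OF norm_blinfun_compose] mult_mono norm_rtens_le
      order_trans[OF norm_gadj_le[OF clin_rtens]]) auto

lemma compr_op_tensor: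
  "S \<in> bop \<Longrightarrow> T \<in> bop \<Longrightarrow> compr \<xi> \<eta> (op_tensor S T) = cscale (cinner \<xi> (T \<eta>)) S"
  by (rule blinfun_eqI, rule cinner_ext)
     (simp add: cinner_compr op_tensor_vtensor cinner_vtensor cinner_scaleC_right)

lemma compr_comp_left:
  assumes "S \<in> bop" "X \<in> bop"
  shows "compr \<xi> \<eta> (op_tensor S id_blinfun o\<^sub>L X) = S o\<^sub>L compr \<xi> \<eta> X"
proof (rule blinfun_eqI, rule cinner_ext)
  fix x y
  show "cinner y (compr \<xi> \<eta> (op_tensor S id_blinfun o\<^sub>L X) x) = cinner y ((S o\<^sub>L compr \<xi> \<eta> X) x)"
    using cinner_adj_left[of "op_tensor S id_blinfun" "vtensor y \<xi>" "X (vtensor x \<eta>)"]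
      cinner_adj_left[of S y "compr \<xi> \<eta> X x"] assms
    by (simp add: cinner_compr adj_op_tensor op_tensor_vtensor adj_simps)
qed

lemma compr_comp_right:
  assumes "S \<in> bop" "X \<in> bop"
  shows "compr \<xi> \<eta> (X o\<^sub>L op_tensor S id_blinfun) = compr \<xi> \<eta> X o\<^sub>L S"
  by (rule blinfun_eqI, rule cinner_ext) (use assms in \<open>simp add: cinner_compr op_tensor_vtensor\<close>)

lemma adj_compr: "X \<in> bop \<Longrightarrow> adj (compr \<xi> \<xi> X) = compr \<xi> \<xi> (adj X)"
proof (rule adj_unique[symmetric])
  fix x y assume X: "X \<in> bop"
  have "cinner (compr \<xi> \<xi> (adj X) x) y = cnj (cinner y (compr \<xi> \<xi> (adj X) x))"
    by (rule cinner_commute)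
  also have "\<dots> = cinner x (compr \<xi> \<xi> X y)"
    using X by (simp add: cinner_compr cinner_adj_right) (metis cinner_commute)
  finally show "cinner (compr \<xi> \<xi> (adj X) x) y = cinner x (compr \<xi> \<xi> X y)" .
qed auto


section \<open>Unitaries that permute tensor legs\<close>

lemma reindex_apply:
  assumes f: "bij f"
  shows "Rep_ell2 (blinfun_apply (reindex f) x) j = Rep_ell2 x (inv f j)"
proof -
  have bi: "bij (inv f)" using f by (rule bij_imp_bij_inv)
  let ?g = "\<lambda>x j. Rep_ell2 x (inv f j)"
  have sq: "square_summable (?g x)" for x
    using Rep_ell2[of x] bi
      summable_on_reindex_bij_betw[of "inv f" UNIV UNIV "\<lambda>i. (cmod (Rep_ell2 x i))\<^sup>2"]
    by (simp add: square_summable_def)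
  have R: "Rep_ell2 (Abs_ell2 (?g x)) = ?g x" for x by (simp add: Abs_ell2_inverse sq)
  have "bounded_linear (\<lambda>x. Abs_ell2 (?g x))"
  proof (rule bounded_linear_intro[where K = 1])
    show "norm (Abs_ell2 (?g x)) \<le> norm x * 1" for x
    proof (rule norm_ell2_le)
      fix F :: "'b set" assume "finite F"
      have "(\<Sum>j\<in>F. (cmod (Rep_ell2 (Abs_ell2 (?g x)) j))\<^sup>2) = (\<Sum>i\<in>inv f ` F. (cmod (Rep_ell2 x i))\<^sup>2)"
        unfolding R by (subst sum.reindex) (use bi in \<open>auto simp: bij_def inj_on_def\<close>)
      also have "\<dots> \<le> (norm x)\<^sup>2" using \<open>finite F\<close> by (intro finite_sum_le_norm_ell2) auto
      finally show "(\<Sum>j\<in>F. (cmod (Rep_ell2 (Abs_ell2 (?g x)) j))\<^sup>2) \<le> (norm x * 1)\<^sup>2" by simp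
    qed simp
  qed (rule ebasis_ext, simp only: cinner_ebasis_left R, simp only: plus_ell2.rep_eq scaleR_ell2.rep_eq R)+
  then show ?thesis unfolding reindex_def by (simp add: bounded_linear_Blinfun_apply R)
qed

lemma clin_reindex: "bij f \<Longrightarrow> clin (reindex f)"
  unfolding clin_def
  by (auto intro!: ebasis_ext simp: cinner_ebasis_left reindex_apply scaleC.rep_eq)

lemma reindex_reindex_inv: "bij f \<Longrightarrow> reindex f o\<^sub>L reindex (inv f) = id_blinfun"
  by (auto intro!: blinfun_eqI ebasis_ext
      simp: cinner_ebasis_left reindex_apply bij_imp_bij_inv inv_inv_eq bij_is_surj surj_f_inv_f)

lemma reindex_inv_reindex: "bij f \<Longrightarrow> reindex (inv f) o\<^sub>L reindex f = id_blinfun"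
  by (auto intro!: blinfun_eqI ebasis_ext
      simp: cinner_ebasis_left reindex_apply bij_imp_bij_inv inv_inv_eq bij_is_inj inv_f_f)

lemma norm_reindex_le: "bij f \<Longrightarrow> norm (reindex f) \<le> 1"
proof (rule norm_blinfun_bound)
  fix x assume f: "bij f"
  then have bi: "bij (inv f)" by (rule bij_imp_bij_inv)
  have "norm (reindex f x) \<le> norm x"
  proof (rule norm_ell2_le)
    fix F :: "'b set" assume "finite F"
    have "(\<Sum>j\<in>F. (cmod (Rep_ell2 (reindex f x) j))\<^sup>2) = (\<Sum>i\<in>inv f ` F. (cmod (Rep_ell2 x i))\<^sup>2)"
      by (subst sum.reindex) (use bi in \<open>auto simp: bij_def inj_on_def reindex_apply[OF f]\<close>)
    also have "\<dots> \<le> (norm x)\<^sup>2" using \<open>finite F\<close> by (intro finite_sum_le_norm_ell2) auto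
    finally show "(\<Sum>j\<in>F. (cmod (Rep_ell2 (reindex f x) j))\<^sup>2) \<le> (norm x)\<^sup>2" .
  qed simp
  then show "norm (reindex f x) \<le> 1 * norm x" by simp
qed simp

lemma transport_bop: "bij f \<Longrightarrow> T \<in> bop \<Longrightarrow> transport f T \<in> bop"
  using clin_reindex[of f] clin_reindex[of "inv f"] bij_imp_bij_inv[of f]
  by (simp add: bop_iff_clin transport_def clin_def)

lemma norm_transport_le: "bij f \<Longrightarrow> norm (transport f T) \<le> norm T"
proof -
  assume f: "bij f"
  have "norm (transport f T) \<le> 1 * norm T * 1"
    unfolding transport_def
    by (intro order_trans[OF norm_blinfun_compose] mult_mono norm_reindex_le f bij_imp_bij_inv) auto
  then show ?thesis by simp
qed

lemma transport_sum: "transport f (\<Sum>i\<in>I. T i) = (\<Sum>i\<in>I. transport f (T i))"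
  unfolding transport_def
  by (simp add: bounded_bilinear.sum_left[OF bounded_bilinear_blinfun_compose]
      bounded_bilinear.sum_right[OF bounded_bilinear_blinfun_compose])

lemma transport_swap:
  assumes "S \<in> bop" "T \<in> bop"
  shows "transport prod.swap (op_tensor S T) = op_tensor T S"
proof (rule op_tensor_unique)
  have [simp]: "bij (prod.swap :: 'a \<times> 'b \<Rightarrow> 'b \<times> 'a)" by (rule bij_swap)
  have inv: "inv (prod.swap :: 'a \<times> 'b \<Rightarrow> 'b \<times> 'a) = prod.swap"
    by (rule inv_unique_comp) auto
  have r: "reindex prod.swap (vtensor x y) = vtensor y x" for x :: "'a ell2" and y :: "'b ell2"
    by (rule ebasis_ext) (auto simp: cinner_ebasis_left reindex_apply inv vtensor.rep_eq split: prod.split)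
  have r': "reindex prod.swap (vtensor x y) = vtensor y x" for x :: "'b ell2" and y :: "'a ell2"
    using reindex_inv_reindex[of "prod.swap :: 'a \<times> 'b \<Rightarrow> _"]
    by (metis \<open>bij prod.swap\<close> blinfun_apply_blinfun_compose id_blinfun.rep_eq id_apply inv r)
  show "transport prod.swap (op_tensor S T) (vtensor x y) = vtensor (T x) (S y)" for x y
    using assms by (simp add: transport_def inv r r' op_tensor_vtensor)
  show "transport prod.swap (op_tensor S T) \<in> bop"
    using assms by (intro transport_bop) auto
qed (use assms in auto)

lemma transport_assoc:
  assumes "S \<in> bop" "T \<in> bop" "R \<in> bop"
  shows "transport (\<lambda>((i, j), k). (i, (j, k))) (op_tensor (op_tensor S T) R)
    = op_tensor S (op_tensor T R)"
proof -
  let ?f = "\<lambda>((i, j), k). (i, (j, k)) :: 'a \<times> 'b \<times> 'c" let ?g = "\<lambda>(i, (j, k)). ((i, j), k) :: ('a \<times> 'b) \<times> 'c"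
  have f: "bij ?f" by (rule o_bij[of ?g]) auto
  have inv: "inv ?f = ?g" by (rule inv_unique_comp) auto
  have g: "bij ?g" using bij_imp_bij_inv[OF f] by (simp add: inv)
  have invg: "inv ?g = ?f" by (rule inv_unique_comp) auto
  have r: "reindex ?f (vtensor (vtensor x y) z) = vtensor x (vtensor y z)" for x y z
    by (rule ebasis_ext)
       (auto simp: cinner_ebasis_left reindex_apply f inv vtensor.rep_eq split: prod.split)
  have r': "reindex ?g (vtensor x (vtensor y z)) = vtensor (vtensor x y) z" for x y z
    by (rule ebasis_ext)
       (auto simp: cinner_ebasis_left reindex_apply g invg vtensor.rep_eq split: prod.split)
  show ?thesis
    unfolding transport_def inv
  proof (rule clin_ext)
    have *: "op_tensor (op_tensor S T) R \<in> bop" "op_tensor S (op_tensor T R) \<in> bop" using assms by auto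
    show "clin (reindex ?f o\<^sub>L op_tensor (op_tensor S T) R o\<^sub>L reindex ?g)"
      using clin_reindex[OF f] clin_reindex[OF g] * by (simp add: clin_def bop_iff_clin)
    show "clin (op_tensor S (op_tensor T R))" using * by (simp add: bop_iff_clin)
    show "(reindex ?f o\<^sub>L op_tensor (op_tensor S T) R o\<^sub>L reindex ?g) (ebasis p) = op_tensor S (op_tensor T R) (ebasis p)" for p
      using assms by (cases p) (auto simp: ebasis_pair r r' op_tensor_vtensor)
  qed
qed

section \<open>*-homomorphisms and strict extensions\<close>

lemma blinfun_compose_assoc: "(a o\<^sub>L b) o\<^sub>L c = a o\<^sub>L (b o\<^sub>L c)"
  by (rule blinfun_eqI) simp

lemma id_blinfun_compose [simp]: "id_blinfun o\<^sub>L a = a" "a o\<^sub>L id_blinfun = a"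
  by (auto intro: blinfun_eqI)

lemma closure_closed_op1:
  assumes f: "continuous_on (closure R) f" and "\<And>x. x \<in> R \<Longrightarrow> f x \<in> R'" and "x \<in> closure R"
  shows "f x \<in> closure R'"
proof -
  have "f ` closure R \<subseteq> closure R'"
    using assms(2) closure_subset by (intro image_closure_subset f closed_closure) auto
  with assms(3) show ?thesis by auto
qed

lemma closure_closed_op2:
  assumes f: "continuous_on UNIV (\<lambda>p. f (fst p) (snd p))"
    and "\<And>x y. x \<in> R \<Longrightarrow> y \<in> R \<Longrightarrow> f x y \<in> R'" and "x \<in> closure R" "y \<in> closure R"
  shows "f x y \<in> closure R'"
proof -
  have "(\<lambda>p. f (fst p) (snd p)) ` closure (R \<times> R) \<subseteq> closure R'"
    using assms(2) closure_subset[of R']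
    by (intro image_closure_subset continuous_on_subset[OF f] closed_closure) auto
  with assms(3,4) show ?thesis by (force simp: closure_Times)
qed

lemma subspace_closure:
  fixes S :: "'a::real_normed_vector set"
  assumes "subspace S" shows "subspace (closure S)"
proof (rule subspaceI)
  show "0 \<in> closure S" using subspace_0[OF assms] closure_subset by auto
  show "x + y \<in> closure S" if "x \<in> closure S" "y \<in> closure S" for x y
    by (rule closure_closed_op2[OF _ _ that]) (auto intro!: continuous_intros subspace_add[OF assms])
  show "c *\<^sub>R x \<in> closure S" if "x \<in> closure S" for c x
    by (rule closure_closed_op1[OF _ _ that]) (auto intro!: continuous_intros subspace_scale[OF assms])
qed

lemma star_subalgebraD:
  assumes "star_subalgebra A"
  shows "A \<subseteq> bop" "0 \<in> A" "a \<in> A \<Longrightarrow> b \<in> A \<Longrightarrow> a + b \<in> A" "a \<in> A \<Longrightarrow> b \<in> A \<Longrightarrow> a o\<^sub>L b \<in> A"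
    "a \<in> A \<Longrightarrow> adj a \<in> A" "a \<in> A \<Longrightarrow> cscale c a \<in> A" "a \<in> A \<Longrightarrow> a \<in> bop"
    "a \<in> A \<Longrightarrow> r *\<^sub>R a \<in> A" "a \<in> A \<Longrightarrow> - a \<in> A" "a \<in> A \<Longrightarrow> b \<in> A \<Longrightarrow> a - b \<in> A"
    "cop.subspace A" "subspace A"
proof -
  show *: "A \<subseteq> bop" "0 \<in> A" "a \<in> A \<Longrightarrow> b \<in> A \<Longrightarrow> a + b \<in> A" "a \<in> A \<Longrightarrow> b \<in> A \<Longrightarrow> a o\<^sub>L b \<in> A"
    "a \<in> A \<Longrightarrow> adj a \<in> A" "a \<in> A \<Longrightarrow> cscale c a \<in> A" "a \<in> A \<Longrightarrow> a \<in> bop" for a b c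
    using assms by (auto simp: star_subalgebra_def)
  show **: "a \<in> A \<Longrightarrow> r *\<^sub>R a \<in> A" for a r by (simp add: scaleR_eq_cscale *)
  show m: "a \<in> A \<Longrightarrow> - a \<in> A" for a using **[of a "-1"] by simp
  show "a \<in> A \<Longrightarrow> b \<in> A \<Longrightarrow> a - b \<in> A" for a b using *(3)[OF _ m] by simp
  show "cop.subspace A" "subspace A" by (auto simp: cop.subspace_def subspace_def * **)
qed

lemma star_homD:
  assumes "star_hom A \<theta> B"
  shows "a \<in> A \<Longrightarrow> \<theta> a \<in> B" "a \<in> A \<Longrightarrow> b \<in> A \<Longrightarrow> \<theta> (a + b) = \<theta> a + \<theta> b"
    "a \<in> A \<Longrightarrow> b \<in> A \<Longrightarrow> \<theta> (a o\<^sub>L b) = \<theta> a o\<^sub>L \<theta> b"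
    "a \<in> A \<Longrightarrow> \<theta> (adj a) = adj (\<theta> a)" "a \<in> A \<Longrightarrow> \<theta> (cscale c a) = cscale c (\<theta> a)"
    "a \<in> A \<Longrightarrow> \<theta> (r *\<^sub>R a) = r *\<^sub>R \<theta> a"
  using assms by (auto simp: star_hom_def scaleR_eq_cscale)

lemma star_hom_linear:
  assumes "star_hom A \<theta> B" "star_subalgebra A"
  shows "\<theta> 0 = 0" "a \<in> A \<Longrightarrow> \<theta> (- a) = - \<theta> a" "a \<in> A \<Longrightarrow> b \<in> A \<Longrightarrow> \<theta> (a - b) = \<theta> a - \<theta> b"
    "(\<And>i. i \<in> F \<Longrightarrow> f i \<in> A) \<Longrightarrow> \<theta> (sum f F) = (\<Sum>i\<in>F. \<theta> (f i))"
proof -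
  note [simp] = star_homD[OF assms(1)] star_subalgebraD[OF assms(2)]
  show z: "\<theta> 0 = 0" using star_homD(5)[OF assms(1), of 0 0] by simp
  show m: "a \<in> A \<Longrightarrow> \<theta> (- a) = - \<theta> a" for a
    using star_homD(6)[OF assms(1), of a "-1"] by simp
  show "a \<in> A \<Longrightarrow> b \<in> A \<Longrightarrow> \<theta> (a - b) = \<theta> a - \<theta> b"
    using star_homD(2)[OF assms(1), of a "- b"] m by simp
  show "(\<And>i. i \<in> F \<Longrightarrow> f i \<in> A) \<Longrightarrow> \<theta> (sum f F) = (\<Sum>i\<in>F. \<theta> (f i))"
    by (induction F rule: infinite_finite_induct) (auto simp: z cop.subspace_sum)
qed

lemma star_hom_mono: "star_hom A \<theta> B \<Longrightarrow> A' \<subseteq> A \<Longrightarrow> B \<subseteq> B' \<Longrightarrow> star_hom A' \<theta> B'"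
  by (simp add: star_hom_def subset_iff)

text \<open>The element \<open>1 - s\<close> is the positive square root of \<open>1 - a\<^sup>* a\<close>; it is obtained as the fixed
  point of \<open>s \<mapsto> (a\<^sup>* a + s\<^sup>2) / 2\<close>.\<close>

lemma ex_sqrt_defect:
  assumes A: "star_subalgebra A" "closed A" and a: "a \<in> A" "norm a < 1"
  shows "\<exists>s\<in>A. adj s = s \<and> s + s - (s o\<^sub>L s) = adj a o\<^sub>L a"
proof -
  note [simp] = star_subalgebraD[OF A(1)]
  define h where "h = adj a o\<^sub>L a"
  define c where "c = (norm a)\<^sup>2"
  have c: "0 \<le> c" "c < 1" using a(2) by (auto simp: c_def power_less_one_iff)
  have h: "h \<in> A" "norm h = c" "adj h = h" "h \<in> bop"
    using a by (auto simp: h_def c_def norm_adj_comp adj_simps)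
  \<comment> \<open>\<open>r\<close> is the smaller root of \<open>r = (c + r^2) / 2\<close>. Hence
    \<open>f\<close> maps the self-adjoint part of the ball of radius \<open>r\<close> into itself,
    and \<open>r < 1\<close> is also the contraction constant of \<open>f\<close> there.\<close>
  define r where "r = 1 - sqrt (1 - c)"
  have r: "0 \<le> r" "r < 1" "(c + r * r) / 2 = r"
    using c by (auto simp: r_def field_simps real_le_lsqrt)
  define K where "K = {s\<in>A. adj s = s \<and> norm s \<le> r}"
  define f where "f s = (1/2) *\<^sub>R (h + (s o\<^sub>L s))" for s
  have "closed K"
  proof -
    have "K = {s\<in>A. adj s = s} \<inter> {s. norm s \<le> r}" by (auto simp: K_def)
    moreover have "closed {s\<in>A. adj s = s}"
      by (rule continuous_closed_preimage_constant[where a = 0 and f = "\<lambda>s. adj s - s", simplified])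
         (intro continuous_on_diff continuous_on_id continuous_on_subset[OF continuous_on_adj]
           star_subalgebraD[OF A(1)] A(2))+
    moreover have "closed {s :: 'a op. norm s \<le> r}" by (intro closed_Collect_le continuous_intros)
    ultimately show ?thesis by (simp add: closed_Int)
  qed
  have "\<exists>!s\<in>K. f s = s"
  proof (rule Banach_fix)
    show "complete K" using \<open>closed K\<close> by (simp add: complete_eq_closed)
    show "K \<noteq> {}" using r by (auto simp: K_def adj_simps intro!: exI[of _ 0])
    show "f ` K \<subseteq> K"
    proof (clarify)
      fix s assume s: "s \<in> K"
      have "norm (s o\<^sub>L s) \<le> r * r"
        using s r by (intro order_trans[OF norm_blinfun_compose] mult_mono) (auto simp: K_def)
      then have "norm (h + (s o\<^sub>L s)) \<le> c + r * r"
        using norm_triangle_ineq[of h "s o\<^sub>L s"] h by simp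
      then have "norm (f s) \<le> r" using r(3) by (simp add: f_def)
      moreover have "adj (f s) = f s"
        using s h by (simp add: K_def f_def scaleR_eq_cscale adj_simps)
      ultimately show "f s \<in> K" using s h by (simp add: K_def f_def)
    qed
    show "dist (f s) (f t) \<le> r * dist s t" if s: "s \<in> K" "t \<in> K" for s t
    proof -
      have d: "f s - f t = (1/2) *\<^sub>R ((s o\<^sub>L (s - t)) + ((s - t) o\<^sub>L t))"
        by (rule blinfun_eqI)
           (simp add: f_def blinfun.add_left blinfun.diff_left blinfun.diff_right blinfun.scaleR_left
            scaleR_right_diff_distrib scaleR_right_distrib)
      have "norm (s o\<^sub>L (s - t)) \<le> r * norm (s - t)"
        using s by (intro order_trans[OF norm_blinfun_compose] mult_right_mono) (auto simp: K_def)
      moreover have "norm ((s - t) o\<^sub>L t) \<le> norm (s - t) * r"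
        using s by (intro order_trans[OF norm_blinfun_compose] mult_left_mono) (auto simp: K_def)
      moreover have "norm (f s - f t) = (1/2) * norm ((s o\<^sub>L (s - t)) + ((s - t) o\<^sub>L t))"
        unfolding d by simp
      ultimately have "norm (f s - f t) \<le> r * norm (s - t)"
        using norm_triangle_ineq[of "s o\<^sub>L (s - t)" "(s - t) o\<^sub>L t"]
        by (simp only: mult.commute[of "norm (s - t)"])
      then show "dist (f s) (f t) \<le> r * dist s t" by (simp add: dist_norm)
    qed
  qed (use r(1,2) in simp_all)
  then obtain s where s: "s \<in> K" "f s = s" by (elim ex1E conjE)
  have "s + s = 2 *\<^sub>R f s" by (simp only: s(2) scaleR_2)
  also have "\<dots> = h + (s o\<^sub>L s)" unfolding f_def by simp
  finally have "s + s - (s o\<^sub>L s) = h" by (simp only: add_diff_cancel_right')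
  with s(1) show ?thesis unfolding K_def h_def by blast
qed

text \<open>For \<open>norm b < 1\<close> the identity
  \<open>adj b o\<^sub>L b = s + s - (s o\<^sub>L s)\<close> is carried over by
  \<open>\<theta>\<close>, and completing the square bounds \<open>norm (\<theta> b x)\<close> by
  \<open>norm x\<close>. It is used in this form, and not as \<open>1 - (1 - s)^2\<close>, because
  \<open>A\<close> may have no unit. Scaling reaches general elements.\<close>

lemma star_hom_contractive:
  assumes A: "star_subalgebra A" "closed A" and \<theta>: "star_hom A \<theta> bop" and a: "a \<in> A"
  shows "norm (\<theta> a) \<le> norm a"
proof -
  have lt: "norm (\<theta> b) \<le> 1" if b: "b \<in> A" "norm b < 1" for b
  proof -
    obtain s where s: "s \<in> A" "adj s = s" "s + s - (s o\<^sub>L s) = adj b o\<^sub>L b"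
      using ex_sqrt_defect[OF A b] by (elim bexE conjE)
    have e: "adj (\<theta> b) o\<^sub>L \<theta> b = \<theta> s + \<theta> s - (\<theta> s o\<^sub>L \<theta> s)"
    proof -
      have "\<theta> (adj b o\<^sub>L b) = adj (\<theta> b) o\<^sub>L \<theta> b"
        by (simp only: star_homD(3)[OF \<theta> star_subalgebraD(5)[OF A(1) b(1)] b(1)] star_homD(4)[OF \<theta> b(1)])
      moreover have "\<theta> (s + s - (s o\<^sub>L s)) = \<theta> s + \<theta> s - (\<theta> s o\<^sub>L \<theta> s)"
        by (simp only: star_hom_linear(3)[OF \<theta> A(1)] star_homD(2,3)[OF \<theta>] star_subalgebraD(3,4)[OF A(1)] s(1))
      ultimately show ?thesis by (simp only: s(3))
    qed
    have t: "adj (\<theta> s) = \<theta> s" using star_homD(4)[OF \<theta> s(1)] unfolding s(2) by (rule sym)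
    have [simp]: "\<theta> s \<in> bop" "\<theta> b \<in> bop" using star_homD(1)[OF \<theta>] s(1) b(1) by blast+
    show ?thesis
    proof (rule norm_blinfun_bound)
      fix x
      have "cinner (\<theta> b x) (\<theta> b x) = cinner x ((adj (\<theta> b) o\<^sub>L \<theta> b) x)"
        by (simp add: cinner_adj_right)
      also have "\<dots> = cinner x (\<theta> s x) + cinner x (\<theta> s x) - cinner x (adj (\<theta> s) (\<theta> s x))"
        unfolding e by (simp add: t blinfun.add_left blinfun.diff_left cinner_add_right cinner.diff_right)
      also have "\<dots> = cinner x x - cinner (x - \<theta> s x) (x - \<theta> s x)"
        using cinner_adj_left[of "\<theta> s" x x] cinner_adj_left[of "\<theta> s" x "\<theta> s x"]
        by (simp add: t cinner.diff_left cinner.diff_right)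
      finally have "Re (cinner (\<theta> b x) (\<theta> b x)) = Re (cinner x x) - Re (cinner (x - \<theta> s x) (x - \<theta> s x))"
        by simp
      then have "(norm (\<theta> b x))\<^sup>2 = (norm x)\<^sup>2 - (norm (x - \<theta> s x))\<^sup>2"
        unfolding Re_cinner_self .
      then have "(norm (\<theta> b x))\<^sup>2 \<le> (norm x)\<^sup>2" by simp
      then have "norm (\<theta> b x) \<le> norm x" by (rule power2_le_imp_le) simp
      then show "norm (\<theta> b x) \<le> 1 * norm x" by simp
    qed simp
  qed
  show ?thesis
  proof (rule dense_ge)
    fix r assume r: "norm a < r"
    then have "0 < r" using norm_ge_zero[of a] by linarith
    then have "norm ((1/r) *\<^sub>R a) < 1" using r by simp
    then have "norm (\<theta> ((1/r) *\<^sub>R a)) \<le> 1"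
      using a by (intro lt star_subalgebraD(8)[OF A(1)])
    then show "norm (\<theta> a) \<le> r"
      unfolding star_homD(6)[OF \<theta> a] using \<open>0 < r\<close> by simp
  qed
qed

lemma star_hom_continuous:
  assumes "star_subalgebra A" "closed A" "star_hom A \<theta> bop"
  shows "continuous_on A \<theta>"
proof (rule continuous_onI)
  fix a and e :: real assume "a \<in> A" "0 < e"
  have "dist (\<theta> b) (\<theta> a) \<le> dist b a" if "b \<in> A" for b
    using star_hom_contractive[OF assms, of "b - a"] that \<open>a \<in> A\<close>
    by (simp add: dist_norm star_hom_linear[OF assms(3,1)] star_subalgebraD[OF assms(1)])
  then show "\<exists>d>0. \<forall>b\<in>A. dist b a < d \<longrightarrow> dist (\<theta> b) (\<theta> a) \<le> e"
    using \<open>0 < e\<close> by (intro exI[of _ e]) force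
qed

lemma continuous_eq_on_closure:
  fixes f g :: "'a::topological_space \<Rightarrow> 'b::real_normed_vector"
  assumes "continuous_on A f" "continuous_on A g" "closed A" "D \<subseteq> A" "A \<subseteq> closure D"
    and "\<And>x. x \<in> D \<Longrightarrow> f x = g x" and "x \<in> A"
  shows "f x = g x"
proof -
  have "closed {x\<in>A. f x - g x = 0}"
    by (rule continuous_closed_preimage_constant) (intro continuous_on_diff assms)+
  then have "closure D \<subseteq> {x\<in>A. f x - g x = 0}"
    using assms by (intro closure_minimal) auto
  then show ?thesis using assms by auto
qed

text \<open>The map to be extended is given by its graph \<open>R\<close>. The norm bound makes
  \<open>closure R\<close> single-valued, and it sends Cauchy sequences of the domain to Cauchy
  sequences, so the domain of \<open>closure R\<close> is closed. Algebraic properties can then be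
  verified on \<open>closure R\<close> by continuity.\<close>

lemma closure_graph:
  fixes R :: "('a::real_normed_vector \<times> 'b::banach) set"
  assumes R: "subspace R" and C: "\<And>x y. (x, y) \<in> R \<Longrightarrow> norm y \<le> C * norm x"
  shows "\<exists>T. (\<forall>x\<in>closure (fst ` R). (x, T x) \<in> closure R) \<and>
    (\<forall>x y. (x, y) \<in> closure R \<longrightarrow> x \<in> closure (fst ` R) \<and> y = T x \<and> norm y \<le> C * norm x)"
proof -
  have sub: "subspace (closure R)" using R by (rule subspace_closure)
  have bd: "norm y \<le> C * norm x" if "(x, y) \<in> closure R" for x y
  proof -
    have "closed {p :: 'a \<times> 'b. norm (snd p) \<le> C * norm (fst p)}"
      by (intro closed_Collect_le continuous_intros)
    then have "closure R \<subseteq> {p. norm (snd p) \<le> C * norm (fst p)}"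
      by (rule closure_minimal[rotated]) (auto intro: C)
    with that show ?thesis by auto
  qed
  have single: "y = y'" if "(x, y) \<in> closure R" "(x, y') \<in> closure R" for x y y'
  proof -
    have "(0, y - y') \<in> closure R" using subspace_diff[OF sub that] by simp
    from bd[OF this] show ?thesis by simp
  qed
  have ex: "\<exists>y. (x, y) \<in> closure R" if x: "x \<in> closure (fst ` R)" for x
  proof -
    obtain u where u: "\<And>n. u n \<in> fst ` R" "u \<longlonglongrightarrow> x" using x by (auto simp: closure_sequential)
    then have "\<forall>n. \<exists>y. (u n, y) \<in> R" by force
    then obtain v where v: "\<And>n. (u n, v n) \<in> R" by metis
    have "Cauchy u" using u(2) by (rule LIMSEQ_imp_Cauchy)
    have "Cauchy v"
    proof (rule CauchyI)
      fix e :: real assume e: "0 < e"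
      \<comment> \<open>The denominator is positive whatever the sign of \<open>C\<close>.\<close>
      have "0 < e / (\<bar>C\<bar> + 1)" using e by (intro divide_pos_pos) auto
      from CauchyD[OF \<open>Cauchy u\<close> this] obtain M
        where M: "\<And>m n. m \<ge> M \<Longrightarrow> n \<ge> M \<Longrightarrow> norm (u m - u n) < e / (\<bar>C\<bar> + 1)" by blast
      have "norm (v m - v n) < e" if "m \<ge> M" "n \<ge> M" for m n
      proof -
        have "norm (v m - v n) \<le> C * norm (u m - u n)"
          using subspace_diff[OF R v[of m] v[of n]] by (intro C) simp
        also have "\<dots> \<le> (\<bar>C\<bar> + 1) * norm (u m - u n)" by (intro mult_right_mono) auto
        also have "\<dots> < (\<bar>C\<bar> + 1) * (e / (\<bar>C\<bar> + 1))" using M[OF that] by (intro mult_strict_left_mono) auto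
        also have "\<dots> = e" by (simp add: add_pos_nonneg)
        finally show ?thesis .
      qed
      then show "\<exists>M. \<forall>m\<ge>M. \<forall>n\<ge>M. norm (v m - v n) < e" by blast
    qed
    then obtain y where "v \<longlonglongrightarrow> y" using Cauchy_convergent convergent_def by blast
    with u(2) have "(\<lambda>n. (u n, v n)) \<longlonglongrightarrow> (x, y)" by (rule tendsto_Pair)
    then show ?thesis
      using v unfolding closure_sequential by (intro exI[of _ y] exI[of _ "\<lambda>n. (u n, v n)"]) auto
  qed
  have dom: "x \<in> closure (fst ` R)" if "(x, y) \<in> closure R" for x y
  proof -
    have "fst ` closure R \<subseteq> closure (fst ` R)"
      by (intro image_closure_subset continuous_on_fst continuous_on_id closed_closure closure_subset)
    with that show ?thesis by force
  qed
  obtain T where "\<And>x. x \<in> closure (fst ` R) \<Longrightarrow> (x, T x) \<in> closure R" using ex by metis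
  with single dom bd show ?thesis by (intro exI[of _ T]) blast
qed

text \<open>A relation replaces a function because a prescription on spanning elements is not known
  in advance to be well defined; that follows from the norm bound. The operations act continuously
  on pairs, so \<open>closure R\<close> inherits every closure property of \<open>R\<close>.\<close>

lemma star_relation_extends:
  fixes R :: "('i op \<times> 'j op) set"
  assumes sub: "R \<subseteq> bop \<times> bop" and R: "subspace R"
    and comp: "\<And>x y x' y'. (x, y) \<in> R \<Longrightarrow> (x', y') \<in> R \<Longrightarrow> (x o\<^sub>L x', y o\<^sub>L y') \<in> R"
    and adj: "\<And>x y. (x, y) \<in> R \<Longrightarrow> (adj x, adj y) \<in> R"
    and scale: "\<And>c x y. (x, y) \<in> R \<Longrightarrow> (cscale c x, cscale c y) \<in> R"
    and le: "\<And>x y. (x, y) \<in> R \<Longrightarrow> norm y \<le> norm x"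
  shows "\<exists>\<Phi>. \<Phi> \<in> extensional (closure (fst ` R)) \<and>
    star_hom (closure (fst ` R)) \<Phi> (closure (snd ` R)) \<and> (\<forall>(x, y)\<in>R. \<Phi> x = y)"
proof -
  obtain T where T: "\<And>x. x \<in> closure (fst ` R) \<Longrightarrow> (x, T x) \<in> closure R"
    and T': "\<And>x y. (x, y) \<in> closure R \<Longrightarrow> x \<in> closure (fst ` R) \<and> y = T x"
    using closure_graph[OF R, of 1] le by (metis mult_1)
  have "closed (bop \<times> bop :: ('i op \<times> 'j op) set)" by (intro closed_Times closed_bop)
  then have cl: "closure R \<subseteq> bop \<times> bop" using sub by (rule closure_minimal[rotated])
  have add: "(x + x', y + y') \<in> closure R" if "(x, y) \<in> closure R" "(x', y') \<in> closure R" for x y x' y'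
    using subspace_add[OF subspace_closure[OF R] that] by simp
  have comp': "(x o\<^sub>L x', y o\<^sub>L y') \<in> closure R" if "(x, y) \<in> closure R" "(x', y') \<in> closure R" for x y x' y'
  proof -
    have "continuous_on UNIV (\<lambda>p :: ('i op \<times> 'j op) \<times> ('i op \<times> 'j op).
        (fst (fst p) o\<^sub>L fst (snd p), snd (fst p) o\<^sub>L snd (snd p)))"
      by (intro continuous_on_Pair bounded_bilinear.continuous_on[OF bounded_bilinear_blinfun_compose]
          continuous_on_fst continuous_on_snd continuous_on_id)
    from closure_closed_op2[of "\<lambda>p q. (fst p o\<^sub>L fst q, snd p o\<^sub>L snd q)", OF this _ that, of R] comp
    show ?thesis by simp
  qed
  have "continuous_on (closure R) (\<lambda>p. (cscale c (fst p), cscale c (snd p)))" for c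
    by (intro continuous_on_Pair bounded_linear.continuous_on[OF bounded_linear_cscale]
        continuous_on_fst continuous_on_snd continuous_on_id)
  from closure_closed_op1[OF this, where R' = R] scale
  have scale': "(cscale c x, cscale c y) \<in> closure R" if "(x, y) \<in> closure R" for c x y
    using that by fastforce
  have "continuous_on (closure R) (\<lambda>p. (adj (fst p), adj (snd p)))"
    using cl by (intro continuous_on_Pair continuous_on_compose2[OF continuous_on_adj]
        continuous_on_fst continuous_on_snd continuous_on_id) auto
  from closure_closed_op1[OF this, where R' = R] adj
  have adj': "(adj x, adj y) \<in> closure R" if "(x, y) \<in> closure R" for x y
    using that by fastforce
  have ran: "y \<in> closure (snd ` R)" if "(x, y) \<in> closure R" for x y
    using closure_closed_op1[OF continuous_on_snd[OF continuous_on_id] _ that, of "snd ` R"] by force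
  let ?\<Phi> = "restrict T (closure (fst ` R))"
  have "star_hom (closure (fst ` R)) ?\<Phi> (closure (snd ` R))"
    unfolding star_hom_def
  proof (intro conjI ballI allI)
    fix a b assume ab: "a \<in> closure (fst ` R)" "b \<in> closure (fst ` R)"
    show "?\<Phi> (a + b) = ?\<Phi> a + ?\<Phi> b" "?\<Phi> (a o\<^sub>L b) = ?\<Phi> a o\<^sub>L ?\<Phi> b"
      using T'[OF add[OF T T, OF ab]] T'[OF comp'[OF T T, OF ab]] ab by auto
  next
    fix a c assume a: "a \<in> closure (fst ` R)"
    show "?\<Phi> a \<in> closure (snd ` R)" "?\<Phi> (adj a) = adj (?\<Phi> a)" "?\<Phi> (cscale c a) = cscale c (?\<Phi> a)"
      using T'[OF adj'[OF T[OF a]]] T'[OF scale'[OF T[OF a]]] ran[OF T[OF a]] a by auto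
  qed
  moreover have "\<forall>(x, y)\<in>R. ?\<Phi> x = y"
    using T' closure_subset[of R] by fastforce
  ultimately show ?thesis by (intro exI[of _ ?\<Phi>]) auto
qed


section \<open>Multipliers and strict extensions\<close>

lemma multipliersD:
  assumes "m \<in> multipliers A"
  shows "m \<in> bop" "a \<in> A \<Longrightarrow> m o\<^sub>L a \<in> A" "a \<in> A \<Longrightarrow> a o\<^sub>L m \<in> A"
  using assms by (simp_all add: multipliers_def)

lemma multipliersI:
  assumes "m \<in> bop" "\<And>a. a \<in> A \<Longrightarrow> m o\<^sub>L a \<in> A" "\<And>a. a \<in> A \<Longrightarrow> a o\<^sub>L m \<in> A"
  shows "m \<in> multipliers A"
  using assms by (simp add: multipliers_def)

lemma star_subalgebra_multipliers:
  assumes A: "star_subalgebra A"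
  shows "star_subalgebra (multipliers A)"
  unfolding star_subalgebra_def
proof (intro conjI ballI allI)
  note A = star_subalgebraD[OF A]
  fix a b assume a: "a \<in> multipliers A" and b: "b \<in> multipliers A"
  show "a + b \<in> multipliers A"
    by (intro multipliersI)
       (simp_all add: multipliersD[OF a] multipliersD[OF b] A(3)
        bounded_bilinear.add_left[OF bounded_bilinear_blinfun_compose]
        bounded_bilinear.add_right[OF bounded_bilinear_blinfun_compose])
  show "a o\<^sub>L b \<in> multipliers A"
  proof (rule multipliersI)
    fix x assume x: "x \<in> A"
    show "(a o\<^sub>L b) o\<^sub>L x \<in> A"
      by (simp add: blinfun_compose_assoc multipliersD(2)[OF a multipliersD(2)[OF b x]])
    show "x o\<^sub>L (a o\<^sub>L b) \<in> A"
      using multipliersD(3)[OF b multipliersD(3)[OF a x]] by (simp only: blinfun_compose_assoc)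
  qed (simp add: multipliersD[OF a] multipliersD[OF b])
next
  note A = star_subalgebraD[OF A]
  fix a c assume a: "a \<in> multipliers A"
  note aD = multipliersD[OF a]
  show "adj a \<in> multipliers A"
  proof (rule multipliersI)
    fix x assume x: "x \<in> A"
    have "adj (adj x o\<^sub>L a) = adj a o\<^sub>L x" "adj (a o\<^sub>L adj x) = x o\<^sub>L adj a"
      using adj_simps(5)[OF _ aD(1), of "adj x"] adj_simps(5)[OF aD(1), of "adj x"] A(7)[OF x] by auto
    then show "adj a o\<^sub>L x \<in> A" "x o\<^sub>L adj a \<in> A"
      using A(5)[OF aD(3)[OF A(5)[OF x]]] A(5)[OF aD(2)[OF A(5)[OF x]]] by simp_all
  qed (simp add: aD)
  show "cscale c a \<in> multipliers A"
    by (rule multipliersI) (simp_all add: aD comp_cscale_left comp_cscale_right A)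
next
  show "0 \<in> multipliers A"
    by (rule multipliersI) (simp_all add: star_subalgebraD(2)[OF A]
        bounded_bilinear.zero_left[OF bounded_bilinear_blinfun_compose]
        bounded_bilinear.zero_right[OF bounded_bilinear_blinfun_compose])
qed (auto dest: multipliersD)

lemma closed_multipliers:
  assumes A: "closed A" shows "closed (multipliers A)"
proof -
  have "closed ((\<lambda>m. m o\<^sub>L a) -` A)" "closed ((\<lambda>m. a o\<^sub>L m) -` A)" for a
    by (rule closed_vimage[OF A], rule linear_continuous_on,
        rule bounded_bilinear.bounded_linear_left[OF bounded_bilinear_blinfun_compose]
          bounded_bilinear.bounded_linear_right[OF bounded_bilinear_blinfun_compose])+
  then have "closed (bop \<inter> (\<Inter>a\<in>A. (\<lambda>m. m o\<^sub>L a) -` A \<inter> (\<lambda>m. a o\<^sub>L m) -` A))"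
    by (intro closed_Int closed_bop closed_INT ballI)
  also have "\<dots> = multipliers A" by (auto simp: multipliers_def)
  finally show ?thesis .
qed

lemma id_in_multipliers [simp]: "id_blinfun \<in> multipliers A"
  by (simp add: multipliers_def)

lemma multipliers_unital:
  assumes "id_blinfun \<in> A" "star_subalgebra A" shows "multipliers A = A"
proof
  show "A \<subseteq> multipliers A"
    by (intro subsetI multipliersI) (simp_all add: star_subalgebraD[OF assms(2)])
  show "multipliers A \<subseteq> A"
    using multipliersD(2)[OF _ assms(1)] by auto
qed

lemma bilinear_zero_on_span:
  assumes "\<And>y. linear (\<lambda>x. Q x y)" "\<And>x. linear (Q x)" "\<And>x y. x \<in> S \<Longrightarrow> y \<in> S' \<Longrightarrow> Q x y = 0" "x \<in> span S" "y \<in> span S'"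
  shows "Q x y = 0"
proof -
  have 1: "Q x y = 0" if "y \<in> S'" for y
    using assms(4)
    by (induction rule: span_induct_alt)
       (auto simp: linear_0[OF assms(1)] linear_add[OF assms(1)] linear_scale[OF assms(1)] assms(3) that)
  show ?thesis
    using assms(5)
    by (induction rule: span_induct_alt)
       (auto simp: linear_0[OF assms(2)] linear_add[OF assms(2)] linear_scale[OF assms(2)] 1)
qed

text \<open>Nondegeneracy on the Hilbert space, whereas \<open>nondeg_hom\<close> asks for density
  in the target algebra. It is what makes an operator \<open>T\<close> determined by the products
  \<open>T o\<^sub>L \<theta> a\<close>.\<close>

definition nondegenerate :: "'i op set \<Rightarrow> ('i op \<Rightarrow> 'j op) \<Rightarrow> bool" where
  "nondegenerate A \<theta> \<longleftrightarrow> closure (span {\<theta> a x | a x. a \<in> A}) = UNIV"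

lemma nondegenerate_ext:
  assumes nd: "nondegenerate A \<theta>" and eq: "\<And>a. a \<in> A \<Longrightarrow> S o\<^sub>L \<theta> a = T o\<^sub>L \<theta> a"
  shows "S = T"
proof (rule blinfun_eqI)
  fix x
  have *: "S (\<theta> a y) = T (\<theta> a y)" if "a \<in> A" for a y
    using arg_cong[OF eq[OF that], of "\<lambda>R. blinfun_apply R y"] by simp
  have "S x = T x" if "x \<in> span {\<theta> a x | a x. a \<in> A}" for x
    using that
    by (induction rule: span_induct_alt) (auto simp: blinfun.add_right blinfun.scaleR_right *)
  moreover have "closed {x. S x = T x}" by (intro closed_Collect_eq continuous_intros)
  ultimately have "closure (span {\<theta> a x | a x. a \<in> A}) \<subseteq> {x. S x = T x}"
    by (intro closure_minimal) auto
  then show "S x = T x" using nd by (auto simp: nondegenerate_def)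
qed

text \<open>If \<open>\<parallel>m\<parallel> < 1\<close> then \<open>1 - m\<^sup>* m = (1 - s)\<^sup>2\<close> with \<open>s\<close> a self-adjoint multiplier, so
  \<open>\<Sum> \<theta>(m a\<^sub>k) x\<^sub>k\<close> is dominated by \<open>\<Sum> \<theta>(a\<^sub>k) x\<^sub>k\<close>.\<close>

lemma ex_strict_ext:
  assumes A: "star_subalgebra A" "closed A" and \<theta>: "star_hom A \<theta> bop" and nd: "nondegenerate A \<theta>"
    and m: "m \<in> multipliers A"
  shows "\<exists>T\<in>bop. \<forall>a\<in>A. T o\<^sub>L \<theta> a = \<theta> (m o\<^sub>L a)"
proof -
  note [simp] = star_subalgebraD[OF A(1)] star_homD[OF \<theta>]
  note mult = star_subalgebraD[OF star_subalgebra_multipliers[OF A(1)]]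
  have mA: "m o\<^sub>L a \<in> A" if "m \<in> multipliers A" "a \<in> A" for m a
    using that by (simp add: multipliers_def)
  have small: "\<exists>T\<in>bop. \<forall>a\<in>A. T o\<^sub>L \<theta> a = \<theta> (m o\<^sub>L a)" if m: "m \<in> multipliers A" "norm m < 1" for m
  proof -
    obtain s where s: "s \<in> multipliers A" "adj s = s" "s + s - (s o\<^sub>L s) = adj m o\<^sub>L m"
      using ex_sqrt_defect[OF star_subalgebra_multipliers[OF A(1)] closed_multipliers[OF A(2)] m]
      by (elim bexE conjE)
    \<comment> \<open>\<open>G\<close> spans the graph of the future extension. \<open>W\<close>
      carries one more component, which makes the estimate an exact identity:
      \<open>norm v ^ 2 + norm (u - w) ^ 2 = norm u ^ 2\<close> for \<open>(u, v, w)\<close> in its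
      span.\<close>
    define G where "G = (\<lambda>(a, x). (\<theta> a x, \<theta> (m o\<^sub>L a) x)) ` (A \<times> UNIV)"
    define W where "W = (\<lambda>(a, x). (\<theta> a x, \<theta> (m o\<^sub>L a) x, \<theta> (s o\<^sub>L a) x)) ` (A \<times> UNIV)"
    \<comment> \<open>The polarization of \<open>norm v ^ 2 - norm u ^ 2 + norm (u - w) ^ 2\<close>.
      Being bilinear, it has to vanish on generators only, where this is the relation between
      \<open>m\<close> and \<open>s\<close>.\<close>
    define Q where "Q p q = inner (fst (snd p)) (fst (snd q)) - inner (fst p) (fst q)
      + inner (fst p - snd (snd p)) (fst q - snd (snd q))" for p q :: "'b ell2 \<times> 'b ell2 \<times> 'b ell2"
    have Q: "linear (\<lambda>p. Q p q)" "linear (Q q)" for q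
      unfolding Q_def
      by (rule linearI; simp add: inner_simps algebra_simps)+
    have Q0: "Q p q = 0" if "p \<in> span W" "q \<in> span W" for p q
    proof (rule bilinear_zero_on_span[OF Q _ that])
      fix p q assume "p \<in> W" "q \<in> W"
      then obtain a x b y where p: "p = (\<theta> a x, \<theta> (m o\<^sub>L a) x, \<theta> (s o\<^sub>L a) x)" "a \<in> A"
        and q: "q = (\<theta> b y, \<theta> (m o\<^sub>L b) y, \<theta> (s o\<^sub>L b) y)" "b \<in> A" by (auto simp: W_def)
      have key: "cinner (\<theta> (k o\<^sub>L a) x) (\<theta> (l o\<^sub>L b) y) = cinner x (\<theta> (adj a o\<^sub>L ((adj k o\<^sub>L l) o\<^sub>L b)) y)"
        if "k \<in> multipliers A" "l \<in> multipliers A" for k l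
      proof -
        have "cinner (\<theta> (k o\<^sub>L a) x) (\<theta> (l o\<^sub>L b) y) = cinner x (\<theta> (adj (k o\<^sub>L a) o\<^sub>L (l o\<^sub>L b)) y)"
          using p(2) q(2) mA that by (simp add: cinner_adj_right del: blinfun_compose_assoc)
        also have "adj (k o\<^sub>L a) o\<^sub>L (l o\<^sub>L b) = adj a o\<^sub>L ((adj k o\<^sub>L l) o\<^sub>L b)"
          using p(2) mult that by (simp add: adj_simps blinfun_compose_assoc)
        finally show ?thesis .
      qed
      have I: "id_blinfun \<in> multipliers A" by simp
      have "\<theta> (adj a o\<^sub>L ((adj m o\<^sub>L m) o\<^sub>L b)) = \<theta> (adj a o\<^sub>L (s o\<^sub>L b)) + \<theta> (adj a o\<^sub>L (s o\<^sub>L b))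
          - \<theta> (adj a o\<^sub>L ((s o\<^sub>L s) o\<^sub>L b))"
      proof -
        have "adj a o\<^sub>L ((adj m o\<^sub>L m) o\<^sub>L b) = (adj a o\<^sub>L (s o\<^sub>L b)) + (adj a o\<^sub>L (s o\<^sub>L b)) - (adj a o\<^sub>L ((s o\<^sub>L s) o\<^sub>L b))"
          by (simp flip: s(3) add: bounded_bilinear.add_left[OF bounded_bilinear_blinfun_compose]
              bounded_bilinear.add_right[OF bounded_bilinear_blinfun_compose]
              bounded_bilinear.diff_left[OF bounded_bilinear_blinfun_compose]
              bounded_bilinear.diff_right[OF bounded_bilinear_blinfun_compose])
        moreover have "adj a o\<^sub>L (s o\<^sub>L b) \<in> A" "adj a o\<^sub>L ((s o\<^sub>L s) o\<^sub>L b) \<in> A"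
          using p(2) q(2) s(1) mA mult by auto
        ultimately show ?thesis by (simp add: star_hom_linear[OF \<theta> A(1)])
      qed
      then have "cinner (\<theta> (m o\<^sub>L a) x) (\<theta> (m o\<^sub>L b) y) - cinner (\<theta> a x) (\<theta> b y)
          + cinner (\<theta> a x - \<theta> (s o\<^sub>L a) x) (\<theta> b y - \<theta> (s o\<^sub>L b) y) = 0"
        using key[OF m(1) m(1)] key[OF I I] key[OF I s(1)] key[OF s(1) I] key[OF s(1) s(1)]
        by (simp add: cinner.diff_left cinner.diff_right cinner_add_right blinfun.add_left
            blinfun.diff_left adj_simps s(2))
      then show "Q p q = 0" unfolding Q_def p q by (simp add: inner_ell2_def flip: plus_complex.simps minus_complex.simps)
    qed
    have le: "norm v \<le> 1 * norm u" if "(u, v) \<in> span G" for u v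
    proof -
      have "linear (\<lambda>p :: 'b ell2 \<times> 'b ell2 \<times> 'b ell2. (fst p, fst (snd p)))"
        by (rule linearI) auto
      then have "span G = (\<lambda>p. (fst p, fst (snd p))) ` span W"
        by (simp flip: linear_span_image add: G_def W_def image_image case_prod_unfold)
      with that obtain w where "(u, v, w) \<in> span W" by auto
      from Q0[OF this this] have "(norm v)\<^sup>2 + (norm (u - w))\<^sup>2 = (norm u)\<^sup>2"
        by (simp add: Q_def power2_norm_eq_inner)
      then have "(norm v)\<^sup>2 \<le> (norm u)\<^sup>2" using zero_le_power2[of "norm (u - w)"] by linarith
      then have "norm v \<le> norm u" by (rule power2_le_imp_le) simp
      then show ?thesis by simp
    qed
    have dense: "closure (fst ` span G) = UNIV"
    proof -
      have "fst ` span G = span (fst ` G)" by (rule linear_span_image[symmetric]) (rule bounded_linear.linear[OF bounded_linear_fst])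
      also have "fst ` G = {\<theta> a x | a x. a \<in> A}" by (force simp: G_def image_image case_prod_unfold)
      finally show ?thesis using nd by (simp add: nondegenerate_def)
    qed
    obtain T where T: "\<And>x. (x, T x) \<in> closure (span G)"
      and T': "\<And>x y. (x, y) \<in> closure (span G) \<Longrightarrow> y = T x \<and> norm y \<le> norm x"
    proof -
      have "\<exists>T. (\<forall>x\<in>closure (fst ` span G). (x, T x) \<in> closure (span G)) \<and>
          (\<forall>x y. (x, y) \<in> closure (span G) \<longrightarrow>
            x \<in> closure (fst ` span G) \<and> y = T x \<and> norm y \<le> 1 * norm x)"
        by (rule closure_graph[OF subspace_span]) (rule le)
      then show thesis using that unfolding dense mult_1 by blast
    qed
    have sub: "subspace (closure (span G))" by (intro subspace_closure subspace_span)
    have bl: "bounded_linear T"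
    proof (rule bounded_linear_intro[where K = 1])
      show "T (x + y) = T x + T y" for x y using T'[of "x + y" "T x + T y"] subspace_add[OF sub T T] by auto
      show "T (r *\<^sub>R x) = r *\<^sub>R T x" for r x using T'[of "r *\<^sub>R x" "r *\<^sub>R T x"] subspace_scale[OF sub T] by auto
      show "norm (T x) \<le> norm x * 1" for x using T T' by auto
    qed
    have val: "T (\<theta> a x) = \<theta> (m o\<^sub>L a) x" if "a \<in> A" for a x
    proof -
      have "(\<theta> a x, \<theta> (m o\<^sub>L a) x) \<in> span G" using that by (intro span_base) (auto simp: G_def)
      then show ?thesis using T' closure_subset by (metis subsetD)
    qed
    have sc: "(scaleC c u, scaleC c v) \<in> span G" if "(u, v) \<in> span G" for c u v
    proof -
      have "linear (\<lambda>p. (scaleC c (fst p), scaleC c (snd p)) :: 'b ell2 \<times> 'b ell2)"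
        by (rule linearI) (auto simp: scaleC_add_right scaleR_eq_scaleC mult.commute)
      then have "(\<lambda>p. (scaleC c (fst p), scaleC c (snd p))) ` span G
          = span ((\<lambda>p. (scaleC c (fst p), scaleC c (snd p))) ` G)" by (simp add: linear_span_image)
      also have "\<dots> \<subseteq> span G"
      proof (intro span_mono subsetI, clarify)
        fix u v assume "(u, v) \<in> G"
        then obtain a x where "u = \<theta> a x" "v = \<theta> (m o\<^sub>L a) x" "a \<in> A" by (auto simp: G_def)
        then show "(scaleC c (fst (u, v)), scaleC c (snd (u, v))) \<in> G"
          using bopD[of "\<theta> a"] bopD[of "\<theta> (m o\<^sub>L a)"] mA[OF m(1)]
          by (auto simp: G_def intro!: image_eqI[of _ _ "(a, scaleC c x)"])
      qed
      finally show ?thesis using that by force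
    qed
    have sc': "(scaleC c x, scaleC c (T x)) \<in> closure (span G)" for c x
    proof -
      have "continuous_on (closure (span G)) (\<lambda>p. (scaleC c (fst p), scaleC c (snd p)))"
        by (intro continuous_on_Pair bounded_linear.continuous_on[OF bounded_linear_scaleC]
            continuous_on_fst continuous_on_snd continuous_on_id)
      from closure_closed_op1[OF this, where R' = "span G"] sc T[of x] show ?thesis by fastforce
    qed
    have "T (scaleC c x) = scaleC c (T x)" for c x using T'[OF sc'] by (metis (no_types))
    then have "Blinfun T \<in> bop" by (simp add: bop_def bounded_linear_Blinfun_apply[OF bl])
    then show ?thesis
      by (intro bexI[of _ "Blinfun T"])
         (auto intro!: blinfun_eqI simp: bounded_linear_Blinfun_apply[OF bl] val)
  qed
  \<comment> \<open>Rescaling to norm below 1; the added 1 also covers \<open>m = 0\<close>.\<close>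
  define r where "r = norm m + 1"
  have r: "0 < r" by (simp add: r_def add_nonneg_pos)
  have "norm ((1/r) *\<^sub>R m) < 1" using r by (simp add: r_def)
  moreover have "(1/r) *\<^sub>R m \<in> multipliers A" using m mult by auto
  ultimately obtain T where T: "T \<in> bop" "\<And>a. a \<in> A \<Longrightarrow> T o\<^sub>L \<theta> a = \<theta> ((1/r) *\<^sub>R m o\<^sub>L a)" using small by blast
  have "r *\<^sub>R T o\<^sub>L \<theta> a = \<theta> (m o\<^sub>L a)" if "a \<in> A" for a
    using T(2)[OF that] mA[OF m that] r
    by (simp add: bounded_bilinear.scaleR_left[OF bounded_bilinear_blinfun_compose])
  then show ?thesis using T(1) by (intro bexI[of _ "r *\<^sub>R T"]) (auto simp: scaleR_eq_cscale)
qed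

lemma
  assumes A: "star_subalgebra A" "closed A" and \<theta>: "star_hom A \<theta> bop" and nd: "nondegenerate A \<theta>"
    and m: "m \<in> multipliers A"
  shows strict_ext_bop: "strict_ext A \<theta> m \<in> bop"
    and strict_ext_comp: "a \<in> A \<Longrightarrow> strict_ext A \<theta> m o\<^sub>L \<theta> a = \<theta> (m o\<^sub>L a)"
    and strict_ext_unique: "(\<And>a. a \<in> A \<Longrightarrow> T o\<^sub>L \<theta> a = \<theta> (m o\<^sub>L a)) \<Longrightarrow> strict_ext A \<theta> m = T"
proof -
  obtain T where T: "T \<in> bop" "\<And>a. a \<in> A \<Longrightarrow> T o\<^sub>L \<theta> a = \<theta> (m o\<^sub>L a)"
    using ex_strict_ext[OF assms] by blast
  have "strict_ext A \<theta> m = T"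
    unfolding strict_ext_def
  proof (rule the_equality)
    show "T \<in> bop \<and> (\<forall>a\<in>A. T o\<^sub>L \<theta> a = \<theta> (m o\<^sub>L a))" using T by blast
    show "T' = T" if "T' \<in> bop \<and> (\<forall>a\<in>A. T' o\<^sub>L \<theta> a = \<theta> (m o\<^sub>L a))" for T'
      by (rule nondegenerate_ext[OF nd]) (simp add: T that)
  qed
  then show 1: "strict_ext A \<theta> m \<in> bop" "a \<in> A \<Longrightarrow> strict_ext A \<theta> m o\<^sub>L \<theta> a = \<theta> (m o\<^sub>L a)" for a
    using T by auto
  show "(\<And>a. a \<in> A \<Longrightarrow> T o\<^sub>L \<theta> a = \<theta> (m o\<^sub>L a)) \<Longrightarrow> strict_ext A \<theta> m = T" for T
    by (rule nondegenerate_ext[OF nd]) (simp add: 1)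
qed

text \<open>By \<open>strict_ext_unique\<close> each identity has to be checked only after composing
  with \<open>\<theta> a\<close> on the right, where it is an identity for \<open>\<theta>\<close>
  on \<open>A\<close>.\<close>

lemma star_hom_strict_ext:
  assumes A: "star_subalgebra A" "closed A" and \<theta>: "star_hom A \<theta> bop" and nd: "nondegenerate A \<theta>"
  shows "star_hom (multipliers A) (strict_ext A \<theta>) bop"
  unfolding star_hom_def
proof (intro conjI ballI allI)
  note mult = star_subalgebraD[OF star_subalgebra_multipliers[OF A(1)]]
  note ext = strict_ext_bop[OF A \<theta> nd] strict_ext_comp[OF A \<theta> nd]
  note uniq = strict_ext_unique[OF A \<theta> nd]
  fix m n assume m: "m \<in> multipliers A" and n: "n \<in> multipliers A"
  note mA = multipliersD(2)[OF m] and nA = multipliersD(2)[OF n]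
  show "strict_ext A \<theta> (m + n) = strict_ext A \<theta> m + strict_ext A \<theta> n"
    by (rule uniq[OF mult(3)[OF m n]])
       (simp only: bounded_bilinear.add_left[OF bounded_bilinear_blinfun_compose]
        ext(2)[OF m] ext(2)[OF n] star_homD(2)[OF \<theta> mA nA])
  show "strict_ext A \<theta> (m o\<^sub>L n) = strict_ext A \<theta> m o\<^sub>L strict_ext A \<theta> n"
    by (rule uniq[OF mult(4)[OF m n]])
       (simp only: blinfun_compose_assoc ext(2)[OF n] ext(2)[OF m nA])
next
  note mult = star_subalgebraD[OF star_subalgebra_multipliers[OF A(1)]]
  note ext = strict_ext_bop[OF A \<theta> nd] strict_ext_comp[OF A \<theta> nd]
  note uniq = strict_ext_unique[OF A \<theta> nd]
  fix m c assume m: "m \<in> multipliers A"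
  show "strict_ext A \<theta> m \<in> bop" by (rule ext(1)[OF m])
  note mA = multipliersD(2)[OF m] and mb = multipliersD(1)[OF m]
  show "strict_ext A \<theta> (cscale c m) = cscale c (strict_ext A \<theta> m)"
    by (rule uniq[OF mult(6)[OF m]])
       (simp only: comp_cscale_left ext(2)[OF m] star_homD(5)[OF \<theta> mA])
  note am = mult(5)[OF m]
  show "strict_ext A \<theta> (adj m) = adj (strict_ext A \<theta> m)"
  proof (rule uniq[OF am])
    fix a assume a: "a \<in> A"
    have ab: "\<theta> a \<in> bop" if "a \<in> A" for a using star_homD(1)[OF \<theta> that] .
    have Eb: "strict_ext A \<theta> m \<in> bop" by (rule ext(1)[OF m])
    have aA: "adj m o\<^sub>L a \<in> A" by (rule multipliersD(2)[OF am a])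
    \<comment> \<open>Nondegeneracy cancels factors \<open>\<theta> b\<close> on the right only;
      taking adjoints of both sides brings the comparison into this shape.\<close>
    have "adj (adj (strict_ext A \<theta> m) o\<^sub>L \<theta> a) = adj (\<theta> (adj m o\<^sub>L a))"
    proof (rule nondegenerate_ext[OF nd])
      fix b assume b: "b \<in> A"
      have "adj (adj (strict_ext A \<theta> m) o\<^sub>L \<theta> a) o\<^sub>L \<theta> b = adj (\<theta> a) o\<^sub>L (strict_ext A \<theta> m o\<^sub>L \<theta> b)"
        by (simp only: adj_simps(5)[OF adj_bop[OF Eb] ab[OF a]] adj_adj[OF Eb] blinfun_compose_assoc)
      also have "\<dots> = \<theta> (adj a o\<^sub>L (m o\<^sub>L b))"
        by (simp only: ext(2)[OF m b] star_homD(3)[OF \<theta> star_subalgebraD(5)[OF A(1) a] mA[OF b]]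
            star_homD(4)[OF \<theta> a])
      also have "adj a o\<^sub>L (m o\<^sub>L b) = adj (adj m o\<^sub>L a) o\<^sub>L b"
        by (simp only: adj_simps(5)[OF adj_bop[OF mb] star_subalgebraD(7)[OF A(1) a]] adj_adj[OF mb]
            blinfun_compose_assoc)
      also have "\<theta> \<dots> = adj (\<theta> (adj m o\<^sub>L a)) o\<^sub>L \<theta> b"
        by (simp only: star_homD(3)[OF \<theta> star_subalgebraD(5)[OF A(1) aA] b] star_homD(4)[OF \<theta> aA])
      finally show "adj (adj (strict_ext A \<theta> m) o\<^sub>L \<theta> a) o\<^sub>L \<theta> b = adj (\<theta> (adj m o\<^sub>L a)) o\<^sub>L \<theta> b" .
    qed
    then have "adj (adj (adj (strict_ext A \<theta> m) o\<^sub>L \<theta> a)) = adj (adj (\<theta> (adj m o\<^sub>L a)))"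
      by (rule arg_cong)
    then show "adj (strict_ext A \<theta> m) o\<^sub>L \<theta> a = \<theta> (adj m o\<^sub>L a)"
      by (simp only: adj_adj[OF bop_simps(6)[OF adj_bop[OF Eb] ab[OF a]]] adj_adj[OF ab[OF aA]])
  qed
qed

lemma strict_ext_id:
  assumes A: "star_subalgebra A" "closed A" and \<theta>: "star_hom A \<theta> bop" and nd: "nondegenerate A \<theta>"
  shows "strict_ext A \<theta> id_blinfun = id_blinfun"
  by (rule strict_ext_unique[OF assms]) auto

lemma strict_ext_unital:
  assumes "id_blinfun \<in> A" "\<theta> id_blinfun = id_blinfun" "star_hom A \<theta> bop" "m \<in> A"
  shows "strict_ext A \<theta> m = \<theta> m"
  unfolding strict_ext_def
proof (rule the_equality)
  show "\<theta> m \<in> bop \<and> (\<forall>a\<in>A. \<theta> m o\<^sub>L \<theta> a = \<theta> (m o\<^sub>L a))" using star_homD[OF assms(3)] assms(4) by auto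
  fix T assume "T \<in> bop \<and> (\<forall>a\<in>A. T o\<^sub>L \<theta> a = \<theta> (m o\<^sub>L a))"
  then have "T o\<^sub>L \<theta> id_blinfun = \<theta> (m o\<^sub>L id_blinfun)" using assms(1) by blast
  then show "T = \<theta> m" by (simp add: assms(2))
qed

section \<open>Tensor products of *-homomorphisms\<close>

lemmas comp_add_left = bounded_bilinear.add_left[OF bounded_bilinear_blinfun_compose]
  and comp_add_right = bounded_bilinear.add_right[OF bounded_bilinear_blinfun_compose]
  and comp_diff_left = bounded_bilinear.diff_left[OF bounded_bilinear_blinfun_compose]
  and comp_diff_right = bounded_bilinear.diff_right[OF bounded_bilinear_blinfun_compose]
  and comp_sum_left = bounded_bilinear.sum_left[OF bounded_bilinear_blinfun_compose]
  and comp_sum_right = bounded_bilinear.sum_right[OF bounded_bilinear_blinfun_compose]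
  and comp_zero_left = bounded_bilinear.zero_left[OF bounded_bilinear_blinfun_compose]
  and comp_zero_right = bounded_bilinear.zero_right[OF bounded_bilinear_blinfun_compose]
  and comp_scaleR_left = bounded_bilinear.scaleR_left[OF bounded_bilinear_blinfun_compose]
  and comp_scaleR_right = bounded_bilinear.scaleR_right[OF bounded_bilinear_blinfun_compose]

section \<open>Matrices of operators\<close>

lemma adj_compr_gen: "X \<in> bop \<Longrightarrow> adj (compr \<xi> \<eta> X) = compr \<eta> \<xi> (adj X)"
proof (rule adj_unique[symmetric])
  fix x y assume X: "X \<in> bop"
  have "cinner (compr \<eta> \<xi> (adj X) x) y = cnj (cinner y (compr \<eta> \<xi> (adj X) x))"
    by (rule cinner_commute)
  also have "\<dots> = cinner x (compr \<xi> \<eta> X y)"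
    using X by (simp add: cinner_compr cinner_adj_right) (metis cinner_commute)
  finally show "cinner (compr \<eta> \<xi> (adj X) x) y = cinner x (compr \<xi> \<eta> X y)" .
qed auto

lemma gadj_rtens_vtensor: "gadj (rtens \<eta>) (vtensor x y) = scaleC (cinner \<eta> y) x"
  by (rule cinner_ext) (simp add: cinner_gadj_right[OF clin_rtens] cinner_vtensor cinner_scaleC_right)

text \<open>The tensor product of \<open>c\<close> with a matrix unit: the matrix whose only nonzero
  entry is \<open>c\<close>, in row \<open>i\<close> and column \<open>j\<close>.\<close>

definition emb :: "'j \<Rightarrow> 'j \<Rightarrow> 'i op \<Rightarrow> ('i \<times> 'j) op" where
  "emb i j c = rtens (ebasis i) o\<^sub>L c o\<^sub>L gadj (rtens (ebasis j))"

lemma gadj_rtens_rtens: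
  "gadj (rtens (ebasis i)) o\<^sub>L rtens (ebasis j) = (if i = j then id_blinfun else 0)"
  by (rule blinfun_eqI) (simp add: gadj_rtens_vtensor ebasis_orthonormal)

lemma bounded_linear_emb: "bounded_linear (emb i j)"
  unfolding emb_def
  by (intro bounded_linear_compose[OF bounded_bilinear.bounded_linear_left[OF bounded_bilinear_blinfun_compose]]
      bounded_bilinear.bounded_linear_right[OF bounded_bilinear_blinfun_compose])

lemmas emb_sum = linear_sum[OF bounded_linear.linear[OF bounded_linear_emb]]
lemmas emb_add = linear_add[OF bounded_linear.linear[OF bounded_linear_emb]]

lemma emb_comp: "emb i j c o\<^sub>L emb k l d = (if j = k then emb i l (c o\<^sub>L d) else 0)"
proof -
  have "emb i j c o\<^sub>L emb k l d = rtens (ebasis i) o\<^sub>L c o\<^sub>L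
      (gadj (rtens (ebasis j)) o\<^sub>L rtens (ebasis k)) o\<^sub>L d o\<^sub>L gadj (rtens (ebasis l))"
    unfolding emb_def by (simp only: blinfun_compose_assoc)
  then show ?thesis
    by (simp add: gadj_rtens_rtens emb_def blinfun_compose_assoc comp_zero_left comp_zero_right)
qed

lemma clin_emb: "c \<in> bop \<Longrightarrow> emb i j c \<in> bop"
  unfolding bop_iff_clin emb_def
  by (simp add: clin_def vtensor_scaleC_left clinD[OF clin_gadj[OF clin_rtens]])

lemma emb_cscale: "emb i j (cscale k c) = cscale k (emb i j c)"
  by (rule blinfun_eqI) (simp add: emb_def vtensor_scaleC_left)

lemma adj_emb:
  assumes "c \<in> bop" shows "adj (emb i j c) = emb j i (adj c)"
proof (rule adj_unique[symmetric])
  fix x y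
  have "cinner (emb j i (adj c) x) y = cinner (adj c (gadj (rtens (ebasis i)) x)) (gadj (rtens (ebasis j)) y)"
    by (simp add: emb_def cinner_gadj_right[OF clin_rtens])
  also have "\<dots> = cinner x (emb i j c y)"
    by (simp add: cinner_adj_left[OF assms] cinner_gadj_left[OF clin_rtens] emb_def)
  finally show "cinner (emb j i (adj c) x) y = cinner x (emb i j c y)" .
qed (use assms in \<open>auto intro: clin_emb\<close>)

lemma compr_emb: "compr (ebasis i) (ebasis j) (emb k l c) = (if i = k \<and> j = l then c else 0)"
proof -
  have "compr (ebasis i) (ebasis j) (emb k l c) = (gadj (rtens (ebasis i)) o\<^sub>L rtens (ebasis k)) o\<^sub>L c o\<^sub>L
      (gadj (rtens (ebasis l)) o\<^sub>L rtens (ebasis j))"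
    unfolding emb_def compr_def by (simp only: blinfun_compose_assoc)
  then show ?thesis by (simp add: gadj_rtens_rtens comp_zero_left comp_zero_right)
qed

text \<open>The identity tensor the projection onto the coordinates in \<open>F\<close>; compression
  by it cuts out a corner of a matrix.\<close>

definition proj :: "'j set \<Rightarrow> ('i \<times> 'j) op" where
  "proj F = (\<Sum>i\<in>F. emb i i id_blinfun)"

lemma proj_bop [simp, intro]: "proj F \<in> bop"
  by (simp add: proj_def clin_emb)

lemma adj_proj [simp]: "adj (proj F) = proj F"
  unfolding proj_def by (subst adj_sum(1)) (simp_all add: clin_emb adj_emb adj_simps)

lemma proj_proj:
  assumes "finite F" "finite F'" shows "proj F o\<^sub>L proj F' = proj (F \<inter> F')"
proof -
  have "proj F o\<^sub>L proj F' = (\<Sum>i\<in>F'. \<Sum>j\<in>F. if j = i then emb j i id_blinfun else 0)"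
    unfolding proj_def comp_sum_left comp_sum_right by (simp add: emb_comp cong: if_cong)
  also have "\<dots> = (\<Sum>i\<in>F'. if i \<in> F then emb i i id_blinfun else 0)"
    using assms by (intro sum.cong refl) (simp add: sum.delta)
  also have "\<dots> = proj (F' \<inter> F)"
    unfolding proj_def using assms by (simp only: sum.inter_restrict)
  finally show ?thesis by (simp only: Int_commute)
qed

lemma norm_proj_le: "finite F \<Longrightarrow> norm (proj F :: ('i \<times> 'j) op) \<le> 1"
proof -
  assume F: "finite F"
  let ?p = "proj F :: ('i \<times> 'j) op"
  have "?p o\<^sub>L ?p = ?p" using proj_proj[OF F F] by simp
  then have "norm ?p = (norm ?p)\<^sup>2"
    using norm_adj_comp[of ?p] by (simp only: adj_proj proj_bop)
  then have "norm ?p * (norm ?p - 1) = 0" by (simp add: power2_eq_square algebra_simps)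
  then show ?thesis by auto
qed

lemma proj_comp_proj:
  "proj F o\<^sub>L X o\<^sub>L proj F = (\<Sum>i\<in>F. \<Sum>j\<in>F. emb i j (compr (ebasis i) (ebasis j) X))"
proof -
  have "emb i i id_blinfun o\<^sub>L X o\<^sub>L emb j j id_blinfun = emb i j (compr (ebasis i) (ebasis j) X)" for i j
    unfolding emb_def compr_def by (simp only: blinfun_compose_assoc id_blinfun_compose)
  then show ?thesis unfolding proj_def by (simp add: comp_sum_left comp_sum_right)
     (rule sum.swap)
qed

text \<open>Vectors whose second leg is supported on finitely many coordinates are dense, and
  between two of them the matrix coefficients of \<open>Y\<close> are those of one finite
  corner.\<close>

lemma norm_le_proj:
  fixes Y :: "('i \<times> 'j) op"
  assumes C: "0 \<le> C" and le: "\<And>F. finite F \<Longrightarrow> norm (proj F o\<^sub>L Y o\<^sub>L proj F) \<le> C"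
  shows "norm Y \<le> C"
proof -
  define D where "D = {u :: ('i \<times> 'j) ell2. \<exists>F. finite F \<and> proj F u = u}"
  have up: "proj (F \<union> F') u = u" if "finite F" "finite F'" "proj F u = u" for F F' and u :: "('i \<times> 'j) ell2"
  proof -
    have "proj (F \<union> F') (proj F u) = proj F u"
      using arg_cong[OF proj_proj[of "F \<union> F'" F], of "\<lambda>T. T u"] that(1,2)
      by (simp add: Int_absorb1 Int_commute)
    then show ?thesis by (simp only: that(3))
  qed
  have addD: "u + v \<in> D" if "u \<in> D" "v \<in> D" for u v
  proof -
    obtain F F' where F: "finite F" "proj F u = u" "finite F'" "proj F' v = v"
      using \<open>u \<in> D\<close> \<open>v \<in> D\<close> unfolding D_def by blast
    have "proj (F \<union> F') (u + v) = u + v"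
      using up[OF F(1,3,2)] up[OF F(3,1,4)] by (simp add: blinfun.add_right Un_commute)
    with F(1,3) show ?thesis unfolding D_def by blast
  qed
  have dense: "u \<in> closure D" for u
  proof (induction u rule: ell2_induct)
    case zero
    show ?case by (rule closure_subset[THEN subsetD]) (auto simp: D_def)
  next
    case (add x y)
    show ?case
      by (rule closure_closed_op2[OF _ _ add]) (auto intro!: continuous_intros addD)
  next
    case (ebasis c p)
    have "proj {snd p} (ebasis p) = (ebasis p :: ('i \<times> 'j) ell2)"
      by (cases p) (simp add: proj_def emb_def ebasis_pair gadj_rtens_vtensor ebasis_orthonormal)
    then have "proj {snd p} (scaleC c (ebasis p)) = (scaleC c (ebasis p) :: ('i \<times> 'j) ell2)"
      by (simp only: bopD[OF proj_bop])
    then have "scaleC c (ebasis p) \<in> D" unfolding D_def by blast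
    then show ?case by (rule closure_subset[THEN subsetD])
  qed simp
  have 1: "cmod (cinner w (Y u)) \<le> C * norm u * norm w" if "u \<in> D" "w \<in> D" for u w
  proof -
    obtain F F' where F: "finite F" "proj F u = u" "finite F'" "proj F' w = w"
      using \<open>u \<in> D\<close> \<open>w \<in> D\<close> unfolding D_def by blast
    let ?G = "F \<union> F'"
    have u: "proj ?G u = u" and w: "proj ?G w = w" using up[OF F(1,3,2)] up[OF F(3,1,4)] by (simp_all add: Un_commute)
    have "cinner w (Y u) = cinner w ((proj ?G o\<^sub>L Y o\<^sub>L proj ?G) u)"
      using cinner_adj_left[OF proj_bop, of ?G w "Y u"] by (simp add: u w)
    also have "cmod \<dots> \<le> norm w * norm ((proj ?G o\<^sub>L Y o\<^sub>L proj ?G) u)" by (rule norm_cinner_le)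
    also have "\<dots> \<le> norm w * (C * norm u)"
      by (intro mult_left_mono order_trans[OF norm_blinfun] mult_right_mono le) (use F in auto)
    finally show ?thesis by (simp only: mult_ac)
  qed
  have 2: "cmod (cinner w (Y u)) \<le> C * norm u * norm w" if "u \<in> D" for u w
  proof -
    have "closed {w. cmod (cinner w (Y u)) \<le> C * norm u * norm w}"
      by (intro closed_Collect_le continuous_intros cinner.continuous_on)
    then have "closure D \<subseteq> {w. cmod (cinner w (Y u)) \<le> C * norm u * norm w}"
      by (rule closure_minimal[rotated]) (use 1 that in auto)
    then show ?thesis using dense by auto
  qed
  have 3: "norm (Y u) \<le> C * norm u" if "u \<in> D" for u
    by (rule norm_le_cinnerI) (use C 2[OF that] in auto)
  have "closed {u. norm (Y u) \<le> C * norm u}" by (intro closed_Collect_le continuous_intros)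
  then have "closure D \<subseteq> {u. norm (Y u) \<le> C * norm u}"
    by (rule closure_minimal[rotated]) (use 3 in auto)
  then show ?thesis using dense C by (intro norm_blinfun_bound) auto
qed

lemma sum_double_delta:
  assumes "finite F" "i \<in> F" "j \<in> F"
  shows "(\<Sum>a\<in>F. \<Sum>b\<in>F. if i = a \<and> j = b then g a b else 0) = (g i j :: 'a::comm_monoid_add)"
proof -
  have "(\<Sum>a\<in>F. \<Sum>b\<in>F. if i = a \<and> j = b then g a b else 0) = (\<Sum>a\<in>F. if i = a then g a j else 0)"
    using assms by (intro sum.cong refl) auto
  then show ?thesis using assms by simp
qed

text \<open>For finite \<open>F\<close>, the matrix algebra over \<open>A\<close> with rows and
  columns in \<open>F\<close>, realized on the product space; the two equations say that nothing
  lives outside the corner.\<close>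

definition matalg :: "'i op set \<Rightarrow> 'j set \<Rightarrow> ('i \<times> 'j) op set" where
  "matalg A F = {X \<in> bop. proj F o\<^sub>L X = X \<and> X o\<^sub>L proj F = X \<and>
    (\<forall>i\<in>F. \<forall>j\<in>F. compr (ebasis i) (ebasis j) X \<in> A)}"

lemma compr_matalg_comp:
  assumes "X o\<^sub>L proj F = X"
  shows "compr (ebasis i) (ebasis j) (X o\<^sub>L Y)
    = (\<Sum>l\<in>F. compr (ebasis i) (ebasis l) X o\<^sub>L compr (ebasis l) (ebasis j) Y)"
proof -
  have "compr (ebasis i) (ebasis j) (X o\<^sub>L Y) = compr (ebasis i) (ebasis j) (X o\<^sub>L proj F o\<^sub>L Y)"
    by (simp only: assms)
  also have "\<dots> = (\<Sum>l\<in>F. compr (ebasis i) (ebasis l) X o\<^sub>L compr (ebasis l) (ebasis j) Y)"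
    unfolding compr_def proj_def emb_def
    by (simp add: comp_sum_left comp_sum_right blinfun_compose_assoc)
  finally show ?thesis .
qed

lemma star_subalgebra_matalg:
  assumes A: "star_subalgebra A"
  shows "star_subalgebra (matalg A F)"
  unfolding star_subalgebra_def
proof (intro conjI ballI allI)
  note A = star_subalgebraD[OF A]
  show "matalg A F \<subseteq> bop" by (auto simp: matalg_def)
  show "0 \<in> matalg A F"
    by (simp add: matalg_def linear_0[OF bounded_linear.linear[OF bounded_linear_compr]] A(2)
        comp_zero_left comp_zero_right)
  fix X Y assume "X \<in> matalg A F" "Y \<in> matalg A F"
  then have X: "X \<in> bop" "proj F o\<^sub>L X = X" "X o\<^sub>L proj F = X"
      "\<And>i j. i \<in> F \<Longrightarrow> j \<in> F \<Longrightarrow> compr (ebasis i) (ebasis j) X \<in> A"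
    and Y: "Y \<in> bop" "proj F o\<^sub>L Y = Y" "Y o\<^sub>L proj F = Y"
      "\<And>i j. i \<in> F \<Longrightarrow> j \<in> F \<Longrightarrow> compr (ebasis i) (ebasis j) Y \<in> A"
    by (simp_all add: matalg_def)
  show "X + Y \<in> matalg A F"
    by (simp add: matalg_def X Y compr_add A(3) comp_add_left comp_add_right)
  have "proj F o\<^sub>L (X o\<^sub>L Y) = X o\<^sub>L Y" by (simp only: X(2) flip: blinfun_compose_assoc)
  moreover have "(X o\<^sub>L Y) o\<^sub>L proj F = X o\<^sub>L Y" by (simp only: Y(3) blinfun_compose_assoc)
  ultimately show "X o\<^sub>L Y \<in> matalg A F"
    by (simp add: matalg_def X(1) Y(1) compr_matalg_comp[OF X(3)] subspace_sum[OF A(12)] A(4) X(4) Y(4))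
next
  note A = star_subalgebraD[OF A]
  fix X c assume "X \<in> matalg A F"
  then have X: "X \<in> bop" "proj F o\<^sub>L X = X" "X o\<^sub>L proj F = X"
      "\<And>i j. i \<in> F \<Longrightarrow> j \<in> F \<Longrightarrow> compr (ebasis i) (ebasis j) X \<in> A"
    by (simp_all add: matalg_def)
  have "proj F o\<^sub>L adj X = adj X" "adj X o\<^sub>L proj F = adj X"
    using adj_simps(5)[OF X(1) proj_bop, of F] adj_simps(5)[OF proj_bop X(1), of F] X(2,3) by auto
  moreover have "compr (ebasis i) (ebasis j) (adj X) \<in> A" if "i \<in> F" "j \<in> F" for i j
    using A(5)[OF X(4)[OF that(2,1)]] by (simp only: adj_compr_gen[OF X(1)])
  ultimately show "adj X \<in> matalg A F" by (simp add: matalg_def X(1))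
  show "cscale c X \<in> matalg A F"
    by (simp add: matalg_def X compr_cscale A(6) comp_cscale_left comp_cscale_right)
qed

lemma closed_matalg:
  assumes A: "closed A" shows "closed (matalg A F)"
proof -
  have 1: "closed {X :: ('a \<times> 'b) op. proj F o\<^sub>L X = X}" "closed {X :: ('a \<times> 'b) op. X o\<^sub>L proj F = X}"
    by (rule closed_Collect_eq; intro linear_continuous_on continuous_on_id
        bounded_bilinear.bounded_linear_left[OF bounded_bilinear_blinfun_compose]
        bounded_bilinear.bounded_linear_right[OF bounded_bilinear_blinfun_compose])+
  have "closed (compr (ebasis i) (ebasis j) -` A)" for i j :: 'b
    by (rule closed_vimage[OF A]) (rule linear_continuous_on[OF bounded_linear_compr])
  then have "closed (bop \<inter> ({X. proj F o\<^sub>L X = X} \<inter> ({X. X o\<^sub>L proj F = X} \<inter>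
      (\<Inter>i\<in>F. \<Inter>j\<in>F. compr (ebasis i) (ebasis j) -` A))))"
    by (intro closed_Int closed_bop 1 closed_INT ballI)
  also have "\<dots> = matalg A F" by (auto simp: matalg_def)
  finally show ?thesis .
qed

definition amp :: "('i op \<Rightarrow> 'k op) \<Rightarrow> 'j set \<Rightarrow> ('i \<times> 'j) op \<Rightarrow> ('k \<times> 'j) op" where
  "amp \<theta> F X = (\<Sum>i\<in>F. \<Sum>j\<in>F. emb i j (\<theta> (compr (ebasis i) (ebasis j) X)))"

lemma star_hom_amp:
  assumes A: "star_subalgebra A" and \<theta>: "star_hom A \<theta> bop" and F: "finite F"
  shows "star_hom (matalg A F) (amp \<theta> F) bop"
  unfolding star_hom_def
proof (intro conjI ballI allI)
  note A' = star_subalgebraD[OF A]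
  fix X Y assume XY: "X \<in> matalg A F" "Y \<in> matalg A F"
  have X: "X \<in> bop" "X o\<^sub>L proj F = X" "\<And>i j. i \<in> F \<Longrightarrow> j \<in> F \<Longrightarrow> compr (ebasis i) (ebasis j) X \<in> A"
    and Y: "Y \<in> bop" "\<And>i j. i \<in> F \<Longrightarrow> j \<in> F \<Longrightarrow> compr (ebasis i) (ebasis j) Y \<in> A"
    using XY by (simp_all add: matalg_def)
  show "amp \<theta> F (X + Y) = amp \<theta> F X + amp \<theta> F Y"
    by (simp add: amp_def compr_add star_homD(2)[OF \<theta> X(3) Y(2)] emb_add sum.distrib)
  have "amp \<theta> F X o\<^sub>L amp \<theta> F Y = (\<Sum>i\<in>F. \<Sum>l\<in>F. \<Sum>j\<in>F. \<Sum>k\<in>F.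
      if l = j then emb i k (\<theta> (compr (ebasis i) (ebasis l) X) o\<^sub>L \<theta> (compr (ebasis j) (ebasis k) Y)) else 0)"
    unfolding amp_def by (simp only: comp_sum_left, simp only: comp_sum_right emb_comp)
  also have "\<dots> = (\<Sum>i\<in>F. \<Sum>l\<in>F. \<Sum>k\<in>F. \<Sum>j\<in>F.
      if l = j then emb i k (\<theta> (compr (ebasis i) (ebasis l) X) o\<^sub>L \<theta> (compr (ebasis j) (ebasis k) Y)) else 0)"
    by (intro sum.cong refl sum.swap)
  also have "\<dots> = (\<Sum>i\<in>F. \<Sum>l\<in>F. \<Sum>k\<in>F.
      emb i k (\<theta> (compr (ebasis i) (ebasis l) X) o\<^sub>L \<theta> (compr (ebasis l) (ebasis k) Y)))"
    using F by (intro sum.cong refl) (simp add: sum.delta')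
  also have "\<dots> = (\<Sum>i\<in>F. \<Sum>k\<in>F. \<Sum>l\<in>F.
      emb i k (\<theta> (compr (ebasis i) (ebasis l) X) o\<^sub>L \<theta> (compr (ebasis l) (ebasis k) Y)))"
    by (intro sum.cong refl sum.swap)
  also have "\<dots> = amp \<theta> F (X o\<^sub>L Y)"
    unfolding amp_def
  proof (intro sum.cong refl)
    fix i k assume ik: "i \<in> F" "k \<in> F"
    have "\<theta> (compr (ebasis i) (ebasis k) (X o\<^sub>L Y))
        = (\<Sum>l\<in>F. \<theta> (compr (ebasis i) (ebasis l) X o\<^sub>L compr (ebasis l) (ebasis k) Y))"
      unfolding compr_matalg_comp[OF X(2)]
      by (rule star_hom_linear(4)[OF \<theta> A]) (intro A'(4) X(3) Y(2) ik)
    also have "\<dots> = (\<Sum>l\<in>F. \<theta> (compr (ebasis i) (ebasis l) X) o\<^sub>L \<theta> (compr (ebasis l) (ebasis k) Y))"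
      by (intro sum.cong refl star_homD(3)[OF \<theta>] X(3) Y(2) ik)
    finally show "(\<Sum>l\<in>F. emb i k (\<theta> (compr (ebasis i) (ebasis l) X) o\<^sub>L \<theta> (compr (ebasis l) (ebasis k) Y)))
        = emb i k (\<theta> (compr (ebasis i) (ebasis k) (X o\<^sub>L Y)))"
      by (simp only: emb_sum)
  qed
  finally show "amp \<theta> F (X o\<^sub>L Y) = amp \<theta> F X o\<^sub>L amp \<theta> F Y" by (rule sym)
next
  fix X c assume XY: "X \<in> matalg A F"
  have X: "X \<in> bop" "X o\<^sub>L proj F = X" "\<And>i j. i \<in> F \<Longrightarrow> j \<in> F \<Longrightarrow> compr (ebasis i) (ebasis j) X \<in> A"
    using XY by (simp_all add: matalg_def)
  have b: "\<theta> (compr (ebasis i) (ebasis j) X) \<in> bop" if "i \<in> F" "j \<in> F" for i j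
    using star_homD(1)[OF \<theta> X(3)[OF that]] .
  show "amp \<theta> F X \<in> bop" by (simp add: amp_def b clin_emb)
  show "amp \<theta> F (cscale c X) = cscale c (amp \<theta> F X)"
    by (simp add: amp_def compr_cscale star_homD(5)[OF \<theta> X(3)] emb_cscale cop.scale_sum_right)
  have "amp \<theta> F (adj X) = (\<Sum>i\<in>F. \<Sum>j\<in>F. emb i j (adj (\<theta> (compr (ebasis j) (ebasis i) X))))"
    unfolding amp_def
    by (intro sum.cong refl) (simp only: adj_compr_gen[OF X(1), symmetric] star_homD(4)[OF \<theta> X(3)])
  also have "\<dots> = (\<Sum>j\<in>F. \<Sum>i\<in>F. emb i j (adj (\<theta> (compr (ebasis j) (ebasis i) X))))"
    by (rule sum.swap)
  also have "\<dots> = adj (amp \<theta> F X)"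
    unfolding amp_def by (simp add: adj_sum(1) b clin_emb adj_emb)
  finally show "amp \<theta> F (adj X) = adj (amp \<theta> F X)" .
qed

text \<open>Complete contractivity: each finite corner of \<open>x\<close> lies in
  \<open>matalg A F\<close>, on which \<open>amp \<theta> F\<close> is again a *-homomorphism, hence
  contractive, and the corners exhaust the norm. It is phrased for pairs because this very estimate
  makes the map on the span well defined.\<close>

lemma norm_amplification_le:
  fixes \<theta> :: "'i op \<Rightarrow> 'k op" and x :: "('i \<times> 'j) op"
  assumes A: "star_subalgebra A" "closed A" and \<theta>: "star_hom A \<theta> bop"
    and xy: "(x, y) \<in> span ((\<lambda>(a, b). (op_tensor a b, op_tensor (\<theta> a) b)) ` (A \<times> bop))"
  shows "norm y \<le> norm x"
proof -
  note A' = star_subalgebraD[OF A(1)]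
  let ?P = "\<lambda>p :: ('i \<times> 'j) op \<times> ('k \<times> 'j) op. fst p \<in> bop \<and> snd p \<in> bop \<and> (\<forall>i j. compr (ebasis i) (ebasis j) (fst p) \<in> A \<and>
    compr (ebasis i) (ebasis j) (snd p) = \<theta> (compr (ebasis i) (ebasis j) (fst p)))"
  have "?P (x, y)"
    using xy
  proof (induction rule: span_induct_alt)
    case base
    show ?case
      by (simp add: linear_0[OF bounded_linear.linear[OF bounded_linear_compr]] A'(2) star_hom_linear(1)[OF \<theta> A(1)])
  next
    case (step c p q)
    then obtain a b where p: "p = (op_tensor a b, op_tensor (\<theta> a) b)" "a \<in> A" "b \<in> bop" by auto
    have ab: "a \<in> bop" "\<theta> a \<in> bop" using p A'(7) star_homD(1)[OF \<theta>] by auto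
    have 1: "compr (ebasis i) (ebasis j) (c *\<^sub>R op_tensor a b) \<in> A"
      "compr (ebasis i) (ebasis j) (c *\<^sub>R op_tensor (\<theta> a) b) = \<theta> (compr (ebasis i) (ebasis j) (c *\<^sub>R op_tensor a b))" for i j
      using p ab by (simp_all add: scaleR_eq_cscale compr_cscale compr_op_tensor A'(6) star_homD(5)[OF \<theta>])
    have 2: "?P q" by (rule step)
    show ?case
      using 1 2 ab p(3) star_homD(2)[OF \<theta> 1(1)]
      by (simp add: p(1) compr_add A'(3)) (simp add: scaleR_eq_cscale)
  qed
  then have x: "x \<in> bop" "\<And>i j. compr (ebasis i) (ebasis j) x \<in> A"
    and y: "\<And>i j. compr (ebasis i) (ebasis j) y = \<theta> (compr (ebasis i) (ebasis j) x)" by auto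
  show ?thesis
  proof (rule norm_le_proj)
    fix F :: "'j set" assume F: "finite F"
    let ?x = "proj F o\<^sub>L x o\<^sub>L proj F"
    have PP: "(proj F :: ('i \<times> 'j) op) o\<^sub>L proj F = proj F" using proj_proj[OF F F] by simp
    have e: "compr (ebasis i) (ebasis j) ?x = compr (ebasis i) (ebasis j) x" if "i \<in> F" "j \<in> F" for i j
      unfolding proj_comp_proj
      by (simp add: compr_sum compr_emb sum_double_delta[OF F that])
    have "proj F o\<^sub>L ?x = ?x" by (simp only: PP flip: blinfun_compose_assoc)
    moreover have "?x o\<^sub>L proj F = ?x" by (simp only: PP blinfun_compose_assoc)
    ultimately have m: "?x \<in> matalg A F" using x e by (simp add: matalg_def)
    have "proj F o\<^sub>L y o\<^sub>L proj F = amp \<theta> F ?x"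
      unfolding proj_comp_proj[of _ y] amp_def by (intro sum.cong refl) (simp only: e y)
    then have "norm (proj F o\<^sub>L y o\<^sub>L proj F) \<le> norm ?x"
      using star_hom_contractive[OF star_subalgebra_matalg[OF A(1)] closed_matalg[OF A(2)]
          star_hom_amp[OF A(1) \<theta> F] m] by simp
    also have "\<dots> \<le> norm (proj F o\<^sub>L x) * norm (proj F :: ('i \<times> 'j) op)" by (rule norm_blinfun_compose)
    also have "\<dots> \<le> (norm (proj F :: ('i \<times> 'j) op) * norm x) * 1"
      by (intro mult_mono norm_blinfun_compose norm_proj_le F) auto
    also have "\<dots> \<le> (1 * norm x) * 1"
      by (intro mult_mono norm_proj_le F) auto
    finally show "norm (proj F o\<^sub>L y o\<^sub>L proj F) \<le> norm x" by simp
  qed simp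
qed

lemma linear_span_map:
  assumes "linear f" "p \<in> span S" "\<And>q. q \<in> S \<Longrightarrow> f q \<in> span S'"
  shows "f p \<in> span S'"
  using assms(2)
proof (induction rule: span_induct_alt)
  case base
  show ?case by (simp add: linear_0[OF assms(1)] span_zero)
next
  case (step c x y)
  then show ?case
    by (simp add: linear_add[OF assms(1)] linear_scale[OF assms(1)] span_add span_scale assms(3))
qed

lemma bilinear_span_map:
  assumes "\<And>y. linear (\<lambda>x. f x y)" "\<And>x. linear (f x)" "p \<in> span S" "q \<in> span S'"
    "\<And>x y. x \<in> S \<Longrightarrow> y \<in> S' \<Longrightarrow> f x y \<in> span T"
  shows "f p q \<in> span T"
  by (rule linear_span_map[OF assms(1,3)], rule linear_span_map[OF assms(2,4)], rule assms(5))

lemma linear_transport: "linear (transport f)"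
  unfolding transport_def
  by (rule linearI) (simp_all add: comp_add_left comp_add_right comp_scaleR_left comp_scaleR_right)

lemma norm_tensor_hom_le:
  fixes \<theta> :: "'i op \<Rightarrow> 'k op" and \<rho> :: "'j op \<Rightarrow> 'l op"
  assumes A: "star_subalgebra A" "closed A" "star_hom A \<theta> bop"
    and B: "star_subalgebra B" "closed B" "star_hom B \<rho> bop"
    and xy: "(x, y) \<in> span ((\<lambda>(a, b). (op_tensor a b, op_tensor (\<theta> a) (\<rho> b))) ` (A \<times> B))"
  shows "norm y \<le> norm x"
proof -
  note A' = star_subalgebraD[OF A(1)] and B' = star_subalgebraD[OF B(1)]
  let ?W = "(\<lambda>(a, b). (op_tensor a b, op_tensor (\<theta> a) b, op_tensor (\<theta> a) (\<rho> b))) ` (A \<times> B)"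
  have lin: "linear (\<lambda>p :: ('i \<times> 'j) op \<times> ('k \<times> 'j) op \<times> ('k \<times> 'l) op. (fst p, snd (snd p)))"
    by (rule linearI) auto
  have "(x, y) \<in> (\<lambda>p. (fst p, snd (snd p))) ` span ?W"
    using xy by (simp flip: linear_span_image[OF lin] add: image_image case_prod_unfold)
  then obtain z where z: "(x, z, y) \<in> span ?W" by auto
  have lin1: "linear (\<lambda>p :: ('i \<times> 'j) op \<times> ('k \<times> 'j) op \<times> ('k \<times> 'l) op. (fst p, fst (snd p)))"
    by (rule linearI) auto
  have "(x, z) \<in> span ((\<lambda>(a, b). (op_tensor a b, op_tensor (\<theta> a) b)) ` (A \<times> bop))"
  proof -
    have "(fst (x, z, y), fst (snd (x, z, y))) \<in> span ((\<lambda>(a, b). (op_tensor a b, op_tensor (\<theta> a) b)) ` (A \<times> bop))"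
      by (rule linear_span_map[OF lin1 z]) (auto intro!: span_base image_eqI[of _ _ "(_, _)"] B'(7))
    then show ?thesis by simp
  qed
  then have "norm z \<le> norm x" by (rule norm_amplification_le[OF A])
  define t1 t2 where "t1 = (transport prod.swap :: ('k \<times> 'j) op \<Rightarrow> ('j \<times> 'k) op)"
    and "t2 = (transport prod.swap :: ('k \<times> 'l) op \<Rightarrow> ('l \<times> 'k) op)"
  have l: "linear t1" "linear t2" by (simp_all add: t1_def t2_def linear_transport)
  have lin2: "linear (\<lambda>p :: ('i \<times> 'j) op \<times> ('k \<times> 'j) op \<times> ('k \<times> 'l) op. (t1 (fst (snd p)), t2 (snd (snd p))))"
    by (rule linearI) (simp_all add: linear_add[OF l(1)] linear_add[OF l(2)] linear_scale[OF l(1)] linear_scale[OF l(2)])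
  have th: "\<theta> a \<in> bop" if "a \<in> A" for a using star_homD(1)[OF A(3) that] .
  have rh: "\<rho> a \<in> bop" if "a \<in> B" for a using star_homD(1)[OF B(3) that] .
  have "(t1 z, t2 y) \<in> span ((\<lambda>(a, b). (op_tensor a b, op_tensor (\<rho> a) b)) ` (B \<times> bop))"
  proof -
    have "(t1 (fst (snd (x, z, y))), t2 (snd (snd (x, z, y))))
        \<in> span ((\<lambda>(a, b). (op_tensor a b, op_tensor (\<rho> a) b)) ` (B \<times> bop))"
    proof (rule linear_span_map[OF lin2 z])
      fix q assume "q \<in> ?W"
      then obtain a b where q: "q = (op_tensor a b, op_tensor (\<theta> a) b, op_tensor (\<theta> a) (\<rho> b))" "a \<in> A" "b \<in> B"
        by auto
      show "(t1 (fst (snd q)), t2 (snd (snd q))) \<in> span ((\<lambda>(a, b). (op_tensor a b, op_tensor (\<rho> a) b)) ` (B \<times> bop))"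
        by (rule span_base, rule image_eqI[of _ _ "(b, \<theta> a)"])
           (use q(2,3) in \<open>simp_all add: q(1) t1_def t2_def transport_swap th rh B'(7)\<close>)
    qed
    then show ?thesis by simp
  qed
  then have 1: "norm (t2 y) \<le> norm (t1 z)" by (rule norm_amplification_le[OF B])
  have "y \<in> span {op_tensor a b | a b. a \<in> bop \<and> b \<in> bop}"
  proof -
    have "snd (snd (x, z, y)) \<in> span {op_tensor a b | a b. a \<in> bop \<and> b \<in> bop}"
    proof (rule linear_span_map[OF _ z])
      show "linear (\<lambda>p :: ('i \<times> 'j) op \<times> ('k \<times> 'j) op \<times> ('k \<times> 'l) op. snd (snd p))"
        by (rule linearI) simp_all
      fix q assume "q \<in> ?W"
      then obtain a b where q: "q = (op_tensor a b, op_tensor (\<theta> a) b, op_tensor (\<theta> a) (\<rho> b))" "a \<in> A" "b \<in> B"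
        by auto
      then have "snd (snd q) \<in> {op_tensor a b | a b. a \<in> bop \<and> b \<in> bop}"
        using th[OF q(2)] rh[OF q(3)] by (simp only: snd_conv) blast
      then show "snd (snd q) \<in> span {op_tensor a b | a b. a \<in> bop \<and> b \<in> bop}" by (rule span_base)
    qed
    then show ?thesis by simp
  qed
  then have "transport prod.swap (t2 y) = y"
  proof (induction rule: span_induct_alt)
    case base
    show ?case by (simp add: t2_def linear_0[OF linear_transport])
  next
    case (step c p q)
    then have "transport prod.swap (t2 p) = p" by (auto simp: t2_def transport_swap)
    with step show ?case
      by (simp add: t2_def linear_add[OF linear_transport] linear_scale[OF linear_transport])
  qed
  then have "norm y \<le> norm (t2 y)" using norm_transport_le[OF bij_swap, of "t2 y"] by simp
  moreover have "norm (t1 z) \<le> norm z" unfolding t1_def by (rule norm_transport_le[OF bij_swap])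
  ultimately show ?thesis using 1 \<open>norm z \<le> norm x\<close> by linarith
qed

lemma star_subalgebra_closure:
  assumes "star_subalgebra A" shows "star_subalgebra (closure A)"
  unfolding star_subalgebra_def
proof (intro conjI ballI allI)
  note A = star_subalgebraD[OF assms]
  show sub: "closure A \<subseteq> bop" by (rule closure_minimal[OF A(1) closed_bop])
  show "0 \<in> closure A" using A(2) closure_subset by auto
  show "a + b \<in> closure A" if "a \<in> closure A" "b \<in> closure A" for a b
    by (rule closure_closed_op2[OF _ _ that]) (auto intro!: continuous_intros A(3))
  show "a o\<^sub>L b \<in> closure A" if "a \<in> closure A" "b \<in> closure A" for a b
    by (rule closure_closed_op2[OF _ _ that])
       (intro bounded_bilinear.continuous_on[OF bounded_bilinear_blinfun_compose]
        continuous_on_fst continuous_on_snd continuous_on_id, rule A(4))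
  show "adj a \<in> closure A" if "a \<in> closure A" for a
    by (rule closure_closed_op1[OF continuous_on_subset[OF continuous_on_adj sub] _ that]) (rule A(5))
  show "cscale c a \<in> closure A" if "a \<in> closure A" for a c
    by (rule closure_closed_op1[OF bounded_linear.continuous_on[OF bounded_linear_cscale continuous_on_id] _ that])
       (rule A(6))
qed

lemma star_relation_span:
  fixes S :: "('i op \<times> 'j op) set"
  assumes "S \<subseteq> bop \<times> bop"
    and comp: "\<And>x y x' y'. (x, y) \<in> S \<Longrightarrow> (x', y') \<in> S \<Longrightarrow> (x o\<^sub>L x', y o\<^sub>L y') \<in> span S"
    and adj: "\<And>x y. (x, y) \<in> S \<Longrightarrow> (adj x, adj y) \<in> span S"
    and scale: "\<And>c x y. (x, y) \<in> S \<Longrightarrow> (cscale c x, cscale c y) \<in> span S"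
  shows "span S \<subseteq> bop \<times> bop"
    and "(x, y) \<in> span S \<Longrightarrow> (x', y') \<in> span S \<Longrightarrow> (x o\<^sub>L x', y o\<^sub>L y') \<in> span S"
    and "(x, y) \<in> span S \<Longrightarrow> (adj x, adj y) \<in> span S"
    and "(x, y) \<in> span S \<Longrightarrow> (cscale c x, cscale c y) \<in> span S"
proof -
  have bb: "fst p \<in> bop \<and> snd p \<in> bop \<and> (adj (fst p), adj (snd p)) \<in> span S" if "p \<in> span S" for p
    using that
  proof (induction rule: span_induct_alt)
    case base
    show ?case using span_zero[of S] by (simp add: adj_simps zero_prod_def)
  next
    case (step c p q)
    obtain x y where p: "p = (x, y)" by (cases p)
    have xy: "x \<in> bop" "y \<in> bop" using assms(1) step(1) p by auto
    have "(adj (x), adj (y)) \<in> span S" using adj step(1) p by auto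
    then have "c *\<^sub>R (adj x, adj y) + (adj (fst q), adj (snd q)) \<in> span S"
      using step by (intro span_add span_scale) auto
    then show ?case using step xy p
      by (simp add: scaleR_eq_cscale adj_simps)
  qed
  then show "span S \<subseteq> bop \<times> bop" by auto
  show "(x, y) \<in> span S \<Longrightarrow> (adj x, adj y) \<in> span S" using bb by fastforce
  have "(fst p o\<^sub>L fst q, snd p o\<^sub>L snd q) \<in> span S" if "p \<in> span S" "q \<in> span S" for p q
    by (rule bilinear_span_map[where f = "\<lambda>p q. (fst p o\<^sub>L fst q, snd p o\<^sub>L snd q)", OF _ _ that])
       (auto intro!: linearI comp
        simp: comp_add_left comp_add_right comp_scaleR_left comp_scaleR_right)
  then show "(x, y) \<in> span S \<Longrightarrow> (x', y') \<in> span S \<Longrightarrow> (x o\<^sub>L x', y o\<^sub>L y') \<in> span S" by fastforce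
  have "linear (\<lambda>p :: 'i op \<times> 'j op. (cscale c (fst p), cscale c (snd p)))"
    by (rule linearI)
       (simp_all add: cop.scale_right_distrib scaleR_eq_cscale mult.commute)
  from linear_span_map[OF this, of "(x, y)" S S] scale
  show "(x, y) \<in> span S \<Longrightarrow> (cscale c x, cscale c y) \<in> span S" by auto
qed

lemma ex_hom_tensor:
  fixes \<theta> :: "'i op \<Rightarrow> 'k op" and \<rho> :: "'j op \<Rightarrow> 'l op"
  assumes A: "star_subalgebra A" "closed A" "star_hom A \<theta> bop"
    and B: "star_subalgebra B" "closed B" "star_hom B \<rho> bop"
  shows "\<exists>\<Phi>. \<Phi> \<in> extensional (min_tensor A B) \<and> star_hom (min_tensor A B) \<Phi> bop \<and>
    (\<forall>a\<in>A. \<forall>b\<in>B. \<Phi> (op_tensor a b) = op_tensor (\<theta> a) (\<rho> b))"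
proof -
  note A' = star_subalgebraD[OF A(1)] and B' = star_subalgebraD[OF B(1)]
  have th: "\<theta> a \<in> bop" if "a \<in> A" for a using star_homD(1)[OF A(3) that] .
  have rh: "\<rho> a \<in> bop" if "a \<in> B" for a using star_homD(1)[OF B(3) that] .
  define S where "S = (\<lambda>(a, b). (op_tensor a b, op_tensor (\<theta> a) (\<rho> b))) ` (A \<times> B)"
  have SI: "(op_tensor a b, op_tensor (\<theta> a) (\<rho> b)) \<in> S" if "a \<in> A" "b \<in> B" for a b
    using that unfolding S_def by (intro image_eqI[of _ _ "(a, b)"]) auto
  have SE: thesis if "(x, y) \<in> S" "\<And>a b. a \<in> A \<Longrightarrow> b \<in> B \<Longrightarrow> x = op_tensor a b \<Longrightarrow> y = op_tensor (\<theta> a) (\<rho> b) \<Longrightarrow> thesis"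
    for x y thesis using that unfolding S_def by auto
  have sub: "S \<subseteq> bop \<times> bop"
    unfolding S_def by (auto intro!: op_tensor_bop A'(7) B'(7) th rh)
  have comp: "(x o\<^sub>L x', y o\<^sub>L y') \<in> S" if "(x, y) \<in> S" "(x', y') \<in> S" for x y x' y'
  proof -
    from that obtain a b a' b' where 1: "a \<in> A" "b \<in> B" "x = op_tensor a b" "y = op_tensor (\<theta> a) (\<rho> b)"
      and 2: "a' \<in> A" "b' \<in> B" "x' = op_tensor a' b'" "y' = op_tensor (\<theta> a') (\<rho> b')"
      by (elim SE) blast
    show ?thesis
      using SI[OF A'(4)[OF 1(1) 2(1)] B'(4)[OF 1(2) 2(2)]] 1 2
      by (simp add: op_tensor_comp A'(7) B'(7) th rh star_homD(3)[OF A(3)] star_homD(3)[OF B(3)])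
  qed
  have adj: "(adj x, adj y) \<in> S" if "(x, y) \<in> S" for x y
  proof -
    from that obtain a b where 1: "a \<in> A" "b \<in> B" "x = op_tensor a b" "y = op_tensor (\<theta> a) (\<rho> b)"
      by (elim SE) blast
    show ?thesis
      using SI[OF A'(5)[OF 1(1)] B'(5)[OF 1(2)]] 1
      by (simp add: adj_op_tensor A'(7) B'(7) th rh star_homD(4)[OF A(3)] star_homD(4)[OF B(3)])
  qed
  have scale: "(cscale c x, cscale c y) \<in> S" if "(x, y) \<in> S" for c x y
  proof -
    from that obtain a b where 1: "a \<in> A" "b \<in> B" "x = op_tensor a b" "y = op_tensor (\<theta> a) (\<rho> b)"
      by (elim SE) blast
    show ?thesis
      using SI[OF A'(6)[OF 1(1)] 1(2), of c] 1
      by (simp add: op_tensor_cscale_left A'(7) B'(7) th rh star_homD(5)[OF A(3)])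
  qed
  note sp = star_relation_span[OF sub span_base[OF comp] span_base[OF adj] span_base[OF scale]]
  have "fst ` span S = span (fst ` S)"
    by (rule linear_span_image[symmetric]) (rule bounded_linear.linear[OF bounded_linear_fst])
  also have "fst ` S = {op_tensor a b | a b. a \<in> A \<and> b \<in> B}"
    unfolding S_def by force
  finally have dom: "closure (fst ` span S) = min_tensor A B" by (simp add: min_tensor_def)
  have "\<exists>\<Phi>. \<Phi> \<in> extensional (closure (fst ` span S)) \<and>
    star_hom (closure (fst ` span S)) \<Phi> (closure (snd ` span S)) \<and> (\<forall>(x, y)\<in>span S. \<Phi> x = y)"
    by (rule star_relation_extends[OF sp(1) subspace_span sp(2-4)])
       (auto intro: norm_tensor_hom_le[OF A B] simp: S_def)
  then obtain \<Phi> where \<Phi>: "\<Phi> \<in> extensional (min_tensor A B)"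
      "star_hom (min_tensor A B) \<Phi> (closure (snd ` span S))" "\<forall>(x, y)\<in>span S. \<Phi> x = y"
    unfolding dom by (elim exE conjE)
  have "closure (snd ` span S) \<subseteq> bop"
    using sp(1) by (intro closure_minimal closed_bop) auto
  with \<Phi>(2) have "star_hom (min_tensor A B) \<Phi> bop" by (rule star_hom_mono[OF _ subset_refl])
  moreover have "\<forall>a\<in>A. \<forall>b\<in>B. \<Phi> (op_tensor a b) = op_tensor (\<theta> a) (\<rho> b)"
    using \<Phi>(3) SI span_base[of _ S] by fastforce
  ultimately show ?thesis using \<Phi>(1) by blast
qed

lemma star_subalgebra_min_tensor:
  assumes A: "star_subalgebra A" and B: "star_subalgebra B"
  shows "star_subalgebra (min_tensor A B)"
proof -
  note A' = star_subalgebraD[OF A] and B' = star_subalgebraD[OF B]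
  let ?T = "{op_tensor a b | a b. a \<in> A \<and> b \<in> B}"
  \<comment> \<open>The diagonal turns a statement on operators into one on pairs, so that
    \<open>star_relation_span\<close> applies.\<close>
  define S where "S = (\<lambda>t. (t, t)) ` ?T"
  have SI: "(op_tensor a b, op_tensor a b) \<in> S" if "a \<in> A" "b \<in> B" for a b
    using that unfolding S_def by auto
  have SE: thesis if "(x, y) \<in> S" "\<And>a b. a \<in> A \<Longrightarrow> b \<in> B \<Longrightarrow> x = op_tensor a b \<Longrightarrow> y = op_tensor a b \<Longrightarrow> thesis"
    for x y thesis using that unfolding S_def by auto
  have sub: "S \<subseteq> bop \<times> bop"
    unfolding S_def by (auto intro!: op_tensor_bop A'(7) B'(7))
  have comp: "(x o\<^sub>L x', y o\<^sub>L y') \<in> S" if "(x, y) \<in> S" "(x', y') \<in> S" for x y x' y'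
  proof -
    from that obtain a b a' b' where 1: "a \<in> A" "b \<in> B" "x = op_tensor a b" "y = op_tensor a b"
      and 2: "a' \<in> A" "b' \<in> B" "x' = op_tensor a' b'" "y' = op_tensor a' b'"
      by (elim SE) blast
    show ?thesis
      using SI[OF A'(4)[OF 1(1) 2(1)] B'(4)[OF 1(2) 2(2)]] 1 2
      by (simp add: op_tensor_comp A'(7) B'(7))
  qed
  have adj: "(adj x, adj y) \<in> S" if "(x, y) \<in> S" for x y
  proof -
    from that obtain a b where 1: "a \<in> A" "b \<in> B" "x = op_tensor a b" "y = op_tensor a b"
      by (elim SE) blast
    show ?thesis
      using SI[OF A'(5)[OF 1(1)] B'(5)[OF 1(2)]] 1
      by (simp add: adj_op_tensor A'(7) B'(7))
  qed
  have scale: "(cscale c x, cscale c y) \<in> S" if "(x, y) \<in> S" for c x y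
  proof -
    from that obtain a b where 1: "a \<in> A" "b \<in> B" "x = op_tensor a b" "y = op_tensor a b"
      by (elim SE) blast
    show ?thesis
      using SI[OF A'(6)[OF 1(1)] 1(2), of c] 1
      by (simp add: op_tensor_cscale_left A'(7) B'(7))
  qed
  note sp = star_relation_span[OF sub span_base[OF comp] span_base[OF adj] span_base[OF scale]]
  have lin: "linear (\<lambda>t :: ('a \<times> 'b) op. (t, t))" by (rule linearI) auto
  have iff: "(t, t) \<in> span S \<longleftrightarrow> t \<in> span ?T" for t
    unfolding S_def linear_span_image[OF lin] by auto
  have "star_subalgebra (span ?T)"
    unfolding star_subalgebra_def
  proof (intro conjI ballI allI)
    show "span ?T \<subseteq> bop" using sp(1) iff by blast
    show "0 \<in> span ?T" by (rule span_zero)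
    fix a b assume ab: "a \<in> span ?T" "b \<in> span ?T"
    show "a + b \<in> span ?T" using ab by (rule span_add)
    show "a o\<^sub>L b \<in> span ?T" using sp(2)[of a a b b] ab unfolding iff by blast
  next
    fix a c assume a: "a \<in> span ?T"
    show "adj a \<in> span ?T" using sp(3)[of a a] a unfolding iff by blast
    show "cscale c a \<in> span ?T" using sp(4)[of a a c] a unfolding iff by blast
  qed
  then show ?thesis unfolding min_tensor_def by (rule star_subalgebra_closure)
qed

lemma closed_min_tensor [simp]: "closed (min_tensor A B)"
  by (simp add: min_tensor_def)

lemma op_tensor_in_min_tensor: "a \<in> A \<Longrightarrow> b \<in> B \<Longrightarrow> op_tensor a b \<in> min_tensor A B"
  unfolding min_tensor_def by (intro closure_subset[THEN subsetD] span_base) auto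

lemma star_hom_eq_min_tensor:
  assumes A: "star_subalgebra A" and B: "star_subalgebra B"
    and "star_hom (min_tensor A B) \<Phi> bop" "star_hom (min_tensor A B) \<Psi> bop"
    and eq: "\<And>a b. a \<in> A \<Longrightarrow> b \<in> B \<Longrightarrow> \<Phi> (op_tensor a b) = \<Psi> (op_tensor a b)"
    and x: "x \<in> min_tensor A B"
  shows "\<Phi> x = \<Psi> x"
proof (rule continuous_eq_on_closure[OF _ _ closed_min_tensor _ _ _ x])
  note AB = star_subalgebra_min_tensor[OF A B]
  let ?T = "{op_tensor a b | a b. a \<in> A \<and> b \<in> B}"
  show "continuous_on (min_tensor A B) \<Phi>" "continuous_on (min_tensor A B) \<Psi>"
    using star_hom_continuous[OF AB closed_min_tensor] assms by blast+
  show T: "span ?T \<subseteq> min_tensor A B" by (simp add: min_tensor_def closure_subset)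
  show "min_tensor A B \<subseteq> closure (span ?T)" by (simp add: min_tensor_def)
  fix x assume x: "x \<in> span ?T"
  then have "x \<in> span ?T \<and> \<Phi> x = \<Psi> x"
  proof (induction rule: span_induct_alt)
    case base
    show ?case by (simp add: star_hom_linear(1)[OF assms(3) AB] star_hom_linear(1)[OF assms(4) AB] span_zero)
  next
    case (step c x y)
    have x: "x \<in> span ?T" using step(1) by (rule span_base)
    have "\<Phi> x = \<Psi> x" using step(1) eq by blast
    moreover have "x \<in> min_tensor A B" "c *\<^sub>R x \<in> min_tensor A B" "y \<in> min_tensor A B"
      using T x step(2) span_scale[OF x, of c] by blast+
    ultimately show ?case
      using step(2) x by (simp add: star_homD(2,6)[OF assms(3)] star_homD(2,6)[OF assms(4)] span_add span_scale)
  qed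
  then show "\<Phi> x = \<Psi> x" ..
qed

text \<open>A *-homomorphism on the minimal tensor product is continuous, hence fixed by its values
  on elementary tensors, and extensionality fixes it elsewhere; so the definite description
  \<open>hom_tensor\<close> denotes.\<close>

lemma
  assumes A: "star_subalgebra A" "closed A" "star_hom A \<theta> bop"
    and B: "star_subalgebra B" "closed B" "star_hom B \<rho> bop"
  shows star_hom_hom_tensor: "star_hom (min_tensor A B) (hom_tensor A \<theta> B \<rho>) bop"
    and hom_tensor_op_tensor: "a \<in> A \<Longrightarrow> b \<in> B \<Longrightarrow> hom_tensor A \<theta> B \<rho> (op_tensor a b) = op_tensor (\<theta> a) (\<rho> b)"
proof -
  obtain \<Phi> where \<Phi>: "\<Phi> \<in> extensional (min_tensor A B)" "star_hom (min_tensor A B) \<Phi> bop"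
    "\<And>a b. a \<in> A \<Longrightarrow> b \<in> B \<Longrightarrow> \<Phi> (op_tensor a b) = op_tensor (\<theta> a) (\<rho> b)"
    using ex_hom_tensor[OF A B] by blast
  have "hom_tensor A \<theta> B \<rho> = \<Phi>"
    unfolding hom_tensor_def
  proof (rule the_equality)
    show "\<Phi> \<in> extensional (min_tensor A B) \<and> star_hom (min_tensor A B) \<Phi> bop \<and>
        (\<forall>a\<in>A. \<forall>b\<in>B. \<Phi> (op_tensor a b) = op_tensor (\<theta> a) (\<rho> b))" using \<Phi> by blast
    fix \<Psi> assume \<Psi>: "\<Psi> \<in> extensional (min_tensor A B) \<and> star_hom (min_tensor A B) \<Psi> bop \<and>
        (\<forall>a\<in>A. \<forall>b\<in>B. \<Psi> (op_tensor a b) = op_tensor (\<theta> a) (\<rho> b))"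
    show "\<Psi> = \<Phi>"
    proof (rule extensionalityI)
      show "\<Psi> \<in> extensional (min_tensor A B)" "\<Phi> \<in> extensional (min_tensor A B)" using \<Psi> \<Phi> by auto
      show "\<Psi> x = \<Phi> x" if "x \<in> min_tensor A B" for x
        by (rule star_hom_eq_min_tensor[OF A(1) B(1) _ \<Phi>(2) _ that]) (use \<Psi> \<Phi>(3) in auto)
    qed
  qed
  then show "star_hom (min_tensor A B) (hom_tensor A \<theta> B \<rho>) bop"
    "a \<in> A \<Longrightarrow> b \<in> B \<Longrightarrow> hom_tensor A \<theta> B \<rho> (op_tensor a b) = op_tensor (\<theta> a) (\<rho> b)"
    using \<Phi> by auto
qed

section \<open>Coefficients of corepresentations\<close>

definition tens :: "'i op set \<Rightarrow> 'j op set \<Rightarrow> ('i \<times> 'j) op set" where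
  "tens S T = {op_tensor u v | u v. u \<in> S \<and> v \<in> T}"

lemma tensI: "u \<in> S \<Longrightarrow> v \<in> T \<Longrightarrow> op_tensor u v \<in> tens S T"
  by (auto simp: tens_def)

lemma tens_mono: "S \<subseteq> S' \<Longrightarrow> T \<subseteq> T' \<Longrightarrow> tens S T \<subseteq> tens S' T'"
  by (auto simp: tens_def)

lemma cspan_subset_bop: "S \<subseteq> bop \<Longrightarrow> cop.span S \<subseteq> bop"
  by (rule cop.span_minimal) (auto simp: cop.subspace_def)

lemma cspan_tens_subset_bop: "S \<subseteq> bop \<Longrightarrow> T \<subseteq> bop \<Longrightarrow> cop.span (tens S T) \<subseteq> bop"
  by (rule cspan_subset_bop) (auto simp: tens_def)

lemma cspan_tens_comp:
  assumes "S \<subseteq> bop" "T \<subseteq> bop" "X \<in> cop.span (tens S S)" "Y \<in> cop.span (tens T T)"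
  shows "X o\<^sub>L Y \<in> cop.span (tens {s o\<^sub>L t | s t. s \<in> S \<and> t \<in> T} {s o\<^sub>L t | s t. s \<in> S \<and> t \<in> T})"
  (is "_ \<in> cop.span ?P")
  using assms(3)
proof (induction rule: cop.span_induct_alt)
  case base
  show ?case by (simp add: comp_zero_left cop.span_zero)
next
  case (step c x X)
  obtain u v where x: "x = op_tensor u v" "u \<in> S" "v \<in> S" using step(1) by (auto simp: tens_def)
  have uv: "u \<in> bop" "v \<in> bop" using x assms(1) by auto
  have "x o\<^sub>L Y \<in> cop.span ?P"
    using assms(4)
  proof (induction rule: cop.span_induct_alt)
    case base
    show ?case by (simp add: comp_zero_right cop.span_zero)
  next
    case (step d y Y)
    obtain w z where y: "y = op_tensor w z" "w \<in> T" "z \<in> T" using step(1) by (auto simp: tens_def)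
    have wz: "w \<in> bop" "z \<in> bop" using y assms(2) by auto
    have "x o\<^sub>L y \<in> ?P"
      unfolding x(1) y(1) op_tensor_comp[OF uv(1) wz(1) uv(2) wz(2)]
      by (rule tensI) (use x y in blast)+
    then show ?case
      using step(2) uv
      by (simp add: comp_add_right comp_cscale_right x(1) cop.span_add cop.span_scale cop.span_base)
  qed
  then show ?case
    using step(2) by (simp add: comp_add_left comp_cscale_left cop.span_add cop.span_scale)
qed

lemma cspan_tens_adj:
  assumes "S \<subseteq> bop" "X \<in> cop.span (tens S S)"
  shows "adj X \<in> cop.span (tens (adj ` S) (adj ` S))"
proof -
  have "X \<in> bop \<and> adj X \<in> cop.span (tens (adj ` S) (adj ` S))"
    using assms(2)
  proof (induction rule: cop.span_induct_alt)
    case base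
    show ?case by (simp add: adj_simps cop.span_zero)
  next
    case (step c x X)
    obtain u v where x: "x = op_tensor u v" "u \<in> S" "v \<in> S" using step(1) by (auto simp: tens_def)
    have uv: "u \<in> bop" "v \<in> bop" using x assms(1) by auto
    have "adj x \<in> tens (adj ` S) (adj ` S)"
      unfolding x(1) adj_op_tensor[OF uv] by (rule tensI) (use x in blast)+
    then show ?case
      using step(2) uv by (simp add: x(1) adj_simps cop.span_add cop.span_scale cop.span_base)
  qed
  then show ?thesis ..
qed

text \<open>Two instances occur: \<open>multipliers A\<close> with
  \<open>strict_ext A \<Delta>\<close>, and a unital C*-bialgebra such as the universal algebra
  \<open>K\<close>. In the first one \<open>D\<close> takes values in multipliers of a tensor
  product, so the target is just \<open>bop\<close>; finite sums of tensors reappear on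
  \<open>cf\<close>.\<close>

locale unital_comult =
  fixes M :: "'i op set" and D :: "'i op \<Rightarrow> ('i \<times> 'i) op"
  assumes M: "star_subalgebra M" "closed M" "id_blinfun \<in> M"
    and D: "star_hom M D bop" "D id_blinfun = id_blinfun"
begin

text \<open>Closedness under comultiplication in the algebraic sense, by finite complex combinations
  of tensors. The entries of a corepresentation form such a set, and so do those of its
  inverse.\<close>

definition coalg :: "'i op set \<Rightarrow> bool" where
  "coalg S \<longleftrightarrow> S \<subseteq> M \<and> (\<forall>s\<in>S. D s \<in> cop.span (tens S S))"

text \<open>The largest set of this kind. It hosts all matrix entries before any Hopf structure is
  known on them, and slicing the second leg of \<open>D a\<close> with \<open>a\<close> in
  \<open>cf\<close> stays in \<open>cf\<close>.\<close>

definition cf :: "'i op set" where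
  "cf = \<Union>{S. coalg S}"

lemmas M' = star_subalgebraD[OF M(1)]
lemmas D' = star_homD[OF D(1)]

lemma coalg_subset_cf: "coalg S \<Longrightarrow> S \<subseteq> cf"
  by (auto simp: cf_def)

lemma coalg_cf: "coalg cf"
  unfolding coalg_def
proof (intro conjI ballI)
  show "cf \<subseteq> M" by (auto simp: cf_def coalg_def)
  fix s assume "s \<in> cf"
  then obtain S where S: "coalg S" "s \<in> S" by (auto simp: cf_def)
  then have "D s \<in> cop.span (tens S S)" by (simp add: coalg_def)
  also have "\<dots> \<subseteq> cop.span (tens cf cf)"
    using coalg_subset_cf[OF S(1)] by (intro cop.span_mono tens_mono)
  finally show "D s \<in> cop.span (tens cf cf)" .
qed

lemma cf_subset: "cf \<subseteq> M" and D_cf: "a \<in> cf \<Longrightarrow> D a \<in> cop.span (tens cf cf)"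
  using coalg_cf by (auto simp: coalg_def)

lemma cf_bop: "a \<in> cf \<Longrightarrow> a \<in> bop"
  using cf_subset M'(1) by auto

lemma cf_subset_bop: "cf \<subseteq> bop"
  using cf_bop by auto

lemma D_bop: "a \<in> M \<Longrightarrow> D a \<in> bop"
  by (rule D'(1))

lemma coalg_cspan: "coalg S \<Longrightarrow> coalg (cop.span S)"
proof -
  assume S: "coalg S"
  have "x \<in> M \<and> D x \<in> cop.span (tens (cop.span S) (cop.span S))" if "x \<in> cop.span S" for x
    using that
  proof (induction rule: cop.span_induct_alt)
    case base
    show ?case by (simp add: M'(2) star_hom_linear(1)[OF D(1) M(1)] cop.span_zero)
  next
    case (step c x y)
    have x: "x \<in> M" "D x \<in> cop.span (tens S S)" using S step(1) by (auto simp: coalg_def)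
    have "D x \<in> cop.span (tens (cop.span S) (cop.span S))"
      using x(2) cop.span_mono[OF tens_mono[OF cop.span_superset cop.span_superset]] by blast
    moreover have "D (cscale c x + y) = cscale c (D x) + D y"
      using step(2) x(1) by (simp add: D'(2)[OF M'(6)] D'(5))
    ultimately show ?case
      using step(2) x(1) by (simp add: M'(3,6) cop.span_add cop.span_scale)
  qed
  then show ?thesis by (auto simp: coalg_def)
qed

lemma cspan_cf: "cop.span cf = cf"
  using coalg_subset_cf[OF coalg_cspan[OF coalg_cf]] cop.span_superset by blast

lemma id_cf: "id_blinfun \<in> cf"
proof -
  have "coalg {id_blinfun}"
    unfolding coalg_def using M(3) D(2)
    by (auto simp: tens_def intro!: cop.span_base)
  then show ?thesis using coalg_subset_cf by blast
qed

text \<open>Since \<open>D\<close> is a *-homomorphism, the products and the adjoints of elements of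
  \<open>cf\<close> are again closed under comultiplication; by maximality they lie in
  \<open>cf\<close>.\<close>

lemma star_subalgebra_cf: "star_subalgebra cf"
  unfolding star_subalgebra_def
proof (intro conjI ballI allI)
  have sub: "cop.subspace cf" using cop.subspace_span[of cf] by (simp only: cspan_cf)
  show "cf \<subseteq> bop" by (rule cf_subset_bop)
  show "0 \<in> cf" using sub by (rule cop.subspace_0)
  fix a b assume a: "a \<in> cf" and b: "b \<in> cf"
  show "a + b \<in> cf" using sub a b by (rule cop.subspace_add)
  let ?P = "{s o\<^sub>L t | s t. s \<in> cf \<and> t \<in> cf}"
  have "coalg ?P"
    unfolding coalg_def
  proof (intro conjI ballI)
    show "?P \<subseteq> M" using cf_subset M'(4) by blast
    fix x assume "x \<in> ?P"
    then obtain s t where x: "x = s o\<^sub>L t" "s \<in> cf" "t \<in> cf" by blast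
    have "D x = D s o\<^sub>L D t"
      unfolding x(1) using x cf_subset by (intro D'(3)) auto
    then show "D x \<in> cop.span (tens ?P ?P)"
      using cspan_tens_comp[OF cf_subset_bop cf_subset_bop D_cf[OF x(2)] D_cf[OF x(3)]] by simp
  qed
  then show "a o\<^sub>L b \<in> cf" using coalg_subset_cf a b by blast
next
  have sub: "cop.subspace cf" using cop.subspace_span[of cf] by (simp only: cspan_cf)
  fix a c assume a: "a \<in> cf"
  show "cscale c a \<in> cf" using sub a by (rule cop.subspace_scale)
  have "coalg (adj ` cf)"
    unfolding coalg_def
  proof (intro conjI ballI)
    show "adj ` cf \<subseteq> M" using cf_subset M'(5) by blast
    fix x assume "x \<in> adj ` cf"
    then obtain s where x: "x = adj s" "s \<in> cf" by blast
    have "D x = adj (D s)" unfolding x(1) using x cf_subset by (intro D'(4)) auto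
    then show "D x \<in> cop.span (tens (adj ` cf) (adj ` cf))"
      using cspan_tens_adj[OF cf_subset_bop D_cf[OF x(2)]] by simp
  qed
  then show "adj a \<in> cf" using coalg_subset_cf a by blast
qed

lemmas cf' = star_subalgebraD[OF star_subalgebra_cf]

definition TT :: "('i \<times> 'i) op set" where
  "TT = cop.span (tens cf cf)"

lemma op_tensor_TT: "u \<in> cf \<Longrightarrow> v \<in> cf \<Longrightarrow> op_tensor u v \<in> TT"
  unfolding TT_def by (intro cop.span_base tensI)

lemma D_TT: "a \<in> cf \<Longrightarrow> D a \<in> TT"
  unfolding TT_def by (rule D_cf)

lemma star_subalgebra_TT: "star_subalgebra TT"
  unfolding star_subalgebra_def
proof (intro conjI ballI allI)
  show "TT \<subseteq> bop" unfolding TT_def by (rule cspan_tens_subset_bop[OF cf_subset_bop cf_subset_bop])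
  show "0 \<in> TT" by (simp add: TT_def cop.span_zero)
  fix a b assume a: "a \<in> TT" and b: "b \<in> TT"
  show "a + b \<in> TT" using a b by (simp add: TT_def cop.span_add)
  have "cop.span (tens {s o\<^sub>L t | s t. s \<in> cf \<and> t \<in> cf} {s o\<^sub>L t | s t. s \<in> cf \<and> t \<in> cf}) \<subseteq> TT"
    unfolding TT_def by (intro cop.span_mono tens_mono) (use cf'(4) in blast)+
  then show "a o\<^sub>L b \<in> TT"
    using cspan_tens_comp[OF cf_subset_bop cf_subset_bop, of a b] a b unfolding TT_def by blast
next
  fix a c assume a: "a \<in> TT"
  show "cscale c a \<in> TT" using a by (simp add: TT_def cop.span_scale)
  have "cop.span (tens (adj ` cf) (adj ` cf)) \<subseteq> TT"
    unfolding TT_def by (intro cop.span_mono tens_mono) (use cf'(5) in blast)+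
  then show "adj a \<in> TT"
    using cspan_tens_adj[OF cf_subset_bop, of a] a unfolding TT_def by blast
qed

lemmas TT' = star_subalgebraD[OF star_subalgebra_TT]

lemma corep_cf:
  assumes "\<And>i j. i \<in> J \<Longrightarrow> j \<in> J \<Longrightarrow> T i j \<in> M"
    and "\<And>i j. i \<in> J \<Longrightarrow> j \<in> J \<Longrightarrow> D (T i j) = (\<Sum>k\<in>J. op_tensor (T i k) (T k j))"
    and "i \<in> J" "j \<in> J"
  shows "T i j \<in> cf"
proof -
  have "coalg {T i j | i j. i \<in> J \<and> j \<in> J}"
    unfolding coalg_def
  proof (intro conjI ballI)
    fix s assume "s \<in> {T i j | i j. i \<in> J \<and> j \<in> J}"
    then obtain i j where s: "s = T i j" "i \<in> J" "j \<in> J" by blast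
    show "D s \<in> cop.span (tens {T i j | i j. i \<in> J \<and> j \<in> J} {T i j | i j. i \<in> J \<and> j \<in> J})"
      unfolding s(1) assms(2)[OF s(2,3)]
      by (intro cop.span_sum cop.span_base tensI) (use s in blast)+
  qed (use assms(1) in blast)
  then show ?thesis using coalg_subset_cf assms(3,4) by blast
qed

text \<open>Uniqueness of inverses: the matrix \<open>V\<close> of expected values is a right
  inverse of the matrix of the \<open>D (T i j)\<close>, of which the \<open>D (T' i j)\<close> form
  a left inverse. The legs come in reversed order because inversion reverses products.\<close>

lemma D_inverse_corep:
  assumes J: "finite J" and T: "\<And>i j. i \<in> J \<Longrightarrow> j \<in> J \<Longrightarrow> T i j \<in> M"
    and DT: "\<And>i j. i \<in> J \<Longrightarrow> j \<in> J \<Longrightarrow> D (T i j) = (\<Sum>k\<in>J. op_tensor (T i k) (T k j))"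
    and T': "\<And>i j. i \<in> J \<Longrightarrow> j \<in> J \<Longrightarrow> T' i j \<in> M"
    and l: "\<And>i j. i \<in> J \<Longrightarrow> j \<in> J \<Longrightarrow> (\<Sum>k\<in>J. T' i k o\<^sub>L T k j) = (if i = j then id_blinfun else 0)"
    and r: "\<And>i j. i \<in> J \<Longrightarrow> j \<in> J \<Longrightarrow> (\<Sum>k\<in>J. T i k o\<^sub>L T' k j) = (if i = j then id_blinfun else 0)"
    and ij: "i \<in> J" "j \<in> J"
  shows "D (T' i j) = (\<Sum>k\<in>J. op_tensor (T' k j) (T' i k))"
proof -
  define V where "V i j = (\<Sum>k\<in>J. op_tensor (T' k j) (T' i k))" for i j
  have b: "T i j \<in> bop" "T' i j \<in> bop" if "i \<in> J" "j \<in> J" for i j using T T' M'(7) that by auto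
  have TV: "(\<Sum>m\<in>J. D (T n m) o\<^sub>L V m j) = (if n = j then id_blinfun else 0)" if n: "n \<in> J" for n
  proof -
    have "(\<Sum>m\<in>J. D (T n m) o\<^sub>L V m j) = (\<Sum>m\<in>J. \<Sum>k\<in>J. \<Sum>q\<in>J. op_tensor (T n k o\<^sub>L T' q j) (T k m o\<^sub>L T' m q))"
    proof (rule sum.cong[OF refl])
      fix m assume m: "m \<in> J"
      have "D (T n m) o\<^sub>L V m j = (\<Sum>k\<in>J. op_tensor (T n k) (T k m) o\<^sub>L V m j)"
        by (simp only: DT[OF n m] comp_sum_left)
      also have "\<dots> = (\<Sum>k\<in>J. \<Sum>q\<in>J. op_tensor (T n k) (T k m) o\<^sub>L op_tensor (T' q j) (T' m q))"
        by (simp only: V_def comp_sum_right)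
      also have "\<dots> = (\<Sum>k\<in>J. \<Sum>q\<in>J. op_tensor (T n k o\<^sub>L T' q j) (T k m o\<^sub>L T' m q))"
        by (intro sum.cong refl op_tensor_comp b n m ij)
      finally show "D (T n m) o\<^sub>L V m j = (\<Sum>k\<in>J. \<Sum>q\<in>J. op_tensor (T n k o\<^sub>L T' q j) (T k m o\<^sub>L T' m q))" .
    qed
    also have "\<dots> = (\<Sum>k\<in>J. \<Sum>m\<in>J. \<Sum>q\<in>J. op_tensor (T n k o\<^sub>L T' q j) (T k m o\<^sub>L T' m q))"
      by (rule sum.swap)
    also have "\<dots> = (\<Sum>k\<in>J. \<Sum>q\<in>J. \<Sum>m\<in>J. op_tensor (T n k o\<^sub>L T' q j) (T k m o\<^sub>L T' m q))"
      by (intro sum.cong refl sum.swap)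
    also have "\<dots> = (\<Sum>k\<in>J. \<Sum>q\<in>J. op_tensor (T n k o\<^sub>L T' q j) (\<Sum>m\<in>J. T k m o\<^sub>L T' m q))"
      by (intro sum.cong refl op_tensor_sum_right[symmetric] bop_simps b n ij)
    also have "\<dots> = (\<Sum>k\<in>J. \<Sum>q\<in>J. if k = q then op_tensor (T n k o\<^sub>L T' q j) id_blinfun else 0)"
    proof (intro sum.cong refl)
      fix k q assume kq: "k \<in> J" "q \<in> J"
      have "T n k o\<^sub>L T' q j \<in> bop" by (intro bop_simps b n ij kq)
      then show "op_tensor (T n k o\<^sub>L T' q j) (\<Sum>m\<in>J. T k m o\<^sub>L T' m q)
          = (if k = q then op_tensor (T n k o\<^sub>L T' q j) id_blinfun else 0)"
        unfolding r[OF kq] by simp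
    qed
    also have "\<dots> = (\<Sum>k\<in>J. op_tensor (T n k o\<^sub>L T' k j) id_blinfun)"
      using J by (intro sum.cong refl) simp
    also have "\<dots> = op_tensor (\<Sum>k\<in>J. T n k o\<^sub>L T' k j) id_blinfun"
      by (intro op_tensor_sum_left[symmetric] bop_simps b n ij)
    also have "\<dots> = (if n = j then id_blinfun else 0)"
      unfolding r[OF n ij(2)] by simp
    finally show ?thesis .
  qed
  have lD: "(\<Sum>n\<in>J. D (T' i n) o\<^sub>L D (T n m)) = (if i = m then id_blinfun else 0)" if m: "m \<in> J" for m
  proof -
    have "(\<Sum>n\<in>J. D (T' i n) o\<^sub>L D (T n m)) = (\<Sum>n\<in>J. D (T' i n o\<^sub>L T n m))"
      by (intro sum.cong refl D'(3)[symmetric] T T' ij m)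
    also have "\<dots> = D (\<Sum>n\<in>J. T' i n o\<^sub>L T n m)"
      by (intro star_hom_linear(4)[OF D(1) M(1), symmetric] M'(4) T T' ij m)
    also have "\<dots> = (if i = m then id_blinfun else 0)"
      unfolding l[OF ij(1) m] by (simp add: D(2) star_hom_linear(1)[OF D(1) M(1)])
    finally show ?thesis .
  qed
  have "V i j = (\<Sum>m\<in>J. (if i = m then id_blinfun else 0) o\<^sub>L V m j)"
    using J ij by (simp add: if_distribR if_distrib[of "\<lambda>x. x o\<^sub>L _"] comp_zero_left cong: if_cong)
  also have "\<dots> = (\<Sum>m\<in>J. \<Sum>n\<in>J. D (T' i n) o\<^sub>L (D (T n m) o\<^sub>L V m j))"
    by (intro sum.cong refl) (simp only: lD[symmetric] comp_sum_left blinfun_compose_assoc)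
  also have "\<dots> = (\<Sum>n\<in>J. \<Sum>m\<in>J. D (T' i n) o\<^sub>L (D (T n m) o\<^sub>L V m j))"
    by (rule sum.swap)
  also have "\<dots> = (\<Sum>n\<in>J. D (T' i n) o\<^sub>L (if n = j then id_blinfun else 0))"
    by (intro sum.cong refl) (simp only: TV[symmetric] comp_sum_right)
  also have "\<dots> = D (T' i j)"
    using J ij by (simp add: if_distrib comp_zero_right cong: if_cong)
  finally show ?thesis by (simp only: V_def)
qed

lemma inverse_corep_cf:
  assumes J: "finite J" and T: "\<And>i j. i \<in> J \<Longrightarrow> j \<in> J \<Longrightarrow> T i j \<in> M"
    and DT: "\<And>i j. i \<in> J \<Longrightarrow> j \<in> J \<Longrightarrow> D (T i j) = (\<Sum>k\<in>J. op_tensor (T i k) (T k j))"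
    and T': "\<And>i j. i \<in> J \<Longrightarrow> j \<in> J \<Longrightarrow> T' i j \<in> M"
    and l: "\<And>i j. i \<in> J \<Longrightarrow> j \<in> J \<Longrightarrow> (\<Sum>k\<in>J. T' i k o\<^sub>L T k j) = (if i = j then id_blinfun else 0)"
    and r: "\<And>i j. i \<in> J \<Longrightarrow> j \<in> J \<Longrightarrow> (\<Sum>k\<in>J. T i k o\<^sub>L T' k j) = (if i = j then id_blinfun else 0)"
    and ij: "i \<in> J" "j \<in> J"
  shows "T' i j \<in> cf"
proof -
  have "coalg {T' i j | i j. i \<in> J \<and> j \<in> J}"
    unfolding coalg_def
  proof (intro conjI ballI)
    fix s assume "s \<in> {T' i j | i j. i \<in> J \<and> j \<in> J}"
    then obtain i j where s: "s = T' i j" "i \<in> J" "j \<in> J" by blast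
    have "D s = (\<Sum>k\<in>J. op_tensor (T' k j) (T' i k))"
      unfolding s(1) by (rule D_inverse_corep[OF J T DT T' l r s(2,3)])
    also have "\<dots> \<in> cop.span (tens {T' i j | i j. i \<in> J \<and> j \<in> J} {T' i j | i j. i \<in> J \<and> j \<in> J})"
      by (intro cop.span_sum cop.span_base tensI) (use s in blast)+
    finally show "D s \<in> cop.span (tens {T' i j | i j. i \<in> J \<and> j \<in> J} {T' i j | i j. i \<in> J \<and> j \<in> J})" .
  qed (use T' in blast)
  then show ?thesis using coalg_subset_cf ij by blast
qed

end

section \<open>Vector states, their slices, and positivity\<close>

definition vstate :: "'i ell2 set \<Rightarrow> 'i op \<Rightarrow> complex" where
  "vstate F a = (\<Sum>\<xi>\<in>F. cinner \<xi> (a \<xi>))"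

definition slice :: "'j ell2 set \<Rightarrow> ('i \<times> 'j) op \<Rightarrow> 'i op" where
  "slice F X = (\<Sum>\<xi>\<in>F. compr \<xi> \<xi> X)"

lemma vstate_linear:
  "vstate F (a + b) = vstate F a + vstate F b" "vstate F (cscale c a) = c * vstate F a"
  "vstate F 0 = 0" "vstate F (sum g I) = (\<Sum>i\<in>I. vstate F (g i))"
proof -
  show 1: "vstate F (a + b) = vstate F a + vstate F b" for a b
    by (simp add: vstate_def blinfun.add_left cinner_add_right sum.distrib)
  show "vstate F (cscale c a) = c * vstate F a"
    by (simp add: vstate_def cinner_scaleC_right sum_distrib_left)
  show 2: "vstate F 0 = 0" by (simp add: vstate_def)
  show "vstate F (sum g I) = (\<Sum>i\<in>I. vstate F (g i))"
    by (induction I rule: infinite_finite_induct) (simp_all add: 1 2)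
qed

lemma vstate_adj: "a \<in> bop \<Longrightarrow> vstate F (adj a) = cnj (vstate F a)"
  unfolding vstate_def cnj_sum
  by (intro sum.cong refl) (simp add: cinner_adj_right, rule cinner_commute)

lemma cmod_vstate_le: "cmod (vstate F a) \<le> (\<Sum>\<xi>\<in>F. (norm \<xi>)\<^sup>2) * norm a"
proof -
  have "cmod (cinner \<xi> (a \<xi>)) \<le> (norm \<xi>)\<^sup>2 * norm a" for \<xi>
  proof -
    have "cmod (cinner \<xi> (a \<xi>)) \<le> norm \<xi> * norm (a \<xi>)" by (rule norm_cinner_le)
    also have "\<dots> \<le> norm \<xi> * (norm a * norm \<xi>)" by (intro mult_left_mono norm_blinfun) auto
    finally show ?thesis by (simp add: power2_eq_square mult_ac)
  qed
  then show ?thesis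
    unfolding vstate_def sum_distrib_right by (intro order_trans[OF norm_sum] sum_mono)
qed

lemma vstate_adj_comp: "a \<in> bop \<Longrightarrow> vstate F (adj a o\<^sub>L a) = of_real (\<Sum>\<xi>\<in>F. (norm (a \<xi>))\<^sup>2)"
  unfolding vstate_def of_real_sum
  by (intro sum.cong refl) (simp add: cinner_adj_right cinner_self_norm)

lemma slice_linear:
  "slice F (X + Y) = slice F X + slice F Y" "slice F (X - Y) = slice F X - slice F Y"
  "slice F (cscale c X) = cscale c (slice F X)" "slice F 0 = 0"
  by (simp_all add: slice_def compr_add compr_diff compr_cscale sum.distrib sum_subtractf
      cop.scale_sum_right linear_0[OF bounded_linear.linear[OF bounded_linear_compr]])

lemma slice_op_tensor:
  "u \<in> bop \<Longrightarrow> v \<in> bop \<Longrightarrow> slice F (op_tensor u v) = cscale (vstate F v) u"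
  by (simp add: slice_def compr_op_tensor vstate_def cop.scale_sum_left)

lemma slice_comp_left:
  "S \<in> bop \<Longrightarrow> X \<in> bop \<Longrightarrow> slice F (op_tensor S id_blinfun o\<^sub>L X) = S o\<^sub>L slice F X"
  by (simp add: slice_def compr_comp_left comp_sum_right)

lemma slice_comp_right:
  "S \<in> bop \<Longrightarrow> X \<in> bop \<Longrightarrow> slice F (X o\<^sub>L op_tensor S id_blinfun) = slice F X o\<^sub>L S"
  by (simp add: slice_def compr_comp_right comp_sum_left)

lemma adj_slice: "X \<in> bop \<Longrightarrow> adj (slice F X) = slice F (adj X)"
  unfolding slice_def by (subst adj_sum(1)) (auto simp: adj_compr)

lemma norm_slice_le: "norm (slice F X) \<le> (\<Sum>\<xi>\<in>F. (norm \<xi>)\<^sup>2) * norm X"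
proof -
  have "norm (compr \<xi> \<xi> X) \<le> (norm \<xi>)\<^sup>2 * norm X" for \<xi>
    using norm_compr_le[of \<xi> \<xi> X] by (simp add: power2_eq_square mult_ac)
  then show ?thesis
    unfolding slice_def sum_distrib_right by (intro order_trans[OF norm_sum] sum_mono)
qed

lemma slice_positive: "Z \<in> bop \<Longrightarrow> 0 \<le> Re (cinner x (slice F (adj Z o\<^sub>L Z) x))"
  unfolding slice_def blinfun.sum_left cinner.sum_right Re_sum
  by (intro sum_nonneg) (simp add: cinner_compr cinner_adj_right cinner_self_norm)

text \<open>The quadratic form of \<open>1 - a\<close> lies between -1 and 1 on unit vectors, and
  for a self-adjoint operator polarization turns such bounds into a norm bound.\<close>

lemma norm_id_minus_positive_le:
  assumes a: "a \<in> bop" "adj a = a" and pos: "\<And>x. 0 \<le> Re (cinner x (a x))" and le: "norm a \<le> 1"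
  shows "norm (id_blinfun - a) \<le> 1"
proof (rule norm_blinfun_bound)
  define T where "T = id_blinfun - a"
  have T: "T \<in> bop" "adj T = T" using a by (simp_all add: T_def adj_simps)
  have sym: "inner x (T y) = inner (T x) y" for x y
    using cinner_adj_left[OF T(1), of x y] by (simp add: inner_ell2_def T(2))
  have ia: "inner x (T x) \<le> (norm x)\<^sup>2" "- (norm x)\<^sup>2 \<le> inner x (T x)" for x
  proof -
    have "inner x (T x) = (norm x)\<^sup>2 - Re (cinner x (a x))"
      by (simp add: T_def blinfun.diff_left inner_diff_right power2_norm_eq_inner) (simp add: inner_ell2_def)
    moreover have "Re (cinner x (a x)) \<le> (norm x)\<^sup>2"
    proof -
      have "Re (cinner x (a x)) \<le> norm x * norm (a x)"
        using complex_Re_le_cmod norm_cinner_le order_trans by blast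
      also have "\<dots> \<le> norm x * (norm a * norm x)" by (intro mult_left_mono norm_blinfun) auto
      also have "\<dots> \<le> norm x * (1 * norm x)" by (intro mult_left_mono mult_right_mono le) auto
      finally show ?thesis by (simp add: power2_eq_square)
    qed
    ultimately show "inner x (T x) \<le> (norm x)\<^sup>2" "- (norm x)\<^sup>2 \<le> inner x (T x)"
      using pos[of x] zero_le_power2[of "norm x"] by linarith+
  qed
  have pol: "2 * inner x (T y) \<le> (norm x)\<^sup>2 + (norm y)\<^sup>2" for x y
  proof -
    have "inner (x + y) (T (x + y)) - inner (x - y) (T (x - y)) = 4 * inner x (T y)"
      using sym[of x y] by (simp add: blinfun.add_right blinfun.diff_right inner_simps inner_commute)
    moreover have "(norm (x + y))\<^sup>2 + (norm (x - y))\<^sup>2 = 2 * (norm x)\<^sup>2 + 2 * (norm y)\<^sup>2"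
      by (simp add: power2_norm_eq_inner inner_simps inner_commute)
    ultimately show ?thesis using ia(1)[of "x + y"] ia(2)[of "x - y"] by linarith
  qed
  fix y
  show "norm ((id_blinfun - a) y) \<le> 1 * norm y"
  proof (cases "T y = 0")
    case False
    define u where "u = norm (T y)"
    have u: "0 < u" using False by (simp add: u_def)
    \<comment> \<open>The test vector is the multiple of \<open>T y\<close> that has the norm of
      \<open>y\<close>; this is the sharp choice in \<open>pol\<close>.\<close>
    have "2 * inner ((norm y / u) *\<^sub>R T y) (T y) \<le> (norm ((norm y / u) *\<^sub>R T y))\<^sup>2 + (norm y)\<^sup>2" by (rule pol)
    then have "2 * (norm y * u) \<le> (norm y)\<^sup>2 + (norm y)\<^sup>2"
      using u by (simp add: u_def[symmetric] power2_norm_eq_inner[symmetric] dot_square_norm power2_eq_square)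
    then have "norm y * u \<le> norm y * norm y" by (simp add: power2_eq_square)
    moreover have "norm y \<noteq> 0" using False by auto
    ultimately have "u \<le> norm y" by simp
    then show ?thesis by (simp add: u_def T_def)
  qed (simp add: T_def)
qed simp

text \<open>Adjoining \<open>s\<close> adds at most one dimension to the operators of the span that
  vanish on \<open>F\<close>; one further vector, on which such an operator is nonzero, separates
  again.\<close>

lemma ex_separating_vectors:
  assumes "finite S"
  shows "\<exists>F. finite F \<and> (\<forall>e\<in>cop.span S. (\<forall>\<xi>\<in>F. blinfun_apply e \<xi> = 0) \<longrightarrow> e = 0)"
  using assms
proof (induction S)
  case empty
  show ?case by (intro exI[of _ "{}"]) simp
next
  case (insert s S)
  then obtain F where F: "finite F" "\<And>e. e \<in> cop.span S \<Longrightarrow> (\<And>\<xi>. \<xi> \<in> F \<Longrightarrow> blinfun_apply e \<xi> = 0) \<Longrightarrow> e = 0"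
    by blast
  show ?case
  proof (cases "\<exists>e\<in>cop.span (insert s S). (\<forall>\<xi>\<in>F. blinfun_apply e \<xi> = 0) \<and> e \<noteq> 0")
    case True
    then obtain e where e: "e \<in> cop.span (insert s S)" "\<And>\<xi>. \<xi> \<in> F \<Longrightarrow> blinfun_apply e \<xi> = 0" "e \<noteq> 0" by blast
    then obtain \<eta> where \<eta>: "blinfun_apply e \<eta> \<noteq> 0" by (metis blinfun_eqI zero_blinfun.rep_eq)
    obtain k where k: "e - cscale k s \<in> cop.span S" using e(1) unfolding cop.span_insert by blast
    have k0: "k \<noteq> 0"
    proof
      assume "k = 0"
      then have "e = 0" using k e(2) by (intro F(2)) simp_all
      with e(3) show False ..
    qed
    have "f = 0" if f: "f \<in> cop.span (insert s S)" "\<And>\<xi>. \<xi> \<in> insert \<eta> F \<Longrightarrow> blinfun_apply f \<xi> = 0" for f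
    proof -
      obtain l where l: "f - cscale l s \<in> cop.span S" using f(1) unfolding cop.span_insert by blast
      have "f - cscale (l / k) e = (f - cscale l s) - cscale (l / k) (e - cscale k s)"
        using k0 by (simp add: cop.scale_right_diff_distrib)
      also have "\<dots> \<in> cop.span S" by (intro cop.span_diff cop.span_scale k l)
      finally have "f - cscale (l / k) e = 0"
        by (rule F(2)) (simp add: blinfun.diff_left f(2) e(2))
      then have f': "f = cscale (l / k) e" by simp
      have "scaleC (l / k) (e \<eta>) = 0" using f(2)[of \<eta>] by (simp add: f')
      then have "cmod (l / k) * norm (e \<eta>) = 0" by (simp only: norm_scaleC[symmetric] norm_zero)
      then have "l / k = 0" using \<eta> by simp
      then show "f = 0" using f' by simp
    qed
    then show ?thesis using F(1) by (intro exI[of _ "insert \<eta> F"]) blast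
  next
    case False
    then show ?thesis using F(1) by blast
  qed
qed

lemma ex_separating_state:
  assumes "finite (S :: 'i op set)"
  shows "\<exists>F. finite F \<and> (\<Sum>\<xi>\<in>F. (norm \<xi>)\<^sup>2) = 1 \<and>
    (\<forall>e\<in>cop.span S. (\<forall>\<xi>\<in>F. blinfun_apply e \<xi> = 0) \<longrightarrow> e = 0)"
proof -
  obtain F0 where F0: "finite F0" "\<And>e. e \<in> cop.span S \<Longrightarrow> (\<And>\<xi>. \<xi> \<in> F0 \<Longrightarrow> blinfun_apply e \<xi> = 0) \<Longrightarrow> e = 0"
    using ex_separating_vectors[OF assms] by blast
  \<comment> \<open>An arbitrary basis vector is added so that the sum of squares is positive and
    can be normalized, even when \<open>F0\<close> is empty.\<close>
  define F1 where "F1 = insert (ebasis undefined) F0"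
  define s where "s = (\<Sum>\<xi>\<in>F1. (norm \<xi>)\<^sup>2)"
  have fin: "finite F1" using F0(1) by (simp add: F1_def)
  have "(norm (ebasis undefined :: 'i ell2))\<^sup>2 \<le> s"
    unfolding s_def by (rule member_le_sum) (auto simp: F1_def F0(1))
  then have s: "0 < s" by simp
  define r where "r = 1 / sqrt s"
  have r: "r \<noteq> 0" "r\<^sup>2 * s = 1" using s by (auto simp: r_def power_divide)
  have inj: "inj_on (\<lambda>\<xi>. r *\<^sub>R \<xi>) F1" using r by (auto intro: inj_onI)
  have "(\<Sum>\<xi>\<in>(\<lambda>\<xi>. r *\<^sub>R \<xi>) ` F1. (norm \<xi>)\<^sup>2) = r\<^sup>2 * s"
    unfolding sum.reindex[OF inj] s_def by (simp add: sum_distrib_left power_mult_distrib)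
  moreover have "e = 0" if "e \<in> cop.span S" "\<forall>\<xi>\<in>(\<lambda>\<xi>. r *\<^sub>R \<xi>) ` F1. blinfun_apply e \<xi> = 0" for e
    using that r by (intro F0(2)) (auto simp: F1_def blinfun.scaleR_right)
  ultimately show ?thesis
    using fin r by (intro exI[of _ "(\<lambda>\<xi>. r *\<^sub>R \<xi>) ` F1"]) auto
qed

text \<open>The degenerate case of Cauchy-Schwarz: for \<open>x = adj c + cscale z a\<close> the
  real part of \<open>\<phi> (adj x o\<^sub>L x)\<close> is affine in \<open>z\<close> once
  \<open>\<phi> (adj a o\<^sub>L a) = 0\<close>, and it stays nonnegative only if its linear part
  vanishes. It serves for a state on \<open>cf\<close> and for one on \<open>TT\<close>.\<close>

lemma state_null:
  assumes S: "star_subalgebra S"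
    and add: "\<And>x y. x \<in> S \<Longrightarrow> y \<in> S \<Longrightarrow> \<phi> (x + y) = \<phi> x + \<phi> y"
    and scale: "\<And>x c. x \<in> S \<Longrightarrow> \<phi> (cscale c x) = c * \<phi> x"
    and adj: "\<And>x. x \<in> S \<Longrightarrow> \<phi> (adj x) = cnj (\<phi> x)"
    and pos: "\<And>x. x \<in> S \<Longrightarrow> 0 \<le> Re (\<phi> (adj x o\<^sub>L x))"
    and a: "a \<in> S" "\<phi> (adj a o\<^sub>L a) = 0" and c: "c \<in> S"
  shows "\<phi> (c o\<^sub>L a) = (0 :: complex)"
proof (rule ccontr)
  note S' = star_subalgebraD[OF S]
  have b: "a \<in> bop" "c \<in> bop" using S'(7) a c by auto
  define \<beta> \<alpha> where "\<beta> = \<phi> (c o\<^sub>L a)" and "\<alpha> = Re (\<phi> (c o\<^sub>L adj c))"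
  assume "\<phi> (c o\<^sub>L a) \<noteq> 0"
  then have \<beta>: "0 < (cmod \<beta>)\<^sup>2" by (simp add: \<beta>_def)
  have ineq: "0 \<le> \<alpha> + 2 * Re (z * \<beta>)" for z
  proof -
    define x where "x = adj c + cscale z a"
    have x: "x \<in> S" unfolding x_def by (intro S' a c)
    have ca: "c o\<^sub>L a \<in> S" "c o\<^sub>L adj c \<in> S" "adj a o\<^sub>L a \<in> S" "adj a o\<^sub>L adj c \<in> S"
      by (intro S' a c)+
    have "adj x o\<^sub>L x = ((c o\<^sub>L adj c) + cscale z (c o\<^sub>L a)) + (cscale (cnj z) (adj a o\<^sub>L adj c) + cscale (cnj z * z) (adj a o\<^sub>L a))"
      using b by (simp add: x_def adj_simps comp_add_left comp_add_right comp_cscale_left comp_cscale_right)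
    then have "\<phi> (adj x o\<^sub>L x) = (\<phi> (c o\<^sub>L adj c) + z * \<phi> (c o\<^sub>L a)) + (cnj z * \<phi> (adj a o\<^sub>L adj c) + cnj z * z * \<phi> (adj a o\<^sub>L a))"
      using ca by (simp add: add scale S'(3) S'(6))
    also have "\<phi> (adj a o\<^sub>L adj c) = cnj \<beta>"
      using adj[OF ca(1)] by (simp add: adj_simps b \<beta>_def)
    finally have "Re (\<phi> (adj x o\<^sub>L x)) = \<alpha> + 2 * Re (z * \<beta>)"
      by (simp add: a(2) \<alpha>_def \<beta>_def)
    with pos[OF x] show ?thesis by simp
  qed
  \<comment> \<open>With this \<open>t\<close> the affine function takes the value -1 at
    \<open>- t * cnj \<beta>\<close>.\<close>
  define t where "t = (\<alpha> + 1) / (2 * (cmod \<beta>)\<^sup>2)"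
  have "Re (- of_real t * cnj \<beta> * \<beta>) = - t * (cmod \<beta>)\<^sup>2"
    unfolding cmod_power2 by (simp add: power2_eq_square algebra_simps)
  then have "0 \<le> \<alpha> - 2 * (t * (cmod \<beta>)\<^sup>2)" using ineq[of "- of_real t * cnj \<beta>"] by simp
  also have "2 * (t * (cmod \<beta>)\<^sup>2) = \<alpha> + 1" using \<beta> by (simp add: t_def)
  finally show False by simp
qed

section \<open>Invariant states\<close>

text \<open>Tychonoff: the set is a product of closed discs, and the topology on functions is that
  of pointwise convergence.\<close>

lemma compact_norm_bounded_functions: "compact {g :: 'a::real_normed_vector \<Rightarrow> complex. \<forall>a. cmod (g a) \<le> norm a}"
proof -
  have "compactin (product_topology (\<lambda>_. euclidean) UNIV) (PiE UNIV (\<lambda>a::'a. cball (0::complex) (norm a)))"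
    by (subst compactin_PiE) (simp add: compactin_euclidean_iff)
  moreover have "PiE UNIV (\<lambda>a::'a. cball (0::complex) (norm a)) = {g. \<forall>a. cmod (g a) \<le> norm a}"
    by auto
  ultimately show ?thesis by (simp add: euclidean_product_topology compactin_euclidean_iff)
qed

text \<open>Pointwise convergence on an uncountable set need not admit convergent subsequences, so
  compactness only gives a cluster point. Along the finer filter \<open>G\<close> all values
  converge at once, and identities valid for every \<open>f n\<close> pass to
  \<open>h\<close>.\<close>

lemma ex_pointwise_cluster_point:
  fixes f :: "nat \<Rightarrow> 'a::real_normed_vector \<Rightarrow> complex"
  assumes "\<And>n a. cmod (f n a) \<le> norm a"
  shows "\<exists>h G. G \<noteq> bot \<and> G \<le> sequentially \<and> (\<forall>a. ((\<lambda>n. f n a) \<longlongrightarrow> h a) G)"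
proof -
  let ?F = "filtermap f sequentially"
  have "?F \<noteq> bot" by (simp add: filtermap_bot_iff)
  moreover have "eventually (\<lambda>g. g \<in> {g. \<forall>a. cmod (g a) \<le> norm a}) ?F"
    using assms by (simp add: eventually_filtermap)
  ultimately obtain h where h: "inf (nhds h) ?F \<noteq> bot"
    using compact_norm_bounded_functions unfolding compact_filter by blast
  define G where "G = inf (filtercomap f (nhds h)) sequentially"
  have "G \<noteq> bot"
  proof
    assume "G = bot"
    then have "eventually (\<lambda>_. False) G" by simp
    then obtain P Q where PQ: "eventually P (filtercomap f (nhds h))" "eventually Q sequentially"
      "\<And>n. P n \<Longrightarrow> Q n \<Longrightarrow> False" unfolding G_def eventually_inf by blast
    then obtain R where R: "eventually R (nhds h)" "\<And>n. R (f n) \<Longrightarrow> P n"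
      unfolding eventually_filtercomap by blast
    have "eventually (\<lambda>g. \<not> R g) ?F"
      unfolding eventually_filtermap using PQ(2) by (rule eventually_mono) (use PQ(3) R(2) in blast)
    with R(1) have "eventually (\<lambda>_. False) (inf (nhds h) ?F)" unfolding eventually_inf by blast
    with h show False by (simp add: eventually_False)
  qed
  moreover have "G \<le> sequentially" by (simp add: G_def)
  moreover have "((\<lambda>n. f n a) \<longlongrightarrow> h a) G" for a
  proof -
    have "(f \<longlongrightarrow> h) G"
      unfolding filterlim_iff_le_filtercomap G_def by simp
    then show ?thesis
      using continuous_on_tendsto_compose[OF continuous_on_product_coordinates, of f h G a] by simp
  qed
  ultimately show ?thesis by blast
qed

text \<open>The norm bound together with the value at the identity stands in for positivity: both
  pass to averages and to pointwise limits, and \<open>state_on_positive\<close> recovers positivity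
  from them.\<close>

definition state_on :: "'i op set \<Rightarrow> ('i op \<Rightarrow> complex) \<Rightarrow> bool" where
  "state_on C h \<longleftrightarrow> h id_blinfun = 1 \<and> (\<forall>a\<in>C. cmod (h a) \<le> norm a) \<and>
    (\<forall>a\<in>C. \<forall>b\<in>C. h (a + b) = h a + h b) \<and> (\<forall>a\<in>C. \<forall>c. h (cscale c a) = c * h a) \<and>
    (\<forall>a\<in>C. h (adj a) = cnj (h a))"

text \<open>For small \<open>r > 0\<close> the operator \<open>1 - r a\<close> is a contraction, so
  \<open>1 - r h(a)\<close> lies in the unit disc, which forces the real part of \<open>h a\<close>
  to be nonnegative. Positivity of \<open>a\<close> is that of operators, because a slice of
  \<open>adj x o\<^sub>L x\<close> is positive without being visibly a square in
  \<open>cf\<close>.\<close>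

lemma state_on_positive:
  assumes h: "state_on C h" and C: "star_subalgebra C" "id_blinfun \<in> C"
    and a: "a \<in> C" "adj a = a" "\<And>x. 0 \<le> Re (cinner x (a x))"
  shows "0 \<le> Re (h a)"
proof -
  note C' = star_subalgebraD[OF C(1)]
  define r where "r = 1 / (norm a + 1)"
  have r: "0 < r" "r * norm a \<le> 1" by (simp_all add: r_def add_nonneg_pos divide_le_eq)
  have ab: "a \<in> bop" using C'(7)[OF a(1)] .
  have "norm (id_blinfun - r *\<^sub>R a) \<le> 1"
  proof (rule norm_id_minus_positive_le)
    show "r *\<^sub>R a \<in> bop" "adj (r *\<^sub>R a) = r *\<^sub>R a" using ab a(2) by (simp_all add: scaleR_eq_cscale adj_simps)
    show "0 \<le> Re (cinner x ((r *\<^sub>R a) x))" for x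
      using a(3)[of x] r(1) by (simp add: blinfun.scaleR_left cinner_scaleR_right)
    show "norm (r *\<^sub>R a) \<le> 1" using r by simp
  qed
  moreover have "id_blinfun - r *\<^sub>R a \<in> C" by (intro C' C(2) a(1))
  moreover have "h (id_blinfun - r *\<^sub>R a) = 1 - r * h a"
  proof -
    have "h (id_blinfun + cscale (- of_real r) a) = h id_blinfun + h (cscale (- of_real r) a)"
      using h C(2) C'(6)[OF a(1)] unfolding state_on_def by blast
    also have "\<dots> = 1 + - of_real r * h a"
      using h a(1) unfolding state_on_def by metis
    finally have "h (id_blinfun + cscale (- of_real r) a) = 1 + - of_real r * h a" .
    then show ?thesis by (simp add: scaleR_eq_cscale)
  qed
  ultimately have "cmod (1 - r * h a) \<le> 1" using h unfolding state_on_def by (metis order_trans)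
  then have "Re (1 - r * h a) \<le> 1" using complex_Re_le_cmod order_trans by blast
  then show ?thesis using r(1) by (simp add: zero_le_mult_iff)
qed

context unital_comult
begin

lemma slice_TT: "X \<in> TT \<Longrightarrow> slice F X \<in> cf"
  unfolding TT_def
proof (induction rule: cop.span_induct_alt)
  case base
  show ?case by (simp add: slice_linear cf'(2))
next
  case (step c x y)
  obtain u v where x: "x = op_tensor u v" "u \<in> cf" "v \<in> cf" using step(1) by (auto simp: tens_def)
  have "slice F x \<in> cf" unfolding x(1) slice_op_tensor[OF cf_bop[OF x(2)] cf_bop[OF x(3)]]
    by (rule cf'(6)[OF x(2)])
  then show ?case using step(2) by (simp add: slice_linear cf'(3) cf'(6))
qed

text \<open>The functional \<open>h\<close> is a cluster point of the Cesaro means of \<open>\<omega> N\<^sup>k\<close>, where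
  \<open>N = (id \<otimes> \<omega>) D\<close> and \<open>\<omega>\<close> is a vector state that separates the span of \<open>S0\<close>. Such an \<open>h\<close> need
  not be unique, but it is invariant on the coefficients in \<open>S0\<close>, which suffices below.\<close>

theorem ex_invariant_state:
  assumes S0: "finite S0" "S0 \<subseteq> cf"
  shows "\<exists>h. state_on cf h \<and> (\<forall>(J :: 'j set) T T'. finite J \<longrightarrow>
    (\<forall>i\<in>J. \<forall>j\<in>J. T i j \<in> S0 \<and> T' i j \<in> cf \<and> D (T i j) = (\<Sum>k\<in>J. op_tensor (T i k) (T k j)) \<and>
      (\<Sum>k\<in>J. T' i k o\<^sub>L T k j) = (if i = j then id_blinfun else 0)) \<longrightarrow>
    (\<forall>i\<in>J. \<forall>j\<in>J. (\<Sum>k\<in>J. cscale (h (T k j)) (T i k)) = cscale (h (T i j)) id_blinfun))"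
proof -
  \<comment> \<open>The identity is included because the defect \<open>e\<close> at the end of the
    proof is a combination of \<open>S0\<close> minus a scalar.\<close>
  obtain F where F: "finite F" "(\<Sum>\<xi>\<in>F. (norm \<xi>)\<^sup>2) = 1"
    and sep: "\<And>e. e \<in> cop.span (insert id_blinfun S0) \<Longrightarrow> (\<And>\<xi>. \<xi> \<in> F \<Longrightarrow> blinfun_apply e \<xi> = 0) \<Longrightarrow> e = 0"
    using ex_separating_state[of "insert id_blinfun S0"] S0(1) by blast
  define om where "om = (vstate F :: 'i op \<Rightarrow> complex)"
  define N where "N a = slice F (D a)" for a
  have om: "om (a + b) = om a + om b" "om (cscale c a) = c * om a" "om 0 = 0" "om (sum g I) = (\<Sum>i\<in>I. om (g i))"
    for a b c and g :: "'j \<Rightarrow> 'i op" and I by (simp_all add: om_def vstate_linear)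
  have om1: "om id_blinfun = 1"
  proof -
    have "om id_blinfun = of_real (\<Sum>\<xi>\<in>F. (norm \<xi>)\<^sup>2)"
      unfolding om_def vstate_def of_real_sum by (simp add: cinner_self_norm)
    then show ?thesis by (simp only: F(2) of_real_1)
  qed
  have cfM: "a \<in> M" if "a \<in> cf" for a using that cf_subset by blast
  have N: "N a \<in> cf" if "a \<in> cf" for a unfolding N_def by (rule slice_TT[OF D_TT[OF that]])
  have Nadd: "N (a + b) = N a + N b" if "a \<in> cf" "b \<in> cf" for a b
    unfolding N_def by (simp add: D'(2)[OF cfM[OF that(1)] cfM[OF that(2)]] slice_linear)
  have Nsc: "N (cscale c a) = cscale c (N a)" if "a \<in> cf" for a c
    unfolding N_def by (simp add: D'(5)[OF cfM[OF that]] slice_linear)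
  have Nadj: "N (adj a) = adj (N a)" if "a \<in> cf" for a
    unfolding N_def by (simp add: D'(4)[OF cfM[OF that]] adj_slice[OF D_bop[OF cfM[OF that]]])
  have N1: "N id_blinfun = id_blinfun"
    unfolding N_def D(2) using slice_op_tensor[of id_blinfun id_blinfun F] om1 by (simp add: om_def)
  have Nn: "norm (N a) \<le> norm a" if "a \<in> cf" for a
  proof -
    have "norm (N a) \<le> 1 * norm (D a)" unfolding N_def using norm_slice_le[of F "D a"] by (simp only: F(2))
    also have "\<dots> \<le> norm a" using star_hom_contractive[OF M(1,2) D(1) cfM[OF that]] by simp
    finally show ?thesis .
  qed
  have P: "(N ^^ k) a \<in> cf" if "a \<in> cf" for k a using that by (induction k) (simp_all add: N)
  have Padd: "(N ^^ k) (a + b) = (N ^^ k) a + (N ^^ k) b" if "a \<in> cf" "b \<in> cf" for k a b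
    using that by (induction k) (simp_all add: Nadd P)
  have Psc: "(N ^^ k) (cscale c a) = cscale c ((N ^^ k) a)" if "a \<in> cf" for k a c
    using that by (induction k) (simp_all add: Nsc P)
  have Padj: "(N ^^ k) (adj a) = adj ((N ^^ k) a)" if "a \<in> cf" for k a
    using that by (induction k) (simp_all add: Nadj P)
  have P1: "(N ^^ k) id_blinfun = id_blinfun" for k by (induction k) (simp_all add: N1)
  have Pn: "norm ((N ^^ k) a) \<le> norm a" if "a \<in> cf" for k a
  proof (induction k)
    case (Suc k)
    then show ?case using Nn[OF P[OF that, of k]] by simp
  qed simp
  have Psum: "om ((N ^^ k) (\<Sum>i\<in>I. g i)) = (\<Sum>i\<in>I. om ((N ^^ k) (g i)))"
    if "\<And>i. i \<in> I \<Longrightarrow> g i \<in> cf" for k I and g :: "'j \<Rightarrow> 'i op"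
    using that
  proof (induction I rule: infinite_finite_induct)
    case (insert x F)
    then show ?case by (simp add: Padd om(1) cop.subspace_sum[OF cf'(11)])
  qed (use Psc[OF cf'(2), of k 0] in \<open>simp_all add: om\<close>)
  have omn: "cmod (om ((N ^^ k) a)) \<le> norm a" if "a \<in> cf" for a k
    using cmod_vstate_le[of F "(N ^^ k) a"] Pn[OF that, of k] F(2) unfolding om_def by simp
  \<comment> \<open>The value zero off \<open>cf\<close> keeps the bound by the norm valid for all
    operators, as the compactness argument demands; linearity is claimed on \<open>cf\<close>
    only.\<close>
  define f where "f n a = (if a \<in> cf then (\<Sum>k\<le>n. om ((N ^^ k) a)) / of_nat (Suc n) else 0)" for n a
  have fn: "cmod (f n a) \<le> norm a" for n a
  proof (cases "a \<in> cf")
    case True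
    have "cmod (\<Sum>k\<le>n. om ((N ^^ k) a)) \<le> (\<Sum>k\<le>n. norm a)"
      by (intro order_trans[OF norm_sum] sum_mono omn True)
    also have "\<dots> = norm a * of_nat (Suc n)" by simp
    finally show ?thesis using True by (simp add: f_def norm_divide divide_le_eq del: of_nat_Suc)
  qed (simp add: f_def)
  from ex_pointwise_cluster_point[of f, OF fn] obtain h G where G: "G \<noteq> bot" "G \<le> sequentially"
    and h: "\<And>a. ((\<lambda>n. f n a) \<longlongrightarrow> h a) G" by blast
  have lim: "h a = l" if "((\<lambda>n. f n a) \<longlongrightarrow> l) G" for a l
    using tendsto_unique[OF G(1) h that] .
  have hadd: "h (a + b) = h a + h b" if "a \<in> cf" "b \<in> cf" for a b
  proof (rule lim)
    have "f n (a + b) = f n a + f n b" for n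
      using that cf'(3)[OF that] by (simp add: f_def Padd om(1) sum.distrib add_divide_distrib)
    then show "((\<lambda>n. f n (a + b)) \<longlongrightarrow> h a + h b) G" by (simp add: tendsto_add h)
  qed
  have hsc: "h (cscale c a) = c * h a" if "a \<in> cf" for a c
  proof (rule lim)
    have "f n (cscale c a) = c * f n a" for n
      using that cf'(6)[OF that] by (simp add: f_def Psc om(2) sum_distrib_left)
    then show "((\<lambda>n. f n (cscale c a)) \<longlongrightarrow> c * h a) G" by (simp add: tendsto_mult_left h)
  qed
  have hadj: "h (adj a) = cnj (h a)" if "a \<in> cf" for a
  proof (rule lim)
    have "f n (adj a) = cnj (f n a)" for n
      using that cf'(5)[OF that] by (simp add: f_def Padj om_def vstate_adj cf_bop P)
    then show "((\<lambda>n. f n (adj a)) \<longlongrightarrow> cnj (h a)) G" by (simp add: tendsto_cnj h)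
  qed
  have h1: "h id_blinfun = 1"
  proof (rule lim)
    have "f n id_blinfun = 1" for n by (simp add: f_def id_cf P1 om1 del: of_nat_Suc)
    then show "((\<lambda>n. f n id_blinfun) \<longlongrightarrow> 1) G" by simp
  qed
  have hn: "cmod (h a) \<le> norm a" for a
    by (rule tendsto_upperbound[OF tendsto_norm[OF h] _ G(1)]) (simp add: fn)
  have st: "state_on cf h"
    unfolding state_on_def by (intro conjI ballI allI h1 hn hadd hsc hadj)
  have hN: "h (N a) = h a" if a: "a \<in> cf" for a
  proof -
    \<comment> \<open>Telescoping: the averages of \<open>N a\<close> and of \<open>a\<close> differ
      by two boundary terms, divided by the number \<open>n + 1\<close> of summands.\<close>
    have d: "cmod (f n (N a) - f n a) \<le> 2 * norm a / of_nat (Suc n)" for n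
    proof -
      have "(\<Sum>k\<le>n. om ((N ^^ k) (N a))) - (\<Sum>k\<le>n. om ((N ^^ k) a)) = om ((N ^^ Suc n) a) - om a"
        by (induction n) (simp_all add: funpow_swap1 algebra_simps)
      then have "f n (N a) - f n a = (om ((N ^^ Suc n) a) - om a) / of_nat (Suc n)"
        using a N[OF a] by (simp add: f_def diff_divide_distrib[symmetric])
      moreover have "cmod (om ((N ^^ Suc n) a) - om a) \<le> 2 * norm a"
        using norm_triangle_ineq4[of "om ((N ^^ Suc n) a)" "om a"] omn[OF a, of "Suc n"] omn[OF a, of 0] by simp
      ultimately show ?thesis by (simp add: norm_divide divide_right_mono del: of_nat_Suc)
    qed
    have "((\<lambda>n. 2 * norm a / of_nat (Suc n)) \<longlongrightarrow> 0) sequentially"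
      by (rule LIMSEQ_Suc[OF lim_const_over_n])
    then have "((\<lambda>n. 2 * norm a / of_nat (Suc n)) \<longlongrightarrow> 0) G" by (rule tendsto_mono[OF G(2)])
    then have "((\<lambda>n. f n (N a) - f n a) \<longlongrightarrow> 0) G"
      by (rule Lim_null_comparison[rotated]) (simp only: d eventually_True)
    moreover have "((\<lambda>n. f n (N a) - f n a) \<longlongrightarrow> h (N a) - h a) G" by (intro tendsto_diff h)
    ultimately have "h (N a) - h a = 0" using tendsto_unique[OF G(1)] by blast
    then show ?thesis by simp
  qed
  \<comment> \<open>The functional \<open>h\<close> tensor \<open>om\<close> on the algebraic tensor
    product; it is positive because slicing by \<open>om\<close> preserves positive
    operators.\<close>
  define \<phi> where "\<phi> X = h (slice F X)" for X
  have \<phi>null: "\<phi> (C o\<^sub>L Z) = 0" if Z: "Z \<in> TT" "\<phi> (adj Z o\<^sub>L Z) = 0" and C: "C \<in> TT" for C Z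
  proof (rule state_null[where \<phi> = \<phi> and a = Z and c = C and S = TT, OF star_subalgebra_TT])
    show "\<phi> (x + y) = \<phi> x + \<phi> y" if "x \<in> TT" "y \<in> TT" for x y
      unfolding \<phi>_def slice_linear by (intro hadd slice_TT that)
    show "\<phi> (cscale c x) = c * \<phi> x" if "x \<in> TT" for x c
      unfolding \<phi>_def slice_linear by (intro hsc slice_TT that)
    show "\<phi> (adj x) = cnj (\<phi> x)" if "x \<in> TT" for x
      unfolding \<phi>_def adj_slice[OF TT'(7)[OF that], symmetric] by (intro hadj slice_TT that)
    show "0 \<le> Re (\<phi> (adj x o\<^sub>L x))" if "x \<in> TT" for x
      unfolding \<phi>_def
    proof (rule state_on_positive[OF st star_subalgebra_cf id_cf])
      have xb: "x \<in> bop" using TT'(7)[OF that] .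
      show "slice F (adj x o\<^sub>L x) \<in> cf" by (intro slice_TT TT' that)
      show "adj (slice F (adj x o\<^sub>L x)) = slice F (adj x o\<^sub>L x)"
        using xb by (simp add: adj_slice adj_simps)
      show "0 \<le> Re (cinner y (slice F (adj x o\<^sub>L x) y))" for y by (rule slice_positive[OF xb])
    qed
  qed (rule Z C)+
  have "(\<Sum>k\<in>J. cscale (h (T k j)) (T i k)) = cscale (h (T i j)) id_blinfun"
    if J: "finite J" and TS: "\<And>i j. i \<in> J \<Longrightarrow> j \<in> J \<Longrightarrow> T i j \<in> S0"
      and T': "\<And>i j. i \<in> J \<Longrightarrow> j \<in> J \<Longrightarrow> T' i j \<in> cf"
      and DT: "\<And>i j. i \<in> J \<Longrightarrow> j \<in> J \<Longrightarrow> D (T i j) = (\<Sum>k\<in>J. op_tensor (T i k) (T k j))"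
      and inv: "\<And>i j. i \<in> J \<Longrightarrow> j \<in> J \<Longrightarrow> (\<Sum>k\<in>J. T' i k o\<^sub>L T k j) = (if i = j then id_blinfun else 0)"
      and ij: "i \<in> J" "j \<in> J"
    for J :: "'j set" and T T' i j
  proof -
    have T: "T i j \<in> cf" if "i \<in> J" "j \<in> J" for i j using TS[OF that] S0(2) by blast
    \<comment> \<open>The slice of \<open>D (T i j)\<close> by \<open>h\<close> in the second leg,
      with \<open>j\<close> fixed. The claim is that it is the scalar
      \<open>h (T i j)\<close>.\<close>
    define b where "b i = (\<Sum>k\<in>J. cscale (h (T k j)) (T i k))" for i
    have bcf: "b i \<in> cf" if "i \<in> J" for i
      unfolding b_def by (intro cop.subspace_sum[OF cf'(11)] cf'(6) T that)
    have bb: "b i \<in> bop" if "i \<in> J" for i using cf_bop[OF bcf[OF that]] .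
    have Tb: "T i j \<in> bop" "T' i j \<in> bop" if "i \<in> J" "j \<in> J" for i j
      using cf_bop[OF T[OF that]] cf_bop[OF T'[OF that]] .
    have NT: "N (T i k) = (\<Sum>l\<in>J. cscale (om (T l k)) (T i l))" if "i \<in> J" "k \<in> J" for i k
    proof -
      have "N (T i k) = (\<Sum>l\<in>J. slice F (op_tensor (T i l) (T l k)))"
        unfolding N_def DT[OF that] slice_def by (simp add: compr_sum) (rule sum.swap)
      also have "\<dots> = (\<Sum>l\<in>J. cscale (om (T l k)) (T i l))"
        unfolding om_def by (intro sum.cong refl slice_op_tensor Tb that)
      finally show ?thesis .
    qed
    have r1: "om ((N ^^ Suc k) (T i m)) = (\<Sum>l\<in>J. om (T l m) * om ((N ^^ k) (T i l)))"
      if "i \<in> J" "m \<in> J" for k i m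
    proof -
      have "om ((N ^^ Suc k) (T i m)) = om ((N ^^ k) (N (T i m)))" by (simp only: funpow_Suc_right o_apply)
      also have "\<dots> = (\<Sum>l\<in>J. om ((N ^^ k) (cscale (om (T l m)) (T i l))))"
        unfolding NT[OF that] by (rule Psum) (intro cf'(6) T that)
      also have "\<dots> = (\<Sum>l\<in>J. om (T l m) * om ((N ^^ k) (T i l)))"
        by (intro sum.cong refl) (simp add: Psc T that om(2))
      finally show ?thesis .
    qed
    \<comment> \<open>The numbers \<open>om ((N ^^ k) (T i m))\<close> are the entries of the power
      with exponent \<open>k + 1\<close> of the scalar matrix \<open>om (T i m)\<close>.
      \<open>r1\<close> splits off the last factor, \<open>r2\<close> the first.\<close>
    have r2: "om ((N ^^ Suc k) (T i m)) = (\<Sum>l\<in>J. om (T i l) * om ((N ^^ k) (T l m)))"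
      if "i \<in> J" "m \<in> J" for k i m
      using that
    proof (induction k arbitrary: i m)
      case 0
      have "om ((N ^^ Suc 0) (T i m)) = (\<Sum>l\<in>J. om (T l m) * om (T i l))" using r1[OF 0, of 0] by simp
      then show ?case by (simp add: mult.commute)
    next
      case (Suc k)
      have "om ((N ^^ Suc (Suc k)) (T i m)) = (\<Sum>l\<in>J. om (T l m) * om ((N ^^ Suc k) (T i l)))"
        by (rule r1[OF Suc.prems])
      also have "\<dots> = (\<Sum>l\<in>J. \<Sum>q\<in>J. om (T l m) * (om (T i q) * om ((N ^^ k) (T q l))))"
        by (intro sum.cong refl) (simp only: Suc.IH[OF Suc.prems(1)] sum_distrib_left)
      also have "\<dots> = (\<Sum>q\<in>J. \<Sum>l\<in>J. om (T i q) * (om (T l m) * om ((N ^^ k) (T q l))))"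
        by (subst sum.swap) (intro sum.cong refl, simp only: mult_ac)
      also have "\<dots> = (\<Sum>q\<in>J. om (T i q) * om ((N ^^ Suc k) (T q m)))"
        by (intro sum.cong refl) (simp only: r1[OF _ Suc.prems(2)] sum_distrib_left)
      finally show ?case .
    qed
    \<comment> \<open>In the limit the scalar matrices satisfy \<open>om(T) h(T) = h(T)\<close>,
      which makes each \<open>b i\<close> a fixed point of \<open>N\<close>.\<close>
    have RH: "(\<Sum>l\<in>J. om (T i l) * h (T l m)) = h (T i m)" if "i \<in> J" "m \<in> J" for i m
    proof -
      have "f n (N (T i m)) = (\<Sum>l\<in>J. om (T i l) * f n (T l m))" for n
      proof -
        have "f n (N (T i m)) = (\<Sum>k\<le>n. om ((N ^^ Suc k) (T i m))) / of_nat (Suc n)"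
          using N[OF T[OF that]] by (simp add: f_def funpow_swap1 del: of_nat_Suc)
        also have "\<dots> = (\<Sum>l\<in>J. \<Sum>k\<le>n. om (T i l) * om ((N ^^ k) (T l m))) / of_nat (Suc n)"
          by (subst sum.swap) (simp only: r2[OF that])
        also have "\<dots> = (\<Sum>l\<in>J. om (T i l) * f n (T l m))"
          unfolding sum_divide_distrib
          by (intro sum.cong refl) (use T that in \<open>simp add: f_def sum_distrib_left sum_divide_distrib del: of_nat_Suc\<close>)
        finally show ?thesis .
      qed
      then have "((\<lambda>n. f n (N (T i m))) \<longlongrightarrow> (\<Sum>l\<in>J. om (T i l) * h (T l m))) G"
        by (simp only:) (intro tendsto_sum tendsto_mult_left h)
      then have "h (N (T i m)) = (\<Sum>l\<in>J. om (T i l) * h (T l m))" by (rule lim)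
      then show ?thesis by (simp only: hN[OF T[OF that]])
    qed
    have Nsum: "N (\<Sum>k\<in>J. g k) = (\<Sum>k\<in>J. N (g k))" if "\<And>k. k \<in> J \<Longrightarrow> g k \<in> cf" for g
      using J that
    proof (induction J)
      case empty
      show ?case using Nsc[OF cf'(2), of 0] by simp
    next
      case (insert x J)
      then show ?case by (simp add: Nadd cop.subspace_sum[OF cf'(11)])
    qed
    have Nb: "N (b i) = b i" if i: "i \<in> J" for i
    proof -
      have "N (b i) = (\<Sum>k\<in>J. N (cscale (h (T k j)) (T i k)))"
        unfolding b_def by (rule Nsum) (intro cf'(6) T i)
      also have "\<dots> = (\<Sum>k\<in>J. \<Sum>l\<in>J. cscale (om (T l k) * h (T k j)) (T i l))"
        by (intro sum.cong refl) (simp add: Nsc T i NT cop.scale_sum_right mult.commute)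
      also have "\<dots> = (\<Sum>l\<in>J. cscale (\<Sum>k\<in>J. om (T l k) * h (T k j)) (T i l))"
        by (subst sum.swap) (simp only: cop.scale_sum_left)
      also have "\<dots> = b i"
        unfolding b_def by (intro sum.cong refl) (simp only: RH[OF _ ij(2)])
      finally show ?thesis .
    qed
    have Db: "D (b i) = (\<Sum>m\<in>J. op_tensor (T i m) (b m))" if i: "i \<in> J" for i
    proof -
      have "D (b i) = (\<Sum>k\<in>J. cscale (h (T k j)) (D (T i k)))"
        unfolding b_def
        by (subst star_hom_linear(4)[OF D(1) M(1)])
           (auto intro!: M'(6) cfM[OF T] sum.cong simp: i D'(5)[OF cfM[OF T]])
      also have "\<dots> = (\<Sum>k\<in>J. \<Sum>m\<in>J. op_tensor (T i m) (cscale (h (T k j)) (T m k)))"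
        by (intro sum.cong refl) (simp add: DT i cop.scale_sum_right op_tensor_cscale_right Tb)
      also have "\<dots> = (\<Sum>m\<in>J. \<Sum>k\<in>J. op_tensor (T i m) (cscale (h (T k j)) (T m k)))"
        by (rule sum.swap)
      also have "\<dots> = (\<Sum>m\<in>J. op_tensor (T i m) (b m))"
        unfolding b_def by (intro sum.cong refl op_tensor_sum_right[symmetric] bop_simps Tb i)
      finally show ?thesis .
    qed
    \<comment> \<open>The failure of \<open>D (b i)\<close> to be \<open>b i\<close> tensor 1. As
      \<open>N (b i) = b i\<close>, slicing \<open>adj (Z i) o\<^sub>L Z i\<close> by
      \<open>om\<close> leaves \<open>N x - x\<close> with
      \<open>x = adj (b i) o\<^sub>L b i\<close>, and \<open>h\<close> annihilates this.\<close>
    define Z where "Z i = D (b i) - op_tensor (b i) id_blinfun" for i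
    have ZTT: "Z i \<in> TT" if "i \<in> J" for i
      unfolding Z_def by (intro TT' D_TT op_tensor_TT bcf id_cf that)
    have Znull: "\<phi> (adj (Z i) o\<^sub>L Z i) = 0" if i: "i \<in> J" for i
    proof -
      note bi = bb[OF i] and ci = bcf[OF i]
      have aci: "adj (b i) \<in> cf" by (rule cf'(5)[OF ci])
      have Dbi: "D (b i) \<in> bop" "D (adj (b i)) \<in> bop" by (intro D_bop cfM ci aci)+
      have t: "op_tensor (b i) id_blinfun \<in> bop" "op_tensor (adj (b i)) id_blinfun \<in> bop" using bi by auto
      have aZ: "adj (Z i) = D (adj (b i)) - op_tensor (adj (b i)) id_blinfun"
        unfolding Z_def using Dbi t bi
        by (simp add: adj_simps adj_op_tensor D'(4)[OF cfM[OF ci]])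
      have "adj (Z i) o\<^sub>L Z i = (D (adj (b i) o\<^sub>L b i) - (D (adj (b i)) o\<^sub>L op_tensor (b i) id_blinfun))
          - ((op_tensor (adj (b i)) id_blinfun o\<^sub>L D (b i)) - op_tensor (adj (b i) o\<^sub>L b i) id_blinfun)"
        unfolding aZ unfolding Z_def comp_diff_left comp_diff_right
        using bi by (simp add: D'(3)[OF cfM[OF aci] cfM[OF ci]] op_tensor_comp)
      then have "slice F (adj (Z i) o\<^sub>L Z i) = (N (adj (b i) o\<^sub>L b i) - (N (adj (b i)) o\<^sub>L b i))
          - ((adj (b i) o\<^sub>L N (b i)) - (adj (b i) o\<^sub>L b i))"
        using bi Dbi om1
        by (simp add: slice_linear N_def slice_comp_left slice_comp_right slice_op_tensor om_def[symmetric])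
      also have "\<dots> = N (adj (b i) o\<^sub>L b i) + cscale (-1) (adj (b i) o\<^sub>L b i)"
        by (simp add: Nadj[OF ci] Nb[OF i])
      finally have "\<phi> (adj (Z i) o\<^sub>L Z i) = h (N (adj (b i) o\<^sub>L b i)) + (-1) * h (adj (b i) o\<^sub>L b i)"
        unfolding \<phi>_def by (simp only: hadd[OF N[OF cf'(4)[OF aci ci]] cf'(6)[OF cf'(4)[OF aci ci]]] hsc[OF cf'(4)[OF aci ci]])
      then show ?thesis by (simp add: hN[OF cf'(4)[OF aci ci]])
    qed
    define e where "e = b i - cscale (h (T i j)) id_blinfun"
    have ecf: "e \<in> cf" unfolding e_def by (intro cf' bcf id_cf ij)
    have eb: "e \<in> bop" by (rule cf_bop[OF ecf])
    \<comment> \<open>Multiplication by the inverse matrix clears the first leg: from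
      \<open>D (b n)\<close> there remains 1 tensor \<open>b i\<close>, and from \<open>b n\<close>
      tensor 1 the scalar \<open>h (T i j)\<close>. Null elements of \<open>\<phi>\<close> form a
      left ideal, so what is left is null as well.\<close>
    have "(\<Sum>n\<in>J. op_tensor (T' i n) id_blinfun o\<^sub>L Z n) = op_tensor id_blinfun e"
    proof -
      have "(\<Sum>n\<in>J. op_tensor (T' i n) id_blinfun o\<^sub>L Z n)
          = (\<Sum>n\<in>J. op_tensor (T' i n) id_blinfun o\<^sub>L D (b n)) - (\<Sum>n\<in>J. op_tensor (T' i n) id_blinfun o\<^sub>L op_tensor (b n) id_blinfun)"
        unfolding Z_def comp_diff_right sum_subtractf ..
      also have "(\<Sum>n\<in>J. op_tensor (T' i n) id_blinfun o\<^sub>L D (b n)) = (\<Sum>n\<in>J. \<Sum>m\<in>J. op_tensor (T' i n o\<^sub>L T n m) (b m))"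
        by (intro sum.cong refl) (simp add: Db comp_sum_right op_tensor_comp Tb bb ij)
      also have "\<dots> = (\<Sum>m\<in>J. op_tensor (\<Sum>n\<in>J. T' i n o\<^sub>L T n m) (b m))"
        by (subst sum.swap) (intro sum.cong refl op_tensor_sum_left[symmetric] bop_simps Tb bb ij)
      also have "\<dots> = (\<Sum>m\<in>J. if i = m then op_tensor id_blinfun (b m) else 0)"
        by (intro sum.cong refl) (simp add: inv ij bb)
      also have "\<dots> = op_tensor id_blinfun (b i)" using J ij by simp
      also have "(\<Sum>n\<in>J. op_tensor (T' i n) id_blinfun o\<^sub>L op_tensor (b n) id_blinfun) = op_tensor (\<Sum>n\<in>J. T' i n o\<^sub>L b n) id_blinfun"
        by (subst op_tensor_sum_left) (auto intro!: sum.cong simp: op_tensor_comp Tb bb ij)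
      also have "(\<Sum>n\<in>J. T' i n o\<^sub>L b n) = cscale (h (T i j)) id_blinfun"
      proof -
        have "(\<Sum>n\<in>J. T' i n o\<^sub>L b n) = (\<Sum>n\<in>J. \<Sum>k\<in>J. cscale (h (T k j)) (T' i n o\<^sub>L T n k))"
          unfolding b_def by (intro sum.cong refl) (simp add: comp_sum_right comp_cscale_right Tb ij)
        also have "\<dots> = (\<Sum>k\<in>J. cscale (h (T k j)) (\<Sum>n\<in>J. T' i n o\<^sub>L T n k))"
          by (subst sum.swap) (simp only: cop.scale_sum_right)
        also have "\<dots> = (\<Sum>k\<in>J. if i = k then cscale (h (T k j)) id_blinfun else 0)"
          by (intro sum.cong refl) (simp add: inv ij)
        finally show ?thesis using J ij by simp
      qed
      finally show ?thesis
        by (simp add: e_def op_tensor_diff_right bb ij op_tensor_cscale_left op_tensor_cscale_right)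
    qed
    then have "op_tensor id_blinfun (adj e o\<^sub>L e) = op_tensor id_blinfun (adj e) o\<^sub>L (\<Sum>n\<in>J. op_tensor (T' i n) id_blinfun o\<^sub>L Z n)"
      using eb by (simp add: op_tensor_comp)
    also have "\<dots> = (\<Sum>n\<in>J. op_tensor (T' i n) (adj e) o\<^sub>L Z n)"
      unfolding comp_sum_right
      by (intro sum.cong refl) (simp add: blinfun_compose_assoc[symmetric] op_tensor_comp eb Tb ij)
    finally have eq: "op_tensor id_blinfun (adj e o\<^sub>L e) = (\<Sum>n\<in>J. op_tensor (T' i n) (adj e) o\<^sub>L Z n)" .
    have "\<phi> (\<Sum>n\<in>J. op_tensor (T' i n) (adj e) o\<^sub>L Z n) = 0"
    proof -
      have sum0: "\<phi> (\<Sum>n\<in>K. g n) = 0" if "finite K" "\<And>n. n \<in> K \<Longrightarrow> g n \<in> TT" "\<And>n. n \<in> K \<Longrightarrow> \<phi> (g n) = 0" for K and g :: "'j \<Rightarrow> _"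
        using that
      proof (induction K)
        case empty
        show ?case using hsc[OF cf'(2), of 0] by (simp add: \<phi>_def slice_linear)
      next
        case (insert x K)
        have "g x \<in> TT" "(\<Sum>n\<in>K. g n) \<in> TT" using insert by (auto intro: cop.subspace_sum[OF TT'(11)])
        then have "\<phi> (g x + (\<Sum>n\<in>K. g n)) = \<phi> (g x) + \<phi> (\<Sum>n\<in>K. g n)"
          unfolding \<phi>_def slice_linear by (intro hadd slice_TT)
        then show ?case using insert by simp
      qed
      have c: "op_tensor (T' i n) (adj e) \<in> TT" if "n \<in> J" for n by (intro op_tensor_TT T' cf'(5) ecf ij that)
      show ?thesis
      proof (rule sum0[OF J])
        fix n assume n: "n \<in> J"
        show "op_tensor (T' i n) (adj e) o\<^sub>L Z n \<in> TT" by (rule TT'(4)[OF c[OF n] ZTT[OF n]])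
        show "\<phi> (op_tensor (T' i n) (adj e) o\<^sub>L Z n) = 0" by (rule \<phi>null[OF ZTT[OF n] Znull[OF n] c[OF n]])
      qed
    qed
    then have "\<phi> (op_tensor id_blinfun (adj e o\<^sub>L e)) = 0" by (simp only: eq)
    \<comment> \<open>This value is the sum of the squares of \<open>norm (e \<xi>)\<close>, so
      \<open>e\<close> vanishes on \<open>F\<close>, and \<open>F\<close> was chosen to detect such
      an \<open>e\<close>.\<close>
    then have "om (adj e o\<^sub>L e) = 0"
      unfolding \<phi>_def using eb hsc[OF id_cf] h1 by (simp add: slice_op_tensor om_def)
    then have "(\<Sum>\<xi>\<in>F. (norm (e \<xi>))\<^sup>2) = 0"
      unfolding om_def vstate_adj_comp[OF eb] by (simp only: of_real_eq_0_iff)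
    then have z: "blinfun_apply e \<xi> = 0" if "\<xi> \<in> F" for \<xi>
      using that F(1) by (simp add: sum_nonneg_eq_0_iff)
    have "e \<in> cop.span (insert id_blinfun S0)"
      unfolding e_def b_def
      by (intro cop.span_diff cop.span_sum cop.span_scale) (auto intro!: cop.span_base TS ij)
    then have "e = 0" by (rule sep) (rule z)
    then show ?thesis by (simp add: e_def b_def)
  qed
  then show ?thesis using st by (intro exI[of _ h]) blast
qed

end

section \<open>Inverses of corepresentations\<close>

text \<open>\<open>T'\<close> is the inverse of \<open>T\<close> and \<open>Z\<close> that of its
  transpose. They are kept as explicit data so that homomorphisms can be applied to them entrywise,
  and \<open>V\<close> records where all entries lie.\<close>

definition bicorep ::
  "'i op set \<Rightarrow> ('i op \<Rightarrow> ('i \<times> 'i) op) \<Rightarrow> nat \<Rightarrow> (nat \<Rightarrow> nat \<Rightarrow> 'i op) \<Rightarrow> (nat \<Rightarrow> nat \<Rightarrow> 'i op) \<Rightarrow>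
    (nat \<Rightarrow> nat \<Rightarrow> 'i op) \<Rightarrow> bool"
where
  "bicorep V D n T T' Z \<longleftrightarrow> (\<forall>i<n. \<forall>j<n. T i j \<in> V \<and> T' i j \<in> V \<and> Z i j \<in> V \<and>
    D (T i j) = (\<Sum>k<n. op_tensor (T i k) (T k j)) \<and>
    (\<Sum>k<n. T' i k o\<^sub>L T k j) = (if i = j then id_blinfun else 0) \<and>
    (\<Sum>k<n. T i k o\<^sub>L T' k j) = (if i = j then id_blinfun else 0) \<and>
    (\<Sum>k<n. T k i o\<^sub>L Z k j) = (if i = j then id_blinfun else 0) \<and>
    (\<Sum>k<n. Z i k o\<^sub>L T j k) = (if i = j then id_blinfun else 0))"

lemma bicorepD:
  assumes "bicorep V D n T T' Z" "i < n" "j < n"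
  shows "T i j \<in> V" "T' i j \<in> V" "Z i j \<in> V" "D (T i j) = (\<Sum>k<n. op_tensor (T i k) (T k j))"
    "(\<Sum>k<n. T' i k o\<^sub>L T k j) = (if i = j then id_blinfun else 0)"
    "(\<Sum>k<n. T i k o\<^sub>L T' k j) = (if i = j then id_blinfun else 0)"
    "(\<Sum>k<n. T k i o\<^sub>L Z k j) = (if i = j then id_blinfun else 0)"
    "(\<Sum>k<n. Z i k o\<^sub>L T j k) = (if i = j then id_blinfun else 0)"
  using assms unfolding bicorep_def by blast+

lemma bicorepI:
  assumes "\<And>i j. i < n \<Longrightarrow> j < n \<Longrightarrow> T i j \<in> V" "\<And>i j. i < n \<Longrightarrow> j < n \<Longrightarrow> T' i j \<in> V"
    "\<And>i j. i < n \<Longrightarrow> j < n \<Longrightarrow> Z i j \<in> V"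
    "\<And>i j. i < n \<Longrightarrow> j < n \<Longrightarrow> D (T i j) = (\<Sum>k<n. op_tensor (T i k) (T k j))"
    "\<And>i j. i < n \<Longrightarrow> j < n \<Longrightarrow> (\<Sum>k<n. T' i k o\<^sub>L T k j) = (if i = j then id_blinfun else 0)"
    "\<And>i j. i < n \<Longrightarrow> j < n \<Longrightarrow> (\<Sum>k<n. T i k o\<^sub>L T' k j) = (if i = j then id_blinfun else 0)"
    "\<And>i j. i < n \<Longrightarrow> j < n \<Longrightarrow> (\<Sum>k<n. T k i o\<^sub>L Z k j) = (if i = j then id_blinfun else 0)"
    "\<And>i j. i < n \<Longrightarrow> j < n \<Longrightarrow> (\<Sum>k<n. Z i k o\<^sub>L T j k) = (if i = j then id_blinfun else 0)"
  shows "bicorep V D n T T' Z"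
  unfolding bicorep_def by (intro allI impI conjI assms)

text \<open>Extending a basis of \<open>V\<close> gives a functional that vanishes on
  \<open>V\<close> but not at \<open>z\<close>. Membership thereby becomes a question on scalars:
  linear combinations known to lie in \<open>V\<close> turn into a homogeneous system, and it is
  enough that its matrix has trivial kernel.\<close>

lemma cop_subspace_functional:
  assumes V: "cop.subspace V"
    and f: "\<And>f :: 'i op \<Rightarrow> complex. (\<And>a b. f (a + b) = f a + f b) \<Longrightarrow> (\<And>c a. f (cscale c a) = c * f a) \<Longrightarrow>
      (\<And>v. v \<in> V \<Longrightarrow> f v = 0) \<Longrightarrow> f z = 0"
  shows "z \<in> V"
proof (rule ccontr)
  assume z: "z \<notin> V"
  interpret p: vector_space_pair "cscale :: complex \<Rightarrow> 'i op \<Rightarrow> 'i op" "(*) :: complex \<Rightarrow> complex \<Rightarrow> complex"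
    by unfold_locales (simp_all add: algebra_simps)
  obtain B where B: "B \<subseteq> V" "\<not> cop.dependent B" "V \<subseteq> cop.span B"
    by (rule cop.maximal_independent_subset)
  have "cop.span B \<subseteq> V" by (rule cop.span_minimal[OF B(1) V])
  then have "z \<notin> cop.span B" using z by blast
  then have ind: "\<not> cop.dependent (insert z B)" using B(2) by (simp add: cop.independent_insertI)
  obtain g where g: "Vector_Spaces.linear cscale (*) g" "\<forall>x\<in>insert z B. g x = (if x = z then 1 else (0::complex))"
    using p.linear_independent_extend[OF ind, of "\<lambda>x. if x = z then 1 else 0"] by blast
  have gV: "g v = 0" if "v \<in> V" for v
  proof (rule p.linear_eq_0_on_span[OF g(1)])
    show "v \<in> cop.span B" using that B(3) by blast
    show "g x = 0" if "x \<in> B" for x using g(2) that B(1) z by auto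
  qed
  have "g z = 0"
  proof (rule f)
    show "g (a + b) = g a + g b" "g (cscale c a) = c * g a" for a b c
      using g(1) unfolding Vector_Spaces.linear_def module_hom_def module_hom_axioms_def by blast+
  qed (rule gV)
  then show False using g(2) by simp
qed

lemma functional_linear:
  fixes f :: "'i op \<Rightarrow> complex"
  assumes "\<And>a b. f (a + b) = f a + f b" "\<And>c a. f (cscale c a) = c * f a"
  shows "f 0 = 0" "f (sum g I) = (\<Sum>i\<in>I. f (g i))"
proof -
  show z: "f 0 = 0" using assms(2)[of 0 0] by simp
  show "f (sum g I) = (\<Sum>i\<in>I. f (g i))"
    by (induction I rule: infinite_finite_induct) (simp_all add: z assms)
qed

lemma sum_prod_lessThan:
  "(\<Sum>p\<in>{..<m} \<times> {..<n::nat}. g p) = (\<Sum>i<m. \<Sum>j<n. g (i, j))"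
  by (simp add: sum.cartesian_product)

context unital_comult
begin

lemma bicorep_cf:
  assumes "bicorep M D n T T' Z" "i < n" "j < n"
  shows "T i j \<in> cf" "T' i j \<in> cf"
proof -
  note T = bicorepD[OF assms(1)]
  show "T i j \<in> cf"
  proof (rule corep_cf[where J = "{..<n}" and T = T])
    fix i j assume "i \<in> {..<n}" "j \<in> {..<n}"
    then have ij: "i < n" "j < n" by simp_all
    show "T i j \<in> M" "D (T i j) = (\<Sum>k<n. op_tensor (T i k) (T k j))" by (fact T(1,4)[OF ij])+
  qed (use assms(2,3) in simp_all)
  show "T' i j \<in> cf"
  proof (rule inverse_corep_cf[where J = "{..<n}" and T = T and T' = T'])
    fix i j assume "i \<in> {..<n}" "j \<in> {..<n}"
    then have ij: "i < n" "j < n" by simp_all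
    show "T i j \<in> M" "T' i j \<in> M" "D (T i j) = (\<Sum>k<n. op_tensor (T i k) (T k j))"
      "(\<Sum>k<n. T' i k o\<^sub>L T k j) = (if i = j then id_blinfun else 0)"
      "(\<Sum>k<n. T i k o\<^sub>L T' k j) = (if i = j then id_blinfun else 0)" by (fact T(1,2,4,5,6)[OF ij])+
  qed (use assms(2,3) in simp_all)
qed

text \<open>Adjoints reverse products, so the inverse of the conjugate matrix is made of the
  transposed inverse: \<open>T'\<close> and \<open>Z\<close> exchange their roles. This is where
  invertibility of the transpose enters.\<close>

lemma bicorep_adj:
  assumes b: "bicorep M D n T T' Z"
  shows "bicorep M D n (\<lambda>i j. adj (T i j)) (\<lambda>i j. adj (Z j i)) (\<lambda>i j. adj (T' j i))"
proof -
  note T = bicorepD[OF b]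
  have bb: "T i j \<in> bop" "T' i j \<in> bop" "Z i j \<in> bop" if "i < n" "j < n" for i j
    using T(1-3)[OF that] M'(7) by auto
  have sum: "(\<Sum>k<n. adj (f k) o\<^sub>L adj (g k)) = adj (\<Sum>k<n. g k o\<^sub>L f k)"
    if "\<And>k. k < n \<Longrightarrow> f k \<in> bop" "\<And>k. k < n \<Longrightarrow> g k \<in> bop" for f g :: "nat \<Rightarrow> 'i op"
    by (subst adj_sum(1)) (simp_all add: that adj_simps)
  show ?thesis
  proof (rule bicorepI)
    fix i j assume ij: "i < n" "j < n"
    show "adj (T i j) \<in> M" "adj (Z j i) \<in> M" "adj (T' j i) \<in> M"
      by (intro M'(5) T ij)+
    have "D (adj (T i j)) = adj (\<Sum>k<n. op_tensor (T i k) (T k j))"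
      by (simp only: D'(4)[OF T(1)[OF ij]] T(4)[OF ij])
    also have "\<dots> = (\<Sum>k<n. op_tensor (adj (T i k)) (adj (T k j)))"
      by (subst adj_sum(1)) (auto simp: adj_op_tensor bb ij)
    finally show "D (adj (T i j)) = (\<Sum>k<n. op_tensor (adj (T i k)) (adj (T k j)))" .
    show "(\<Sum>k<n. adj (Z k i) o\<^sub>L adj (T k j)) = (if i = j then id_blinfun else 0)"
      by (subst sum) (auto simp: adj_simps(1,2) bb ij T(7)[OF ij(2,1)])
    show "(\<Sum>k<n. adj (T i k) o\<^sub>L adj (Z j k)) = (if i = j then id_blinfun else 0)"
      by (subst sum) (auto simp: adj_simps(1,2) bb ij T(8)[OF ij(2,1)])
    show "(\<Sum>k<n. adj (T k i) o\<^sub>L adj (T' j k)) = (if i = j then id_blinfun else 0)"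
      by (subst sum) (auto simp: adj_simps(1,2) bb ij T(5)[OF ij(2,1)])
    show "(\<Sum>k<n. adj (T' k i) o\<^sub>L adj (T j k)) = (if i = j then id_blinfun else 0)"
      by (subst sum) (auto simp: adj_simps(1,2) bb ij T(6)[OF ij(2,1)])
  qed
qed

text \<open>The tensor product of two corepresentations; its inverse multiplies in the opposite
  order. Rows and columns are pairs, for which \<open>ex_invariant_state\<close> allows arbitrary
  index types.\<close>

lemma kronecker_corep:
  assumes X: "bicorep M D m X X' XZ" and Y: "bicorep M D n Y Y' YZ"
  defines "W \<equiv> \<lambda>(i, p) (j, q). X i j o\<^sub>L Y p q" and "W' \<equiv> \<lambda>(i, p) (j, q). Y' p q o\<^sub>L X' i j"
  assumes I: "I \<in> {..<m} \<times> {..<n}" "L \<in> {..<m} \<times> {..<n}"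
  shows "W I L \<in> cf" "W' I L \<in> cf"
    and "D (W I L) = (\<Sum>k\<in>{..<m} \<times> {..<n}. op_tensor (W I k) (W k L))"
    and "(\<Sum>k\<in>{..<m} \<times> {..<n}. W' I k o\<^sub>L W k L) = (if I = L then id_blinfun else 0)"
proof -
  note XD = bicorepD[OF X] and YD = bicorepD[OF Y]
  have Xb: "X i j \<in> bop" "X' i j \<in> bop" if "i < m" "j < m" for i j using XD(1,2)[OF that] M'(7) by auto
  have Yb: "Y i j \<in> bop" "Y' i j \<in> bop" if "i < n" "j < n" for i j using YD(1,2)[OF that] M'(7) by auto
  obtain i p j q where e: "I = (i, p)" "L = (j, q)" "i < m" "p < n" "j < m" "q < n" using I by auto
  show "W I L \<in> cf" "W' I L \<in> cf"
    unfolding W_def W'_def e(1,2) prod.case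
    by (intro cf'(4) bicorep_cf[OF X] bicorep_cf[OF Y] e(3-6))+
  have "D (W I L) = D (X i j) o\<^sub>L D (Y p q)"
    unfolding W_def e(1,2) prod.case by (intro D'(3) XD YD e)
  also have "\<dots> = (\<Sum>k<m. \<Sum>l<n. op_tensor (X i k) (X k j) o\<^sub>L op_tensor (Y p l) (Y l q))"
    unfolding XD(4)[OF e(3,5)] YD(4)[OF e(4,6)] by (simp only: comp_sum_left, simp only: comp_sum_right)
  also have "\<dots> = (\<Sum>k<m. \<Sum>l<n. op_tensor (X i k o\<^sub>L Y p l) (X k j o\<^sub>L Y l q))"
    by (intro sum.cong refl op_tensor_comp Xb Yb e) simp_all
  finally show "D (W I L) = (\<Sum>k\<in>{..<m} \<times> {..<n}. op_tensor (W I k) (W k L))"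
    unfolding sum_prod_lessThan by (simp only: W_def e prod.case)
  have "(\<Sum>k\<in>{..<m} \<times> {..<n}. W' I k o\<^sub>L W k L) = (\<Sum>k<m. \<Sum>l<n. (Y' p l o\<^sub>L X' i k) o\<^sub>L (X k j o\<^sub>L Y l q))"
    unfolding sum_prod_lessThan by (simp only: W_def W'_def e prod.case)
  also have "\<dots> = (\<Sum>l<n. \<Sum>k<m. Y' p l o\<^sub>L ((X' i k o\<^sub>L X k j) o\<^sub>L Y l q))"
    by (subst sum.swap) (simp only: blinfun_compose_assoc)
  also have "\<dots> = (\<Sum>l<n. Y' p l o\<^sub>L ((\<Sum>k<m. X' i k o\<^sub>L X k j) o\<^sub>L Y l q))"
    by (simp only: comp_sum_left comp_sum_right)
  also have "\<dots> = (if i = j then (\<Sum>l<n. Y' p l o\<^sub>L Y l q) else 0)"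
    unfolding XD(5)[OF e(3,5)] by (simp add: comp_zero_left comp_zero_right)
  also have "\<dots> = (if I = L then id_blinfun else 0)"
    unfolding YD(5)[OF e(4,6)] e(1,2) by simp
  finally show "(\<Sum>k\<in>{..<m} \<times> {..<n}. W' I k o\<^sub>L W k L) = (if I = L then id_blinfun else 0)" .
qed

lemma state_on_linear:
  assumes "state_on cf h"
  shows "a \<in> cf \<Longrightarrow> b \<in> cf \<Longrightarrow> h (a + b) = h a + h b" "a \<in> cf \<Longrightarrow> h (cscale c a) = c * h a"
    "a \<in> cf \<Longrightarrow> h (adj a) = cnj (h a)" "a \<in> cf \<Longrightarrow> cmod (h a) \<le> norm a" "h id_blinfun = 1" "h 0 = 0"
    "(\<And>i. i \<in> I \<Longrightarrow> g i \<in> cf) \<Longrightarrow> h (sum g I) = (\<Sum>i\<in>I. h (g i))"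
    "a \<in> cf \<Longrightarrow> b \<in> cf \<Longrightarrow> h (a - b) = h a - h b"
    "a \<in> cf \<Longrightarrow> 0 \<le> Re (h (adj a o\<^sub>L a))"
    "a \<in> cf \<Longrightarrow> Im (h (adj a o\<^sub>L a)) = 0"
    "a \<in> cf \<Longrightarrow> b \<in> cf \<Longrightarrow> h (adj a o\<^sub>L a) = 0 \<Longrightarrow> h (b o\<^sub>L a) = 0"
proof -
  have s: "\<And>a b. a \<in> cf \<Longrightarrow> b \<in> cf \<Longrightarrow> h (a + b) = h a + h b" "\<And>a c. a \<in> cf \<Longrightarrow> h (cscale c a) = c * h a"
    "\<And>a. a \<in> cf \<Longrightarrow> h (adj a) = cnj (h a)" "\<And>a. a \<in> cf \<Longrightarrow> cmod (h a) \<le> norm a" "h id_blinfun = 1"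
    using assms unfolding state_on_def by blast+
  show "a \<in> cf \<Longrightarrow> b \<in> cf \<Longrightarrow> h (a + b) = h a + h b" "a \<in> cf \<Longrightarrow> h (cscale c a) = c * h a"
    "a \<in> cf \<Longrightarrow> h (adj a) = cnj (h a)" "a \<in> cf \<Longrightarrow> cmod (h a) \<le> norm a" "h id_blinfun = 1" by (fact s)+
  show z: "h 0 = 0" using s(2)[OF cf'(2), of 0] by simp
  show "(\<And>i. i \<in> I \<Longrightarrow> g i \<in> cf) \<Longrightarrow> h (sum g I) = (\<Sum>i\<in>I. h (g i))"
    by (induction I rule: infinite_finite_induct) (simp_all add: z s(1) cop.subspace_sum[OF cf'(11)])
  show "h (a - b) = h a - h b" if "a \<in> cf" "b \<in> cf"
  proof -
    have "h (a + cscale (- 1) b) = h a + (-1) * h b"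
      using that cf'(6)[OF that(2)] by (simp only: s(1,2))
    then show ?thesis by simp
  qed
  have pos: "0 \<le> Re (h (adj a o\<^sub>L a))" if a: "a \<in> cf" for a
  proof (rule state_on_positive[OF assms star_subalgebra_cf id_cf])
    have ab: "a \<in> bop" using cf_bop[OF a] .
    show "adj a o\<^sub>L a \<in> cf" by (intro cf' a)
    show "adj (adj a o\<^sub>L a) = adj a o\<^sub>L a" using ab by (simp add: adj_simps)
    show "0 \<le> Re (cinner x ((adj a o\<^sub>L a) x))" for x
      using ab by (simp add: cinner_adj_right cinner_self_norm)
  qed
  then show "a \<in> cf \<Longrightarrow> 0 \<le> Re (h (adj a o\<^sub>L a))" .
  show "Im (h (adj a o\<^sub>L a)) = 0" if a: "a \<in> cf"
  proof -
    have ab: "a \<in> bop" using cf_bop[OF a] .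
    have "h (adj a o\<^sub>L a) = cnj (h (adj a o\<^sub>L a))"
      using s(3)[OF cf'(4)[OF cf'(5)[OF a] a]] ab by (simp add: adj_simps)
    then show ?thesis by (metis cnj.simps(2) eq_neg_iff_add_eq_0 double_zero)
  qed
  show "h (b o\<^sub>L a) = 0" if "a \<in> cf" "b \<in> cf" "h (adj a o\<^sub>L a) = 0"
    by (rule state_null[where \<phi> = h and a = a and c = b and S = cf, OF star_subalgebra_cf])
       (use s pos that in blast)+
qed

text \<open>The matrix \<open>H = (\<Sum>\<^sub>k h(T\<^sub>j\<^sub>k\<^sup>* T\<^sub>q\<^sub>k))\<^sub>j\<^sub>q\<close> is positive definite and intertwines \<open>Z\<close> with the conjugate
  of \<open>T\<close>.\<close>

lemma transpose_inverse_in: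
  assumes b: "bicorep M D n T T' Z" and V: "cop.subspace V"
    and TV: "\<And>i j. i < n \<Longrightarrow> j < n \<Longrightarrow> adj (T i j) \<in> V" and rs: "r < n" "s < n"
  shows "Z r s \<in> V"
proof (rule cop_subspace_functional[OF V])
  note T = bicorepD[OF b]
  note bc = bicorep_adj[OF b]
  define W where "W = (\<lambda>(i, p) (j, q). adj (T i j) o\<^sub>L T p q)"
  define W' where "W' = (\<lambda>(i, p) (j, q). T' p q o\<^sub>L adj (Z j i))"
  let ?J = "{..<n} \<times> {..<n}"
  note kr = kronecker_corep[OF bc b, folded W_def W'_def]
  have Tcf: "T i j \<in> cf" "adj (Z i j) \<in> cf" if "i < n" "j < n" for i j
    using bicorep_cf(1)[OF b that] bicorep_cf(2)[OF bc that(2,1)] by auto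
  have Zcf: "Z i j \<in> cf" if "i < n" "j < n" for i j
    using cf'(5)[OF Tcf(2)[OF that]] adj_adj[OF M'(7)[OF T(3)[OF that]]] by simp
  have Tb: "T i j \<in> bop" "Z i j \<in> bop" if "i < n" "j < n" for i j
    using T(1,3)[OF that] M'(7) by auto
  define S0 where "S0 = (\<lambda>(I, L). W I L) ` (?J \<times> ?J)"
  have S0: "finite S0" "S0 \<subseteq> cf"
    unfolding S0_def using kr(1) by auto
  obtain h where h: "state_on cf h"
    and inv: "\<And>I L. I \<in> ?J \<Longrightarrow> L \<in> ?J \<Longrightarrow> (\<Sum>k\<in>?J. cscale (h (W k L)) (W I k)) = cscale (h (W I L)) id_blinfun"
  proof -
    from ex_invariant_state[OF S0, where 'j = "nat \<times> nat"] obtain h where h: "state_on cf h"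
      and inv: "\<forall>(J :: (nat \<times> nat) set) T T'. finite J \<longrightarrow>
        (\<forall>i\<in>J. \<forall>j\<in>J. T i j \<in> S0 \<and> T' i j \<in> cf \<and> D (T i j) = (\<Sum>k\<in>J. op_tensor (T i k) (T k j)) \<and>
          (\<Sum>k\<in>J. T' i k o\<^sub>L T k j) = (if i = j then id_blinfun else 0)) \<longrightarrow>
        (\<forall>i\<in>J. \<forall>j\<in>J. (\<Sum>k\<in>J. cscale (h (T k j)) (T i k)) = cscale (h (T i j)) id_blinfun)"
      by (elim exE conjE)
    have "\<forall>i\<in>?J. \<forall>j\<in>?J. W i j \<in> S0 \<and> W' i j \<in> cf \<and> D (W i j) = (\<Sum>k\<in>?J. op_tensor (W i k) (W k j)) \<and>
          (\<Sum>k\<in>?J. W' i k o\<^sub>L W k j) = (if i = j then id_blinfun else 0)"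
    proof (intro ballI)
      fix i j assume ij: "i \<in> ?J" "j \<in> ?J"
      have "W i j \<in> S0" unfolding S0_def using ij by (intro image_eqI[of _ _ "(i, j)"]) auto
      with kr[OF ij] show "W i j \<in> S0 \<and> W' i j \<in> cf \<and> D (W i j) = (\<Sum>k\<in>?J. op_tensor (W i k) (W k j)) \<and>
          (\<Sum>k\<in>?J. W' i k o\<^sub>L W k j) = (if i = j then id_blinfun else 0)" by blast
    qed
    then have "\<forall>i\<in>?J. \<forall>j\<in>?J. (\<Sum>k\<in>?J. cscale (h (W k j)) (W i k)) = cscale (h (W i j)) id_blinfun"
      by (rule mp[OF mp[OF spec[OF spec[OF spec[OF inv, of ?J], of W], of W']], rotated]) simp
    then show thesis by (intro that[OF h]) blast
  qed
  note hl = state_on_linear[OF h]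
  define H where "H a c = (\<Sum>k<n. h (adj (T a k) o\<^sub>L T c k))" for a c
  \<comment> \<open>Invariance of \<open>h\<close> for the product of the conjugate of
    \<open>T\<close> with \<open>T\<close>, at the column \<open>(k, k)\<close>. Summed over
    \<open>k\<close> it says in matrix form that the conjugate of \<open>T\<close>, times
    \<open>H\<close>, times the transpose of \<open>T\<close>, is \<open>H\<close>.\<close>
  have WJ: "(\<Sum>a<n. \<Sum>c<n. cscale (h (adj (T a k) o\<^sub>L T c k)) (adj (T i a) o\<^sub>L T p c))
      = cscale (h (adj (T i k) o\<^sub>L T p k)) id_blinfun" if "i < n" "p < n" "k < n" for i p k
    using inv[of "(i, p)" "(k, k)"] that unfolding sum_prod_lessThan by (simp add: W_def)
  have 1: "(\<Sum>a<n. \<Sum>c<n. cscale (H a c) (adj (T i a) o\<^sub>L T p c)) = cscale (H i p) id_blinfun"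
    if "i < n" "p < n" for i p
  proof -
    have "(\<Sum>k<n. \<Sum>a<n. \<Sum>c<n. cscale (h (adj (T a k) o\<^sub>L T c k)) (adj (T i a) o\<^sub>L T p c))
        = (\<Sum>k<n. cscale (h (adj (T i k) o\<^sub>L T p k)) id_blinfun)"
      by (intro sum.cong refl WJ that) simp
    also have "\<dots> = cscale (H i p) id_blinfun" by (simp only: H_def cop.scale_sum_left)
    also have "(\<Sum>k<n. \<Sum>a<n. \<Sum>c<n. cscale (h (adj (T a k) o\<^sub>L T c k)) (adj (T i a) o\<^sub>L T p c))
        = (\<Sum>a<n. \<Sum>k<n. \<Sum>c<n. cscale (h (adj (T a k) o\<^sub>L T c k)) (adj (T i a) o\<^sub>L T p c))" by (rule sum.swap)
    also have "\<dots> = (\<Sum>a<n. \<Sum>c<n. \<Sum>k<n. cscale (h (adj (T a k) o\<^sub>L T c k)) (adj (T i a) o\<^sub>L T p c))"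
      by (intro sum.cong refl sum.swap)
    finally show ?thesis by (simp only: H_def cop.scale_sum_left)
  qed
  \<comment> \<open>Multiplying by \<open>Z\<close>, the inverse of the transpose, shows that
    \<open>H Z\<close> is the conjugate of \<open>T\<close> times \<open>H\<close>, whose entries
    lie in \<open>V\<close>.\<close>
  have 2: "(\<Sum>p<n. cscale (H i p) (Z p s)) \<in> V" if i: "i < n" for i
  proof -
    have "(\<Sum>p<n. cscale (H i p) (Z p s)) = (\<Sum>p<n. (\<Sum>a<n. \<Sum>c<n. cscale (H a c) (adj (T i a) o\<^sub>L T p c)) o\<^sub>L Z p s)"
      by (intro sum.cong refl) (simp add: 1 i comp_cscale_left)
    also have "\<dots> = (\<Sum>p<n. \<Sum>a<n. \<Sum>c<n. cscale (H a c) (adj (T i a) o\<^sub>L (T p c o\<^sub>L Z p s)))"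
      by (simp only: comp_sum_left comp_cscale_left blinfun_compose_assoc)
    also have "\<dots> = (\<Sum>a<n. \<Sum>p<n. \<Sum>c<n. cscale (H a c) (adj (T i a) o\<^sub>L (T p c o\<^sub>L Z p s)))"
      by (rule sum.swap)
    also have "\<dots> = (\<Sum>a<n. \<Sum>c<n. \<Sum>p<n. cscale (H a c) (adj (T i a) o\<^sub>L (T p c o\<^sub>L Z p s)))"
      by (intro sum.cong refl sum.swap)
    also have "\<dots> = (\<Sum>a<n. \<Sum>c<n. cscale (H a c) (adj (T i a) o\<^sub>L (\<Sum>p<n. T p c o\<^sub>L Z p s)))"
      by (simp only: comp_sum_right cop.scale_sum_right)
    also have "\<dots> = (\<Sum>a<n. \<Sum>c<n. if c = s then cscale (H a c) (adj (T i a)) else 0)"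
      by (intro sum.cong refl) (simp add: T(7) rs comp_zero_right)
    also have "\<dots> = (\<Sum>a<n. cscale (H a s) (adj (T i a)))"
      using rs by simp
    also have "\<dots> \<in> V"
      by (intro cop.subspace_sum[OF V] cop.subspace_scale[OF V] TV i) simp
    finally show ?thesis .
  qed
  fix f :: "'i op \<Rightarrow> complex"
  assume f: "\<And>a b. f (a + b) = f a + f b" "\<And>c a. f (cscale c a) = c * f a" "\<And>v. v \<in> V \<Longrightarrow> f v = 0"
  define v where "v p = f (Z p s)" for p
  have Hv: "(\<Sum>p<n. H i p * v p) = 0" if "i < n" for i
    using f(3)[OF 2[OF that]] unfolding functional_linear(2)[of f, OF f(1,2)] by (simp only: f(2) v_def)
  \<comment> \<open>Since \<open>H v = 0\<close>, the \<open>a k\<close> turn out to be null for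
    \<open>h\<close>. As \<open>h\<close> may fail to be faithful, \<open>v\<close> is recovered
    from the inverse: \<open>h\<close> also kills \<open>Z r k o\<^sub>L a k\<close>, and the sum of
    these over \<open>k\<close> is the scalar \<open>v r\<close>.\<close>
  define a where "a k = (\<Sum>p<n. cscale (v p) (T p k))" for k
  have acf: "a k \<in> cf" if "k < n" for k
    unfolding a_def by (intro cop.subspace_sum[OF cf'(11)] cf'(6) Tcf that) simp
  have ha: "h (adj (a k) o\<^sub>L a k) = (\<Sum>i<n. \<Sum>p<n. cnj (v i) * (v p * h (adj (T i k) o\<^sub>L T p k)))" if k: "k < n" for k
  proof -
    have "adj (a k) = (\<Sum>i<n. cscale (cnj (v i)) (adj (T i k)))"
      unfolding a_def by (subst adj_sum(1)) (simp_all add: adj_simps Tb k)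
    then have "adj (a k) o\<^sub>L a k = (\<Sum>i<n. \<Sum>p<n. cscale (cnj (v i)) (cscale (v p) (adj (T i k) o\<^sub>L T p k)))"
      unfolding a_def
      by (simp only: comp_sum_left, simp only: comp_sum_right)
         (intro sum.cong refl, simp add: comp_cscale_left comp_cscale_right Tb k mult.commute)
    also have "h \<dots> = (\<Sum>i<n. \<Sum>p<n. h (cscale (cnj (v i)) (cscale (v p) (adj (T i k) o\<^sub>L T p k))))"
      using k by (subst hl(7), intro cop.subspace_sum[OF cf'(11)] cf' Tcf; simp)
         (intro sum.cong refl hl(7) cf' Tcf; simp)
    also have "\<dots> = (\<Sum>i<n. \<Sum>p<n. cnj (v i) * (v p * h (adj (T i k) o\<^sub>L T p k)))"
      using k by (intro sum.cong refl) (simp only: hl(2) cf'(4,5,6) Tcf(1) lessThan_iff)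
    finally show ?thesis .
  qed
  have "(\<Sum>k<n. h (adj (a k) o\<^sub>L a k)) = (\<Sum>k<n. \<Sum>i<n. \<Sum>p<n. cnj (v i) * (v p * h (adj (T i k) o\<^sub>L T p k)))"
    by (intro sum.cong refl ha) simp
  also have "\<dots> = (\<Sum>i<n. \<Sum>k<n. \<Sum>p<n. cnj (v i) * (v p * h (adj (T i k) o\<^sub>L T p k)))" by (rule sum.swap)
  also have "\<dots> = (\<Sum>i<n. \<Sum>p<n. \<Sum>k<n. cnj (v i) * (v p * h (adj (T i k) o\<^sub>L T p k)))"
    by (intro sum.cong refl sum.swap)
  also have "\<dots> = (\<Sum>i<n. cnj (v i) * (\<Sum>p<n. H i p * v p))"
    unfolding H_def by (simp only: sum_distrib_left sum_distrib_right mult_ac)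
  also have "\<dots> = 0" by (simp add: Hv)
  finally have "(\<Sum>k<n. Re (h (adj (a k) o\<^sub>L a k))) = 0" by (simp flip: Re_sum)
  then have "\<forall>k\<in>{..<n}. Re (h (adj (a k) o\<^sub>L a k)) = 0"
    by (subst (asm) sum_nonneg_eq_0_iff) (use hl(9)[OF acf] in auto)
  then have a0: "h (adj (a k) o\<^sub>L a k) = 0" if "k < n" for k
    using that hl(10)[OF acf[OF that]] by (simp add: complex_eq_iff)
  have "(\<Sum>k<n. h (Z r k o\<^sub>L a k)) = 0"
  proof (intro sum.neutral ballI)
    fix k assume "k \<in> {..<n}"
    then have k: "k < n" by simp
    show "h (Z r k o\<^sub>L a k) = 0" by (rule hl(11)[OF acf[OF k] Zcf[OF rs(1) k] a0[OF k]])
  qed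
  also have "(\<Sum>k<n. h (Z r k o\<^sub>L a k)) = h (\<Sum>k<n. Z r k o\<^sub>L a k)"
    by (intro hl(7)[symmetric] cf'(4) Zcf acf rs) simp_all
  also have "(\<Sum>k<n. Z r k o\<^sub>L a k) = (\<Sum>k<n. \<Sum>p<n. cscale (v p) (Z r k o\<^sub>L T p k))"
    unfolding a_def by (intro sum.cong refl) (simp add: comp_sum_right comp_cscale_right Tb rs)
  also have "\<dots> = (\<Sum>p<n. cscale (v p) (\<Sum>k<n. Z r k o\<^sub>L T p k))"
    by (subst sum.swap) (simp only: cop.scale_sum_right)
  also have "\<dots> = (\<Sum>p<n. if r = p then cscale (v p) id_blinfun else 0)"
    by (intro sum.cong refl) (simp add: T(8) rs)
  also have "\<dots> = cscale (v r) id_blinfun" using rs by simp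
  finally show "f (Z r s) = 0" using hl(2)[OF id_cf] hl(5) by (simp add: v_def)
qed

end

lemma bicorep_mono: "bicorep V D n T T' Z \<Longrightarrow> V \<subseteq> V' \<Longrightarrow> bicorep V' D n T T' Z"
  unfolding bicorep_def by blast

context unital_comult
begin

text \<open>By the invariance of \<open>h\<close>, the matrices \<open>h(X\<^sub>p\<^sub>j F)\<close> with \<open>F\<close> in \<open>V\<close> intertwine \<open>X\<close> with
  corepresentations over \<open>V\<close>. If \<open>F\<^sub>j\<^sub>s\<close> approximates the inverse of \<open>X\<close>, then
  \<open>\<Sum>\<^sub>j h(X\<^sub>p\<^sub>j F\<^sub>j\<^sub>s)\<close> is close to the identity matrix, hence invertible.\<close>

theorem corep_in_dense:
  assumes X: "bicorep M D m X X' XZ" and V: "cop.subspace V" "V \<subseteq> M" "M \<subseteq> closure V"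
    and coef: "\<And>F. F \<in> V \<Longrightarrow> \<exists>n Y Y' YZ c. bicorep V D n Y Y' YZ \<and> F = (\<Sum>r<n. \<Sum>l<n. cscale (c r l) (Y r l))"
    and ii: "i0 < m" "j0 < m"
  shows "X i0 j0 \<in> V"
proof (rule cop_subspace_functional[OF V(1)])
  note XD = bicorepD[OF X]
  \<comment> \<open>\<open>B\<close> dominates every row sum of norms and is positive by the added
    1. With the tolerance \<open>d\<close>, the entries of \<open>Q\<close> below are within
    \<open>1 / (m + 1)\<close> of the identity matrix, which makes an \<open>m\<close> by
    \<open>m\<close> matrix injective.\<close>
  define B where "B = (\<Sum>p<m. \<Sum>j<m. norm (X p j)) + 1"
  define d where "d = 1 / ((real m + 1) * B)"
  have "0 \<le> (\<Sum>p<m. \<Sum>j<m. norm (X p j))" by (intro sum_nonneg norm_ge_zero)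
  then have B: "0 < B" by (simp add: B_def)
  have d: "0 < d" using B by (simp add: d_def)
  have exF: "\<exists>F. F \<in> V \<and> norm (F - X' j s) < d" if js: "j < m" "s < m" for j s
  proof -
    have "X' j s \<in> closure V" using XD(2)[OF js] V(3) by blast
    then show ?thesis using d unfolding closure_approachable dist_norm by blast
  qed
  define F where "F j s = (SOME F. F \<in> V \<and> norm (F - X' j s) < d)" for j s
  have F: "F j s \<in> V \<and> norm (F j s - X' j s) < d" if "j < m" "s < m" for j s
    unfolding F_def by (rule someI_ex) (rule exF[OF that])
  \<comment> \<open>The corepresentations for different \<open>F j s\<close> may differ in size;
    packing the data of one pair into a tuple lets a single choice cover them.\<close>
  let ?P = "\<lambda>j s q. bicorep V D (fst q) (fst (snd q)) (fst (snd (snd q))) (fst (snd (snd (snd q)))) \<and>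
      F j s = (\<Sum>r<fst q. \<Sum>l<fst q. cscale (snd (snd (snd (snd q))) r l) (fst (snd q) r l))"
  have exq: "\<exists>q. ?P j s q" if js: "j < m" "s < m" for j s
  proof -
    have "F j s \<in> V" using F[OF js] by blast
    from coef[OF this] obtain n Y Y' YZ c where "bicorep V D n Y Y' YZ" "F j s = (\<Sum>r<n. \<Sum>l<n. cscale (c r l) (Y r l))"
      by (elim exE conjE)
    then show ?thesis by (intro exI[of _ "(n, Y, Y', YZ, c)"]) (simp only: fst_conv snd_conv)
  qed
  define q where "q j s = (SOME q. ?P j s q)" for j s
  have q: "?P j s (q j s)" if "j < m" "s < m" for j s
    unfolding q_def by (rule someI_ex) (rule exq[OF that])
  define n where "n j s = fst (q j s)" for j s
  define Y where "Y j s = fst (snd (q j s))" for j s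
  define Y' where "Y' j s = fst (snd (snd (q j s)))" for j s
  define YZ where "YZ j s = fst (snd (snd (snd (q j s))))" for j s
  define c where "c j s = snd (snd (snd (snd (q j s))))" for j s
  have YV: "bicorep V D (n j s) (Y j s) (Y' j s) (YZ j s)" if "j < m" "s < m" for j s
    using q[OF that] by (simp only: n_def Y_def Y'_def YZ_def)
  have FY: "F j s = (\<Sum>r<n j s. \<Sum>l<n j s. cscale (c j s r l) (Y j s r l))" if "j < m" "s < m" for j s
    using q[OF that] by (simp only: n_def Y_def c_def)
  have YM: "bicorep M D (n j s) (Y j s) (Y' j s) (YZ j s)" if "j < m" "s < m" for j s
    by (rule bicorep_mono[OF YV[OF that] V(2)])
  define W where "W j s = (\<lambda>(i, p) (k, l). X i k o\<^sub>L Y j s p l)" for j s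
  define W' where "W' j s = (\<lambda>(i, p) (k, l). Y' j s p l o\<^sub>L X' i k)" for j s
  define J where "J j s = {..<m} \<times> {..<n j s}" for j s
  note kr = kronecker_corep[OF X YM, folded W_def W'_def J_def]
  have fJ: "finite (J j s)" for j s by (simp add: J_def)
  \<comment> \<open>One state has to serve all \<open>j\<close> and \<open>s\<close> at once,
    because \<open>Q\<close> sums over \<open>j\<close>; hence the entries of all the products are
    collected.\<close>
  define S0 where "S0 = (\<Union>j<m. \<Union>s<m. (\<lambda>(I, L). W j s I L) ` (J j s \<times> J j s))"
  have S0: "finite S0" "S0 \<subseteq> cf"
  proof -
    show "finite S0" unfolding S0_def by (intro finite_UN_I finite_lessThan finite_imageI finite_cartesian_product fJ)
    show "S0 \<subseteq> cf" unfolding S0_def using kr(1) by fastforce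
  qed
  obtain h where h: "state_on cf h"
    and inv: "\<And>j s I L. j < m \<Longrightarrow> s < m \<Longrightarrow> I \<in> J j s \<Longrightarrow> L \<in> J j s \<Longrightarrow>
      (\<Sum>k\<in>J j s. cscale (h (W j s k L)) (W j s I k)) = cscale (h (W j s I L)) id_blinfun"
  proof -
    from ex_invariant_state[OF S0, where 'j = "nat \<times> nat"] obtain h where h: "state_on cf h"
      and inv: "\<forall>(J :: (nat \<times> nat) set) T T'. finite J \<longrightarrow>
        (\<forall>i\<in>J. \<forall>j\<in>J. T i j \<in> S0 \<and> T' i j \<in> cf \<and> D (T i j) = (\<Sum>k\<in>J. op_tensor (T i k) (T k j)) \<and>
          (\<Sum>k\<in>J. T' i k o\<^sub>L T k j) = (if i = j then id_blinfun else 0)) \<longrightarrow>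
        (\<forall>i\<in>J. \<forall>j\<in>J. (\<Sum>k\<in>J. cscale (h (T k j)) (T i k)) = cscale (h (T i j)) id_blinfun)"
      by (elim exE conjE)
    have all: "\<forall>I\<in>J j s. \<forall>L\<in>J j s. (\<Sum>k\<in>J j s. cscale (h (W j s k L)) (W j s I k)) = cscale (h (W j s I L)) id_blinfun"
      if js: "j < m" "s < m" for j s
    proof (rule mp[OF mp[OF spec[OF spec[OF spec[OF inv, of "J j s"], of "W j s"], of "W' j s"] fJ]], intro ballI conjI)
      fix I L assume IL: "I \<in> J j s" "L \<in> J j s"
      have "W j s I L \<in> (\<lambda>(I, L). W j s I L) ` (J j s \<times> J j s)"
        using IL by (intro image_eqI[of _ _ "(I, L)"]) simp_all
      then show "W j s I L \<in> S0" unfolding S0_def using js by blast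
      show "W' j s I L \<in> cf" by (fact kr(2)[OF js IL])
      show "D (W j s I L) = (\<Sum>k\<in>J j s. op_tensor (W j s I k) (W j s k L))" by (fact kr(3)[OF js IL])
      show "(\<Sum>k\<in>J j s. W' j s I k o\<^sub>L W j s k L) = (if I = L then id_blinfun else 0)"
        by (fact kr(4)[OF js IL])
    qed
    show thesis by (rule that[OF h]) (rule all[rule_format])
  qed
  note hl = state_on_linear[OF h]
  have Xcf: "X i j \<in> cf" "X' i j \<in> cf" if "i < m" "j < m" for i j using bicorep_cf[OF X that] by auto
  have Ycf: "Y j s r l \<in> cf" if "j < m" "s < m" "r < n j s" "l < n j s" for j s r l
    using bicorep_cf(1)[OF YM[OF that(1,2)] that(3,4)] .
  have Fcf: "F j s \<in> cf" if "j < m" "s < m" for j s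
    unfolding FY[OF that] by (intro cop.subspace_sum[OF cf'(11)] cf'(6) Ycf that) simp_all
  have Xb: "X i j \<in> bop" if "i < m" "j < m" for i j using cf_bop[OF Xcf(1)[OF that]] .
  have 1: "(\<Sum>p<m. cscale (h (X p j o\<^sub>L Y j s r l)) (X i0 p)) \<in> V"
    if js: "j < m" "s < m" and rl: "r < n j s" "l < n j s" for j s r l
  proof -
    note YD = bicorepD[OF YV[OF js]]
    have e: "(\<Sum>p<m. \<Sum>t<n j s. cscale (h (X p j o\<^sub>L Y j s t l)) (X i0 p o\<^sub>L Y j s k t))
        = cscale (h (X i0 j o\<^sub>L Y j s k l)) id_blinfun" if k: "k < n j s" for k
      using inv[OF js, of "(i0, k)" "(j, l)"] ii js rl k unfolding J_def sum_prod_lessThan by (simp add: W_def)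
    \<comment> \<open>Summing over the row index \<open>k\<close> removes \<open>Y\<close> from the
      right of \<open>X\<close>, which takes the inverse \<open>YZ\<close> of its transpose. The
      other side is then a scalar combination of entries of \<open>YZ\<close>, hence in
      \<open>V\<close>.\<close>
    have "(\<Sum>k<n j s. cscale (h (X i0 j o\<^sub>L Y j s k l)) (YZ j s k r))
        = (\<Sum>k<n j s. (\<Sum>p<m. \<Sum>t<n j s. cscale (h (X p j o\<^sub>L Y j s t l)) (X i0 p o\<^sub>L Y j s k t)) o\<^sub>L YZ j s k r)"
      by (intro sum.cong refl) (simp add: e comp_cscale_left)
    also have "\<dots> = (\<Sum>k<n j s. \<Sum>p<m. \<Sum>t<n j s. cscale (h (X p j o\<^sub>L Y j s t l)) (X i0 p o\<^sub>L (Y j s k t o\<^sub>L YZ j s k r)))"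
      by (simp only: comp_sum_left comp_cscale_left blinfun_compose_assoc)
    also have "\<dots> = (\<Sum>p<m. \<Sum>k<n j s. \<Sum>t<n j s. cscale (h (X p j o\<^sub>L Y j s t l)) (X i0 p o\<^sub>L (Y j s k t o\<^sub>L YZ j s k r)))"
      by (rule sum.swap)
    also have "\<dots> = (\<Sum>p<m. \<Sum>t<n j s. \<Sum>k<n j s. cscale (h (X p j o\<^sub>L Y j s t l)) (X i0 p o\<^sub>L (Y j s k t o\<^sub>L YZ j s k r)))"
      by (intro sum.cong refl sum.swap)
    also have "\<dots> = (\<Sum>p<m. \<Sum>t<n j s. cscale (h (X p j o\<^sub>L Y j s t l)) (X i0 p o\<^sub>L (\<Sum>k<n j s. Y j s k t o\<^sub>L YZ j s k r)))"
      by (simp only: comp_sum_right cop.scale_sum_right)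
    also have "\<dots> = (\<Sum>p<m. \<Sum>t<n j s. if t = r then cscale (h (X p j o\<^sub>L Y j s t l)) (X i0 p) else 0)"
      by (intro sum.cong refl) (simp add: YD(7) rl comp_zero_right)
    also have "\<dots> = (\<Sum>p<m. cscale (h (X p j o\<^sub>L Y j s r l)) (X i0 p))"
      using rl by simp
    finally have "(\<Sum>p<m. cscale (h (X p j o\<^sub>L Y j s r l)) (X i0 p))
        = (\<Sum>k<n j s. cscale (h (X i0 j o\<^sub>L Y j s k l)) (YZ j s k r))" by (rule sym)
    also have "\<dots> \<in> V"
      by (intro cop.subspace_sum[OF V(1)] cop.subspace_scale[OF V(1)] YD(3) rl) simp
    finally show ?thesis .
  qed
  define Q where "Q p s = (\<Sum>j<m. h (X p j o\<^sub>L F j s))" for p s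
  have hF: "h (X p j o\<^sub>L F j s) = (\<Sum>r<n j s. \<Sum>l<n j s. c j s r l * h (X p j o\<^sub>L Y j s r l))"
    if "p < m" "j < m" "s < m" for p j s
  proof -
    have XF: "X p j o\<^sub>L F j s = (\<Sum>r<n j s. \<Sum>l<n j s. cscale (c j s r l) (X p j o\<^sub>L Y j s r l))"
      unfolding FY[OF that(2,3)] by (simp add: comp_sum_right comp_cscale_right Xb that)
    have t: "cscale (c j s r l) (X p j o\<^sub>L Y j s r l) \<in> cf" if rl: "r < n j s" "l < n j s" for r l
      by (intro cf'(4,6) Xcf(1) Ycf \<open>p < m\<close> \<open>j < m\<close> \<open>s < m\<close> rl)
    have "h (X p j o\<^sub>L F j s) = (\<Sum>r<n j s. h (\<Sum>l<n j s. cscale (c j s r l) (X p j o\<^sub>L Y j s r l)))"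
      unfolding XF by (rule hl(7)) (intro cop.subspace_sum[OF cf'(11)] t; simp)
    also have "\<dots> = (\<Sum>r<n j s. \<Sum>l<n j s. h (cscale (c j s r l) (X p j o\<^sub>L Y j s r l)))"
      by (intro sum.cong refl hl(7) t) simp_all
    also have "\<dots> = (\<Sum>r<n j s. \<Sum>l<n j s. c j s r l * h (X p j o\<^sub>L Y j s r l))"
      by (intro sum.cong refl hl(2) cf' Xcf Ycf that) simp_all
    finally show ?thesis .
  qed
  have 2: "(\<Sum>p<m. cscale (Q p s) (X i0 p)) \<in> V" if s: "s < m" for s
  proof -
    have "(\<Sum>p<m. cscale (Q p s) (X i0 p)) = (\<Sum>p<m. \<Sum>j<m. \<Sum>r<n j s. \<Sum>l<n j s.
        cscale (c j s r l) (cscale (h (X p j o\<^sub>L Y j s r l)) (X i0 p)))"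
      unfolding Q_def by (intro sum.cong refl) (simp add: hF s cop.scale_sum_left)
    also have "\<dots> = (\<Sum>j<m. \<Sum>p<m. \<Sum>r<n j s. \<Sum>l<n j s.
        cscale (c j s r l) (cscale (h (X p j o\<^sub>L Y j s r l)) (X i0 p)))" by (rule sum.swap)
    also have "\<dots> = (\<Sum>j<m. \<Sum>r<n j s. \<Sum>p<m. \<Sum>l<n j s.
        cscale (c j s r l) (cscale (h (X p j o\<^sub>L Y j s r l)) (X i0 p)))" by (intro sum.cong refl sum.swap)
    also have "\<dots> = (\<Sum>j<m. \<Sum>r<n j s. \<Sum>l<n j s. \<Sum>p<m.
        cscale (c j s r l) (cscale (h (X p j o\<^sub>L Y j s r l)) (X i0 p)))" by (intro sum.cong refl sum.swap)
    also have "\<dots> = (\<Sum>j<m. \<Sum>r<n j s. \<Sum>l<n j s. cscale (c j s r l) (\<Sum>p<m. cscale (h (X p j o\<^sub>L Y j s r l)) (X i0 p)))"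
      by (simp only: cop.scale_sum_right)
    also have "\<dots> \<in> V"
      by (intro cop.subspace_sum[OF V(1)] cop.subspace_scale[OF V(1)] 1 s) simp_all
    finally show ?thesis .
  qed
  have Qn: "cmod (Q p s - (if p = s then 1 else 0)) \<le> 1 / (real m + 1)" if ps: "p < m" "s < m" for p s
  proof -
    have "h (\<Sum>j<m. X p j o\<^sub>L X' j s) = (\<Sum>j<m. h (X p j o\<^sub>L X' j s))"
      by (rule hl(7)) (intro cf' Xcf ps; simp)
    moreover have "h (\<Sum>j<m. X p j o\<^sub>L X' j s) = (if p = s then 1 else 0)"
      unfolding XD(6)[OF ps] by (simp add: hl(5,6))
    ultimately have "Q p s - (if p = s then 1 else 0) = (\<Sum>j<m. h (X p j o\<^sub>L F j s) - h (X p j o\<^sub>L X' j s))"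
      by (simp add: Q_def sum_subtractf)
    also have "\<dots> = (\<Sum>j<m. h (X p j o\<^sub>L (F j s - X' j s)))"
      unfolding comp_diff_right
      by (intro sum.cong refl hl(8)[symmetric] cf'(4) Xcf Fcf ps) simp_all
    also have "cmod \<dots> \<le> (\<Sum>j<m. norm (X p j) * d)"
    proof (rule order_trans[OF norm_sum sum_mono])
      fix j assume "j \<in> {..<m}"
      then have j: "j < m" by simp
      have "cmod (h (X p j o\<^sub>L (F j s - X' j s))) \<le> norm (X p j o\<^sub>L (F j s - X' j s))"
        by (intro hl(4) cf'(4,10) Xcf Fcf ps j)
      also have "\<dots> \<le> norm (X p j) * norm (F j s - X' j s)" by (rule norm_blinfun_compose)
      also have "\<dots> \<le> norm (X p j) * d" using F[OF j ps(2)] by (intro mult_left_mono) auto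
      finally show "cmod (h (X p j o\<^sub>L (F j s - X' j s))) \<le> norm (X p j) * d" .
    qed
    also have "\<dots> = (\<Sum>j<m. norm (X p j)) * d" by (simp only: sum_distrib_right)
    also have "\<dots> \<le> B * d"
    proof (rule mult_right_mono)
      have "(\<Sum>j<m. norm (X p j)) \<le> (\<Sum>p<m. \<Sum>j<m. norm (X p j))"
        using ps by (intro member_le_sum[of p "{..<m}" "\<lambda>p. \<Sum>j<m. norm (X p j)"] sum_nonneg) auto
      then show "(\<Sum>j<m. norm (X p j)) \<le> B" by (simp add: B_def)
    qed (use d in simp)
    also have "\<dots> = 1 / (real m + 1)" using B by (simp add: d_def)
    finally show ?thesis .
  qed
  fix f :: "'i op \<Rightarrow> complex"
  assume f: "\<And>a b. f (a + b) = f a + f b" "\<And>c a. f (cscale c a) = c * f a" "\<And>v. v \<in> V \<Longrightarrow> f v = 0"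
  define v where "v p = f (X i0 p)" for p
  have Qv: "(\<Sum>p<m. Q p s * v p) = 0" if "s < m" for s
    using f(3)[OF 2[OF that]] unfolding functional_linear(2)[of f, OF f(1,2)] by (simp only: f(2) v_def)
  \<comment> \<open>Diagonal dominance: each coordinate of a vector killed by the transpose of
    \<open>Q\<close> is at most \<open>\<eta>\<close> times the sum of all absolute values; adding
    up \<open>m\<close> of these bounds with \<open>m * \<eta> < 1\<close> leaves only zero.\<close>
  define \<eta> where "\<eta> = 1 / (real m + 1)"
  have vs: "cmod (v s) \<le> \<eta> * (\<Sum>p<m. cmod (v p))" if s: "s < m" for s
  proof -
    have "(\<Sum>p<m. (Q p s - (if p = s then 1 else 0)) * v p) = (\<Sum>p<m. Q p s * v p) - (\<Sum>p<m. if p = s then v p else 0)"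
      unfolding sum_subtractf[symmetric] by (intro sum.cong refl) (simp add: algebra_simps)
    also have "\<dots> = - v s" using s by (simp add: Qv)
    finally have "cmod (v s) = cmod (\<Sum>p<m. (Q p s - (if p = s then 1 else 0)) * v p)" by simp
    also have "\<dots> \<le> (\<Sum>p<m. \<eta> * cmod (v p))"
      unfolding \<eta>_def
      by (rule order_trans[OF norm_sum sum_mono]) (simp only: norm_mult, intro mult_right_mono Qn s, simp_all)
    finally show ?thesis by (simp only: sum_distrib_left)
  qed
  have "(\<Sum>s<m. cmod (v s)) \<le> (\<Sum>s<m. \<eta> * (\<Sum>p<m. cmod (v p)))" by (intro sum_mono vs) simp
  also have "\<dots> = (real m * \<eta>) * (\<Sum>p<m. cmod (v p))" by simp
  finally have "(1 - real m * \<eta>) * (\<Sum>p<m. cmod (v p)) \<le> 0" by (simp add: algebra_simps)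
  moreover have "0 < 1 - real m * \<eta>" by (simp add: \<eta>_def field_simps)
  ultimately have "(\<Sum>p<m. cmod (v p)) \<le> 0" by (simp add: mult_le_0_iff)
  moreover have "cmod (v j0) \<le> (\<Sum>p<m. cmod (v p))"
    using ii by (intro member_le_sum) simp_all
  ultimately have "cmod (v j0) \<le> 0" by linarith
  then show "f (X i0 j0) = 0" by (simp add: v_def)
qed

end

section \<open>Coefficients of Hopf *-algebras\<close>

text \<open>Slicing the second leg by the functional of \<open>u\<close> and \<open>v\<close> turns
  the relation into a linear relation among the independent first legs.\<close>

lemma independent_op_tensor_left:
  assumes ind: "\<not> cop.dependent S" and G: "finite G" "G \<subseteq> S" "G \<subseteq> bop"
    and y: "\<And>l. l \<in> G \<Longrightarrow> y l \<in> bop" and z: "(\<Sum>l\<in>G. op_tensor l (y l)) = 0" and l: "l \<in> G"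
  shows "y l = 0"
proof (rule blinfun_eqI, rule cinner_ext)
  fix v u
  have "(\<Sum>l\<in>G. cscale (cinner u (y l v)) l) = 0"
  proof (rule blinfun_eqI, rule cinner_ext)
    fix a b
    have "cinner b ((\<Sum>l\<in>G. cscale (cinner u (y l v)) l) a)
        = cinner (vtensor b u) ((\<Sum>l\<in>G. op_tensor l (y l)) (vtensor a v))"
      unfolding blinfun.sum_left cinner.sum_right
    proof (intro sum.cong refl)
      fix l assume l: "l \<in> G"
      then have "l \<in> bop" "y l \<in> bop" using G(3) y by auto
      then show "cinner b (blinfun_apply (cscale (cinner u (y l v)) l) a)
          = cinner (vtensor b u) (op_tensor l (y l) (vtensor a v))"
        by (simp add: cinner_op_tensor_vtensor cinner_scaleC_right)
    qed
    then show "cinner b ((\<Sum>l\<in>G. cscale (cinner u (y l v)) l) a) = cinner b (blinfun_apply 0 a)"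
      by (simp add: z)
  qed
  then have "cinner u (y l v) = 0" by (rule cop.independentD[OF ind G(1,2) _ l])
  then show "cinner u (y l v) = cinner u (blinfun_apply 0 v)" by simp
qed

lemma independent_op_tensor_right:
  assumes ind: "\<not> cop.dependent S" and G: "finite G" "G \<subseteq> S" "G \<subseteq> bop"
    and y: "\<And>l. l \<in> G \<Longrightarrow> y l \<in> bop" and z: "(\<Sum>l\<in>G. op_tensor (y l) l) = 0" and l: "l \<in> G"
  shows "y l = 0"
proof (rule independent_op_tensor_left[OF ind G y _ l])
  have "transport prod.swap (\<Sum>l\<in>G. op_tensor (y l) l) = (\<Sum>l\<in>G. op_tensor l (y l))"
    unfolding transport_sum using G(3) y by (intro sum.cong refl transport_swap) auto
  then show "(\<Sum>l\<in>G. op_tensor l (y l)) = 0" by (simp add: z linear_0[OF linear_transport])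
qed

text \<open>The coefficients vanish off \<open>G\<close>, so that expansions with different supports
  can be added over the union. Real scalars from \<open>span\<close> and complex ones from the basis
  expansion are both absorbed by the second leg.\<close>

lemma span_tensor_expand_left:
  assumes P: "cop.subspace P" "P \<subseteq> bop" and S: "S \<subseteq> P" "P \<subseteq> cop.span S"
    and X: "X \<in> span {op_tensor b c | b c. b \<in> P \<and> c \<in> P}"
  shows "\<exists>G y. finite G \<and> G \<subseteq> S \<and> (\<forall>l. y l \<in> P) \<and> (\<forall>l. l \<notin> G \<longrightarrow> y l = 0) \<and> X = (\<Sum>l\<in>G. op_tensor l (y l))"
  using X
proof (induction rule: span_induct_alt)
  case base
  show ?case by (rule exI[of _ "{}"], rule exI[of _ "\<lambda>_. 0"]) (simp add: cop.subspace_0[OF P(1)])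
next
  case (step r x X)
  then obtain b c where x: "x = op_tensor b c" "b \<in> P" "c \<in> P" by blast
  have "b \<in> cop.span S" using x(2) S(2) by blast
  then obtain t q where t: "finite t" "t \<subseteq> S" "b = (\<Sum>l\<in>t. cscale (q l) l)"
    unfolding cop.span_explicit by blast
  obtain G y where G: "finite G" "G \<subseteq> S" "\<And>l. y l \<in> P" "\<And>l. l \<notin> G \<Longrightarrow> y l = 0" "X = (\<Sum>l\<in>G. op_tensor l (y l))"
    using step(2) by blast
  define z where "z l = y l + (if l \<in> t then cscale (of_real r * q l) c else 0)" for l
  have SP: "l \<in> bop" if "l \<in> S" for l using that S(1) P(2) by blast
  have cb: "c \<in> bop" using x(3) P(2) by blast
  have yb: "y l \<in> bop" for l using G(3) P(2) by blast
  have "r *\<^sub>R x = (\<Sum>l\<in>t. op_tensor l (cscale (of_real r * q l) c))"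
  proof -
    have "x = (\<Sum>l\<in>t. op_tensor (cscale (q l) l) c)"
      unfolding x(1) t(3) by (rule op_tensor_sum_left) (use t(2) SP cb in auto)
    also have "\<dots> = (\<Sum>l\<in>t. cscale (q l) (op_tensor l c))"
      by (intro sum.cong refl op_tensor_cscale_left SP cb) (use t(2) in blast)
    finally have "r *\<^sub>R x = (\<Sum>l\<in>t. cscale (of_real r * q l) (op_tensor l c))"
      by (simp add: scaleR_eq_cscale cop.scale_sum_right)
    also have "\<dots> = (\<Sum>l\<in>t. op_tensor l (cscale (of_real r * q l) c))"
      by (intro sum.cong refl op_tensor_cscale_right[symmetric] SP cb) (use t(2) in blast)
    finally show ?thesis .
  qed
  also have "\<dots> = (\<Sum>l\<in>G \<union> t. op_tensor l (if l \<in> t then cscale (of_real r * q l) c else 0))"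
    by (rule sum.mono_neutral_cong_left) (use t(1,2) G(1,2) SP in auto)
  finally have 1: "r *\<^sub>R x = (\<Sum>l\<in>G \<union> t. op_tensor l (if l \<in> t then cscale (of_real r * q l) c else 0))" .
  have "X = (\<Sum>l\<in>G \<union> t. op_tensor l (y l))"
    unfolding G(5) by (rule sum.mono_neutral_left) (use t(1,2) G SP in auto)
  with 1 have "r *\<^sub>R x + X = (\<Sum>l\<in>G \<union> t. op_tensor l (y l) + op_tensor l (if l \<in> t then cscale (of_real r * q l) c else 0))"
    by (simp only: sum.distrib add.commute)
  also have "\<dots> = (\<Sum>l\<in>G \<union> t. op_tensor l (z l))"
  proof (intro sum.cong refl)
    fix l assume "l \<in> G \<union> t"
    then have "l \<in> bop" using G(2) t(2) SP by blast
    then show "op_tensor l (y l) + op_tensor l (if l \<in> t then cscale (of_real r * q l) c else 0) = op_tensor l (z l)"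
      unfolding z_def by (intro op_tensor_add_right[symmetric] yb) (simp_all add: cb)
  qed
  finally have 2: "r *\<^sub>R x + X = (\<Sum>l\<in>G \<union> t. op_tensor l (z l))" .
  have "z l \<in> P" for l
    unfolding z_def using G(3) x(3)
    by (simp add: cop.subspace_add[OF P(1)] cop.subspace_scale[OF P(1)] cop.subspace_0[OF P(1)])
  moreover have "z l = 0" if "l \<notin> G \<union> t" for l using that G(4) by (simp add: z_def)
  ultimately show ?case
    using 2 G(1,2) t(1,2) by (intro exI[of _ "G \<union> t"] exI[of _ z]) simp
qed

lemma span_tensor_swap:
  assumes "P \<subseteq> bop" "X \<in> span {op_tensor b c | b c. b \<in> P \<and> c \<in> P}"
  shows "transport prod.swap X \<in> span {op_tensor b c | b c. b \<in> P \<and> c \<in> P}"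
proof (rule linear_span_map[OF linear_transport assms(2)])
  fix q assume "q \<in> {op_tensor b c | b c. b \<in> P \<and> c \<in> P}"
  then obtain b c where q: "q = op_tensor b c" "b \<in> P" "c \<in> P" by blast
  then have "b \<in> bop" "c \<in> bop" using assms(1) by blast+
  then have "transport prod.swap q = op_tensor c b" unfolding q(1) by (rule transport_swap)
  then show "transport prod.swap q \<in> span {op_tensor b c | b c. b \<in> P \<and> c \<in> P}"
    using q(2,3) by (intro span_base) blast
qed

lemma span_tensor_expand_right:
  fixes P :: "'i op set"
  assumes P: "cop.subspace P" "P \<subseteq> bop" and S: "S \<subseteq> P" "P \<subseteq> cop.span S"
    and X: "X \<in> span {op_tensor b c | b c. b \<in> P \<and> c \<in> P}"
  shows "\<exists>G y. finite G \<and> G \<subseteq> S \<and> (\<forall>l. y l \<in> P) \<and> X = (\<Sum>l\<in>G. op_tensor (y l) l)"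
proof -
  obtain G y where G: "finite G" "G \<subseteq> S" "\<And>l. y l \<in> P" "transport prod.swap X = (\<Sum>l\<in>G. op_tensor l (y l))"
    using span_tensor_expand_left[OF P S span_tensor_swap[OF P(2) X]] by blast
  have inv: "inv (prod.swap :: 'i \<times> 'i \<Rightarrow> 'i \<times> 'i) = prod.swap"
    by (rule inv_unique_comp) auto
  have "bij (prod.swap :: 'i \<times> 'i \<Rightarrow> 'i \<times> 'i)" by (rule bij_swap)
  from reindex_reindex_inv[OF this]
  have "reindex prod.swap o\<^sub>L reindex prod.swap = (id_blinfun :: ('i \<times> 'i) op)" unfolding inv .
  then have tt: "transport prod.swap (transport prod.swap X) = X"
    unfolding transport_def inv
    by (metis blinfun_compose_assoc id_blinfun_compose)
  have "transport prod.swap (transport prod.swap X) = (\<Sum>l\<in>G. op_tensor (y l) l)"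
    unfolding G(4) transport_sum
    by (intro sum.cong refl transport_swap) (use G S P in blast)+
  with tt G show ?thesis by (intro exI[of _ G] exI[of _ y]) auto
qed

text \<open>The sums in \<open>coassoc\<close> are indexed by operators because, in the
  decompositions to which it is applied, basis elements of one leg serve as their own
  indices.\<close>

locale hopf_algebra =
  fixes P :: "'i op set" and D :: "'i op \<Rightarrow> ('i \<times> 'i) op" and \<epsilon> :: "'i op \<Rightarrow> complex" and S :: "'i op \<Rightarrow> 'i op"
  assumes P: "star_subalgebra P"
    and D_span: "\<And>a. a \<in> P \<Longrightarrow> D a \<in> span {op_tensor b c | b c. b \<in> P \<and> c \<in> P}"
    and D_adj: "\<And>a. a \<in> P \<Longrightarrow> D (adj a) = adj (D a)"
    and coassoc: "\<And>a I b c. a \<in> P \<Longrightarrow> finite I \<Longrightarrow> (\<And>k. k \<in> I \<Longrightarrow> b k \<in> P) \<Longrightarrow> (\<And>k. k \<in> I \<Longrightarrow> c k \<in> P) \<Longrightarrow>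
      D a = (\<Sum>k\<in>(I :: 'i op set). op_tensor (b k) (c k)) \<Longrightarrow>
      (\<Sum>k\<in>I. transport (\<lambda>((i, j), k). (i, (j, k))) (op_tensor (D (b k)) (c k)))
        = (\<Sum>k\<in>I. op_tensor (b k) (D (c k)))"
    and hopf: "\<And>a (n :: nat) b c. a \<in> P \<Longrightarrow> \<forall>k<n. b k \<in> P \<and> c k \<in> P \<Longrightarrow> D a = (\<Sum>k<n. op_tensor (b k) (c k)) \<Longrightarrow>
        (\<Sum>k<n. cscale (\<epsilon> (b k)) (c k)) = a \<and> (\<Sum>k<n. cscale (\<epsilon> (c k)) (b k)) = a \<and>
        (\<Sum>k<n. S (b k) o\<^sub>L c k) = cscale (\<epsilon> a) id_blinfun \<and>
        (\<Sum>k<n. b k o\<^sub>L S (c k)) = cscale (\<epsilon> a) id_blinfun"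
    and S_in: "\<And>a. a \<in> P \<Longrightarrow> S a \<in> P"
begin

lemmas P' = star_subalgebraD[OF P]

lemma hopf_finite:
  assumes "a \<in> P" "finite I" "\<And>k. k \<in> I \<Longrightarrow> b k \<in> P" "\<And>k. k \<in> I \<Longrightarrow> c k \<in> P"
    and D: "D a = (\<Sum>k\<in>I. op_tensor (b k) (c k))"
  shows "(\<Sum>k\<in>I. cscale (\<epsilon> (b k)) (c k)) = a" "(\<Sum>k\<in>I. cscale (\<epsilon> (c k)) (b k)) = a"
    "(\<Sum>k\<in>I. S (b k) o\<^sub>L c k) = cscale (\<epsilon> a) id_blinfun"
    "(\<Sum>k\<in>I. b k o\<^sub>L S (c k)) = cscale (\<epsilon> a) id_blinfun"
proof -
  obtain e where e: "bij_betw e {..<card I} I"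
    using ex_bij_betw_nat_finite[OF assms(2)] unfolding atLeast0LessThan by blast
  have eI: "e k \<in> I" if "k < card I" for k using bij_betwE[OF e] that by blast
  have s: "(\<Sum>k\<in>I. g k) = (\<Sum>k<card I. g (e k))" for g :: "_ \<Rightarrow> 'j::comm_monoid_add"
    using sum.reindex_bij_betw[OF e, of g] by (rule sym)
  have "\<forall>k<card I. b (e k) \<in> P \<and> c (e k) \<in> P" using eI assms(3,4) by blast
  from hopf[OF assms(1) this] D
  show "(\<Sum>k\<in>I. cscale (\<epsilon> (b k)) (c k)) = a" "(\<Sum>k\<in>I. cscale (\<epsilon> (c k)) (b k)) = a"
    "(\<Sum>k\<in>I. S (b k) o\<^sub>L c k) = cscale (\<epsilon> a) id_blinfun"
    "(\<Sum>k\<in>I. b k o\<^sub>L S (c k)) = cscale (\<epsilon> a) id_blinfun"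
    unfolding s by blast+
qed

text \<open>The span of the left legs of \<open>D p\<close> is a finite-dimensional comodule containing \<open>p\<close>; the
  matrix of the coaction in a basis \<open>F\<close> is the corepresentation \<open>T\<close>.\<close>

lemma ex_comodule:
  assumes p: "p \<in> P"
  shows "\<exists>F T. finite F \<and> F \<subseteq> P \<and> \<not> cop.dependent F \<and> p \<in> cop.span F \<and> (\<forall>l f. T l f \<in> P) \<and>
    (\<forall>f\<in>F. D f = (\<Sum>l\<in>F. op_tensor l (T l f))) \<and>
    (\<forall>k\<in>F. \<forall>f\<in>F. D (T k f) = (\<Sum>l\<in>F. op_tensor (T k l) (T l f)))"
proof -
  obtain B0 where B0: "B0 \<subseteq> P" "\<not> cop.dependent B0" "P \<subseteq> cop.span B0"
    by (rule cop.maximal_independent_subset)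
  obtain C g where C: "finite C" "C \<subseteq> B0" "\<And>l. g l \<in> P" "D p = (\<Sum>c\<in>C. op_tensor (g c) c)"
    using span_tensor_expand_right[OF P'(11,1) B0(1,3) D_span[OF p]] by blast
  obtain F where F: "F \<subseteq> g ` C" "\<not> cop.dependent F" "g ` C \<subseteq> cop.span F"
    by (rule cop.maximal_independent_subset)
  have fF: "finite F" using F(1) C(1) finite_subset by blast
  have FP: "F \<subseteq> P" using F(1) C(3) by blast
  \<comment> \<open>Completing \<open>F\<close> to a basis makes first legs outside the span of
    \<open>F\<close> detectable.\<close>
  obtain B where B: "F \<subseteq> B" "B \<subseteq> P" "\<not> cop.dependent B" "P \<subseteq> cop.span B"
    by (rule cop.maximal_independent_subset_extend[OF FP F(2)])
  have Bb: "B \<subseteq> bop" using B(2) P'(1) by blast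
  have CP: "C \<subseteq> P" "C \<subseteq> bop" using C(2) B0(1) P'(1) by blast+
  have "\<exists>G y. finite G \<and> G \<subseteq> B \<and> (\<forall>l. y l \<in> P) \<and> (\<forall>l. l \<notin> G \<longrightarrow> y l = 0) \<and> D (g c) = (\<Sum>l\<in>G. op_tensor l (y l))" for c
    using span_tensor_expand_left[OF P'(11,1) B(2,4) D_span[OF C(3)]] .
  then have "\<forall>c. \<exists>q. finite (fst q) \<and> fst q \<subseteq> B \<and> (\<forall>l. snd q l \<in> P) \<and> (\<forall>l. l \<notin> fst q \<longrightarrow> snd q l = 0) \<and>
      D (g c) = (\<Sum>l\<in>fst q. op_tensor l (snd q l))"
    by (simp only: split_paired_Ex fst_conv snd_conv) blast
  from choice[OF this] obtain q where q: "\<And>c. finite (fst (q c))" "\<And>c. fst (q c) \<subseteq> B"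
    "\<And>c l. snd (q c) l \<in> P" "\<And>c l. l \<notin> fst (q c) \<Longrightarrow> snd (q c) l = 0"
    "\<And>c. D (g c) = (\<Sum>l\<in>fst (q c). op_tensor l (snd (q c) l))" by blast
  define y where "y c = snd (q c)" for c
  define G where "G = (\<Union>c\<in>C. fst (q c)) \<union> F"
  have G: "finite G" "G \<subseteq> B" "F \<subseteq> G" using C(1) q(1,2) fF B(1) by (auto simp: G_def)
  have Gb: "G \<subseteq> bop" using G(2) Bb by blast
  have yP: "y c l \<in> P" for c l using q(3) by (simp add: y_def)
  have yb: "y c l \<in> bop" for c l using yP P'(1) by blast
  have gb: "g c \<in> bop" for c using C(3) P'(1) by blast
  have Db: "D a \<in> bop" if "a \<in> P" for a
  proof -
    have "span {op_tensor b c | b c. b \<in> P \<and> c \<in> P} \<subseteq> bop"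
      by (rule span_minimal) (use P'(1) star_subalgebraD(12)[OF star_subalgebra_bop] in auto)
    then show ?thesis using D_span[OF that] by blast
  qed
  have Dg: "D (g c) = (\<Sum>l\<in>G. op_tensor l (y c l))" if "c \<in> C" for c
    unfolding q(5)[of c] y_def
    by (rule sum.mono_neutral_left) (use that G(1) Gb q(4) in \<open>auto simp: G_def\<close>)
  have "\<forall>c\<in>C. \<exists>r. g c = (\<Sum>l\<in>F. cscale (r l) l)"
    using F(3) unfolding cop.span_finite[OF fF] by blast
  then obtain r where r: "\<And>c. c \<in> C \<Longrightarrow> g c = (\<Sum>l\<in>F. cscale (r c l) l)" by metis
  define r' where "r' c l = (if l \<in> F then r c l else 0)" for c l
  have gr: "g c = (\<Sum>l\<in>G. cscale (r' c l) l)" if "c \<in> C" for c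
    unfolding r[OF that]
    by (rule sum.mono_neutral_cong_left) (use G in \<open>auto simp: r'_def\<close>)
  \<comment> \<open>Coassociativity at \<open>p\<close>, with both sides expanded along
    \<open>B\<close> in the first leg; the coefficients of \<open>l\<close> must agree.\<close>
  have eqG: "(\<Sum>c\<in>C. op_tensor (y c l) c) - (\<Sum>c\<in>C. cscale (r' c l) (D c)) = 0" if l: "l \<in> G" for l
  proof (rule independent_op_tensor_left[OF B(3) G(1,2) Gb _ _ l])
    fix l
    show "(\<Sum>c\<in>C. op_tensor (y c l) c) - (\<Sum>c\<in>C. cscale (r' c l) (D c)) \<in> bop"
      by (intro bop_simps sum_bop op_tensor_bop yb Db) (use CP in auto)
  next
    have "(\<Sum>c\<in>C. transport (\<lambda>((i, j), k). (i, (j, k))) (op_tensor (D (g c)) c)) = (\<Sum>c\<in>C. op_tensor (g c) (D c))"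
      by (rule coassoc[OF p C(1)]) (use C CP in auto)
    also have "(\<Sum>c\<in>C. transport (\<lambda>((i, j), k). (i, (j, k))) (op_tensor (D (g c)) c))
        = (\<Sum>c\<in>C. \<Sum>l\<in>G. op_tensor l (op_tensor (y c l) c))"
    proof (intro sum.cong refl)
      fix c assume c: "c \<in> C"
      then have cb: "c \<in> bop" using CP by blast
      have "op_tensor (D (g c)) c = (\<Sum>l\<in>G. op_tensor (op_tensor l (y c l)) c)"
        unfolding Dg[OF c] by (rule op_tensor_sum_left) (use Gb yb cb in auto)
      then show "transport (\<lambda>((i, j), k). (i, (j, k))) (op_tensor (D (g c)) c) = (\<Sum>l\<in>G. op_tensor l (op_tensor (y c l) c))"
        by (simp only: transport_sum) (intro sum.cong refl transport_assoc yb cb, use Gb in blast)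
    qed
    also have "\<dots> = (\<Sum>l\<in>G. \<Sum>c\<in>C. op_tensor l (op_tensor (y c l) c))" by (rule sum.swap)
    also have "\<dots> = (\<Sum>l\<in>G. op_tensor l (\<Sum>c\<in>C. op_tensor (y c l) c))"
      by (intro sum.cong refl op_tensor_sum_right[symmetric]) (use Gb yb CP in auto)
    also have "(\<Sum>c\<in>C. op_tensor (g c) (D c)) = (\<Sum>c\<in>C. \<Sum>l\<in>G. op_tensor l (cscale (r' c l) (D c)))"
    proof (intro sum.cong refl)
      fix c assume c: "c \<in> C"
      then have Dc: "D c \<in> bop" using CP Db by blast
      have "op_tensor (g c) (D c) = (\<Sum>l\<in>G. op_tensor (cscale (r' c l) l) (D c))"
        unfolding gr[OF c] by (rule op_tensor_sum_left) (use Gb Dc in auto)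
      also have "\<dots> = (\<Sum>l\<in>G. op_tensor l (cscale (r' c l) (D c)))"
      proof (intro sum.cong refl)
        fix l assume "l \<in> G"
        then have "l \<in> bop" using Gb by blast
        then show "op_tensor (cscale (r' c l) l) (D c) = op_tensor l (cscale (r' c l) (D c))"
          by (simp only: op_tensor_cscale_left[OF _ Dc] op_tensor_cscale_right[OF _ Dc])
      qed
      finally show "op_tensor (g c) (D c) = (\<Sum>l\<in>G. op_tensor l (cscale (r' c l) (D c)))" .
    qed
    also have "\<dots> = (\<Sum>l\<in>G. \<Sum>c\<in>C. op_tensor l (cscale (r' c l) (D c)))" by (rule sum.swap)
    also have "\<dots> = (\<Sum>l\<in>G. op_tensor l (\<Sum>c\<in>C. cscale (r' c l) (D c)))"
      by (intro sum.cong refl op_tensor_sum_right[symmetric] bop_simps Db) (use Gb CP in auto)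
    finally have e: "(\<Sum>l\<in>G. op_tensor l (\<Sum>c\<in>C. op_tensor (y c l) c)) = (\<Sum>l\<in>G. op_tensor l (\<Sum>c\<in>C. cscale (r' c l) (D c)))" .
    have "(\<Sum>l\<in>G. op_tensor l ((\<Sum>c\<in>C. op_tensor (y c l) c) - (\<Sum>c\<in>C. cscale (r' c l) (D c))))
        = (\<Sum>l\<in>G. op_tensor l (\<Sum>c\<in>C. op_tensor (y c l) c) - op_tensor l (\<Sum>c\<in>C. cscale (r' c l) (D c)))"
      by (intro sum.cong refl op_tensor_diff_right sum_bop op_tensor_bop bop_simps yb Db) (use Gb CP in auto)
    also have "\<dots> = 0" by (simp only: sum_subtractf e diff_self)
    finally show "(\<Sum>l\<in>G. op_tensor l ((\<Sum>c\<in>C. op_tensor (y c l) c) - (\<Sum>c\<in>C. cscale (r' c l) (D c)))) = 0" .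
  qed
  \<comment> \<open>For \<open>l\<close> outside \<open>F\<close> the second sum in
    \<open>eqG\<close> is zero, as each \<open>g c\<close> is a combination of \<open>F\<close>.
    Independence of \<open>C\<close> then kills every \<open>y c l\<close>, so the first legs of
    \<open>D (g c)\<close> lie in the span of \<open>F\<close>.\<close>
  have y0: "y c l = 0" if c: "c \<in> C" and l: "l \<in> G" "l \<notin> F" for c l
  proof (rule independent_op_tensor_right[OF B0(2) C(1,2) CP(2) yb _ c])
    show "(\<Sum>c\<in>C. op_tensor (y c l) c) = 0" using eqG[OF l(1)] l(2) by (simp add: r'_def)
  qed
  have DgF: "D (g c) = (\<Sum>l\<in>F. op_tensor l (y c l))" if c: "c \<in> C" for c
    unfolding Dg[OF c]
    by (rule sum.mono_neutral_right[OF G(1,3)]) (use y0[OF c] Gb in auto)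
  have "\<forall>f\<in>F. \<exists>c\<in>C. f = g c" using F(1) by blast
  then obtain s where s: "\<And>f. f \<in> F \<Longrightarrow> s f \<in> C \<and> f = g (s f)" by metis
  define T where "T l f = y (s f) l" for l f
  have TP: "T l f \<in> P" for l f by (simp add: T_def yP)
  have Tb: "T l f \<in> bop" for l f by (simp add: T_def yb)
  have DF: "D f = (\<Sum>l\<in>F. op_tensor l (T l f))" if "f \<in> F" for f
    using DgF[of "s f"] s[OF that] by (simp add: T_def)
  have Fb: "F \<subseteq> bop" using FP P'(1) by blast
  have DT: "D (T k f) = (\<Sum>l\<in>F. op_tensor (T k l) (T l f))" if k: "k \<in> F" and f: "f \<in> F" for k f
  proof -
    have "(\<Sum>l\<in>F. op_tensor (T k l) (T l f)) - D (T k f) = 0"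
    proof (rule independent_op_tensor_left[OF F(2) fF subset_refl Fb _ _ k])
      fix k
      show "(\<Sum>l\<in>F. op_tensor (T k l) (T l f)) - D (T k f) \<in> bop"
        by (intro bop_simps sum_bop op_tensor_bop Tb Db TP)
    next
      have "(\<Sum>l\<in>F. transport (\<lambda>((i, j), k). (i, (j, k))) (op_tensor (D l) (T l f))) = (\<Sum>l\<in>F. op_tensor l (D (T l f)))"
        by (rule coassoc[OF _ fF _ TP DF[OF f]]) (use FP f in auto)
      also have "(\<Sum>l\<in>F. transport (\<lambda>((i, j), k). (i, (j, k))) (op_tensor (D l) (T l f)))
          = (\<Sum>l\<in>F. \<Sum>k\<in>F. op_tensor k (op_tensor (T k l) (T l f)))"
      proof (intro sum.cong refl)
        fix l assume l: "l \<in> F"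
        have "op_tensor (D l) (T l f) = (\<Sum>k\<in>F. op_tensor (op_tensor k (T k l)) (T l f))"
          unfolding DF[OF l] by (rule op_tensor_sum_left) (use Fb Tb in auto)
        then show "transport (\<lambda>((i, j), k). (i, (j, k))) (op_tensor (D l) (T l f)) = (\<Sum>k\<in>F. op_tensor k (op_tensor (T k l) (T l f)))"
          by (simp only: transport_sum) (intro sum.cong refl transport_assoc Tb, use Fb in blast)
      qed
      also have "\<dots> = (\<Sum>k\<in>F. \<Sum>l\<in>F. op_tensor k (op_tensor (T k l) (T l f)))" by (rule sum.swap)
      also have "\<dots> = (\<Sum>k\<in>F. op_tensor k (\<Sum>l\<in>F. op_tensor (T k l) (T l f)))"
        by (intro sum.cong refl op_tensor_sum_right[symmetric]) (use Fb Tb in auto)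
      finally have e: "(\<Sum>k\<in>F. op_tensor k (\<Sum>l\<in>F. op_tensor (T k l) (T l f))) = (\<Sum>k\<in>F. op_tensor k (D (T k f)))" .
      have "(\<Sum>k\<in>F. op_tensor k ((\<Sum>l\<in>F. op_tensor (T k l) (T l f)) - D (T k f)))
          = (\<Sum>k\<in>F. op_tensor k (\<Sum>l\<in>F. op_tensor (T k l) (T l f)) - op_tensor k (D (T k f)))"
        by (intro sum.cong refl op_tensor_diff_right sum_bop op_tensor_bop Tb Db TP) (use Fb in auto)
      also have "\<dots> = 0" by (simp only: sum_subtractf e diff_self)
      finally show "(\<Sum>k\<in>F. op_tensor k ((\<Sum>l\<in>F. op_tensor (T k l) (T l f)) - D (T k f))) = 0" .
    qed
    then show ?thesis by simp
  qed
  \<comment> \<open>The counit on the second leg places \<open>p\<close> itself in the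
    comodule.\<close>
  have "p = (\<Sum>c\<in>C. cscale (\<epsilon> c) (g c))"
    by (rule hopf_finite(2)[OF p C(1) _ _ C(4), symmetric]) (use C CP in auto)
  also have "\<dots> \<in> cop.span F"
    by (intro cop.span_sum cop.span_scale) (use F(3) in blast)
  finally show ?thesis
    using fF FP F(2) TP DF DT by (intro exI[of _ F] exI[of _ T]) blast
qed

theorem ex_bicorep:
  assumes p: "p \<in> P"
  shows "\<exists>n T T' Z c. bicorep P D n T T' Z \<and> p = (\<Sum>i<n. \<Sum>j<n. cscale (c i j) (T i j))"
proof -
  obtain F T where F: "finite F" "F \<subseteq> P" "\<not> cop.dependent F" "p \<in> cop.span F" and TP: "\<And>l f. T l f \<in> P"
    and DF: "\<And>f. f \<in> F \<Longrightarrow> D f = (\<Sum>l\<in>F. op_tensor l (T l f))"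
    and DT: "\<And>k f. k \<in> F \<Longrightarrow> f \<in> F \<Longrightarrow> D (T k f) = (\<Sum>l\<in>F. op_tensor (T k l) (T l f))"
    using ex_comodule[OF p] by blast
  have Fb: "F \<subseteq> bop" using F(2) P'(1) by blast
  have Tb: "T l f \<in> bop" for l f using TP P'(1) by blast
  have aTP: "adj (T l f) \<in> P" for l f by (rule P'(5)[OF TP])
  have aTb: "adj (T l f) \<in> bop" for l f using Tb by simp
  have FP: "f \<in> P" if "f \<in> F" for f using that F(2) by blast
  \<comment> \<open>Comparison of coefficients in the independent set \<open>F\<close>; it yields
    the counit on the matrix \<open>T\<close> and on its conjugate.\<close>
  have delta: "u l = (if l = f then 1 else 0)"
    if "f \<in> F" "l \<in> F" "f = (\<Sum>l\<in>F. cscale (u l) l)" for f l u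
  proof -
    have "(\<Sum>l\<in>F. cscale (u l - (if l = f then 1 else 0)) l) = (\<Sum>l\<in>F. cscale (u l) l) - (\<Sum>l\<in>F. if l = f then l else 0)"
      unfolding sum_subtractf[symmetric] by (intro sum.cong refl) (simp add: cop.scale_left_diff_distrib)
    also have "\<dots> = 0" using that(1) F(1) by (simp add: that(3)[symmetric])
    finally have "u l - (if l = f then 1 else 0) = 0" by (rule cop.independentD[OF F(3,1) subset_refl _ that(2)])
    then show ?thesis by simp
  qed
  have eT: "\<epsilon> (T k f) = (if k = f then 1 else 0)" if "k \<in> F" "f \<in> F" for k f
    by (rule delta[OF that(2,1)])
       (rule hopf_finite(2)[OF FP[OF that(2)] F(1) FP TP DF[OF that(2)], symmetric])
  have Daf: "D (adj f) = (\<Sum>l\<in>F. op_tensor (adj l) (adj (T l f)))" if "f \<in> F" for f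
  proof -
    have "D (adj f) = (\<Sum>l\<in>F. adj (op_tensor l (T l f)))"
      unfolding D_adj[OF FP[OF that]] DF[OF that] by (rule adj_sum(1)) (use Fb Tb in auto)
    also have "\<dots> = (\<Sum>l\<in>F. op_tensor (adj l) (adj (T l f)))"
      by (intro sum.cong refl adj_op_tensor Tb) (use Fb in blast)
    finally show ?thesis .
  qed
  \<comment> \<open>The counit on adjoints is not prescribed by the axioms of the locale; its value
    here comes from the counit identity for \<open>D (adj f)\<close>, read in the independent set
    \<open>F\<close> after taking adjoints.\<close>
  have eaT: "\<epsilon> (adj (T k f)) = (if k = f then 1 else 0)" if "k \<in> F" "f \<in> F" for k f
  proof -
    have "(\<Sum>l\<in>F. cscale (\<epsilon> (adj (T l f))) (adj l)) = adj f"
      by (rule hopf_finite(2)[OF _ F(1) _ aTP Daf[OF that(2)]]) (intro P'(5) FP that(2); assumption)+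
    then have "adj (\<Sum>l\<in>F. cscale (\<epsilon> (adj (T l f))) (adj l)) = f"
      using that(2) Fb by (simp add: subset_iff)
    also have "adj (\<Sum>l\<in>F. cscale (\<epsilon> (adj (T l f))) (adj l)) = (\<Sum>l\<in>F. adj (cscale (\<epsilon> (adj (T l f))) (adj l)))"
      by (rule adj_sum(1)) (use Fb in auto)
    also have "\<dots> = (\<Sum>l\<in>F. cscale (cnj (\<epsilon> (adj (T l f)))) l)"
      by (intro sum.cong refl) (use Fb in \<open>auto simp: adj_simps\<close>)
    finally have "cnj (\<epsilon> (adj (T k f))) = (if k = f then 1 else 0)"
      by (intro delta[OF that(2,1)]) (rule sym)
    then show ?thesis by (metis complex_cnj_cnj complex_cnj_one complex_cnj_zero)
  qed
  have DaT: "D (adj (T k f)) = (\<Sum>l\<in>F. op_tensor (adj (T k l)) (adj (T l f)))" if "k \<in> F" "f \<in> F" for k f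
  proof -
    have "D (adj (T k f)) = (\<Sum>l\<in>F. adj (op_tensor (T k l) (T l f)))"
      unfolding D_adj[OF TP] DT[OF that] by (rule adj_sum(1)) (use Tb in auto)
    then show ?thesis by (simp only: adj_op_tensor[OF Tb Tb])
  qed
  have Sb: "S a \<in> bop" if "a \<in> P" for a using S_in[OF that] P'(1) by blast
  have S1: "(\<Sum>l\<in>F. S (T k l) o\<^sub>L T l f) = (if k = f then id_blinfun else 0)"
    "(\<Sum>l\<in>F. T k l o\<^sub>L S (T l f)) = (if k = f then id_blinfun else 0)" if "k \<in> F" "f \<in> F" for k f
    using hopf_finite(3,4)[OF TP F(1) TP TP DT[OF that]] by (simp_all add: eT[OF that])
  have S2: "(\<Sum>l\<in>F. S (adj (T k l)) o\<^sub>L adj (T l f)) = (if k = f then id_blinfun else 0)"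
    "(\<Sum>l\<in>F. adj (T k l) o\<^sub>L S (adj (T l f))) = (if k = f then id_blinfun else 0)" if "k \<in> F" "f \<in> F" for k f
    using hopf_finite(3,4)[OF aTP F(1) aTP aTP DaT[OF that]] by (simp_all add: eaT[OF that])
  have asum: "(\<Sum>l\<in>F. adj (v l) o\<^sub>L adj (w l)) = adj (\<Sum>l\<in>F. w l o\<^sub>L v l)"
    if "\<And>l. l \<in> F \<Longrightarrow> v l \<in> bop" "\<And>l. l \<in> F \<Longrightarrow> w l \<in> bop" for v w :: "'i op \<Rightarrow> 'i op"
    by (subst adj_sum(1)) (simp_all add: that adj_simps)
  \<comment> \<open>The antipode inverts the conjugate matrix, and taking adjoints of the entries
    turns this into an inverse of the transpose. The combination of \<open>adj\<close>,
    \<open>S\<close>, \<open>adj\<close> is the usual formula for the inverse antipode.\<close>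
  have Z1: "(\<Sum>l\<in>F. T l k o\<^sub>L adj (S (adj (T f l)))) = (if k = f then id_blinfun else 0)" if "k \<in> F" "f \<in> F" for k f
  proof -
    have "(\<Sum>l\<in>F. T l k o\<^sub>L adj (S (adj (T f l)))) = (\<Sum>l\<in>F. adj (adj (T l k)) o\<^sub>L adj (S (adj (T f l))))"
      by (simp only: adj_adj[OF Tb])
    also have "\<dots> = adj (\<Sum>l\<in>F. S (adj (T f l)) o\<^sub>L adj (T l k))"
      by (rule asum) (intro aTb Sb aTP)+
    also have "\<dots> = (if k = f then id_blinfun else 0)"
      unfolding S2(1)[OF that(2,1)] by (simp add: adj_simps(1,2))
    finally show ?thesis .
  qed
  have Z2: "(\<Sum>l\<in>F. adj (S (adj (T l k))) o\<^sub>L T f l) = (if k = f then id_blinfun else 0)" if "k \<in> F" "f \<in> F" for k f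
  proof -
    have "(\<Sum>l\<in>F. adj (S (adj (T l k))) o\<^sub>L T f l) = (\<Sum>l\<in>F. adj (S (adj (T l k))) o\<^sub>L adj (adj (T f l)))"
      by (simp only: adj_adj[OF Tb])
    also have "\<dots> = adj (\<Sum>l\<in>F. adj (T f l) o\<^sub>L S (adj (T l k)))"
      by (rule asum) (intro aTb Sb aTP)+
    also have "\<dots> = (if k = f then id_blinfun else 0)"
      unfolding S2(2)[OF that(2,1)] by (simp add: adj_simps(1,2))
    finally show ?thesis .
  qed
  define n where "n = card F"
  obtain e where e: "bij_betw e {..<n} F"
    using ex_bij_betw_nat_finite[OF F(1)] unfolding atLeast0LessThan n_def by blast
  have eF: "e k \<in> F" if "k < n" for k using bij_betwE[OF e] that by blast
  have einj: "e i = e j \<longleftrightarrow> i = j" if "i < n" "j < n" for i j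
    using bij_betw_imp_inj_on[OF e] that by (auto dest: inj_onD)
  have s: "(\<Sum>k<n. g (e k)) = (\<Sum>k\<in>F. g k)" for g :: "_ \<Rightarrow> 'j::comm_monoid_add"
    by (rule sum.reindex_bij_betw[OF e])
  have bc: "bicorep P D n (\<lambda>i j. T (e i) (e j)) (\<lambda>i j. S (T (e i) (e j))) (\<lambda>i j. adj (S (adj (T (e j) (e i)))))"
  proof (rule bicorepI)
    fix i j assume ij: "i < n" "j < n"
    note ee = eF[OF ij(1)] eF[OF ij(2)]
    show "T (e i) (e j) \<in> P" "S (T (e i) (e j)) \<in> P" "adj (S (adj (T (e j) (e i)))) \<in> P"
      by (intro TP S_in P'(5))+
    show "D (T (e i) (e j)) = (\<Sum>k<n. op_tensor (T (e i) (e k)) (T (e k) (e j)))"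
      unfolding DT[OF ee] by (rule s[symmetric])
    show "(\<Sum>k<n. S (T (e i) (e k)) o\<^sub>L T (e k) (e j)) = (if i = j then id_blinfun else 0)"
      using S1(1)[OF ee] s[of "\<lambda>k. S (T (e i) k) o\<^sub>L T k (e j)"] by (simp only: einj[OF ij])
    show "(\<Sum>k<n. T (e i) (e k) o\<^sub>L S (T (e k) (e j))) = (if i = j then id_blinfun else 0)"
      using S1(2)[OF ee] s[of "\<lambda>k. T (e i) k o\<^sub>L S (T k (e j))"] by (simp only: einj[OF ij])
    show "(\<Sum>k<n. T (e k) (e i) o\<^sub>L adj (S (adj (T (e j) (e k))))) = (if i = j then id_blinfun else 0)"
      using Z1[OF ee] s[of "\<lambda>k. T k (e i) o\<^sub>L adj (S (adj (T (e j) k)))"] by (simp only: einj[OF ij])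
    show "(\<Sum>k<n. adj (S (adj (T (e k) (e i)))) o\<^sub>L T (e j) (e k)) = (if i = j then id_blinfun else 0)"
      using Z2[OF ee] s[of "\<lambda>k. adj (S (adj (T k (e i)))) o\<^sub>L T (e j) k"] by (simp only: einj[OF ij])
  qed
  obtain \<alpha> where \<alpha>: "p = (\<Sum>f\<in>F. cscale (\<alpha> f) f)"
    using F(4) unfolding cop.span_finite[OF F(1)] by blast
  \<comment> \<open>The counit on the first leg of \<open>D f\<close> writes \<open>f\<close> as a
    combination of the entries of \<open>T\<close>.\<close>
  have "p = (\<Sum>f\<in>F. cscale (\<alpha> f) (\<Sum>l\<in>F. cscale (\<epsilon> l) (T l f)))"
    unfolding \<alpha>
  proof (intro sum.cong refl)
    fix f assume f: "f \<in> F"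
    have "(\<Sum>l\<in>F. cscale (\<epsilon> l) (T l f)) = f"
      by (rule hopf_finite(1)[OF FP[OF f] F(1) FP TP DF[OF f]])
    then show "cscale (\<alpha> f) f = cscale (\<alpha> f) (\<Sum>l\<in>F. cscale (\<epsilon> l) (T l f))" by simp
  qed
  also have "\<dots> = (\<Sum>f\<in>F. \<Sum>l\<in>F. cscale (\<alpha> f * \<epsilon> l) (T l f))" by (simp add: cop.scale_sum_right)
  also have "\<dots> = (\<Sum>l\<in>F. \<Sum>f\<in>F. cscale (\<alpha> f * \<epsilon> l) (T l f))" by (rule sum.swap)
  also have "\<dots> = (\<Sum>i<n. \<Sum>j<n. cscale (\<alpha> (e j) * \<epsilon> (e i)) (T (e i) (e j)))"
    unfolding s[symmetric] ..
  finally have "p = (\<Sum>i<n. \<Sum>j<n. cscale (\<alpha> (e j) * \<epsilon> (e i)) (T (e i) (e j)))" .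
  with bc show ?thesis
    by (intro exI[of _ n] exI[of _ "\<lambda>i j. T (e i) (e j)"] exI[of _ "\<lambda>i j. S (T (e i) (e j))"]
        exI[of _ "\<lambda>i j. adj (S (adj (T (e j) (e i))))"] exI[of _ "\<lambda>i j. \<alpha> (e j) * \<epsilon> (e i)"] conjI)
qed

end

section \<open>Universal quantum groups and almost periodic elements\<close>

lemma cstar_algebraD:
  assumes "cstar_algebra A"
  shows "star_subalgebra A" "closed A" "nondegenerate A (\<lambda>x. x)"
  using assms by (simp_all add: cstar_algebra_def nondegenerate_def)

lemma star_hom_comp: "star_hom A \<theta> B \<Longrightarrow> star_hom B \<rho> C \<Longrightarrow> star_hom A (\<lambda>x. \<rho> (\<theta> x)) C"
  by (simp add: star_hom_def)

lemma star_hom_bop: "star_hom A \<theta> B \<Longrightarrow> B \<subseteq> bop \<Longrightarrow> star_hom A \<theta> bop"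
  by (rule star_hom_mono[OF _ subset_refl])

lemma multipliers_subset_bop: "multipliers A \<subseteq> bop"
  by (auto simp: multipliers_def)

lemma star_subalgebra_image:
  assumes A: "star_subalgebra A" and \<theta>: "star_hom A \<theta> bop"
  shows "star_subalgebra (\<theta> ` A)"
  unfolding star_subalgebra_def
proof (intro conjI ballI allI)
  note A' = star_subalgebraD[OF A] and t = star_homD[OF \<theta>]
  show "\<theta> ` A \<subseteq> bop" using t(1) by blast
  show "0 \<in> \<theta> ` A" using star_hom_linear(1)[OF \<theta> A] A'(2) by (metis imageI)
  fix x y assume "x \<in> \<theta> ` A" "y \<in> \<theta> ` A"
  then obtain a b where ab: "x = \<theta> a" "y = \<theta> b" "a \<in> A" "b \<in> A" by blast
  show "x + y \<in> \<theta> ` A" unfolding ab(1,2) t(2)[OF ab(3,4), symmetric] by (intro imageI A' ab)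
  show "x o\<^sub>L y \<in> \<theta> ` A" unfolding ab(1,2) t(3)[OF ab(3,4), symmetric] by (intro imageI A' ab)
next
  note A' = star_subalgebraD[OF A] and t = star_homD[OF \<theta>]
  fix x c assume "x \<in> \<theta> ` A"
  then obtain a where a: "x = \<theta> a" "a \<in> A" by blast
  show "adj x \<in> \<theta> ` A" unfolding a(1) t(4)[OF a(2), symmetric] by (intro imageI A' a)
  show "cscale c x \<in> \<theta> ` A" unfolding a(1) t(5)[OF a(2), symmetric] by (intro imageI A' a)
qed

lemma star_hom_extends:
  assumes D: "star_subalgebra D" and g: "star_hom D g bop" and le: "\<And>x. x \<in> D \<Longrightarrow> norm (g x) \<le> norm x"
  shows "\<exists>\<Phi>. \<Phi> \<in> extensional (closure D) \<and> star_hom (closure D) \<Phi> (closure (g ` D)) \<and> (\<forall>x\<in>D. \<Phi> x = g x)"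
proof -
  note D' = star_subalgebraD[OF D] and g' = star_homD[OF g]
  define R where "R = (\<lambda>x. (x, g x)) ` D"
  have RI: "(x, g x) \<in> R" if "x \<in> D" for x using that by (auto simp: R_def)
  have RE: "x \<in> D" "y = g x" if "(x, y) \<in> R" for x y using that by (auto simp: R_def)
  have "fst ` R = D" "snd ` R = g ` D" by (simp_all add: R_def image_image)
  moreover have "\<exists>\<Phi>. \<Phi> \<in> extensional (closure (fst ` R)) \<and>
    star_hom (closure (fst ` R)) \<Phi> (closure (snd ` R)) \<and> (\<forall>(x, y)\<in>R. \<Phi> x = y)"
  proof (rule star_relation_extends)
    show "R \<subseteq> bop \<times> bop" using D'(7) g'(1) by (auto simp: R_def)
    show "subspace R"
    proof (rule subspaceI)
      show "0 \<in> R" using RI[OF D'(2)] star_hom_linear(1)[OF g D] by (simp add: zero_prod_def)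
      show "p + q \<in> R" if "p \<in> R" "q \<in> R" for p q
        using that unfolding R_def by (elim imageE) (simp add: image_iff g'(2) D'(3))
      show "c *\<^sub>R p \<in> R" if "p \<in> R" for c p
        using that unfolding R_def by (elim imageE) (simp add: image_iff g'(6) D'(8))
    qed
    fix x y x' y' c assume 1: "(x, y) \<in> R" and 2: "(x', y') \<in> R"
    show "(x o\<^sub>L x', y o\<^sub>L y') \<in> R"
      using RI[OF D'(4)[OF RE(1)[OF 1] RE(1)[OF 2]]]
      by (simp add: g'(3)[OF RE(1)[OF 1] RE(1)[OF 2]] RE(2)[OF 1] RE(2)[OF 2])
  next
    fix x y c assume 1: "(x, y) \<in> R"
    show "(adj x, adj y) \<in> R"
      using RI[OF D'(5)[OF RE(1)[OF 1]]] by (simp add: g'(4)[OF RE(1)[OF 1]] RE(2)[OF 1])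
    show "(cscale c x, cscale c y) \<in> R"
      using RI[OF D'(6)[OF RE(1)[OF 1]]] by (simp add: g'(5)[OF RE(1)[OF 1]] RE(2)[OF 1])
    show "norm y \<le> norm x" using le[OF RE(1)[OF 1]] by (simp add: RE(2)[OF 1])
  qed
  moreover have "(\<forall>(x, y)\<in>R. \<Phi> x = y) \<longleftrightarrow> (\<forall>x\<in>D. \<Phi> x = g x)" for \<Phi>
    unfolding R_def by simp
  ultimately show ?thesis by simp
qed

lemma star_hom_eq_closure:
  assumes A: "star_subalgebra A" "closed A" and F: "star_hom A F bop" "star_hom A F' bop"
    and D: "closure D = A" and eq: "\<And>x. x \<in> D \<Longrightarrow> F x = F' x" and x: "x \<in> A"
  shows "F x = F' x"
proof (rule continuous_eq_on_closure[OF star_hom_continuous[OF A F(1)] star_hom_continuous[OF A F(2)] A(2)])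
  show "D \<subseteq> A" using closure_subset[of D] unfolding D .
  show "A \<subseteq> closure D" unfolding D ..
qed (fact eq x)+

lemma star_hom_coef:
  assumes V: "star_subalgebra V" and F: "star_hom V F B"
    and T: "\<And>i j. i < n \<Longrightarrow> j < n \<Longrightarrow> T i j \<in> V"
  shows "F (\<Sum>i<n. \<Sum>j<n. cscale (c i j) (T i j)) = (\<Sum>i<n. \<Sum>j<n. cscale (c i j) (F (T i j)))"
proof -
  note V' = star_subalgebraD[OF V]
  have "F (\<Sum>i<n. \<Sum>j<n. cscale (c i j) (T i j)) = (\<Sum>i<n. F (\<Sum>j<n. cscale (c i j) (T i j)))"
    by (rule star_hom_linear(4)[OF F V]) (intro cop.subspace_sum[OF V'(11)] V'(6) T; simp)
  also have "\<dots> = (\<Sum>i<n. \<Sum>j<n. F (cscale (c i j) (T i j)))"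
    by (intro sum.cong refl star_hom_linear(4)[OF F V] V'(6) T) simp_all
  also have "\<dots> = (\<Sum>i<n. \<Sum>j<n. cscale (c i j) (F (T i j)))"
    by (intro sum.cong refl star_homD(5)[OF F] T) simp_all
  finally show ?thesis .
qed

lemma star_hom_eq_coef:
  assumes V: "star_subalgebra V" and F: "star_hom V F bop" "star_hom V F' bop"
    and T: "\<And>i j. i < n \<Longrightarrow> j < n \<Longrightarrow> T i j \<in> V" "\<And>i j. i < n \<Longrightarrow> j < n \<Longrightarrow> F (T i j) = F' (T i j)"
    and x: "x = (\<Sum>i<n. \<Sum>j<n. cscale (c i j) (T i j))"
  shows "F x = F' x"
proof -
  have "F x = (\<Sum>i<n. \<Sum>j<n. cscale (c i j) (F (T i j)))"
    unfolding x by (rule star_hom_coef[OF V F(1) T(1)])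
  also have "\<dots> = (\<Sum>i<n. \<Sum>j<n. cscale (c i j) (F' (T i j)))"
    by (intro sum.cong refl) (simp add: T(2))
  also have "\<dots> = F' x"
    unfolding x by (rule star_hom_coef[OF V F(2) T(1), symmetric])
  finally show ?thesis .
qed

text \<open>The products of \<open>\<Delta> a\<close> with elements of the minimal tensor product
  are dense in it, and it acts nondegenerately because \<open>A\<close> does. The facts
  \<open>1\<close> to \<open>3\<close> pass from operators to simple tensors of vectors, one leg at
  a time.\<close>

lemma nondegenerate_comult:
  assumes A: "cstar_algebra A" and nd: "nondeg_hom A \<Delta> (min_tensor A A)"
  shows "nondegenerate A \<Delta>"
proof -
  define S where "S = closure (span {blinfun_apply (\<Delta> a) x | a x. a \<in> A})"
  have S: "subspace S" "closed S" by (simp_all add: S_def subspace_closure)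
  have base: "\<Delta> a x \<in> S" if "a \<in> A" for a x
    unfolding S_def by (rule closure_subset[THEN subsetD], rule span_base) (use that in blast)
  have 1: "t z \<in> S" if t: "t \<in> min_tensor A A" for t z
  proof -
    have "closed ((\<lambda>t. blinfun_apply t z) -` S)"
      by (rule closed_vimage[OF S(2)]) (intro continuous_intros)
    moreover have "span {\<Delta> a o\<^sub>L b | a b. a \<in> A \<and> b \<in> min_tensor A A} \<subseteq> (\<lambda>t. blinfun_apply t z) -` S"
    proof (rule span_minimal)
      show "subspace ((\<lambda>t. blinfun_apply t z) -` S)"
        using S(1) by (auto simp: subspace_def blinfun.add_left blinfun.scaleR_left)
      show "{\<Delta> a o\<^sub>L b | a b. a \<in> A \<and> b \<in> min_tensor A A} \<subseteq> (\<lambda>t. blinfun_apply t z) -` S"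
        by (intro subsetI vimageI2, elim CollectE exE conjE) (simp add: base)
    qed
    ultimately have "closure (span {\<Delta> a o\<^sub>L b | a b. a \<in> A \<and> b \<in> min_tensor A A}) \<subseteq> (\<lambda>t. blinfun_apply t z) -` S"
      by (intro closure_minimal)
    then show ?thesis using nd t unfolding nondeg_hom_def by blast
  qed
  have Ad: "closure (span {blinfun_apply a x | a x. a \<in> A}) = UNIV" using A by (simp add: cstar_algebra_def)
  have Ab: "a \<in> bop" if "a \<in> A" for a using star_subalgebraD(7)[OF cstar_algebraD(1)[OF A] that] .
  have total: "x \<in> U" if U: "subspace U" "closed U" "\<And>a x. a \<in> A \<Longrightarrow> blinfun_apply a x \<in> U" for U x
  proof -
    have "closure (span {blinfun_apply a x | a x. a \<in> A}) \<subseteq> U"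
      by (intro closure_minimal span_minimal U(1,2)) (use U(3) in blast)
    then show ?thesis using Ad by blast
  qed
  have 2: "vtensor x (b y) \<in> S" if b: "b \<in> A" for x b y
  proof -
    have "x \<in> (\<lambda>x. vtensor x (b y)) -` S"
    proof (rule total)
      show "subspace ((\<lambda>x. vtensor x (b y)) -` S)"
        using S(1) by (auto simp: subspace_def vtensor.zero_left vtensor.add_left vtensor.scaleR_left)
      show "closed ((\<lambda>x. vtensor x (b y)) -` S)"
        by (rule closed_vimage[OF S(2)]) (intro linear_continuous_on vtensor.bounded_linear_left)
      fix a x assume a: "a \<in> A"
      have "op_tensor a b (vtensor x y) \<in> S" by (intro 1 op_tensor_in_min_tensor a b)
      then show "a x \<in> (\<lambda>x. vtensor x (b y)) -` S" by (simp add: op_tensor_vtensor Ab a b)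
    qed
    then show ?thesis by simp
  qed
  have 3: "vtensor x y \<in> S" for x y
  proof -
    have "y \<in> vtensor x -` S"
    proof (rule total)
      show "subspace (vtensor x -` S)"
        using S(1) by (auto simp: subspace_def vtensor.zero_right vtensor.add_right vtensor.scaleR_right)
      show "closed (vtensor x -` S)"
        by (rule closed_vimage[OF S(2)]) (intro linear_continuous_on vtensor.bounded_linear_right)
    qed (use 2 in simp)
    then show ?thesis by simp
  qed
  have "x \<in> S" for x
  proof (induction x rule: ell2_induct)
    case closed
    show ?case using S(2) by simp
  next
    case zero
    show ?case using S(1) by (rule subspace_0)
  next
    case (add x y)
    show ?case by (rule subspace_add[OF S(1) add])
  next
    case (ebasis c i)
    show ?case using 3[of "scaleC c (ebasis (fst i))" "ebasis (snd i)"]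
      by (simp add: vtensor_scaleC_left flip: ebasis_pair)
  qed
  then show ?thesis by (auto simp: nondegenerate_def S_def)
qed

text \<open>\<open>\<theta> id_blinfun\<close> is a left identity on the products
  \<open>\<theta> a o\<^sub>L b\<close>, hence on \<open>B\<close> by density, and \<open>B\<close>
  acts nondegenerately.\<close>

lemma nondeg_hom_id:
  assumes nd: "nondeg_hom A \<theta> B" and A: "id_blinfun \<in> A" and B: "nondegenerate B (\<lambda>x. x)"
  shows "\<theta> id_blinfun = id_blinfun"
proof (rule nondegenerate_ext[OF B])
  have hom: "star_hom A \<theta> (multipliers B)" using nd by (simp add: nondeg_hom_def)
  fix b assume b: "b \<in> B"
  have "closed {t. \<theta> id_blinfun o\<^sub>L t = t}"
    by (intro closed_Collect_eq linear_continuous_on bounded_linear_ident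
        bounded_bilinear.bounded_linear_right[OF bounded_bilinear_blinfun_compose])
  moreover have "span {\<theta> a o\<^sub>L b | a b. a \<in> A \<and> b \<in> B} \<subseteq> {t. \<theta> id_blinfun o\<^sub>L t = t}"
  proof (rule span_minimal)
    show "{\<theta> a o\<^sub>L b | a b. a \<in> A \<and> b \<in> B} \<subseteq> {t. \<theta> id_blinfun o\<^sub>L t = t}"
      using star_homD(3)[OF hom A] by (auto simp flip: blinfun_compose_assoc)
    show "subspace {t. \<theta> id_blinfun o\<^sub>L t = t}"
      by (simp add: subspace_def comp_add_right comp_scaleR_right comp_zero_right)
  qed
  ultimately have "closure (span {\<theta> a o\<^sub>L b | a b. a \<in> A \<and> b \<in> B}) \<subseteq> {t. \<theta> id_blinfun o\<^sub>L t = t}"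
    by (intro closure_minimal)
  then show "\<theta> id_blinfun o\<^sub>L b = id_blinfun o\<^sub>L b" using nd b unfolding nondeg_hom_def by auto
qed

lemma nondegenerate_unital: "id_blinfun \<in> A \<Longrightarrow> nondegenerate A (\<lambda>x. x)"
proof -
  assume "id_blinfun \<in> A"
  then have "x \<in> {blinfun_apply a x | a x. a \<in> A}" for x
    by (metis (mono_tags, lifting) id_blinfun.rep_eq id_apply mem_Collect_eq)
  then have "{blinfun_apply a x | a x. a \<in> A} = UNIV" by blast
  then show ?thesis by (simp add: nondegenerate_def)
qed

lemma nondeg_hom_unital:
  assumes \<theta>: "star_hom A \<theta> (multipliers B)" "id_blinfun \<in> A" "\<theta> id_blinfun = id_blinfun"
    and B: "star_subalgebra B" "closed B"
  shows "nondeg_hom A \<theta> B"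
  unfolding nondeg_hom_def
proof (intro conjI \<theta>(1))
  have "{\<theta> a o\<^sub>L b | a b. a \<in> A \<and> b \<in> B} = B"
  proof
    show "{\<theta> a o\<^sub>L b | a b. a \<in> A \<and> b \<in> B} \<subseteq> B"
      using star_homD(1)[OF \<theta>(1)] multipliersD(2) by blast
    show "B \<subseteq> {\<theta> a o\<^sub>L b | a b. a \<in> A \<and> b \<in> B}"
    proof
      fix b assume "b \<in> B"
      moreover have "b = \<theta> id_blinfun o\<^sub>L b" by (simp add: \<theta>(3))
      ultimately show "b \<in> {\<theta> a o\<^sub>L b | a b. a \<in> A \<and> b \<in> B}" using \<theta>(2) by blast
    qed
  qed
  then show "closure (span {\<theta> a o\<^sub>L b | a b. a \<in> A \<and> b \<in> B}) = B"
    by (simp only: span_eq_iff[THEN iffD2, OF star_subalgebraD(12)[OF B(1)]] closure_closed[OF B(2)])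
qed

section \<open>Unital bialgebras and universal quantum groups\<close>

definition unital_bialgebra :: "'i op set \<Rightarrow> ('i op \<Rightarrow> ('i \<times> 'i) op) \<Rightarrow> bool" where
  "unital_bialgebra C D \<longleftrightarrow> star_subalgebra C \<and> closed C \<and> id_blinfun \<in> C \<and>
    star_hom C D (min_tensor C C) \<and> D id_blinfun = id_blinfun"

lemma unital_bialgebraD:
  assumes "unital_bialgebra C D"
  shows "star_subalgebra C" "closed C" "id_blinfun \<in> C" "star_hom C D (min_tensor C C)"
    "D id_blinfun = id_blinfun" "star_hom C D bop" "star_subalgebra (min_tensor C C)"
    "id_blinfun \<in> min_tensor C C" "multipliers C = C"
proof -
  show 1: "star_subalgebra C" "closed C" "id_blinfun \<in> C" "star_hom C D (min_tensor C C)"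
    "D id_blinfun = id_blinfun" using assms by (simp_all add: unital_bialgebra_def)
  show 2: "star_subalgebra (min_tensor C C)" by (rule star_subalgebra_min_tensor[OF 1(1) 1(1)])
  show "star_hom C D bop" by (rule star_hom_bop[OF 1(4) star_subalgebraD(1)[OF 2]])
  show "id_blinfun \<in> min_tensor C C" using op_tensor_in_min_tensor[OF 1(3) 1(3)] by simp
  show "multipliers C = C" by (rule multipliers_unital[OF 1(3,1)])
qed

lemma unital_bialgebra_comult: "unital_bialgebra C D \<Longrightarrow> unital_comult C D"
  using unital_bialgebraD[of C D] by unfold_locales auto

text \<open>With a unit, every multiplier of the tensor product already lies in it, so the
  comultiplication takes values in the tensor product itself.\<close>

lemma cstar_bialgebra_unital:
  assumes "cstar_bialgebra C D" "id_blinfun \<in> C"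
  shows "unital_bialgebra C D"
proof -
  have C: "cstar_algebra C" "nondeg_hom C D (min_tensor C C)" using assms by (simp_all add: cstar_bialgebra_def)
  note C' = cstar_algebraD[OF C(1)]
  have i: "id_blinfun \<in> min_tensor C C" using op_tensor_in_min_tensor[OF assms(2) assms(2)] by simp
  have m: "multipliers (min_tensor C C) = min_tensor C C"
    by (rule multipliers_unital[OF i star_subalgebra_min_tensor[OF C'(1) C'(1)]])
  have "star_hom C D (min_tensor C C)" using C(2) by (simp add: nondeg_hom_def m)
  moreover have "D id_blinfun = id_blinfun"
    by (rule nondeg_hom_id[OF C(2) assms(2) nondegenerate_unital[OF i]])
  ultimately show ?thesis using C' assms(2) by (simp add: unital_bialgebra_def)
qed

lemma universal_cqgD:
  assumes u: "universal_cqg P D C \<iota> DC" and i: "id_blinfun \<in> P"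
  shows "star_subalgebra P" "star_hom P \<iota> C" "closure (\<iota> ` P) = C" "\<iota> id_blinfun = id_blinfun"
    "unital_bialgebra C DC"
    "\<And>(n :: nat) T i j. i < n \<Longrightarrow> j < n \<Longrightarrow> (\<And>i j. i < n \<Longrightarrow> j < n \<Longrightarrow> T i j \<in> P) \<Longrightarrow>
      D (T i j) = (\<Sum>k<n. op_tensor (T i k) (T k j)) \<Longrightarrow>
      DC (\<iota> (T i j)) = (\<Sum>k<n. op_tensor (\<iota> (T i k)) (\<iota> (T k j)))"
    "\<And>p a. cstar_seminorm P p \<Longrightarrow> a \<in> P \<Longrightarrow> p a \<le> norm (\<iota> a)"
proof -
  have e: "universal_envelope P C \<iota>" and b: "cstar_bialgebra C DC" using u by (simp_all add: universal_cqg_def)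
  show 1: "star_subalgebra P" "star_hom P \<iota> C" "closure (\<iota> ` P) = C"
    using e by (simp_all add: universal_envelope_def)
  have "cstar_algebra C" using e by (simp add: universal_envelope_def)
  note C = cstar_algebraD[OF this]
  \<comment> \<open>\<open>universal_envelope\<close> does not state this;
    \<open>\<iota> id_blinfun\<close> is a left identity on the dense image of \<open>P\<close>,
    hence on \<open>C\<close>.\<close>
  show 2: "\<iota> id_blinfun = id_blinfun"
  proof (rule nondegenerate_ext[OF C(3)])
    fix c assume c: "c \<in> C"
    have "closed {t. \<iota> id_blinfun o\<^sub>L t = t}"
      by (intro closed_Collect_eq linear_continuous_on bounded_linear_ident
          bounded_bilinear.bounded_linear_right[OF bounded_bilinear_blinfun_compose])
    moreover have "\<iota> ` P \<subseteq> {t. \<iota> id_blinfun o\<^sub>L t = t}"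
      using star_homD(3)[OF 1(2) i] by (auto simp: )
    ultimately have "closure (\<iota> ` P) \<subseteq> {t. \<iota> id_blinfun o\<^sub>L t = t}" by (intro closure_minimal)
    then show "\<iota> id_blinfun o\<^sub>L c = id_blinfun o\<^sub>L c" using c 1(3) by auto
  qed
  have "id_blinfun \<in> C" using star_homD(1)[OF 1(2) i] by (simp add: 2)
  with b show "unital_bialgebra C DC" by (rule cstar_bialgebra_unital)
  show "DC (\<iota> (T i j)) = (\<Sum>k<n. op_tensor (\<iota> (T i k)) (\<iota> (T k j)))"
    if "i < n" "j < n" "\<And>i j. i < n \<Longrightarrow> j < n \<Longrightarrow> T i j \<in> P" "D (T i j) = (\<Sum>k<n. op_tensor (T i k) (T k j))"
    for n :: nat and T i j
  proof -
    have c: "\<forall>a\<in>P. \<forall>(n::nat) b c. (\<forall>k<n. b k \<in> P \<and> c k \<in> P) \<and> D a = (\<Sum>k<n. op_tensor (b k) (c k)) \<longrightarrow>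
      DC (\<iota> a) = (\<Sum>k<n. op_tensor (\<iota> (b k)) (\<iota> (c k)))" using u by (simp add: universal_cqg_def)
    have "(\<forall>k<n. T i k \<in> P \<and> T k j \<in> P) \<and> D (T i j) = (\<Sum>k<n. op_tensor (T i k) (T k j))"
      using that by blast
    then show ?thesis
      by (rule mp[OF spec[OF spec[OF spec[OF bspec[OF c that(3)[OF that(1,2)]], of n], of "\<lambda>k. T i k"], of "\<lambda>k. T k j"]])
  qed
  show "p a \<le> norm (\<iota> a)" if "cstar_seminorm P p" "a \<in> P" for p a
    using e that unfolding universal_envelope_def by blast
qed

text \<open>Since \<open>H\<close> is unital, the strict extension of the tensor product of
  homomorphisms is plain evaluation, and the Hopf condition can be tested on finite sums of
  tensors.\<close>

lemma hom_tensor_unital: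
  assumes H: "unital_bialgebra H DH" and \<theta>: "star_hom H \<theta> bop" "\<theta> id_blinfun = id_blinfun"
  shows "star_hom (min_tensor H H) (hom_tensor H \<theta> H \<theta>) bop"
    and "a \<in> H \<Longrightarrow> b \<in> H \<Longrightarrow> hom_tensor H \<theta> H \<theta> (op_tensor a b) = op_tensor (\<theta> a) (\<theta> b)"
    and "x \<in> min_tensor H H \<Longrightarrow> strict_ext (min_tensor H H) (hom_tensor H \<theta> H \<theta>) x = hom_tensor H \<theta> H \<theta> x"
    and "star_hom H (\<lambda>a. hom_tensor H \<theta> H \<theta> (DH a)) bop"
    and "(\<And>k. k \<in> I \<Longrightarrow> b' k \<in> H) \<Longrightarrow> (\<And>k. k \<in> I \<Longrightarrow> c' k \<in> H) \<Longrightarrow>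
      hom_tensor H \<theta> H \<theta> (\<Sum>k\<in>I. op_tensor (b' k) (c' k)) = (\<Sum>k\<in>I. op_tensor (\<theta> (b' k)) (\<theta> (c' k)))"
proof -
  note H' = unital_bialgebraD[OF H]
  show 1: "star_hom (min_tensor H H) (hom_tensor H \<theta> H \<theta>) bop"
    by (rule star_hom_hom_tensor[OF H'(1,2) \<theta>(1) H'(1,2) \<theta>(1)])
  show 2: "a \<in> H \<Longrightarrow> b \<in> H \<Longrightarrow> hom_tensor H \<theta> H \<theta> (op_tensor a b) = op_tensor (\<theta> a) (\<theta> b)" for a b
    by (rule hom_tensor_op_tensor[OF H'(1,2) \<theta>(1) H'(1,2) \<theta>(1)])
  have "hom_tensor H \<theta> H \<theta> id_blinfun = id_blinfun"
    using 2[OF H'(3) H'(3)] by (simp add: \<theta>(2))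
  then show "x \<in> min_tensor H H \<Longrightarrow> strict_ext (min_tensor H H) (hom_tensor H \<theta> H \<theta>) x = hom_tensor H \<theta> H \<theta> x"
    by (rule strict_ext_unital[OF H'(8) _ 1])
  show "star_hom H (\<lambda>a. hom_tensor H \<theta> H \<theta> (DH a)) bop" by (rule star_hom_comp[OF H'(4) 1])
  show "hom_tensor H \<theta> H \<theta> (\<Sum>k\<in>I. op_tensor (b' k) (c' k)) = (\<Sum>k\<in>I. op_tensor (\<theta> (b' k)) (\<theta> (c' k)))"
    if "\<And>k. k \<in> I \<Longrightarrow> b' k \<in> H" "\<And>k. k \<in> I \<Longrightarrow> c' k \<in> H"
    by (subst star_hom_linear(4)[OF 1 H'(7)]) (simp_all add: that op_tensor_in_min_tensor 2)
qed

text \<open>A unital *-homomorphism preserves the inverse relations entrywise. The comultiplications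
  are not assumed to be related elsewhere, so the formula on the images of the entries is a separate
  premise.\<close>

lemma bicorep_image:
  assumes V: "star_subalgebra V" and F: "star_hom V F V'" "F id_blinfun = id_blinfun"
    and b: "bicorep V D n T T' Z"
    and D': "\<And>i j. i < n \<Longrightarrow> j < n \<Longrightarrow> D' (F (T i j)) = (\<Sum>k<n. op_tensor (F (T i k)) (F (T k j)))"
  shows "bicorep V' D' n (\<lambda>i j. F (T i j)) (\<lambda>i j. F (T' i j)) (\<lambda>i j. F (Z i j))"
proof -
  note V' = star_subalgebraD[OF V] and F' = star_homD[OF F(1)] and T = bicorepD[OF b]
  have F0: "F 0 = 0" using F'(5)[OF V'(2), of 0] by simp
  have Fadd: "F (\<Sum>k\<in>I. f k) = (\<Sum>k\<in>I. F (f k))" if "\<And>k. k \<in> I \<Longrightarrow> f k \<in> V" for I :: "nat set" and f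
    using that by (induction I rule: infinite_finite_induct) (simp_all add: F0 F'(2) cop.subspace_sum[OF V'(11)])
  have s: "(\<Sum>k<n. F (f k) o\<^sub>L F (g k)) = (if P then id_blinfun else 0)"
    if "(\<Sum>k<n. f k o\<^sub>L g k) = (if P then id_blinfun else 0)" "\<And>k. k < n \<Longrightarrow> f k \<in> V" "\<And>k. k < n \<Longrightarrow> g k \<in> V"
    for f g :: "nat \<Rightarrow> _" and P
  proof -
    have "(\<Sum>k<n. F (f k) o\<^sub>L F (g k)) = (\<Sum>k<n. F (f k o\<^sub>L g k))"
      by (intro sum.cong refl) (simp add: F'(3) that(2,3))
    also have "\<dots> = F (\<Sum>k<n. f k o\<^sub>L g k)"
      by (rule Fadd[symmetric]) (simp add: V'(4) that(2,3))
    finally show ?thesis unfolding that(1) by (simp add: F(2) F0)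
  qed
  show ?thesis
    by (rule bicorepI) (assumption | rule F'(1) T(1-3) D' s[OF T(5)] s[OF T(6)] s[OF T(7)] s[OF T(8)])+
qed

section \<open>Admissible corepresentations and almost periodic elements\<close>

lemma admissible_corep_iff:
  "admissible_corep A \<Delta> n T \<longleftrightarrow> (\<exists>T' Z. bicorep (multipliers A) (strict_ext A \<Delta>) n T T' Z)"
proof
  assume a: "admissible_corep A \<Delta> n T"
  then have T: "i < n \<Longrightarrow> j < n \<Longrightarrow> T i j \<in> multipliers A"
    "i < n \<Longrightarrow> j < n \<Longrightarrow> strict_ext A \<Delta> (T i j) = (\<Sum>k<n. op_tensor (T i k) (T k j))" for i j
    by (simp_all only: admissible_corep_def invertible_corep_def)
  have "mat_invertible (multipliers A) n T" "mat_invertible (multipliers A) n (\<lambda>i j. T j i)"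
    using a by (simp_all only: admissible_corep_def invertible_corep_def)
  then obtain T' Z where inv: "\<forall>i<n. \<forall>j<n. T' i j \<in> multipliers A" "\<forall>i<n. \<forall>j<n. Z i j \<in> multipliers A"
    "\<forall>i<n. \<forall>j<n. (\<Sum>k<n. T i k o\<^sub>L T' k j) = (if i = j then id_blinfun else 0) \<and>
      (\<Sum>k<n. T' i k o\<^sub>L T k j) = (if i = j then id_blinfun else 0)"
    "\<forall>i<n. \<forall>j<n. (\<Sum>k<n. T k i o\<^sub>L Z k j) = (if i = j then id_blinfun else 0) \<and>
      (\<Sum>k<n. Z i k o\<^sub>L T j k) = (if i = j then id_blinfun else 0)"
    unfolding mat_invertible_def by (elim exE conjE)
  note inv = inv[rule_format]
  show "\<exists>T' Z. bicorep (multipliers A) (strict_ext A \<Delta>) n T T' Z"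
    by (intro exI, rule bicorepI[of n T _ T' Z])
       (fact T | fact inv(1,2) | fact conjunct1[OF inv(3)] conjunct2[OF inv(3)] conjunct1[OF inv(4)] conjunct2[OF inv(4)])+
next
  assume "\<exists>T' Z. bicorep (multipliers A) (strict_ext A \<Delta>) n T T' Z"
  then obtain T' Z where "bicorep (multipliers A) (strict_ext A \<Delta>) n T T' Z" by (elim exE)
  note T = bicorepD[OF this]
  have "mat_invertible (multipliers A) n T"
    unfolding mat_invertible_def by (intro exI[of _ T'] conjI allI impI T)
  moreover have "mat_invertible (multipliers A) n (\<lambda>i j. T j i)"
    unfolding mat_invertible_def by (intro exI[of _ Z] conjI allI impI T)
  ultimately show "admissible_corep A \<Delta> n T"
    unfolding admissible_corep_def invertible_corep_def by (intro conjI allI impI T)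
qed

lemma AP_E:
  assumes "x \<in> AP A \<Delta>"
  obtains n T T' Z c where "bicorep (multipliers A) (strict_ext A \<Delta>) n T T' Z"
    "x = (\<Sum>i<n. \<Sum>j<n. cscale (c i j) (T i j))"
  using assms unfolding AP_def admissible_corep_iff by blast

lemma AP_I:
  assumes "bicorep (multipliers A) (strict_ext A \<Delta>) n T T' Z"
  shows "(\<Sum>i<n. \<Sum>j<n. cscale (c i j) (T i j)) \<in> AP A \<Delta>"
  using assms unfolding AP_def admissible_corep_iff by blast

lemma bicorep_AP:
  assumes b: "bicorep (multipliers A) (strict_ext A \<Delta>) n T T' Z" and ij: "i < n" "j < n"
  shows "T i j \<in> AP A \<Delta>"
proof -
  have "(\<Sum>k<n. \<Sum>l<n. cscale (if k = i \<and> l = j then 1 else 0) (T k l)) = (\<Sum>k<n. if k = i then T k j else 0)"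
  proof (intro sum.cong refl)
    fix k
    have "(\<Sum>l<n. cscale (if k = i \<and> l = j then 1 else 0) (T k l)) = (\<Sum>l<n. if l = j then (if k = i then T k l else 0) else 0)"
      by (intro sum.cong refl) simp
    then show "(\<Sum>l<n. cscale (if k = i \<and> l = j then 1 else 0) (T k l)) = (if k = i then T k j else 0)"
      using ij by simp
  qed
  also have "\<dots> = T i j" using ij by simp
  finally show ?thesis using AP_I[OF b, of "\<lambda>k l. if k = i \<and> l = j then 1 else 0"] by simp
qed

text \<open>For \<open>Z\<close> this is \<open>transpose_inverse_in\<close>, as adjoints of almost
  periodic elements are almost periodic. For \<open>T'\<close> it is the same fact for the conjugate
  corepresentation, whose transposed inverse has the adjoints of \<open>T'\<close> as
  entries.\<close>

lemma bicorep_AP_inverse: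
  assumes b: "bicorep (multipliers A) (strict_ext A \<Delta>) n T T' Z" and AP: "star_subalgebra (AP A \<Delta>)"
    and uc: "unital_comult (multipliers A) (strict_ext A \<Delta>)"
  shows "bicorep (AP A \<Delta>) (strict_ext A \<Delta>) n T T' Z"
proof -
  interpret unital_comult "multipliers A" "strict_ext A \<Delta>" by fact
  note AP' = star_subalgebraD[OF AP]
  note T = bicorepD[OF b]
  have TAP: "T i j \<in> AP A \<Delta>" if "i < n" "j < n" for i j by (rule bicorep_AP[OF b that])
  have Z: "Z i j \<in> AP A \<Delta>" if "i < n" "j < n" for i j
    by (rule transpose_inverse_in[OF b AP'(11) _ that]) (intro AP'(5) TAP)
  have "adj (T' j i) \<in> AP A \<Delta>" if "i < n" "j < n" for i j
  proof (rule transpose_inverse_in[OF bicorep_adj[OF b] AP'(11) _ that])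
    fix i j assume ij: "i < n" "j < n"
    show "adj (adj (T i j)) \<in> AP A \<Delta>" by (intro AP'(5) TAP ij)
  qed
  then have T': "T' i j \<in> AP A \<Delta>" if "i < n" "j < n" for i j
    using AP'(5)[of "adj (T' i j)"] that adj_adj[OF M'(7)[OF T(2)[OF that]]] by simp
  show ?thesis
    by (rule bicorepI) (assumption | rule TAP T' Z T(4-8))+
qed

section \<open>Compactification\<close>

lemma comult_multipliers:
  assumes "cstar_bialgebra A \<Delta>"
  shows "unital_comult (multipliers A) (strict_ext A \<Delta>)"
proof -
  have A: "cstar_algebra A" "nondeg_hom A \<Delta> (min_tensor A A)"
    using assms by (simp_all only: cstar_bialgebra_def)
  note A' = cstar_algebraD[OF A(1)]
  have D: "star_hom A \<Delta> bop"
    by (rule star_hom_bop[OF _ multipliers_subset_bop], rule conjunct1[OF A(2)[unfolded nondeg_hom_def]])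
  note nd = nondegenerate_comult[OF A]
  show ?thesis
    by unfold_locales (rule star_subalgebra_multipliers[OF A'(1)] closed_multipliers[OF A'(2)] id_in_multipliers
        star_hom_strict_ext[OF A'(1,2) D nd] strict_ext_id[OF A'(1,2) D nd])+
qed

lemma id_in_AP:
  assumes "cstar_bialgebra A \<Delta>"
  shows "id_blinfun \<in> AP A \<Delta>"
proof -
  interpret unital_comult "multipliers A" "strict_ext A \<Delta>" by (rule comult_multipliers[OF assms])
  have "bicorep (multipliers A) (strict_ext A \<Delta>) 1 (\<lambda>_ _. id_blinfun) (\<lambda>_ _. id_blinfun) (\<lambda>_ _. id_blinfun)"
    by (rule bicorepI) (simp_all add: D(2))
  from bicorep_AP[OF this, of 0 0] show ?thesis by simp
qed

lemma AP_subset_multipliers: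
  assumes "star_subalgebra A"
  shows "AP A \<Delta> \<subseteq> multipliers A"
proof
  note M' = star_subalgebraD[OF star_subalgebra_multipliers[OF assms]]
  fix x assume "x \<in> AP A \<Delta>"
  then obtain n T T' Z c where b: "bicorep (multipliers A) (strict_ext A \<Delta>) n T T' Z"
    and x: "x = (\<Sum>i<n. \<Sum>j<n. cscale (c i j) (T i j))"
    by (rule AP_E)
  show "x \<in> multipliers A"
    unfolding x by (intro cop.subspace_sum[OF M'(11)] M'(6) bicorepD(1)[OF b]) simp_all
qed

text \<open>What \<open>AP\<close> and a dense Hopf *-algebra have in common; in this form both are
  fed into the same lemmas on universal envelopes.\<close>

definition spanned_by_bicoreps :: "'i op set \<Rightarrow> ('i op \<Rightarrow> ('i \<times> 'i) op) \<Rightarrow> bool" where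
  "spanned_by_bicoreps P D \<longleftrightarrow> star_subalgebra P \<and> id_blinfun \<in> P \<and>
    (\<forall>p\<in>P. \<exists>n T T' Z c. bicorep P D n T T' Z \<and> p = (\<Sum>i<n. \<Sum>j<n. cscale (c i j) (T i j)))"

lemma spanned_by_bicorepsE:
  assumes "spanned_by_bicoreps P D" "p \<in> P"
  obtains n T T' Z c where "bicorep P D n T T' Z" "p = (\<Sum>i<n. \<Sum>j<n. cscale (c i j) (T i j))"
  using assms(1)[unfolded spanned_by_bicoreps_def, THEN conjunct2, THEN conjunct2, THEN bspec, OF assms(2)]
  by (elim exE conjE)

lemma spanned_by_bicoreps_AP:
  assumes A: "cstar_bialgebra A \<Delta>" and AP: "star_subalgebra (AP A \<Delta>)"
  shows "spanned_by_bicoreps (AP A \<Delta>) (strict_ext A \<Delta>)"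
  unfolding spanned_by_bicoreps_def
proof (intro conjI ballI AP id_in_AP[OF A])
  fix p assume "p \<in> AP A \<Delta>"
  then obtain n T T' Z c where b: "bicorep (multipliers A) (strict_ext A \<Delta>) n T T' Z"
    and p: "p = (\<Sum>i<n. \<Sum>j<n. cscale (c i j) (T i j))"
    by (rule AP_E)
  show "\<exists>n T T' Z c. bicorep (AP A \<Delta>) (strict_ext A \<Delta>) n T T' Z \<and> p = (\<Sum>i<n. \<Sum>j<n. cscale (c i j) (T i j))"
    by (intro exI, rule conjI[OF bicorep_AP_inverse[OF b AP comult_multipliers[OF A]] p])
qed

text \<open>As \<open>B\<close> is unital, the strict extensions in the coassociativity of
  \<open>cstar_bialgebra\<close> are evaluations; applied to a finite decomposition of
  \<open>\<Delta> a\<close>, they give the algebraic form.\<close>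

lemma hopf_algebra_dense_hopf_star_algebra:
  assumes B: "cstar_bialgebra B \<Delta>" "id_blinfun \<in> B" and P: "dense_hopf_star_algebra B \<Delta> P"
  shows "\<exists>\<epsilon> S. hopf_algebra P \<Delta> \<epsilon> S"
proof -
  note P0 = P[unfolded dense_hopf_star_algebra_def]
  note P1 = P0[THEN conjunct1] P0[THEN conjunct2, THEN conjunct1] P0[THEN conjunct2, THEN conjunct2, THEN conjunct1]
    P0[THEN conjunct2, THEN conjunct2, THEN conjunct2, THEN conjunct1]
  from P0 obtain \<epsilon> :: "'a op \<Rightarrow> complex" and S :: "'a op \<Rightarrow> 'a op" where
    S: "\<forall>a\<in>P. S a \<in> P \<and> (\<forall>c. S (cscale c a) = cscale c (S a))"
    and hopf: "\<forall>a\<in>P. \<forall>(n::nat) b c. (\<forall>k<n. b k \<in> P \<and> c k \<in> P) \<and> \<Delta> a = (\<Sum>k<n. op_tensor (b k) (c k)) \<longrightarrow>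
        (\<Sum>k<n. cscale (\<epsilon> (b k)) (c k)) = a \<and> (\<Sum>k<n. cscale (\<epsilon> (c k)) (b k)) = a \<and>
        (\<Sum>k<n. S (b k) o\<^sub>L c k) = cscale (\<epsilon> a) id_blinfun \<and>
        (\<Sum>k<n. b k o\<^sub>L S (c k)) = cscale (\<epsilon> a) id_blinfun"
    by (elim exE conjE)
  note B' = unital_bialgebraD[OF cstar_bialgebra_unital[OF B]]
  have PB: "p \<in> B" if "p \<in> P" for p using closure_subset[of P] that unfolding P1(3) by (rule subsetD)
  have Dbop: "\<Delta> b \<in> bop" if "b \<in> B" for b by (rule star_homD(1)[OF B'(6) that])
  have id: "star_hom B (\<lambda>x. x) bop" using B'(1) by (simp add: star_hom_def star_subalgebra_def subset_iff)
  note L = star_hom_hom_tensor[OF B'(1,2,6) B'(1,2) id] and R = star_hom_hom_tensor[OF B'(1,2) id B'(1,2,6)]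
  note Lt = hom_tensor_op_tensor[OF B'(1,2,6) B'(1,2) id] and Rt = hom_tensor_op_tensor[OF B'(1,2) id B'(1,2,6)]
  have co: "transport (\<lambda>((i, j), k). (i, (j, k))) (hom_tensor B \<Delta> B (\<lambda>x. x) (\<Delta> a)) = hom_tensor B (\<lambda>x. x) B \<Delta> (\<Delta> a)"
    if a: "a \<in> B" for a
  proof -
    have m: "\<Delta> a \<in> min_tensor B B" by (rule star_homD(1)[OF B'(4) a])
    have l: "hom_tensor B \<Delta> B (\<lambda>x. x) id_blinfun = id_blinfun"
      using Lt[OF B'(3) B'(3)] by (simp add: B'(5))
    have r: "hom_tensor B (\<lambda>x. x) B \<Delta> id_blinfun = id_blinfun"
      using Rt[OF B'(3) B'(3)] by (simp add: B'(5))
    note co = B(1)[unfolded cstar_bialgebra_def, THEN conjunct2, THEN conjunct2, THEN bspec, OF a]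
    show ?thesis
      using co unfolding strict_ext_unital[OF B'(8) l L m] strict_ext_unital[OF B'(8) r R m] .
  qed
  have "hopf_algebra P \<Delta> \<epsilon> S"
  proof
    show "star_subalgebra P" by (rule P1)
    show "\<Delta> a \<in> span {op_tensor b c | b c. b \<in> P \<and> c \<in> P}" if "a \<in> P" for a using P1(4) that by (rule bspec)
    show "\<Delta> (adj a) = adj (\<Delta> a)" if "a \<in> P" for a by (rule star_homD(4)[OF B'(4) PB[OF that]])
    show "S a \<in> P" if "a \<in> P" for a by (rule conjunct1[OF bspec[OF S that]])
    show "(\<Sum>k<n. cscale (\<epsilon> (b k)) (c k)) = a \<and> (\<Sum>k<n. cscale (\<epsilon> (c k)) (b k)) = a \<and>
        (\<Sum>k<n. S (b k) o\<^sub>L c k) = cscale (\<epsilon> a) id_blinfun \<and>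
        (\<Sum>k<n. b k o\<^sub>L S (c k)) = cscale (\<epsilon> a) id_blinfun"
      if "a \<in> P" "\<forall>k<n. b k \<in> P \<and> c k \<in> P" "\<Delta> a = (\<Sum>k<n. op_tensor (b k) (c k))" for a b c and n :: nat
      by (rule mp[OF spec[OF spec[OF spec[OF bspec[OF hopf that(1)]]]] conjI[OF that(2,3)]])
    fix a :: "'a op" and I :: "'a op set" and b c
    assume a: "a \<in> P" and I: "finite I" and b: "\<And>k. k \<in> I \<Longrightarrow> b k \<in> P" and c: "\<And>k. k \<in> I \<Longrightarrow> c k \<in> P"
      and eq: "\<Delta> a = (\<Sum>k\<in>I. op_tensor (b k) (c k))"
    have t: "op_tensor (b k) (c k) \<in> min_tensor B B" if "k \<in> I" for k
      by (intro op_tensor_in_min_tensor PB b c that)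
    have "hom_tensor B \<Delta> B (\<lambda>x. x) (\<Delta> a) = (\<Sum>k\<in>I. hom_tensor B \<Delta> B (\<lambda>x. x) (op_tensor (b k) (c k)))"
      unfolding eq by (rule star_hom_linear(4)[OF L B'(7) t])
    also have "\<dots> = (\<Sum>k\<in>I. op_tensor (\<Delta> (b k)) (c k))"
      by (intro sum.cong refl Lt PB b c)
    finally have 1: "hom_tensor B \<Delta> B (\<lambda>x. x) (\<Delta> a) = (\<Sum>k\<in>I. op_tensor (\<Delta> (b k)) (c k))" .
    have "hom_tensor B (\<lambda>x. x) B \<Delta> (\<Delta> a) = (\<Sum>k\<in>I. hom_tensor B (\<lambda>x. x) B \<Delta> (op_tensor (b k) (c k)))"
      unfolding eq by (rule star_hom_linear(4)[OF R B'(7) t])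
    also have "\<dots> = (\<Sum>k\<in>I. op_tensor (b k) (\<Delta> (c k)))"
      by (intro sum.cong refl Rt PB b c)
    finally have 2: "hom_tensor B (\<lambda>x. x) B \<Delta> (\<Delta> a) = (\<Sum>k\<in>I. op_tensor (b k) (\<Delta> (c k)))" .
    show "(\<Sum>k\<in>I. transport (\<lambda>((i, j), k). (i, (j, k))) (op_tensor (\<Delta> (b k)) (c k)))
        = (\<Sum>k\<in>I. op_tensor (b k) (\<Delta> (c k)))"
      using co[OF PB[OF a]] unfolding 1 2 transport_sum .
  qed
  then show ?thesis by (intro exI)
qed

lemma spanned_by_bicoreps_dense_hopf_star_algebra:
  assumes B: "cstar_bialgebra B \<Delta>" "id_blinfun \<in> B" and P: "dense_hopf_star_algebra B \<Delta> P"
  shows "spanned_by_bicoreps P \<Delta>"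
proof -
  obtain \<epsilon> S where h: "hopf_algebra P \<Delta> \<epsilon> S"
    using hopf_algebra_dense_hopf_star_algebra[OF assms] by (elim exE)
  have "star_subalgebra P" "id_blinfun \<in> P" using P by (simp_all only: dense_hopf_star_algebra_def)
  then show ?thesis unfolding spanned_by_bicoreps_def by (intro conjI ballI hopf_algebra.ex_bicorep[OF h])
qed


section \<open>Hopf homomorphisms of universal quantum groups\<close>

lemma universal_cqg_bicorep:
  assumes u: "universal_cqg P D C \<iota> DC" and i: "id_blinfun \<in> P" and b: "bicorep P D n T T' Z"
  shows "bicorep C DC n (\<lambda>i j. \<iota> (T i j)) (\<lambda>i j. \<iota> (T' i j)) (\<lambda>i j. \<iota> (Z i j))"
proof (rule bicorep_image[OF _ _ _ b])
  note u' = universal_cqgD[OF u i]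
  show "star_subalgebra P" "star_hom P \<iota> C" "\<iota> id_blinfun = id_blinfun" by (rule u')+
  show "DC (\<iota> (T i j)) = (\<Sum>k<n. op_tensor (\<iota> (T i k)) (\<iota> (T k j)))" if "i < n" "j < n" for i j
    by (rule u'(6)[OF that bicorepD(1)[OF b] bicorepD(4)[OF b that]])
qed

lemma universal_cqg_coef:
  assumes u: "universal_cqg P D C \<iota> DC" and P: "spanned_by_bicoreps P D" and x: "x \<in> \<iota> ` P"
  obtains n T T' Z c where "bicorep P D n T T' Z" "x = (\<Sum>i<n. \<Sum>j<n. cscale (c i j) (\<iota> (T i j)))"
proof -
  have P': "star_subalgebra P" "id_blinfun \<in> P" using P by (simp_all only: spanned_by_bicoreps_def)
  from x obtain p where p: "x = \<iota> p" "p \<in> P" by (rule imageE)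
  obtain n T T' Z c where b: "bicorep P D n T T' Z" and pp: "p = (\<Sum>i<n. \<Sum>j<n. cscale (c i j) (T i j))"
    by (rule spanned_by_bicorepsE[OF P p(2)])
  have "x = (\<Sum>i<n. \<Sum>j<n. cscale (c i j) (\<iota> (T i j)))"
    unfolding p(1) pp by (rule star_hom_coef[OF P'(1) universal_cqgD(2)[OF u P'(2)] bicorepD(1)[OF b]])
  from that[OF b this] show ?thesis .
qed

text \<open>Both sides of the Hopf condition are *-homomorphisms on \<open>H\<close>, hence
  continuous, so they have to be compared only on entries of corepresentations, whose span is
  dense.\<close>

lemma hopf_hom_universal_cqg:
  assumes u: "universal_cqg P D H \<iota> DH" and P: "spanned_by_bicoreps P D"
    and B: "star_subalgebra B" "closed B" and E: "star_hom (multipliers B) (strict_ext B DB) bop"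
    and \<theta>: "star_hom H \<theta> (multipliers B)" "\<theta> id_blinfun = id_blinfun"
    and eq: "\<And>n T T' Z i j. bicorep P D n T T' Z \<Longrightarrow> i < n \<Longrightarrow> j < n \<Longrightarrow>
      strict_ext B DB (\<theta> (\<iota> (T i j))) = (\<Sum>k<n. op_tensor (\<theta> (\<iota> (T i k))) (\<theta> (\<iota> (T k j))))"
  shows "hopf_hom H DH B DB \<theta>"
proof -
  have P': "star_subalgebra P" "id_blinfun \<in> P" using P by (simp_all only: spanned_by_bicoreps_def)
  note u' = universal_cqgD[OF u P'(2)]
  note H = unital_bialgebraD[OF u'(5)]
  note \<theta>' = star_hom_bop[OF \<theta>(1) multipliers_subset_bop]
  note ht = hom_tensor_unital[OF u'(5) \<theta>' \<theta>(2)]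
  have "strict_ext B DB (\<theta> a) = hom_tensor H \<theta> H \<theta> (DH a)" if a: "a \<in> H" for a
  proof (rule star_hom_eq_closure[OF H(1,2) star_hom_comp[OF \<theta>(1) E] ht(4) u'(3) _ a])
    fix x assume "x \<in> \<iota> ` P"
    then obtain n T T' Z c where b: "bicorep P D n T T' Z" and x: "x = (\<Sum>i<n. \<Sum>j<n. cscale (c i j) (\<iota> (T i j)))"
      by (rule universal_cqg_coef[OF u P])
    have T: "\<iota> (T i j) \<in> H" if "i < n" "j < n" for i j by (rule bicorepD(1)[OF universal_cqg_bicorep[OF u P'(2) b] that])
    show "strict_ext B DB (\<theta> x) = hom_tensor H \<theta> H \<theta> (DH x)"
    proof (rule star_hom_eq_coef[OF H(1) star_hom_comp[OF \<theta>(1) E] ht(4) T _ x])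
      fix i j assume ij: "i < n" "j < n"
      have "DH (\<iota> (T i j)) = (\<Sum>k<n. op_tensor (\<iota> (T i k)) (\<iota> (T k j)))"
        by (rule bicorepD(4)[OF universal_cqg_bicorep[OF u P'(2) b] ij])
      moreover have "hom_tensor H \<theta> H \<theta> (\<Sum>k<n. op_tensor (\<iota> (T i k)) (\<iota> (T k j)))
        = (\<Sum>k<n. op_tensor (\<theta> (\<iota> (T i k))) (\<theta> (\<iota> (T k j))))"
        by (rule ht(5)) (simp_all add: T ij)
      ultimately show "strict_ext B DB (\<theta> (\<iota> (T i j))) = hom_tensor H \<theta> H \<theta> (DH (\<iota> (T i j)))"
        by (simp only: eq[OF b ij])
    qed
  qed
  then have "strict_ext B DB (\<theta> a) = strict_ext (min_tensor H H) (hom_tensor H \<theta> H \<theta>) (DH a)" if "a \<in> H" for a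
    using that by (simp only: ht(3)[OF star_homD(1)[OF H(4) that]])
  with nondeg_hom_unital[OF \<theta>(1) H(3) \<theta>(2) B] show ?thesis by (simp add: hopf_hom_def)
qed

lemma hopf_hom_bicorep:
  assumes H: "unital_bialgebra H DH" and \<theta>: "hopf_hom H DH B DB \<theta>" "\<theta> id_blinfun = id_blinfun"
    and b: "bicorep H DH n T T' Z"
  shows "bicorep (multipliers B) (strict_ext B DB) n (\<lambda>i j. \<theta> (T i j)) (\<lambda>i j. \<theta> (T' i j)) (\<lambda>i j. \<theta> (Z i j))"
proof -
  note H' = unital_bialgebraD[OF H]
  have hom: "star_hom H \<theta> (multipliers B)"
    and eq: "\<And>a. a \<in> H \<Longrightarrow> strict_ext B DB (\<theta> a) = strict_ext (min_tensor H H) (hom_tensor H \<theta> H \<theta>) (DH a)"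
    using \<theta>(1) by (simp_all only: hopf_hom_def nondeg_hom_def)
  note \<theta>' = star_hom_bop[OF hom multipliers_subset_bop]
  note ht = hom_tensor_unital[OF H \<theta>' \<theta>(2)]
  note T = bicorepD[OF b]
  show ?thesis
  proof (rule bicorep_image[OF H'(1) hom \<theta>(2) b])
    fix i j assume ij: "i < n" "j < n"
    have "strict_ext B DB (\<theta> (T i j)) = hom_tensor H \<theta> H \<theta> (DH (T i j))"
      unfolding eq[OF T(1)[OF ij]] by (rule ht(3)[OF star_homD(1)[OF H'(4) T(1)[OF ij]]])
    also have "\<dots> = hom_tensor H \<theta> H \<theta> (\<Sum>k<n. op_tensor (T i k) (T k j))"
      by (simp only: T(4)[OF ij])
    also have "\<dots> = (\<Sum>k<n. op_tensor (\<theta> (T i k)) (\<theta> (T k j)))"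
      by (rule ht(5)) (simp_all add: T(1) ij)
    finally show "strict_ext B DB (\<theta> (T i j)) = (\<Sum>k<n. op_tensor (\<theta> (T i k)) (\<theta> (T k j)))" .
  qed
qed

text \<open>\<open>X\<close> is an arbitrary corepresentation of the universal algebra, with no
  given relation to \<open>P\<close>; averaging over products of \<open>X\<close> with
  corepresentations from \<open>P\<close> locates its entries.\<close>

lemma universal_cqg_corep_in_dense:
  assumes u: "universal_cqg P D C \<iota> DC" and P: "spanned_by_bicoreps P D"
    and X: "bicorep C DC m X X' XZ" and ij: "i < m" "j < m"
  shows "X i j \<in> \<iota> ` P"
proof -
  have P': "star_subalgebra P" "id_blinfun \<in> P" using P by (simp_all only: spanned_by_bicoreps_def)
  note u' = universal_cqgD[OF u P'(2)]
  note C = unital_bialgebraD[OF u'(5)]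
  interpret unital_comult C DC by (rule unital_bialgebra_comult[OF u'(5)])
  note \<iota>P = star_subalgebra_image[OF P'(1) star_hom_bop[OF u'(2) star_subalgebraD(1)[OF C(1)]]]
  show ?thesis
  proof (rule corep_in_dense[OF X star_subalgebraD(11)[OF \<iota>P] _ _ _ ij])
    show "\<iota> ` P \<subseteq> C" using star_homD(1)[OF u'(2)] by (rule image_subsetI)
    show "C \<subseteq> closure (\<iota> ` P)" unfolding u'(3) ..
    fix F assume "F \<in> \<iota> ` P"
    then obtain n T T' Z c where b: "bicorep P D n T T' Z" and F: "F = (\<Sum>i<n. \<Sum>j<n. cscale (c i j) (\<iota> (T i j)))"
      by (rule universal_cqg_coef[OF u P])
    have hom: "star_hom P \<iota> (\<iota> ` P)" using u'(2) by (simp add: star_hom_def)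
    have "bicorep (\<iota> ` P) DC n (\<lambda>i j. \<iota> (T i j)) (\<lambda>i j. \<iota> (T' i j)) (\<lambda>i j. \<iota> (Z i j))"
    proof (rule bicorep_image[OF P'(1) hom u'(4) b])
      show "DC (\<iota> (T i j)) = (\<Sum>k<n. op_tensor (\<iota> (T i k)) (\<iota> (T k j)))" if "i < n" "j < n" for i j
        by (rule bicorepD(4)[OF universal_cqg_bicorep[OF u P'(2) b] that])
    qed
    then show "\<exists>n Y Y' YZ c. bicorep (\<iota> ` P) DC n Y Y' YZ \<and> F = (\<Sum>r<n. \<Sum>l<n. cscale (c r l) (Y r l))"
      by (intro exI, rule conjI[OF _ F])
  qed
qed


text \<open>On the entries \<open>\<iota> (T i j)\<close> the map \<open>\<Lambda>\<close> returns
  \<open>T i j\<close>, so the Hopf condition is the corepresentation identity in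
  \<open>multipliers A\<close>.\<close>

lemma hopf_hom_compactification:
  assumes A: "cstar_bialgebra A \<Delta>" and u: "universal_cqg (AP A \<Delta>) (strict_ext A \<Delta>) K \<iota> \<Delta>K"
    and \<Lambda>: "star_hom K \<Lambda> (AP_closure A \<Delta>)" "\<And>a. a \<in> AP A \<Delta> \<Longrightarrow> \<Lambda> (\<iota> a) = a"
  shows "hopf_hom K \<Delta>K A \<Delta> \<Lambda>"
proof -
  have A': "star_subalgebra A" "closed A"
    by (rule cstar_algebraD[OF conjunct1[OF A[unfolded cstar_bialgebra_def]]])+
  note id = id_in_AP[OF A]
  note u' = universal_cqgD[OF u id]
  interpret M: unital_comult "multipliers A" "strict_ext A \<Delta>" by (rule comult_multipliers[OF A])
  have "AP_closure A \<Delta> \<subseteq> multipliers A"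
    unfolding AP_closure_def by (rule closure_minimal[OF AP_subset_multipliers[OF A'(1)] M.M(2)])
  then have hom: "star_hom K \<Lambda> (multipliers A)" by (rule star_hom_mono[OF \<Lambda>(1) subset_refl])
  show ?thesis
  proof (rule hopf_hom_universal_cqg[OF u spanned_by_bicoreps_AP[OF A u'(1)] A' M.D(1) hom])
    show "\<Lambda> id_blinfun = id_blinfun" using \<Lambda>(2)[OF id] by (simp only: u'(4))
    fix n T T' Z i j assume b: "bicorep (AP A \<Delta>) (strict_ext A \<Delta>) n T T' Z" and ij: "i < n" "j < n"
    have "(\<Sum>k<n. op_tensor (T i k) (T k j)) = (\<Sum>k<n. op_tensor (\<Lambda> (\<iota> (T i k))) (\<Lambda> (\<iota> (T k j))))"
      by (intro sum.cong refl) (simp add: \<Lambda>(2)[OF bicorepD(1)[OF b]] ij)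
    then show "strict_ext A \<Delta> (\<Lambda> (\<iota> (T i j))) = (\<Sum>k<n. op_tensor (\<Lambda> (\<iota> (T i k))) (\<Lambda> (\<iota> (T k j))))"
      by (simp only: \<Lambda>(2)[OF bicorepD(1)[OF b ij]] bicorepD(4)[OF b ij])
  qed
qed

text \<open>\<open>\<theta>\<close> carries both inverse matrices along, so the image of a
  corepresentation over \<open>P\<close> is admissible.\<close>

lemma hopf_hom_bicorep_AP:
  assumes A: "cstar_bialgebra A \<Delta>" and AP: "star_subalgebra (AP A \<Delta>)"
    and u: "universal_cqg P D H \<iota> \<Delta>H" and P: "spanned_by_bicoreps P D" and \<theta>: "hopf_hom H \<Delta>H A \<Delta> \<theta>"
  shows "\<theta> id_blinfun = id_blinfun"
    and "bicorep P D n T T' Z \<Longrightarrow> bicorep (AP A \<Delta>) (strict_ext A \<Delta>) n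
      (\<lambda>i j. \<theta> (\<iota> (T i j))) (\<lambda>i j. \<theta> (\<iota> (T' i j))) (\<lambda>i j. \<theta> (\<iota> (Z i j)))"
    and "star_hom P (\<lambda>p. \<theta> (\<iota> p)) (AP A \<Delta>)"
proof -
  have P': "star_subalgebra P" "id_blinfun \<in> P" using P by (simp_all only: spanned_by_bicoreps_def)
  note u' = universal_cqgD[OF u P'(2)]
  note H = unital_bialgebraD[OF u'(5)]
  have nd: "nondeg_hom H \<theta> A" using \<theta> by (simp only: hopf_hom_def)
  have "cstar_algebra A" using A by (simp only: cstar_bialgebra_def)
  show id: "\<theta> id_blinfun = id_blinfun"
    by (rule nondeg_hom_id[OF nd H(3) cstar_algebraD(3)[OF \<open>cstar_algebra A\<close>]])
  show b': "bicorep (AP A \<Delta>) (strict_ext A \<Delta>) n (\<lambda>i j. \<theta> (\<iota> (T i j))) (\<lambda>i j. \<theta> (\<iota> (T' i j))) (\<lambda>i j. \<theta> (\<iota> (Z i j)))"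
    if b: "bicorep P D n T T' Z" for n T T' Z
    by (rule bicorep_AP_inverse[OF hopf_hom_bicorep[OF u'(5) \<theta> id universal_cqg_bicorep[OF u P'(2) b]]
          AP comult_multipliers[OF A]])
  have hom: "star_hom P (\<lambda>p. \<theta> (\<iota> p)) (multipliers A)"
    by (rule star_hom_comp[OF u'(2) conjunct1[OF nd[unfolded nondeg_hom_def]]])
  have "\<theta> (\<iota> p) \<in> AP A \<Delta>" if p: "p \<in> P" for p
  proof -
    obtain n T T' Z c where b: "bicorep P D n T T' Z" and p: "p = (\<Sum>i<n. \<Sum>j<n. cscale (c i j) (T i j))"
      by (rule spanned_by_bicorepsE[OF P p])
    have "\<theta> (\<iota> p) = (\<Sum>i<n. \<Sum>j<n. cscale (c i j) (\<theta> (\<iota> (T i j))))"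
      unfolding p by (rule star_hom_coef[OF P'(1) hom bicorepD(1)[OF b]])
    also have "\<dots> \<in> AP A \<Delta>"
      by (intro cop.subspace_sum[OF star_subalgebraD(11)[OF AP]] star_subalgebraD(6)[OF AP] bicorepD(1)[OF b'[OF b]]) simp_all
    finally show ?thesis .
  qed
  then show "star_hom P (\<lambda>p. \<theta> (\<iota> p)) (AP A \<Delta>)" using hom by (simp add: star_hom_def)
qed

lemma ex_compactification_factor:
  assumes A: "cstar_bialgebra A \<Delta>" and uK: "universal_cqg (AP A \<Delta>) (strict_ext A \<Delta>) K \<iota>K \<Delta>K"
    and \<Lambda>: "star_hom K \<Lambda> bop" "\<And>a. a \<in> AP A \<Delta> \<Longrightarrow> \<Lambda> (\<iota>K a) = a"
    and u: "universal_cqg P D H \<iota> \<Delta>H" and P: "spanned_by_bicoreps P D" and \<theta>: "hopf_hom H \<Delta>H A \<Delta> \<theta>"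
  shows "\<exists>\<theta>1. \<theta>1 \<in> extensional H \<and> hopf_hom H \<Delta>H K \<Delta>K \<theta>1 \<and> (\<forall>h\<in>H. \<theta> h = \<Lambda> (\<theta>1 h))"
proof -
  have P': "star_subalgebra P" "id_blinfun \<in> P" using P by (simp_all only: spanned_by_bicoreps_def)
  note u' = universal_cqgD[OF u P'(2)] and uK' = universal_cqgD[OF uK id_in_AP[OF A]]
  note H = unital_bialgebraD[OF u'(5)] and K = unital_bialgebraD[OF uK'(5)]
  note t = hopf_hom_bicorep_AP[OF A uK'(1) u P \<theta>]
  have thom: "star_hom H \<theta> (multipliers A)" using \<theta> by (simp only: hopf_hom_def nondeg_hom_def)
  have g: "star_hom P (\<lambda>p. \<iota>K (\<theta> (\<iota> p))) K" by (rule star_hom_comp[OF t(3) uK'(2)])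
  have gbop: "\<iota>K (\<theta> (\<iota> p)) \<in> bop" if "p \<in> P" for p
    by (rule star_subalgebraD(7)[OF K(1) star_homD(1)[OF g that]])
  \<comment> \<open>Here the universality of \<open>H\<close> is used: the norm of the prescribed
    value is a C*-seminorm on \<open>P\<close>, hence bounded by the norm in
    \<open>H\<close>.\<close>
  have "cstar_seminorm P (\<lambda>p. norm (\<iota>K (\<theta> (\<iota> p))))"
    unfolding cstar_seminorm_def
  proof (intro conjI ballI allI norm_ge_zero)
    note g' = star_homD[OF g]
    fix a b c assume a: "a \<in> P"
    show "norm (\<iota>K (\<theta> (\<iota> (adj a o\<^sub>L a)))) = (norm (\<iota>K (\<theta> (\<iota> a))))\<^sup>2"
      by (simp only: g'(3)[OF star_subalgebraD(5)[OF P'(1) a] a] g'(4)[OF a] norm_adj_comp[OF gbop[OF a]])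
    show "norm (\<iota>K (\<theta> (\<iota> (cscale c a)))) = cmod c * norm (\<iota>K (\<theta> (\<iota> a)))"
      by (simp only: g'(5)[OF a] norm_cscale)
    assume b: "b \<in> P"
    show "norm (\<iota>K (\<theta> (\<iota> (a + b)))) \<le> norm (\<iota>K (\<theta> (\<iota> a))) + norm (\<iota>K (\<theta> (\<iota> b)))"
      unfolding g'(2)[OF a b] by (rule norm_triangle_ineq)
    show "norm (\<iota>K (\<theta> (\<iota> (a o\<^sub>L b)))) \<le> norm (\<iota>K (\<theta> (\<iota> a))) * norm (\<iota>K (\<theta> (\<iota> b)))"
      unfolding g'(3)[OF a b] by (rule norm_blinfun_compose)
  qed
  note le = u'(7)[OF this]
  note \<iota>P = star_subalgebra_image[OF P'(1) star_hom_bop[OF u'(2) star_subalgebraD(1)[OF H(1)]]]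
  have sub: "\<iota> ` P \<subseteq> H" using star_homD(1)[OF u'(2)] by (rule image_subsetI)
  \<comment> \<open>The factor is prescribed on elements of \<open>H\<close> as
    \<open>\<iota>K (\<theta> x)\<close>, and not on \<open>P\<close>, so it is well defined even if
    \<open>\<iota>\<close> identifies elements of \<open>P\<close>.\<close>
  have "star_hom (\<iota> ` P) \<theta> (AP A \<Delta>)"
  proof -
    have "\<theta> x \<in> AP A \<Delta>" if "x \<in> \<iota> ` P" for x using that star_homD(1)[OF t(3)] by (elim imageE) simp
    moreover have "star_hom (\<iota> ` P) \<theta> (multipliers A)" by (rule star_hom_mono[OF thom sub subset_refl])
    ultimately show ?thesis by (simp add: star_hom_def)
  qed
  note h = star_hom_comp[OF this uK'(2)]
  have "\<exists>\<Phi>. \<Phi> \<in> extensional (closure (\<iota> ` P)) \<and>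
    star_hom (closure (\<iota> ` P)) \<Phi> (closure ((\<lambda>x. \<iota>K (\<theta> x)) ` \<iota> ` P)) \<and> (\<forall>x\<in>\<iota> ` P. \<Phi> x = \<iota>K (\<theta> x))"
  proof (rule star_hom_extends[OF \<iota>P star_hom_bop[OF h star_subalgebraD(1)[OF K(1)]]])
    fix x assume "x \<in> \<iota> ` P"
    then show "norm (\<iota>K (\<theta> x)) \<le> norm x" using le by (elim imageE) simp
  qed
  then obtain \<theta>1 where 1: "\<theta>1 \<in> extensional H" "star_hom H \<theta>1 (closure ((\<lambda>x. \<iota>K (\<theta> x)) ` \<iota> ` P))"
    "\<forall>x\<in>\<iota> ` P. \<theta>1 x = \<iota>K (\<theta> x)"
    unfolding u'(3) by (elim exE conjE)
  have eq: "\<theta>1 (\<iota> p) = \<iota>K (\<theta> (\<iota> p))" if "p \<in> P" for p using 1(3) that by simp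
  have "closure ((\<lambda>x. \<iota>K (\<theta> x)) ` \<iota> ` P) \<subseteq> K"
    by (rule closure_minimal[OF image_subsetI[OF star_homD(1)[OF h]] K(2)])
  from star_hom_mono[OF 1(2) subset_refl this] have hom: "star_hom H \<theta>1 K" .
  then have hom': "star_hom H \<theta>1 (multipliers K)" by (simp only: K(9))
  have ext: "strict_ext K \<Delta>K m = \<Delta>K m" if "m \<in> K" for m
    by (rule strict_ext_unital[OF K(3,5,6) that])
  have E: "star_hom (multipliers K) (strict_ext K \<Delta>K) bop"
    using K(6) star_subalgebraD(3-6)[OF K(1)] by (simp add: K(9) star_hom_def ext)
  have "hopf_hom H \<Delta>H K \<Delta>K \<theta>1"
  proof (rule hopf_hom_universal_cqg[OF u P K(1,2) E hom'])
    show "\<theta>1 id_blinfun = id_blinfun" using eq[OF P'(2)] by (simp only: u'(4) t(1) uK'(4))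
    fix n T T' Z i j assume b: "bicorep P D n T T' Z" and ij: "i < n" "j < n"
    note c = bicorepD(1,4)[OF universal_cqg_bicorep[OF uK id_in_AP[OF A] t(2)[OF b]]]
    have T: "\<theta>1 (\<iota> (T i j)) = \<iota>K (\<theta> (\<iota> (T i j)))" if "i < n" "j < n" for i j by (rule eq[OF bicorepD(1)[OF b that]])
    have "(\<Sum>k<n. op_tensor (\<theta>1 (\<iota> (T i k))) (\<theta>1 (\<iota> (T k j))))
      = (\<Sum>k<n. op_tensor (\<iota>K (\<theta> (\<iota> (T i k)))) (\<iota>K (\<theta> (\<iota> (T k j)))))"
      by (intro sum.cong refl) (simp add: T ij)
    then show "strict_ext K \<Delta>K (\<theta>1 (\<iota> (T i j))) = (\<Sum>k<n. op_tensor (\<theta>1 (\<iota> (T i k))) (\<theta>1 (\<iota> (T k j))))"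
      by (simp only: T[OF ij] ext[OF c(1)[OF ij]] c(2)[OF ij])
  qed
  moreover have "\<theta> h = \<Lambda> (\<theta>1 h)" if h: "h \<in> H" for h
  proof (rule star_hom_eq_closure[OF H(1,2) star_hom_bop[OF thom multipliers_subset_bop] star_hom_comp[OF hom \<Lambda>(1)] u'(3) _ h])
    fix x assume "x \<in> \<iota> ` P"
    then obtain p where p: "x = \<iota> p" "p \<in> P" by (rule imageE)
    show "\<theta> x = \<Lambda> (\<theta>1 x)" unfolding p(1) eq[OF p(2)] by (rule \<Lambda>(2)[OF star_homD(1)[OF t(3) p(2)], symmetric])
  qed
  ultimately show ?thesis using 1(1) by (intro exI conjI ballI)
qed

lemma compactification_factor_unique:
  assumes A: "cstar_bialgebra A \<Delta>" and uK: "universal_cqg (AP A \<Delta>) (strict_ext A \<Delta>) K \<iota>K \<Delta>K"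
    and \<Lambda>: "\<And>a. a \<in> AP A \<Delta> \<Longrightarrow> \<Lambda> (\<iota>K a) = a"
    and u: "universal_cqg P D H \<iota> \<Delta>H" and P: "spanned_by_bicoreps P D"
    and \<theta>1: "\<theta>1 \<in> extensional H" "hopf_hom H \<Delta>H K \<Delta>K \<theta>1" "\<And>h. h \<in> H \<Longrightarrow> \<theta> h = \<Lambda> (\<theta>1 h)"
    and \<theta>2: "\<theta>2 \<in> extensional H" "hopf_hom H \<Delta>H K \<Delta>K \<theta>2" "\<And>h. h \<in> H \<Longrightarrow> \<theta> h = \<Lambda> (\<theta>2 h)"
  shows "\<theta>1 = \<theta>2"
proof -
  have P': "star_subalgebra P" "id_blinfun \<in> P" using P by (simp_all only: spanned_by_bicoreps_def)
  note u' = universal_cqgD[OF u P'(2)] and uK' = universal_cqgD[OF uK id_in_AP[OF A]]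
  note H = unital_bialgebraD[OF u'(5)] and K = unital_bialgebraD[OF uK'(5)]
  note AP = spanned_by_bicoreps_AP[OF A uK'(1)]
  \<comment> \<open>Any factor is forced on the dense image of \<open>P\<close>; two factors then
    agree on \<open>H\<close> by continuity.\<close>
  have *: "star_hom H \<rho> K \<and> (\<forall>x\<in>\<iota> ` P. \<rho> x = \<iota>K (\<theta> x))"
    if \<rho>: "hopf_hom H \<Delta>H K \<Delta>K \<rho>" "\<And>h. h \<in> H \<Longrightarrow> \<theta> h = \<Lambda> (\<rho> h)" for \<rho>
  proof (intro conjI ballI)
    have nd: "nondeg_hom H \<rho> K" using \<rho>(1) by (simp only: hopf_hom_def)
    then show hom: "star_hom H \<rho> K" by (simp only: nondeg_hom_def K(9))
    have id: "\<rho> id_blinfun = id_blinfun" by (rule nondeg_hom_id[OF nd H(3) nondegenerate_unital[OF K(3)]])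
    fix x assume "x \<in> \<iota> ` P"
    then obtain n T T' Z c where b: "bicorep P D n T T' Z" and x: "x = (\<Sum>i<n. \<Sum>j<n. cscale (c i j) (\<iota> (T i j)))"
      by (rule universal_cqg_coef[OF u P])
    note b' = hopf_hom_bicorep[OF u'(5) \<rho>(1) id universal_cqg_bicorep[OF u P'(2) b]]
    have bK: "bicorep K \<Delta>K n (\<lambda>i j. \<rho> (\<iota> (T i j))) (\<lambda>i j. \<rho> (\<iota> (T' i j))) (\<lambda>i j. \<rho> (\<iota> (Z i j)))"
    proof (rule bicorepI)
      note r = bicorepD[OF b', unfolded K(9)]
      fix i j assume ij: "i < n" "j < n"
      show "\<Delta>K (\<rho> (\<iota> (T i j))) = (\<Sum>k<n. op_tensor (\<rho> (\<iota> (T i k))) (\<rho> (\<iota> (T k j))))"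
        unfolding r(4)[OF ij, symmetric] by (rule strict_ext_unital[OF K(3,5,6) r(1)[OF ij], symmetric])
    qed (rule bicorepD[OF b', unfolded K(9)]; assumption)+
    have T: "\<iota> (T i j) \<in> H" if "i < n" "j < n" for i j by (rule star_homD(1)[OF u'(2) bicorepD(1)[OF b that]])
    have TAP: "\<rho> (\<iota> (T i j)) \<in> \<iota>K ` AP A \<Delta>" if "i < n" "j < n" for i j
      by (rule universal_cqg_corep_in_dense[OF uK AP bK that])
    have \<rho>x: "\<rho> x = (\<Sum>i<n. \<Sum>j<n. cscale (c i j) (\<rho> (\<iota> (T i j))))"
      unfolding x by (rule star_hom_coef[OF H(1) hom T])
    note \<iota>K = star_subalgebra_image[OF uK'(1) star_hom_bop[OF uK'(2) star_subalgebraD(1)[OF K(1)]]]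
    have "\<rho> x \<in> \<iota>K ` AP A \<Delta>"
      unfolding \<rho>x by (intro cop.subspace_sum[OF star_subalgebraD(11)[OF \<iota>K]] star_subalgebraD(6)[OF \<iota>K] TAP) simp_all
    then obtain a where a: "\<rho> x = \<iota>K a" "a \<in> AP A \<Delta>" by (rule imageE)
    have "x \<in> H" using \<open>x \<in> \<iota> ` P\<close> star_homD(1)[OF u'(2)] by (elim imageE) simp
    \<comment> \<open>\<open>\<Lambda>\<close> is evaluated only now that \<open>\<rho> x\<close> is
      known to be \<open>\<iota>K a\<close> with \<open>a\<close> in \<open>AP\<close>; elsewhere on
      \<open>K\<close> it may have a kernel.\<close>
    then have "\<theta> x = a" unfolding \<rho>(2)[OF \<open>x \<in> H\<close>] a(1) by (intro \<Lambda> a(2))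
    then show "\<rho> x = \<iota>K (\<theta> x)" by (simp only: a(1))
  qed
  note 1 = *[OF \<theta>1(2,3)] and 2 = *[OF \<theta>2(2,3)]
  show ?thesis
  proof (rule extensionalityI[OF \<theta>1(1) \<theta>2(1)])
    fix h assume h: "h \<in> H"
    note bop = star_hom_bop[OF conjunct1[OF 1] star_subalgebraD(1)[OF K(1)]]
      star_hom_bop[OF conjunct1[OF 2] star_subalgebraD(1)[OF K(1)]]
    show "\<theta>1 h = \<theta>2 h"
    proof (rule star_hom_eq_closure[OF H(1,2) bop u'(3) _ h])
      show "\<theta>1 x = \<theta>2 x" if "x \<in> \<iota> ` P" for x
        by (rule trans[OF bspec[OF conjunct2[OF 1] that] bspec[OF conjunct2[OF 2] that, symmetric]])
    qed
  qed
qed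

text \<open>A compact quantum group is presented by any C*-algebraic form \<open>B\<close> with
  dense Hopf *-algebra \<open>P\<close>, and \<open>H\<close> is its universal algebra.
  Homomorphisms are total functions here, whence \<open>extensional H\<close> in the uniqueness
  claim.\<close>

theorem proposition3p4:
  fixes G :: "'x qgroup"
    and A :: "'u op set" and \<Delta> :: "'u op \<Rightarrow> ('u \<times> 'u) op"
    and K :: "'k op set" and \<Delta>K :: "'k op \<Rightarrow> ('k \<times> 'k) op"
    and \<iota>K :: "'u op \<Rightarrow> 'k op" and \<Lambda> :: "'k op \<Rightarrow> 'u op"
  assumes "lcqg G"
    and "universal_C0 G A \<Delta>"
    and "universal_cqg (AP A \<Delta>) (strict_ext A \<Delta>) K \<iota>K \<Delta>K"
    and "star_hom K \<Lambda> (AP_closure A \<Delta>)" and "\<forall>a\<in>AP A \<Delta>. \<Lambda> (\<iota>K a) = a"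
  shows "hopf_hom K \<Delta>K A \<Delta> \<Lambda> \<and>
    (\<forall>(B :: 'b op set) \<Delta>B P (H :: 'h op set) \<iota>H \<Delta>H \<theta>.
      cqg B \<Delta>B \<and> dense_hopf_star_algebra B \<Delta>B P \<and> universal_cqg P \<Delta>B H \<iota>H \<Delta>H \<and>
      hopf_hom H \<Delta>H A \<Delta> \<theta> \<longrightarrow>
      (\<exists>!\<theta>1. \<theta>1 \<in> extensional H \<and> hopf_hom H \<Delta>H K \<Delta>K \<theta>1 \<and> (\<forall>h\<in>H. \<theta> h = \<Lambda> (\<theta>1 h))))"
proof (intro conjI allI impI)
  have A: "cstar_bialgebra A \<Delta>" using assms(2) by (simp only: universal_C0_def)
  note uK = assms(3) and \<Lambda> = bspec[OF assms(5)]
  show "hopf_hom K \<Delta>K A \<Delta> \<Lambda>" by (rule hopf_hom_compactification[OF A uK assms(4) \<Lambda>])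
  then have "star_hom K \<Lambda> (multipliers A)" by (simp only: hopf_hom_def nondeg_hom_def)
  note \<Lambda>bop = star_hom_bop[OF this multipliers_subset_bop]
  fix B :: "'b op set" and \<Delta>B P and H :: "'h op set" and \<iota>H \<Delta>H \<theta>
  assume "cqg B \<Delta>B \<and> dense_hopf_star_algebra B \<Delta>B P \<and> universal_cqg P \<Delta>B H \<iota>H \<Delta>H \<and> hopf_hom H \<Delta>H A \<Delta> \<theta>"
  then have B: "cqg B \<Delta>B" "dense_hopf_star_algebra B \<Delta>B P" "universal_cqg P \<Delta>B H \<iota>H \<Delta>H" "hopf_hom H \<Delta>H A \<Delta> \<theta>"
    by simp_all
  have "cstar_bialgebra B \<Delta>B" "id_blinfun \<in> B" using B(1) by (simp_all only: cqg_def)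
  note P = spanned_by_bicoreps_dense_hopf_star_algebra[OF this B(2)]
  have "\<exists>\<theta>1. \<theta>1 \<in> extensional H \<and> hopf_hom H \<Delta>H K \<Delta>K \<theta>1 \<and> (\<forall>h\<in>H. \<theta> h = \<Lambda> (\<theta>1 h))"
    by (rule ex_compactification_factor[OF A uK \<Lambda>bop \<Lambda> B(3) P B(4)])
  then show "\<exists>!\<theta>1. \<theta>1 \<in> extensional H \<and> hopf_hom H \<Delta>H K \<Delta>K \<theta>1 \<and> (\<forall>h\<in>H. \<theta> h = \<Lambda> (\<theta>1 h))"
  proof (rule ex_ex1I, elim conjE)
    fix \<theta>1 \<theta>2
    assume 1: "\<theta>1 \<in> extensional H" "hopf_hom H \<Delta>H K \<Delta>K \<theta>1" "\<forall>h\<in>H. \<theta> h = \<Lambda> (\<theta>1 h)"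
      and 2: "\<theta>2 \<in> extensional H" "hopf_hom H \<Delta>H K \<Delta>K \<theta>2" "\<forall>h\<in>H. \<theta> h = \<Lambda> (\<theta>2 h)"
    show "\<theta>1 = \<theta>2"
      by (rule compactification_factor_unique[OF A uK \<Lambda> B(3) P 1(1,2) bspec[OF 1(3)] 2(1,2) bspec[OF 2(3)]])
  qed
qed

end
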